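(* Let $W$ be an irreducible Coxeter group with simple reflections indexed by $I$, and let $\mathbf d=(d_i)_{i\in I}$ be integers with $d_i\geqslant 2$ for all $i$. The nil-Hecke $\Bbbk$-algebra $n\mathcal H(W,\mathbf d,J_{<4})$ is a finitely generated $\Bbbk$-module if and only if exactly one of the following occurs: (1) $W$ is a finite Coxeter group and $\mathbf d=(2,\dots,2)$; (2) $W$ is of type $A_n$ for some $n\geqslant 1$, and $\mathbf d=(d,2,\dots,2)$ or $(2,\dots,2,d)$ for some $d>2$. In the first case, $\dim n\mathcal H(W,\mathbf d,J_{<4})$ equals: $|W|$ for $W$ of type $A_n,D_n,E_6,E_7,E_8$; $\sum_{k=0}^n\binom nk^2k!$ for type $B_n$; $304$ for type $F_4$; $76$ for type $H_3$; $1460$ for type $H_4$; and for type $I_2(m)$ it equals $2m$ if $m<4$ and $2m-1$ if $m\geqslant 4$. In the second case, $\dim n\mathcal H(W,\mathbf d,J_{<4})=n!\,(1+n(d-1))$.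
   Context: $\Bbbk$ is a fixed nonzero unital commutative ring. A Coxeter group $W$ has a finite nonempty index set $I$ of simple reflections and a Coxeter matrix $(m_{ij})_{i,j\in I}$ with $m_{ii}=1$ and $m_{ij}=m_{ji}\in\{2,3,\dots,\infty\}$ for $i\ne j$. Let $J$ be the set of unordered pairs $\{a,b\}\subset I$, $a\neq b$, with $m_{ab}<\infty$. For $j=\{a,b\}\in J$ let $\mathbf v_j=\mathbf s_a\mathbf s_b\mathbf s_a\cdots$ and $\mathbf w_j=\mathbf s_b\mathbf s_a\mathbf s_b\cdots$ be the two alternating words with $m_{ab}$ letters each; these are the two sides of the braid relation for $j$, whose length is $\ell(\mathbf v_j)=\ell(\mathbf w_j)=m_{ab}$. For $J_0\subset J$ and $\mathbf d=(d_i)_{i\in I}$ with integers $d_i\geqslant 2$, the nil-Hecke algebra $n\mathcal H(W,\mathbf d,J_0)$ is the associative unital $\Bbbk$-algebra generated by $\{\mathbf s_i:i\in I\}$ with relations $$\mathbf s_i^{d_i}=0\ (i\in I),\qquad \mathbf v_j=\mathbf w_j\ (j\in J_0),\qquad \mathbf v_j=0=\mathbf w_j\ (j\in J\setminus J_0).$$ For $k\geqslant 1$ put $J_{<k}=\{j\in J:\ell(\mathbf v_j)<k\}$. $W$ is irreducible if the graph on $I$ with $i,j$ adjacent iff $m_{ij}\geqslant 3$ is connected. Types refer to the standard classification of irreducible finite Coxeter groups; in type $A_n$ the nodes are numbered consecutively along the path and $\mathbf d$ is listed in this order; $I_2(m)$ is the dihedral group of order $2m$. The statement $\dim M=r$ means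 that $M$ is a free $\Bbbk$-module of rank $r$. *)

theory Defs
  imports
    "HOL-Algebra.Algebra"
    "HOL-Algebra.Algebraic_Closure_Type"
    "HOL-Library.Poly_Mapping"
    "HOL-Library.Extended_Nat"
begin

section \<open>Coxeter matrices and Coxeter groups\<close>

definition coxeter_matrix :: "('i \<Rightarrow> 'i \<Rightarrow> enat) \<Rightarrow> bool" where
  "coxeter_matrix m \<longleftrightarrow>
     (\<forall>i. m i i = 1) \<and> (\<forall>i j. m i j = m j i) \<and> (\<forall>i j. i \<noteq> j \<longrightarrow> m i j \<ge> 2)"

definition irreducible_coxeter :: "('i \<Rightarrow> 'i \<Rightarrow> enat) \<Rightarrow> bool" where
  "irreducible_coxeter m \<longleftrightarrow> (\<forall>i j. (i, j) \<in> {(a, b). m a b \<ge> 3}\<^sup>*)"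

text \<open>
  The Coxeter group is presented by the relations \<open>(s_i s_j)^m_ij = 1\<close> for all \<open>i, j\<close> with
  \<open>m_ij\<close> finite. Since \<open>i = j\<close> gives \<open>s_i s_i = 1\<close>, every generator is its own inverse, so words
  in the generators (without formal inverses) suffice and the group presentation agrees with the
  monoid presentation.
\<close>

inductive coxeter_equiv :: "('i \<Rightarrow> 'i \<Rightarrow> enat) \<Rightarrow> 'i list \<Rightarrow> 'i list \<Rightarrow> bool"
  for m :: "'i \<Rightarrow> 'i \<Rightarrow> enat" where
  relation: "m i j \<noteq> \<infinity> \<Longrightarrow>
    coxeter_equiv m (u @ concat (replicate (the_enat (m i j)) [i, j]) @ v) (u @ v)"
| refl: "coxeter_equiv m u u"
| sym: "coxeter_equiv m u v \<Longrightarrow> coxeter_equiv m v u"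
| trans: "coxeter_equiv m u v \<Longrightarrow> coxeter_equiv m v w \<Longrightarrow> coxeter_equiv m u w"

definition coxeter_rel :: "('i \<Rightarrow> 'i \<Rightarrow> enat) \<Rightarrow> ('i list \<times> 'i list) set" where
  "coxeter_rel m = {(u, v). coxeter_equiv m u v}"

definition coxeter_group :: "('i \<Rightarrow> 'i \<Rightarrow> enat) \<Rightarrow> 'i list set monoid" where
  "coxeter_group m =
     \<lparr>carrier = UNIV // coxeter_rel m,
      monoid.mult = (\<lambda>A B. \<Union>x\<in>A. \<Union>y\<in>B. coxeter_rel m `` {x @ y}),
      one = coxeter_rel m `` {[]}\<rparr>"

lemma equiv_coxeter_rel: "equiv UNIV (coxeter_rel m)"
  by (rule equivI)
    (auto simp: coxeter_rel_def refl_on_def sym_def trans_def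
      intro: coxeter_equiv.refl coxeter_equiv.sym coxeter_equiv.trans)

lemma coxeter_equiv_context:
  "coxeter_equiv m u v \<Longrightarrow> coxeter_equiv m (x @ u @ y) (x @ v @ y)"
proof (induction rule: coxeter_equiv.induct)
  case (relation i j u v)
  then show ?case
    using coxeter_equiv.relation[of m i j "x @ u" "v @ y"] by simp
next
  case (trans u v w)
  show ?case by (rule coxeter_equiv.trans[OF trans.IH])
qed (auto intro: coxeter_equiv.refl coxeter_equiv.sym)

lemma coxeter_equiv_append:
  assumes "coxeter_equiv m u u'" "coxeter_equiv m v v'"
  shows "coxeter_equiv m (u @ v) (u' @ v')"
  using coxeter_equiv.trans[OF coxeter_equiv_context[OF assms(1), of "[]" v]]
    coxeter_equiv_context[OF assms(2), of u' "[]"]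
  by simp

lemma coxeter_group_mult_class:
  "coxeter_rel m `` {u} \<otimes>\<^bsub>coxeter_group m\<^esub> coxeter_rel m `` {v} = coxeter_rel m `` {u @ v}"
proof -
  have "coxeter_rel m `` {x @ y} = coxeter_rel m `` {u @ v}"
    if "x \<in> coxeter_rel m `` {u}" "y \<in> coxeter_rel m `` {v}" for x y
    using that
    by (intro equiv_class_eq[OF equiv_coxeter_rel])
      (simp add: coxeter_rel_def coxeter_equiv_append coxeter_equiv.sym)
  moreover have "u \<in> coxeter_rel m `` {u}" "v \<in> coxeter_rel m `` {v}"
    by (auto simp: coxeter_rel_def intro: coxeter_equiv.refl)
  ultimately have "(\<Union>x\<in>coxeter_rel m `` {u}. \<Union>y\<in>coxeter_rel m `` {v}. coxeter_rel m `` {x @ y})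
      = coxeter_rel m `` {u @ v}"
    by blast
  then show ?thesis
    by (simp add: coxeter_group_def)
qed

lemma group_coxeter_group:
  assumes "coxeter_matrix m"
  shows "group (coxeter_group m)"
proof -
  have sq: "coxeter_equiv m ([i] @ [i]) []" for i
    using assms coxeter_equiv.relation[of m i i "[]" "[]"]
    by (simp add: coxeter_matrix_def one_enat_def)
  have inv: "coxeter_equiv m (rev u @ u) []" for u
  proof (induction u)
    case (Cons i u)
    have "coxeter_equiv m (rev u @ ([i] @ [i]) @ u) (rev u @ [] @ u)"
      by (rule coxeter_equiv_context[OF sq])
    with Cons show ?case using coxeter_equiv.trans by fastforce
  qed (simp add: coxeter_equiv.refl)
  have cls: "A \<in> carrier (coxeter_group m) \<longleftrightarrow> (\<exists>u. A = coxeter_rel m `` {u})" for A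
    by (auto simp: coxeter_group_def quotient_def)
  have one: "\<one>\<^bsub>coxeter_group m\<^esub> = coxeter_rel m `` {[]}"
    by (simp add: coxeter_group_def)
  show ?thesis
  proof (rule groupI)
    fix A assume "A \<in> carrier (coxeter_group m)"
    then obtain u where u: "A = coxeter_rel m `` {u}" by (auto simp: cls)
    have "coxeter_rel m `` {rev u @ u} = coxeter_rel m `` {[]}"
      using inv by (intro equiv_class_eq[OF equiv_coxeter_rel]) (simp add: coxeter_rel_def)
    then have "coxeter_rel m `` {rev u} \<otimes>\<^bsub>coxeter_group m\<^esub> A = \<one>\<^bsub>coxeter_group m\<^esub>"
      by (simp add: u one coxeter_group_mult_class)
    moreover have "coxeter_rel m `` {rev u} \<in> carrier (coxeter_group m)"
      by (auto simp: cls)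
    ultimately show
      "\<exists>B\<in>carrier (coxeter_group m). B \<otimes>\<^bsub>coxeter_group m\<^esub> A = \<one>\<^bsub>coxeter_group m\<^esub>"
      by blast
  qed (auto simp: cls one coxeter_group_mult_class)
qed

section \<open>Coxeter types\<close>

text \<open>Bourbaki numbering of the nodes by \<open>{1..n}\<close>; values outside this range are irrelevant.\<close>

definition path_matrix :: "(nat \<Rightarrow> enat) \<Rightarrow> nat \<Rightarrow> nat \<Rightarrow> enat" where
  "path_matrix e i j =
     (if i = j then 1 else if j = Suc i then e i else if i = Suc j then e j else 2)"

definition simply_laced_matrix :: "nat set set \<Rightarrow> nat \<Rightarrow> nat \<Rightarrow> enat" where
  "simply_laced_matrix E i j = (if i = j then 1 else if {i, j} \<in> E then 3 else 2)"

definition matrix_A :: "nat \<Rightarrow> nat \<Rightarrow> enat" where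
  "matrix_A = path_matrix (\<lambda>_. 3)"

definition matrix_B :: "nat \<Rightarrow> nat \<Rightarrow> nat \<Rightarrow> enat" where
  "matrix_B n = path_matrix (\<lambda>i. if Suc i = n then 4 else 3)"

definition matrix_D :: "nat \<Rightarrow> nat \<Rightarrow> nat \<Rightarrow> enat" where
  "matrix_D n = simply_laced_matrix ({{i, Suc i} |i. 1 \<le> i \<and> Suc i < n} \<union> {{n - 2, n}})"

definition matrix_E :: "nat \<Rightarrow> nat \<Rightarrow> nat \<Rightarrow> enat" where
  "matrix_E n = simply_laced_matrix ({{1, 3}, {2, 4}} \<union> {{i, Suc i} |i. 3 \<le> i \<and> Suc i \<le> n})"

definition matrix_F4 :: "nat \<Rightarrow> nat \<Rightarrow> enat" where
  "matrix_F4 = path_matrix (\<lambda>i. if i = 2 then 4 else 3)"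

definition matrix_H :: "nat \<Rightarrow> nat \<Rightarrow> enat" where
  "matrix_H = path_matrix (\<lambda>i. if i = 1 then 5 else 3)"

definition matrix_I2 :: "nat \<Rightarrow> nat \<Rightarrow> nat \<Rightarrow> enat" where
  "matrix_I2 p = path_matrix (\<lambda>_. enat p)"

definition coxeter_numbering ::
  "(nat \<Rightarrow> nat \<Rightarrow> enat) \<Rightarrow> nat \<Rightarrow> ('i \<Rightarrow> 'i \<Rightarrow> enat) \<Rightarrow> (nat \<Rightarrow> 'i) \<Rightarrow> bool" where
  "coxeter_numbering C n m \<sigma> \<longleftrightarrow>
     bij_betw \<sigma> {1..n} UNIV \<and> (\<forall>i\<in>{1..n}. \<forall>j\<in>{1..n}. m (\<sigma> i) (\<sigma> j) = C i j)"

definition has_coxeter_type ::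
  "(nat \<Rightarrow> nat \<Rightarrow> enat) \<Rightarrow> nat \<Rightarrow> ('i \<Rightarrow> 'i \<Rightarrow> enat) \<Rightarrow> bool" where
  "has_coxeter_type C n m \<longleftrightarrow> (\<exists>\<sigma>. coxeter_numbering C n m \<sigma>)"

text \<open>Type \<open>A_n\<close> with exponents \<open>(e, 2, ..., 2)\<close> or \<open>(2, ..., 2, e)\<close> along the path:\<close>

definition type_A_end_exponent ::
  "('i \<Rightarrow> 'i \<Rightarrow> enat) \<Rightarrow> ('i \<Rightarrow> nat) \<Rightarrow> nat \<Rightarrow> nat \<Rightarrow> bool" where
  "type_A_end_exponent m d n e \<longleftrightarrow>
     (\<exists>\<sigma>. coxeter_numbering matrix_A n m \<sigma> \<and>
        ((d (\<sigma> 1) = e \<and> (\<forall>i\<in>{2..n}. d (\<sigma> i) = 2)) \<or>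
         ((\<forall>i\<in>{1..<n}. d (\<sigma> i) = 2) \<and> d (\<sigma> n) = e)))"

section \<open>The free associative algebra\<close>

text \<open>
  A type copy of lists, so that the monoid algebra multiplication of
  \<^theory>\<open>HOL-Library.Poly_Mapping\<close> (which wants an additively written monoid of exponents)
  becomes concatenation of words.
\<close>

datatype 'i free_monoid = Word (letters: "'i list")

instantiation free_monoid :: (type) monoid_add
begin

definition zero_free_monoid :: "'a free_monoid" where
  "0 = Word []"

definition plus_free_monoid :: "'a free_monoid \<Rightarrow> 'a free_monoid \<Rightarrow> 'a free_monoid" where
  "u + v = Word (letters u @ letters v)"

instance
  by standard (auto simp: zero_free_monoid_def plus_free_monoid_def)

end

type_synonym ('i, 'k) free_algebra = "'i free_monoid \<Rightarrow>\<^sub>0 'k"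

definition word_monomial :: "'i list \<Rightarrow> ('i, 'k::comm_ring_1) free_algebra" where
  "word_monomial w = Poly_Mapping.single (Word w) 1"

definition scalar :: "'k::comm_ring_1 \<Rightarrow> ('i, 'k) free_algebra" where
  "scalar c = Poly_Mapping.single 0 c"

section \<open>Nil-Hecke algebras\<close>

primrec alternating_word :: "'i \<Rightarrow> 'i \<Rightarrow> nat \<Rightarrow> 'i list" where
  "alternating_word a b 0 = []"
| "alternating_word a b (Suc n) = a # alternating_word b a n"

text \<open>
  The side of the braid relation for \<open>{a, b}\<close> that starts with \<open>a\<close>; the other side is obtained
  by exchanging \<open>a\<close> and \<open>b\<close>.
\<close>

definition braid_word :: "('i \<Rightarrow> 'i \<Rightarrow> enat) \<Rightarrow> 'i \<Rightarrow> 'i \<Rightarrow> 'i list" where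
  "braid_word m a b = alternating_word a b (the_enat (m a b))"

definition braid_pairs :: "('i \<Rightarrow> 'i \<Rightarrow> enat) \<Rightarrow> 'i set set" where
  "braid_pairs m = {{a, b} |a b. a \<noteq> b \<and> m a b < \<infinity>}"

definition braid_pairs_less :: "('i \<Rightarrow> 'i \<Rightarrow> enat) \<Rightarrow> nat \<Rightarrow> 'i set set" where
  "braid_pairs_less m k = {{a, b} |a b. {a, b} \<in> braid_pairs m \<and> length (braid_word m a b) < k}"

text \<open>
  The variables \<open>a, b\<close> range over ordered pairs, so both braid words of each pair outside \<open>J0\<close>
  occur in the last set.
\<close>

definition nil_hecke_relators ::
  "('i \<Rightarrow> 'i \<Rightarrow> enat) \<Rightarrow> ('i \<Rightarrow> nat) \<Rightarrow> 'i set set \<Rightarrow> ('i, 'k::comm_ring_1) free_algebra set" where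
  "nil_hecke_relators m d J0 =
     {word_monomial (replicate (d i) i) |i. True} \<union>
     {word_monomial (braid_word m a b) - word_monomial (braid_word m b a) |a b. {a, b} \<in> J0} \<union>
     {word_monomial (braid_word m a b) |a b. {a, b} \<in> braid_pairs m - J0}"

definition quotient_algebra ::
  "('i, 'k::comm_ring_1) free_algebra set \<Rightarrow> ('k, ('i, 'k) free_algebra set) module" where
  "quotient_algebra I =
     ring.extend (FactRing ring_of_type_algebra I)
       (module.fields (\<lambda>c A. \<Union>x\<in>A. I +>\<^bsub>ring_of_type_algebra\<^esub> (scalar c * x)))"

definition nil_hecke ::
  "('i \<Rightarrow> 'i \<Rightarrow> enat) \<Rightarrow> ('i \<Rightarrow> nat) \<Rightarrow> 'i set set
     \<Rightarrow> ('k::comm_ring_1, ('i, 'k) free_algebra set) module" where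
  "nil_hecke m d J0 =
     quotient_algebra (Idl\<^bsub>ring_of_type_algebra\<^esub> (nil_hecke_relators m d J0))"

section \<open>Finitely generated and free modules\<close>

definition finitely_generated_module :: "('r, 'a) ring_scheme \<Rightarrow> ('r, 'b, 'c) module_scheme \<Rightarrow> bool" where
  "finitely_generated_module R M \<longleftrightarrow>
     (\<exists>A. finite A \<and> A \<subseteq> carrier M \<and>
        (\<forall>y\<in>carrier M. \<exists>c\<in>A \<rightarrow> carrier R. y = (\<Oplus>\<^bsub>M\<^esub>x\<in>A. c x \<odot>\<^bsub>M\<^esub> x)))"

definition free_module_of_rank :: "('r, 'a) ring_scheme \<Rightarrow> ('r, 'b, 'c) module_scheme \<Rightarrow> nat \<Rightarrow> bool" where
  "free_module_of_rank R M r \<longleftrightarrow>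
     (\<exists>B. finite B \<and> card B = r \<and> B \<subseteq> carrier M \<and>
        (\<forall>y\<in>carrier M. \<exists>!c. c \<in> B \<rightarrow>\<^sub>E carrier R \<and> y = (\<Oplus>\<^bsub>M\<^esub>x\<in>B. c x \<odot>\<^bsub>M\<^esub> x)))"

section \<open>The quotient is a ring and a module over the base ring\<close>

lemma scalar_add: "scalar (a + b) = scalar a + scalar b"
  by (simp add: scalar_def single_add)

lemma scalar_mult: "scalar (a * b) = scalar a * scalar b"
  by (simp add: scalar_def mult_single)

lemma scalar_one: "scalar 1 = 1"
  by (simp add: scalar_def)

lemma ring_of_type_algebra_ring: "ring (ring_of_type_algebra :: 'a::ring_1 ring)"
proof -
  have "\<exists>y. y + x = 0" for x :: 'a
    using add.left_inverse by blast
  then show ?thesis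
    unfolding ring_of_type_algebra_def
    by (intro ringI abelian_groupI monoidI) (auto simp: algebra_simps)
qed

lemma ring_of_type_algebra_coset:
  "(I +>\<^bsub>ring_of_type_algebra\<^esub> x) = (\<lambda>h. h + x) ` I" for x :: "'a::ring_1"
  unfolding a_r_coset_def r_coset_def by (auto simp: ring_of_type_algebra_def)

lemma abelian_group_by_representatives:
  fixes Q :: "('b, 'c) ring_scheme" and cl :: "'a::ring_1 \<Rightarrow> 'b"
  assumes carrier: "carrier Q = range cl"
    and add: "\<And>x y. cl x \<oplus>\<^bsub>Q\<^esub> cl y = cl (x + y)"
    and zero: "\<zero>\<^bsub>Q\<^esub> = cl 0"
  shows "abelian_group Q"
proof (rule abelian_groupI)
  fix A assume "A \<in> carrier Q"
  then obtain x where x: "A = cl x" by (auto simp: carrier)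
  have "cl (- x) \<oplus>\<^bsub>Q\<^esub> A = \<zero>\<^bsub>Q\<^esub>" by (simp add: x add zero)
  then show "\<exists>B\<in>carrier Q. B \<oplus>\<^bsub>Q\<^esub> A = \<zero>\<^bsub>Q\<^esub>" by (auto simp: carrier)
qed (auto simp: carrier add zero ac_simps)

lemma ring_by_representatives:
  fixes Q :: "('b, 'c) ring_scheme" and cl :: "'a::ring_1 \<Rightarrow> 'b"
  assumes carrier: "carrier Q = range cl"
    and add: "\<And>x y. cl x \<oplus>\<^bsub>Q\<^esub> cl y = cl (x + y)"
    and zero: "\<zero>\<^bsub>Q\<^esub> = cl 0"
    and mult: "\<And>x y. cl x \<otimes>\<^bsub>Q\<^esub> cl y = cl (x * y)"
    and one: "\<one>\<^bsub>Q\<^esub> = cl 1"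
  shows "ring Q"
proof (rule ringI)
  show "abelian_group Q"
    by (rule abelian_group_by_representatives[OF carrier add zero])
  show "Group.monoid Q"
    by (rule monoidI) (auto simp: carrier mult one mult.assoc)
qed (auto simp: carrier add mult algebra_simps)

lemma module_by_representatives:
  fixes Q :: "('k::comm_ring_1, 'b, 'c) module_scheme"
    and cl :: "'a::ring_1 \<Rightarrow> 'b" and sc :: "'k \<Rightarrow> 'a"
  assumes carrier: "carrier Q = range cl"
    and add: "\<And>x y. cl x \<oplus>\<^bsub>Q\<^esub> cl y = cl (x + y)"
    and zero: "\<zero>\<^bsub>Q\<^esub> = cl 0"
    and smult: "\<And>c x. c \<odot>\<^bsub>Q\<^esub> cl x = cl (sc c * x)"
    and sc: "\<And>a b. sc (a + b) = sc a + sc b" "\<And>a b. sc (a * b) = sc a * sc b" "sc 1 = 1"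
  shows "Module.module ring_of_type_algebra Q"
proof (rule moduleI)
  show "cring (ring_of_type_algebra :: 'k ring)"
    by (rule cring_from_type_algebra)
  show "abelian_group Q"
    by (rule abelian_group_by_representatives[OF carrier add zero])
qed (auto simp: carrier add smult sc ring_of_type_algebra_def algebra_simps)

context
  fixes I :: "('i, 'k::comm_ring_1) free_algebra set"
  assumes I: "ideal I ring_of_type_algebra"
begin

interpretation ideal I "ring_of_type_algebra :: ('i, 'k) free_algebra ring" by (rule I)

interpretation Q: ring "FactRing (ring_of_type_algebra :: ('i, 'k) free_algebra ring) I"
  by (rule quotient_is_ring)

lemma quotient_algebra_fields:
  "carrier (quotient_algebra I) = carrier (FactRing ring_of_type_algebra I)"
  "monoid.mult (quotient_algebra I) = monoid.mult (FactRing ring_of_type_algebra I)"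
  "monoid.one (quotient_algebra I) = monoid.one (FactRing ring_of_type_algebra I)"
  "ring.zero (quotient_algebra I) = ring.zero (FactRing ring_of_type_algebra I)"
  "ring.add (quotient_algebra I) = ring.add (FactRing ring_of_type_algebra I)"
  by (simp_all add: quotient_algebra_def ring.defs module.defs FactRing_def)

lemma quotient_algebra_carrier:
  "A \<in> carrier (quotient_algebra I) \<longleftrightarrow> (\<exists>x. A = I +>\<^bsub>ring_of_type_algebra\<^esub> x)"
proof -
  have "carrier (ring_of_type_algebra :: ('i, 'k) free_algebra ring) = UNIV"
    by (simp add: ring_of_type_algebra_def)
  then show ?thesis
    unfolding quotient_algebra_fields(1) FactRing_def A_RCOSETS_def RCOSETS_def a_r_coset_def
    by simp
qed

lemma quotient_algebra_mult_class:
  "(I +>\<^bsub>ring_of_type_algebra\<^esub> x) \<otimes>\<^bsub>quotient_algebra I\<^esub> (I +>\<^bsub>ring_of_type_algebra\<^esub> y)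
     = I +>\<^bsub>ring_of_type_algebra\<^esub> (x * y)"
  using rcoset_mult_add[of x y]
  by (simp add: quotient_algebra_fields(2) FactRing_def ring_of_type_algebra_def)

lemma quotient_algebra_add_class:
  "(I +>\<^bsub>ring_of_type_algebra\<^esub> x) \<oplus>\<^bsub>quotient_algebra I\<^esub> (I +>\<^bsub>ring_of_type_algebra\<^esub> y)
     = I +>\<^bsub>ring_of_type_algebra\<^esub> (x + y)"
  using a_rcos_sum[of x y]
  by (simp add: quotient_algebra_fields(5) FactRing_def ring_of_type_algebra_def)

lemma quotient_algebra_smult_class:
  "c \<odot>\<^bsub>quotient_algebra I\<^esub> (I +>\<^bsub>ring_of_type_algebra\<^esub> x)
     = I +>\<^bsub>ring_of_type_algebra\<^esub> (scalar c * x)"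
proof -
  have "I +>\<^bsub>ring_of_type_algebra\<^esub> (scalar c * y) = I +>\<^bsub>ring_of_type_algebra\<^esub> (scalar c * x)"
    if y: "y \<in> I +>\<^bsub>ring_of_type_algebra\<^esub> x" for y
  proof -
    obtain h where h: "h \<in> I" "y = h + x"
      using y by (auto simp: ring_of_type_algebra_coset)
    have "scalar c * h \<in> I"
      using I_l_closed[OF h(1), of "scalar c"] by (simp add: ring_of_type_algebra_def)
    then have "scalar c * y \<in> I +>\<^bsub>ring_of_type_algebra\<^esub> (scalar c * x)"
      by (auto simp: ring_of_type_algebra_coset h(2) distrib_left add.assoc)
    then show ?thesis
      by (intro a_repr_independence'[symmetric]) (auto simp: ring_of_type_algebra_def)
  qed
  moreover have "x \<in> I +>\<^bsub>ring_of_type_algebra\<^esub> x"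
    by (rule a_rcos_self) (simp add: ring_of_type_algebra_def)
  moreover have "c \<odot>\<^bsub>quotient_algebra I\<^esub> (I +>\<^bsub>ring_of_type_algebra\<^esub> x) =
      (\<Union>y\<in>I +>\<^bsub>ring_of_type_algebra\<^esub> x. I +>\<^bsub>ring_of_type_algebra\<^esub> (scalar c * y))"
    by (simp add: quotient_algebra_def ring.defs module.defs)
  ultimately show ?thesis
    by blast
qed

lemma quotient_algebra_zero: "\<zero>\<^bsub>quotient_algebra I\<^esub> = I +>\<^bsub>ring_of_type_algebra\<^esub> 0"
  unfolding ring_of_type_algebra_coset by (simp add: quotient_algebra_fields(4) FactRing_def)

lemma quotient_algebra_one: "\<one>\<^bsub>quotient_algebra I\<^esub> = I +>\<^bsub>ring_of_type_algebra\<^esub> 1"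
  by (simp add: quotient_algebra_fields(3) FactRing_def)
    (simp add: ring_of_type_algebra_def)

lemma carrier_quotient_algebra:
  "carrier (quotient_algebra I) = range (\<lambda>x. I +>\<^bsub>ring_of_type_algebra\<^esub> x)"
  using quotient_algebra_carrier by blast

lemmas ring_quotient_algebra =
  ring_by_representatives[OF carrier_quotient_algebra quotient_algebra_add_class
    quotient_algebra_zero quotient_algebra_mult_class quotient_algebra_one]

lemmas module_quotient_algebra =
  module_by_representatives[OF carrier_quotient_algebra quotient_algebra_add_class
    quotient_algebra_zero quotient_algebra_smult_class scalar_add scalar_mult scalar_one]

end

lemma ideal_nil_hecke:
  "ideal (Idl\<^bsub>ring_of_type_algebra\<^esub> (nil_hecke_relators m d J0 :: ('i, 'k::comm_ring_1) free_algebra set))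
     ring_of_type_algebra"
  by (rule ring.genideal_ideal[OF ring_of_type_algebra_ring]) (simp add: ring_of_type_algebra_def)

lemmas ring_nil_hecke = ring_quotient_algebra[OF ideal_nil_hecke, folded nil_hecke_def]
lemmas module_nil_hecke = module_quotient_algebra[OF ideal_nil_hecke, folded nil_hecke_def]

end

theory Submission
  imports Defs "HOL-Combinatorics.Permutations"
begin

text \<open>All relators are words or differences of two words of equal length, so the algebra has a basis
  of words taken modulo the braid moves of length 2 and 3, from which the classes of null words are
  removed: a word is null if a braid-equivalent word contains a power \<open>s_i^d_i\<close> or one side of a
  longer braid relation. Finite generation therefore means that there are finitely many nonnull
  classes, and the rank is their number (\<open>free_module_nonnull_classes\<close>,
  \<open>finitely_generated_iff_finite_classes\<close>). The rest of the proof is combinatorics of words.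

  Infinitely many classes are exhibited by partial actions of the letters on a set of states that
  respect the relations, with \<open>None\<close> for zero, and in which arbitrarily long words survive. Such
  actions exclude infinite labels, cycles and branch points next to a long label or a large exponent, large exponents
  away from an end of a path of type A, and all diagrams with a label above 3 other than
  \<open>I_2(p)\<close>, \<open>B_n\<close>, \<open>F_4\<close>, \<open>H_3\<close>, \<open>H_4\<close> (\<open>exponent_type_A\<close>, \<open>long_label_types\<close>).

  For the Coxeter group itself, the numbers game plays the part of the geometric representation:
  it shows that for \<open>d = 2\<close> and all braid relations the nonnull classes are the elements of the
  group. If all labels are 2 or 3, all braid relations are short, so finiteness of the algebra and of the group
  coincide without any classification. The types with a long label are finite
  because they act on a finite set of vectors that contains a vector of the open chamber.

  Ranks are counted by partial actions that are also complete: each word that is sent to \<open>None\<close> is null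
  and two words with the same effect are equivalent (\<open>nil_model\<close>). Type A with an end exponent
  sorts permutations carrying a colour, type B sorts partial injections (rook placements), and \<open>F_4\<close>,
  \<open>H_3\<close>, \<open>H_4\<close> are finite tables whose local conditions are checked by evaluation.\<close>

section \<open>Words modulo braid relations\<close>

text \<open>Words of equal value, up to the moves for the pairs in \<open>J\<close>; the moves are symmetric because the pairs are unordered.\<close>
inductive braid_equiv :: "('i => 'i => enat) => 'i set set => 'i list => 'i list => bool"
 for m :: "'i => 'i => enat" and J :: "'i set set" where
 move: "{a, b} \<in> J ==> braid_equiv m J (u @ braid_word m a b @ v) (u @ braid_word m b a @ v)"
| refl: "braid_equiv m J u u"
| trans: "braid_equiv m J u v ==> braid_equiv m J v w ==> braid_equiv m J u w"

definition forbidden_words ::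
 "('i => 'i => enat) => ('i => nat) => 'i set set => 'i list set" where
 "forbidden_words m d J =
  {replicate (d i) i |i. True} \<union> {braid_word m a b |a b. {a, b} \<in> braid_pairs m - J}"

definition null_word ::
 "('i => 'i => enat) => ('i => nat) => 'i set set => 'i list => bool" where
 "null_word m d J w \<longleftrightarrow> (\<exists>u f v. f \<in> forbidden_words m d J & braid_equiv m J w (u @ f @ v))"

definition nonnull_classes ::
 "('i => 'i => enat) => ('i => nat) => 'i set set => 'i list set set" where
 "nonnull_classes m d J = (%u. Collect (braid_equiv m J u)) ` {u. ~ null_word m d J u}"

lemma braid_equiv_sym: "braid_equiv m J u v ==> braid_equiv m J v u"
proof (induction rule: braid_equiv.induct)
 case (move a b u v)
 then show ?case using braid_equiv.move[of b a] by (simp add: insert_commute)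
qed (auto intro: braid_equiv.refl braid_equiv.trans)

lemma braid_equiv_context:
 "braid_equiv m J u v ==> braid_equiv m J (x @ u @ y) (x @ v @ y)"
proof (induction rule: braid_equiv.induct)
 case (move a b u v)
 then show ?case using braid_equiv.move[of a b J m "x @ u" "v @ y"] by simp
next
 case (trans u v w)
 show ?case by (rule braid_equiv.trans[OF trans.IH])
qed (rule braid_equiv.refl)

lemma braid_equiv_append:
 assumes "braid_equiv m J u u'" "braid_equiv m J v v'"
 shows "braid_equiv m J (u @ v) (u' @ v')"
 using braid_equiv.trans[OF braid_equiv_context[OF assms(1), of "[]" v]]
  braid_equiv_context[OF assms(2), of u' "[]"]
 by simp

lemma Collect_braid_equiv_eq_iff:
 "Collect (braid_equiv m J u) = Collect (braid_equiv m J v) \<longleftrightarrow> braid_equiv m J u v"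
 by (metis (mono_tags, lifting) Collect_cong braid_equiv.refl braid_equiv.trans braid_equiv_sym
   mem_Collect_eq)

lemma null_word_cong:
 "braid_equiv m J u v ==> null_word m d J u \<longleftrightarrow> null_word m d J v"
 unfolding null_word_def by (meson braid_equiv.trans braid_equiv_sym)

lemma null_word_append:
 assumes "null_word m d J w"
 shows "null_word m d J (x @ w @ y)"
proof -
 obtain u f v where f: "f \<in> forbidden_words m d J" "braid_equiv m J w (u @ f @ v)"
  using assms unfolding null_word_def by blast
 have "braid_equiv m J (x @ w @ y) ((x @ u) @ f @ (v @ y))"
  using braid_equiv_context[OF f(2), of x y] by simp
 then show ?thesis using f(1) unfolding null_word_def by blast
qed

lemma null_word_forbidden: "f \<in> forbidden_words m d J ==> null_word m d J f"
 unfolding null_word_def by (metis append.left_neutral append.right_neutral braid_equiv.refl)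

section \<open>A basis of the nil-Hecke algebra\<close>

definition functional :: "('i list => 'k::comm_ring_1) => ('i, 'k) free_algebra => 'k" where
 "functional f p = (\<Sum>u\<in>Poly_Mapping.keys p. Poly_Mapping.lookup p u * f (letters u))"

lemma functional_superset:
 assumes "finite A" "Poly_Mapping.keys p \<subseteq> A"
 shows "functional f p = (\<Sum>u\<in>A. Poly_Mapping.lookup p u * f (letters u))"
 unfolding functional_def using assms
 by (intro sum.mono_neutral_left) (auto simp: in_keys_iff)

lemma functional_single [simp]: "functional f (Poly_Mapping.single u c) = c * f (letters u)"
 by (simp add: functional_def)

lemma functional_zero [simp]: "functional f 0 = 0"
 by (simp add: functional_def)

lemma functional_add [simp]: "functional f (p + q) = functional f p + functional f q"
proof -
 let ?A = "Poly_Mapping.keys p \<union> Poly_Mapping.keys q"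
 have "Poly_Mapping.keys (p + q) \<subseteq> ?A" by (rule Poly_Mapping.keys_add)
 then show ?thesis
  by (simp add: functional_superset[of ?A] lookup_add distrib_right sum.distrib)
qed

lemma functional_uminus [simp]: "functional f (- p) = - functional f p"
 using functional_add[of f p "- p"] by (simp add: eq_neg_iff_add_eq_0 add.commute)

lemma functional_diff [simp]: "functional f (p - q) = functional f p - functional f q"
 using functional_add[of f p "- q"] by simp

lemma functional_sum: "functional f (sum g A) = (\<Sum>x\<in>A. functional f (g x))"
 by (induction A rule: infinite_finite_induct) auto

lemma free_algebra_induct [case_names zero single add]:
 assumes "P 0" "!!w c. P (Poly_Mapping.single (Word w) c)"
  and "!!p q. P p ==> P q ==> P (p + q)"
 shows "P (p :: ('i, 'k::comm_ring_1) free_algebra)"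
proof -
 have "P (\<Sum>u\<in>A. Poly_Mapping.single u (Poly_Mapping.lookup p u))" if "finite A" for A
  using that
 proof (induction A rule: finite_induct)
  case (insert u A)
  have "P (Poly_Mapping.single u c)" for c
   using assms(2)[of "letters u" c] by simp
  with insert show ?case by (simp add: assms(3))
 qed (simp add: assms(1))
 moreover have "p = (\<Sum>u\<in>Poly_Mapping.keys p. Poly_Mapping.single u (Poly_Mapping.lookup p u))"
  by (rule poly_mapping_eqI)
   (auto simp: lookup_sum lookup_single when_def in_keys_iff)
 ultimately show ?thesis by (metis finite_keys)
qed

lemma functional_mult_single_left:
 "functional f (Poly_Mapping.single (Word w) c * p) = c * functional (%v. f (w @ v)) p"
 by (induction p rule: free_algebra_induct)
  (simp_all add: mult_single plus_free_monoid_def distrib_left mult.assoc)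

lemma functional_mult_single_right:
 "functional f (p * Poly_Mapping.single (Word w) c) = c * functional (%v. f (v @ w)) p"
 by (induction p rule: free_algebra_induct)
  (simp_all add: mult_single plus_free_monoid_def distrib_left distrib_right ac_simps)

lemma functional_scalar [simp]: "functional f (scalar c * p) = c * functional f p"
 using functional_mult_single_left[of f "[]" c p]
 by (simp add: scalar_def zero_free_monoid_def)

lemma functional_word [simp]: "functional f (word_monomial w) = f w"
 by (simp add: word_monomial_def)

definition class_function ::
 "('i => 'i => enat) => ('i => nat) => 'i set set => ('i list => 'k::comm_ring_1) => bool" where
 "class_function m d J f \<longleftrightarrow>
  (\<forall>u v. braid_equiv m J u v --> f u = f v) & (\<forall>u. null_word m d J u --> f u = 0)"

lemma class_function_shift:
 assumes "class_function m d J f"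
 shows "class_function m d J (%v. f (x @ v @ y))"
 using assms unfolding class_function_def
 by (meson braid_equiv_context null_word_append)

lemma class_function_indicator:
 assumes "~ null_word m d J w"
 shows "class_function m d J (%u. if braid_equiv m J w u then 1 else 0)"
 unfolding class_function_def
proof (intro conjI allI impI)
 fix u v assume "braid_equiv m J u v"
 then have "braid_equiv m J w u \<longleftrightarrow> braid_equiv m J w v"
  using braid_equiv.trans braid_equiv_sym by metis
 then show "(if braid_equiv m J w u then 1 else 0) = (if braid_equiv m J w v then 1 else 0)"
  by simp
next
 fix u assume "null_word m d J u"
 then have "~ braid_equiv m J w u" using assms null_word_cong by metis
 then show "(if braid_equiv m J w u then 1 else 0) = 0" by simp
qed

abbreviation nil_hecke_ideal ::
 "('i => 'i => enat) => ('i => nat) => 'i set set => ('i, 'k::comm_ring_1) free_algebra set" where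
 "nil_hecke_ideal m d J \<equiv> Idl\<^bsub>ring_of_type_algebra\<^esub> (nil_hecke_relators m d J)"

lemma functional_nil_hecke_ideal:
 fixes p :: "('i, 'k::comm_ring_1) free_algebra"
 assumes f: "class_function m d J f" and p: "p \<in> nil_hecke_ideal m d J"
 shows "functional f p = 0"
proof -
 let ?R = "ring_of_type_algebra :: ('i, 'k) free_algebra ring"
 interpret R: ring ?R by (rule ring_of_type_algebra_ring)
 define K where "K = {p :: ('i, 'k) free_algebra. \<forall>f :: 'i list => 'k. class_function m d J f --> functional f p = 0}"
 have left: "q * p \<in> K" and right: "p * q \<in> K" if p: "p \<in> K" for p q :: "('i, 'k) free_algebra"
 proof -
  show "q * p \<in> K"
   unfolding K_def
  proof (intro CollectI allI impI)
   fix f :: "'i list => 'k" assume f: "class_function m d J f"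
   show "functional f (q * p) = 0"
   proof (induction q rule: free_algebra_induct)
    case (single w c)
    show ?case
     using p class_function_shift[OF f, of w "[]"]
     by (simp add: functional_mult_single_left K_def)
   qed (simp_all add: distrib_right)
  qed
  show "p * q \<in> K"
   unfolding K_def
  proof (intro CollectI allI impI)
   fix f :: "'i list => 'k" assume f: "class_function m d J f"
   show "functional f (p * q) = 0"
   proof (induction q rule: free_algebra_induct)
    case (single w c)
    show ?case
     using p class_function_shift[OF f, of "[]" w]
     by (simp add: functional_mult_single_right K_def)
   qed (simp_all add: distrib_left)
  qed
 qed
 have "ideal K ?R"
 proof (rule idealI)
  show "subgroup K (add_monoid ?R)"
  proof (rule group.subgroupI)
   show "group (add_monoid ?R)" by (rule R.add.group_axioms)
   show "inv\<^bsub>add_monoid ?R\<^esub> a \<in> K" if "a \<in> K" for a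
   proof -
    have "- a \<oplus>\<^bsub>?R\<^esub> a = \<zero>\<^bsub>?R\<^esub>" "- a \<in> carrier ?R" "a \<in> carrier ?R"
     by (simp_all add: ring_of_type_algebra_def)
    then have "inv\<^bsub>add_monoid ?R\<^esub> a = - a"
     using R.add.inv_equality by (simp add: a_inv_def)
    then show ?thesis using that by (simp add: K_def)
   qed
  qed (auto simp: K_def ring_of_type_algebra_def intro: exI[of _ 0])
 qed (use left right in \<open>auto simp: ring_of_type_algebra_def ring_of_type_algebra_ring[unfolded ring_of_type_algebra_def]\<close>)
 moreover have "nil_hecke_relators m d J \<subseteq> K"
 proof -
  have "word_monomial w \<in> K" if "w \<in> forbidden_words m d J" for w
   using null_word_forbidden[OF that] by (simp add: K_def class_function_def)
  moreover have "word_monomial (braid_word m a b) - word_monomial (braid_word m b a) \<in> K"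
   if "{a, b} \<in> J" for a b
  proof -
   have "braid_equiv m J (braid_word m a b) (braid_word m b a)"
    using braid_equiv.move[OF that, of m "[]" "[]"] by simp
   then show ?thesis by (simp add: K_def class_function_def)
  qed
  ultimately show ?thesis
   unfolding nil_hecke_relators_def forbidden_words_def by blast
 qed
 ultimately have "nil_hecke_ideal m d J \<subseteq> K"
  by (rule R.genideal_minimal)
 with f p show ?thesis by (auto simp: K_def)
qed

context
 fixes m :: "'i => 'i => enat" and d :: "'i => nat" and J :: "'i set set"
  and I :: "('i, 'k::comm_ring_1) free_algebra set"
 assumes I_def: "I = nil_hecke_ideal m d J"
begin

interpretation I: ideal I "ring_of_type_algebra :: ('i, 'k) free_algebra ring"
 unfolding I_def by (rule ideal_nil_hecke)

lemma idl: "ideal I (ring_of_type_algebra :: ('i, 'k) free_algebra ring)"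
 unfolding I_def by (rule ideal_nil_hecke)

private abbreviation cl :: "('i, 'k) free_algebra => ('i, 'k) free_algebra set" where
 "cl x \<equiv> I +>\<^bsub>ring_of_type_algebra\<^esub> x"

private abbreviation H :: "('k, ('i, 'k) free_algebra set) module" where
 "H \<equiv> quotient_algebra I"

lemma ideal_closed:
 "p \<in> I ==> q \<in> I ==> p + q \<in> I" "p \<in> I ==> q * p \<in> I" "p \<in> I ==> p * q \<in> I"
 "p \<in> I ==> q \<in> I ==> p - q \<in> I" "0 \<in> I"
proof -
 show add: "p + q \<in> I" if "p \<in> I" "q \<in> I" for p q
  using additive_subgroup.a_closed[OF I.additive_subgroup_axioms that] by (simp add: ring_of_type_algebra_def)
 show left: "q * p \<in> I" if "p \<in> I" for p q
  using I.I_l_closed[OF that, of q] by (simp add: ring_of_type_algebra_def)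
 show "p * q \<in> I" if "p \<in> I" for p q
  using I.I_r_closed[OF that, of q] by (simp add: ring_of_type_algebra_def)
 show "p - q \<in> I" if "p \<in> I" "q \<in> I" for p q
  using add[OF that(1) left[OF that(2), of "- 1"]] by simp
 show "0 \<in> I"
  using additive_subgroup.zero_closed[OF I.additive_subgroup_axioms] by (simp add: ring_of_type_algebra_def)
qed

lemma coset_eq_iff: "cl x = cl y \<longleftrightarrow> x - y \<in> I"
proof
 assume "cl x = cl y"
 moreover have "x \<in> cl x"
  by (rule I.a_rcos_self) (simp add: ring_of_type_algebra_def)
 ultimately show "x - y \<in> I" by (auto simp: ring_of_type_algebra_coset)
next
 assume "x - y \<in> I"
 then have "x \<in> cl y" by (force simp: ring_of_type_algebra_coset)
 then show "cl x = cl y"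
  by (intro I.a_repr_independence'[symmetric]) (auto simp: ring_of_type_algebra_def)
qed

lemma relators_in_ideal:
 "w \<in> forbidden_words m d J ==> word_monomial w \<in> I"
 "{a, b} \<in> J ==> word_monomial (braid_word m a b) - word_monomial (braid_word m b a) \<in> I"
proof -
 have "nil_hecke_relators m d J \<subseteq> I"
  unfolding I_def
  by (rule ring.genideal_self[OF ring_of_type_algebra_ring]) (simp add: ring_of_type_algebra_def)
 then show "w \<in> forbidden_words m d J ==> word_monomial w \<in> I"
  "{a, b} \<in> J ==> word_monomial (braid_word m a b) - word_monomial (braid_word m b a) \<in> I"
  unfolding nil_hecke_relators_def forbidden_words_def by blast+
qed

lemma word_monomial_append: "word_monomial (u @ v) = (word_monomial u * word_monomial v :: ('i, 'k) free_algebra)"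
 by (simp add: word_monomial_def mult_single plus_free_monoid_def)

lemma word_monomial_braid_equiv:
 "braid_equiv m J u v ==> word_monomial u - word_monomial v \<in> I"
proof (induction rule: braid_equiv.induct)
 case (move a b u v)
 have "word_monomial u * (word_monomial (braid_word m a b) - word_monomial (braid_word m b a))
   * word_monomial v \<in> I"
  by (intro ideal_closed relators_in_ideal move)
 then show ?case by (simp add: word_monomial_append algebra_simps)
next
 case (trans u v w)
 then show ?case using ideal_closed(1)[OF trans.IH] by simp
qed (simp add: ideal_closed)

lemma word_monomial_null:
 assumes "null_word m d J w"
 shows "word_monomial w \<in> I"
proof -
 obtain u f v where f: "f \<in> forbidden_words m d J" "braid_equiv m J w (u @ f @ v)"
  using assms unfolding null_word_def by blast
 have "word_monomial (u @ f @ v) \<in> I"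
  unfolding word_monomial_append by (intro ideal_closed relators_in_ideal f)
 from ideal_closed(1)[OF word_monomial_braid_equiv[OF f(2)] this] show ?thesis by simp
qed

lemma finsum_cosets:
 assumes "finite A"
 shows "(\<Oplus>\<^bsub>H\<^esub>x\<in>A. cl (g x)) = cl (\<Sum>x\<in>A. g x)"
proof -
 interpret H: Module.module "ring_of_type_algebra :: 'k ring" H
  by (rule module_quotient_algebra, rule idl)
 have closed: "cl x \<in> carrier H" for x
  using quotient_algebra_carrier[OF idl] by blast
 show ?thesis
  using assms
 proof (induction A rule: finite_induct)
  case empty
  then show ?case by (simp add: quotient_algebra_zero[OF idl])
 next
  case (insert x A)
  then show ?case
   using closed by (simp add: H.finsum_insert Pi_def quotient_algebra_add_class[OF idl])
 qed
qed

text \<open>The classes span, since null words vanish and equivalent words agree in the quotient. They are independent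
 because the functional on the free algebra that reads off the total coefficient of one nonnull class vanishes on the ideal.\<close>
theorem free_module_nonnull_classes:
 assumes "finite (nonnull_classes m d J)"
 shows "free_module_of_rank ring_of_type_algebra (H :: ('k, ('i, 'k) free_algebra set) module)
  (card (nonnull_classes m d J))"
proof -
 define rep where "rep C = (SOME u. ~ null_word m d J u & C = Collect (braid_equiv m J u))" for C
 have rep: "~ null_word m d J (rep C)" "C = Collect (braid_equiv m J (rep C))"
  if "C \<in> nonnull_classes m d J" for C
  using that someI_ex[of "%u. ~ null_word m d J u & C = Collect (braid_equiv m J u)"]
  unfolding rep_def nonnull_classes_def by blast+
 define R where "R = rep ` nonnull_classes m d J"
 have fin: "finite R" using assms by (simp add: R_def)
 have card_R: "card R = card (nonnull_classes m d J)"
  unfolding R_def by (rule card_image) (metis inj_onI rep(2))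
 have R_nonnull: "~ null_word m d J w" if "w \<in> R" for w
  using that rep by (auto simp: R_def)
 have R_unique: "u = w" if "u \<in> R" "w \<in> R" "braid_equiv m J u w" for u w
  using that rep(2) unfolding R_def by (metis (no_types, lifting) Collect_braid_equiv_eq_iff imageE)
 have R_exists: "\<exists>w\<in>R. braid_equiv m J w u" if "~ null_word m d J u" for u
 proof -
  have "Collect (braid_equiv m J u) \<in> nonnull_classes m d J"
   using that by (auto simp: nonnull_classes_def)
  then show ?thesis
   using rep(2) braid_equiv_sym braid_equiv.refl unfolding R_def by (metis image_eqI mem_Collect_eq)
 qed
 define ind :: "'i list => 'i list => 'k" where
  "ind w = (%u. if braid_equiv m J w u then 1 else 0)" for w
 have ind: "class_function m d J (ind w)" if "w \<in> R" for w
  unfolding ind_def by (rule class_function_indicator) (rule R_nonnull[OF that])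
 have ind_R: "ind w u = (if u = w then 1 else 0)" if "w \<in> R" "u \<in> R" for u w
 proof (cases "u = w")
  case True
  then show ?thesis by (simp add: ind_def braid_equiv.refl)
 next
  case False
  then have "~ braid_equiv m J w u" using that R_unique by metis
  with False show ?thesis by (simp add: ind_def)
 qed
 define comb :: "('i list => 'k) => ('i, 'k) free_algebra" where
  "comb c = (\<Sum>w\<in>R. scalar (c w) * word_monomial w)" for c
 have ind_comb: "functional (ind w) (comb c) = c w" if "w \<in> R" for w c
 proof -
  have "functional (ind w) (comb c) = (\<Sum>u\<in>R. c u * ind w u)"
   by (simp add: comb_def functional_sum)
  also have "\<dots> = (\<Sum>u\<in>R. if u = w then c u else 0)"
   using that by (intro sum.cong) (auto simp: ind_R)
  finally show ?thesis using that fin by simp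
 qed
 have span: "cl p = cl (comb (%w. functional (ind w) p))" for p
  unfolding coset_eq_iff
 proof (induction p rule: free_algebra_induct)
  case zero
  show ?case by (simp add: comb_def scalar_def ideal_closed)
 next
  case (single u c)
  have mono: "Poly_Mapping.single (Word u) c = scalar c * word_monomial u"
   by (simp add: scalar_def word_monomial_def mult_single)
  show ?case
  proof (cases "null_word m d J u")
   case True
   then have "ind w u = 0" if "w \<in> R" for w
    using ind[OF that] by (simp add: class_function_def)
   then have "comb (%w. functional (ind w) (Poly_Mapping.single (Word u) c)) = 0"
    by (simp add: comb_def scalar_def)
   then show ?thesis
    using word_monomial_null[OF True] by (simp add: mono ideal_closed)
  next
   case False
   then obtain w where w: "w \<in> R" "braid_equiv m J w u" using R_exists by blast
   have "ind w' u = (if w' = w then 1 else 0)" if "w' \<in> R" for w'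
   proof -
    have "braid_equiv m J w' u \<longleftrightarrow> w' = w"
     using that w R_unique by (meson braid_equiv.trans braid_equiv_sym)
    then show ?thesis by (simp add: ind_def)
   qed
   then have "comb (%w. functional (ind w) (Poly_Mapping.single (Word u) c))
     = (\<Sum>w'\<in>R. if w' = w then scalar c * word_monomial w else 0)"
    unfolding comb_def by (intro sum.cong) (auto simp: scalar_def)
   also have "\<dots> = scalar c * word_monomial w" using w fin by simp
   finally show ?thesis
    using ideal_closed(2)[OF word_monomial_braid_equiv[OF braid_equiv_sym[OF w(2)]], of "scalar c"]
    by (simp add: mono right_diff_distrib)
  qed
 next
  case (add p q)
  have "comb (%w. functional (ind w) (p + q))
    = comb (%w. functional (ind w) p) + comb (%w. functional (ind w) q)"
   by (simp add: comb_def scalar_add distrib_right sum.distrib)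
  then show ?case using ideal_closed(1)[OF add.IH] by (simp add: algebra_simps)
 qed
 have comb_inj: "c w = c' w" if "cl (comb c) = cl (comb c')" "w \<in> R" for c c' w
 proof -
  have "functional (ind w) (comb c - comb c') = 0"
   using that by (intro functional_nil_hecke_ideal[OF ind]) (auto simp: coset_eq_iff I_def[symmetric])
  then show ?thesis using that by (simp add: ind_comb)
 qed
 define b :: "'i list => ('i, 'k) free_algebra set" where "b w = cl (word_monomial w)" for w
 have b_inj: "inj_on b R"
 proof (rule inj_onI)
  fix u w assume uw: "u \<in> R" "w \<in> R" "b u = b w"
  have single: "comb (%v. if v = u then 1 else 0) = word_monomial u" if "u \<in> R" for u
  proof -
   have "comb (%v. if v = u then 1 else 0) = (\<Sum>v\<in>R. if v = u then word_monomial u else 0)"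
    unfolding comb_def by (intro sum.cong) (auto simp: scalar_def)
   then show ?thesis using that fin by simp
  qed
  have "(if u = u then 1 else 0 :: 'k) = (if u = w then 1 else 0)"
   using comb_inj[of "%v. if v = u then 1 else 0" "%v. if v = w then 1 else 0" u] uw
   by (simp add: single b_def)
  then show "u = w" by (simp split: if_splits)
 qed
 have lincomb: "(\<Oplus>\<^bsub>H\<^esub>x\<in>b ` R. c x \<odot>\<^bsub>H\<^esub> x) = cl (comb (%w. c (b w)))" for c
 proof -
  interpret H: Module.module "ring_of_type_algebra :: 'k ring" H
   by (rule module_quotient_algebra, rule idl)
  have closed: "cl x \<in> carrier H" for x
   using quotient_algebra_carrier[OF idl] by blast
  have "(\<Oplus>\<^bsub>H\<^esub>x\<in>b ` R. c x \<odot>\<^bsub>H\<^esub> x) = (\<Oplus>\<^bsub>H\<^esub>w\<in>R. c (b w) \<odot>\<^bsub>H\<^esub> b w)"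
   using b_inj by (intro H.finsum_reindex)
    (auto simp: b_def quotient_algebra_smult_class[OF idl] closed)
  then show ?thesis
   by (simp add: b_def quotient_algebra_smult_class[OF idl] finsum_cosets[OF fin] comb_def)
 qed
 show ?thesis
  unfolding free_module_of_rank_def
 proof (intro exI conjI ballI)
  show "finite (b ` R)" using fin by simp
  show "card (b ` R) = card (nonnull_classes m d J)"
   using b_inj card_R by (simp add: card_image)
  show "b ` R \<subseteq> carrier H"
   using quotient_algebra_carrier[OF idl] by (auto simp: b_def)
  fix y assume "y \<in> carrier H"
  then obtain p where p: "y = cl p"
   using quotient_algebra_carrier[OF idl] by blast
  define c where "c = (\<lambda>x\<in>b ` R. functional (ind (inv_into R b x)) p)"
  have c: "c (b w) = functional (ind w) p" if "w \<in> R" for w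
   using that b_inj by (simp add: c_def)
  show "\<exists>!c. c \<in> b ` R \<rightarrow>\<^sub>E carrier ring_of_type_algebra & y = (\<Oplus>\<^bsub>H\<^esub>x\<in>b ` R. c x \<odot>\<^bsub>H\<^esub> x)"
  proof (rule ex1I[of _ c])
   have "comb (%w. c (b w)) = comb (%w. functional (ind w) p)"
    unfolding comb_def by (intro sum.cong) (auto simp: c)
   then show "c \<in> b ` R \<rightarrow>\<^sub>E carrier ring_of_type_algebra & y = (\<Oplus>\<^bsub>H\<^esub>x\<in>b ` R. c x \<odot>\<^bsub>H\<^esub> x)"
    using span[of p] by (auto simp: lincomb p c_def ring_of_type_algebra_def)
   fix c' assume c': "c' \<in> b ` R \<rightarrow>\<^sub>E carrier ring_of_type_algebra & y = (\<Oplus>\<^bsub>H\<^esub>x\<in>b ` R. c' x \<odot>\<^bsub>H\<^esub> x)"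
   show "c' = c"
   proof (rule extensionalityI[of _ "b ` R"])
    show "c' \<in> extensional (b ` R)" using c' by (simp add: PiE_def)
    show "c \<in> extensional (b ` R)" by (simp add: c_def)
    fix x assume "x \<in> b ` R"
    then obtain w where w: "w \<in> R" "x = b w" by blast
    have "cl (comb (%w. c' (b w))) = cl (comb (%w. functional (ind w) p))"
     using c' span[of p] by (simp add: lincomb p)
    from comb_inj[OF this w(1)] show "c' x = c x" using w by (simp add: c)
   qed
  qed
 qed
qed

text \<open>A finite generating set involves finitely many words; the functional of a class that none of them represents
 would vanish on the whole algebra, although it is 1 on that class.\<close>
theorem finitely_generated_iff_finite_classes:
 "finitely_generated_module ring_of_type_algebra (H :: ('k, ('i, 'k) free_algebra set) module)
  \<longleftrightarrow> finite (nonnull_classes m d J)"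
proof
 assume "finite (nonnull_classes m d J)"
 from free_module_nonnull_classes[OF this] obtain B where B:
  "finite B" "B \<subseteq> carrier H"
  "\<forall>y\<in>carrier H. \<exists>!c. c \<in> B \<rightarrow>\<^sub>E carrier (ring_of_type_algebra :: 'k ring) & y = (\<Oplus>\<^bsub>H\<^esub>x\<in>B. c x \<odot>\<^bsub>H\<^esub> x)"
  unfolding free_module_of_rank_def by (elim exE conjE) (rule that)
 have "\<exists>c\<in>B \<rightarrow> carrier (ring_of_type_algebra :: 'k ring). y = (\<Oplus>\<^bsub>H\<^esub>x\<in>B. c x \<odot>\<^bsub>H\<^esub> x)"
  if y: "y \<in> carrier H" for y
 proof -
  obtain c where "c \<in> B \<rightarrow>\<^sub>E carrier (ring_of_type_algebra :: 'k ring)"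
   "y = (\<Oplus>\<^bsub>H\<^esub>x\<in>B. c x \<odot>\<^bsub>H\<^esub> x)"
   using ex1_implies_ex[OF bspec[OF B(3) y]] by (elim exE conjE) (rule that)
  then show ?thesis by (intro bexI[of _ c]) (auto simp: PiE_def)
 qed
 with B(1,2) show "finitely_generated_module ring_of_type_algebra H"
  unfolding finitely_generated_module_def by blast
next
 assume "finitely_generated_module (ring_of_type_algebra :: 'k ring) H"
 then obtain A where A: "finite A" "A \<subseteq> carrier H"
  "\<forall>y\<in>carrier H. \<exists>c\<in>A \<rightarrow> carrier (ring_of_type_algebra :: 'k ring). y = (\<Oplus>\<^bsub>H\<^esub>x\<in>A. c x \<odot>\<^bsub>H\<^esub> x)"
  unfolding finitely_generated_module_def by blast
 have "\<forall>x\<in>A. \<exists>p. x = cl p" using A(2) quotient_algebra_carrier[OF idl] by blast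
 then obtain p where p: "!!x. x \<in> A ==> x = cl (p x)" by metis
 define W where "W = letters ` (\<Union>x\<in>A. Poly_Mapping.keys (p x))"
 have "finite W" using A(1) by (simp add: W_def)
 show "finite (nonnull_classes m d J)"
 proof (rule ccontr)
  assume "infinite (nonnull_classes m d J)"
  then have "~ nonnull_classes m d J \<subseteq> (%u. Collect (braid_equiv m J u)) ` W"
   using \<open>finite W\<close> by (meson finite_imageI finite_subset)
  then have "\<exists>w. ~ null_word m d J w & (\<forall>u\<in>W. ~ braid_equiv m J w u)"
   unfolding nonnull_classes_def by (auto simp: image_iff Collect_braid_equiv_eq_iff)
  then obtain w where w: "~ null_word m d J w" "!!u. u \<in> W ==> ~ braid_equiv m J w u"
   by blast
  define f :: "'i list => 'k" where "f = (%u. if braid_equiv m J w u then 1 else 0)"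
  have f: "class_function m d J f"
   unfolding f_def by (rule class_function_indicator[OF w(1)])
  have fp: "functional f (p x) = 0" if "x \<in> A" for x
   unfolding functional_def
   by (rule sum.neutral) (use that w(2) in \<open>auto simp: f_def W_def\<close>)
  have "cl (word_monomial w) \<in> carrier H"
   using quotient_algebra_carrier[OF idl] by blast
  with A(3) obtain c where c: "cl (word_monomial w) = (\<Oplus>\<^bsub>H\<^esub>x\<in>A. c x \<odot>\<^bsub>H\<^esub> x)" by blast
  interpret H: Module.module "ring_of_type_algebra :: 'k ring" H
   by (rule module_quotient_algebra, rule idl)
  have closed: "cl x \<in> carrier H" for x
   using quotient_algebra_carrier[OF idl] by blast
  have "(\<Oplus>\<^bsub>H\<^esub>x\<in>A. c x \<odot>\<^bsub>H\<^esub> x) = (\<Oplus>\<^bsub>H\<^esub>x\<in>A. cl (scalar (c x) * p x))"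
  proof (rule H.finsum_cong')
   show "c x \<odot>\<^bsub>H\<^esub> x = cl (scalar (c x) * p x)" if "x \<in> A" for x
    using p[OF that] quotient_algebra_smult_class[OF idl, of "c x" "p x"] by simp
  qed (use closed in auto)
  then have "word_monomial w - (\<Sum>x\<in>A. scalar (c x) * p x) \<in> I"
   using c by (simp add: finsum_cosets[OF A(1)] coset_eq_iff)
  from functional_nil_hecke_ideal[OF f this[unfolded I_def]]
  have "f w = 0" by (simp add: functional_sum fp)
  then show False by (simp add: f_def braid_equiv.refl)
 qed
qed

end

section \<open>Partial actions on words\<close>

primrec run :: "('i => 's => 's option) => 'i list => 's => 's option" where
 "run act [] s = Some s"
| "run act (i # w) s = Option.bind (act i s) (run act w)"

lemma run_append: "run act (u @ v) s = Option.bind (run act u s) (run act v)"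
 by (induction u arbitrary: s) (simp_all add: Option.bind_assoc cong: Option.bind_cong)

lemma run_snoc: "run act (w @ [i]) s = Option.bind (run act w s) (act i)"
proof (induction w arbitrary: s)
 case Nil
 show ?case by (cases "act i s") auto
qed (simp_all add: Option.bind_assoc cong: Option.bind_cong)

lemma run_append_Some:
 "run act (u @ v) s = Some t \<longleftrightarrow> (\<exists>r. run act u s = Some r & run act v r = Some t)"
 by (auto simp: run_append bind_eq_Some_conv)

text \<open>A module with a basis permuted up to zero by the letters; \<open>None\<close> stands for zero.\<close>
definition nil_action ::
 "('i => 'i => enat) => ('i => nat) => 'i set set => 's set => ('i => 's => 's option) => bool" where
 "nil_action m d J S act \<longleftrightarrow>
  (\<forall>s\<in>S. \<forall>i t. act i s = Some t --> t \<in> S) &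
  (\<forall>s\<in>S. \<forall>a b. {a, b} \<in> J --> run act (braid_word m a b) s = run act (braid_word m b a) s) &
  (\<forall>s\<in>S. \<forall>f\<in>forbidden_words m d J. run act f s = None)"

lemma run_closed:
 assumes "!!s i t. s \<in> S ==> act i s = Some t ==> t \<in> S"
 shows "s \<in> S ==> run act w s = Some t ==> t \<in> S"
 using assms by (induction w arbitrary: s) (auto simp: bind_eq_Some_conv)

context
 fixes m :: "'i => 'i => enat" and d J S act
 assumes action: "nil_action m d J (S :: 's set) act"
begin

lemma nil_action_closed: "s \<in> S ==> run act w s = Some t ==> t \<in> S"
 using run_closed[of S act] action unfolding nil_action_def by blast

lemma nil_action_braid_equiv:
 "braid_equiv m J u v ==> s \<in> S ==> run act u s = run act v s"
proof (induction arbitrary: s rule: braid_equiv.induct)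
 case (move a b u v)
 have "run act (braid_word m a b) t = run act (braid_word m b a) t" if "t \<in> S" for t
  using action that move(1) unfolding nil_action_def by blast
 then show ?case
  using nil_action_closed[OF move(2), of u] by (cases "run act u s") (simp_all add: run_append)
qed auto

lemma nil_action_null:
 assumes "null_word m d J w" "s \<in> S"
 shows "run act w s = None"
proof -
 obtain u f v where f: "f \<in> forbidden_words m d J" "braid_equiv m J w (u @ f @ v)"
  using assms(1) unfolding null_word_def by blast
 have "run act (u @ f @ v) s = None"
  using action f(1) nil_action_closed[OF assms(2), of u] unfolding nil_action_def
  by (cases "run act u s") (simp_all add: run_append)
 then show ?thesis using nil_action_braid_equiv[OF f(2) assms(2)] by simp
qed

end

lemma braid_equiv_length:
 assumes "!!a b. m a b = m b a" "braid_equiv m J u v"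
 shows "length u = length v"
proof -
 have alt: "length (alternating_word a b n) = n" for a b :: 'a and n
  by (induction n arbitrary: a b) auto
 show ?thesis
  using assms(2,1) by (induction rule: braid_equiv.induct) (simp_all add: braid_word_def alt)
qed

text \<open>Equivalent words have equal length, so finitely many classes bound the length of nonnull words, whereas a
 word that does not lead to \<open>None\<close> is nonnull.\<close>
lemma infinite_nonnull_classes:
 assumes m: "!!a b. m a b = m b a" and act: "nil_action m d J S act"
  and long: "!!n. \<exists>w s. s \<in> S & n \<le> length w & run act w s ~= None"
 shows "infinite (nonnull_classes m d J)"
proof
 assume fin: "finite (nonnull_classes m d J)"
 define len :: "'a list set => nat" where "len C = length (SOME u. u \<in> C)" for C
 have len: "len (Collect (braid_equiv m J u)) = length u" for u
 proof -
  have "(SOME v. v \<in> Collect (braid_equiv m J u)) \<in> Collect (braid_equiv m J u)"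
   by (rule someI[of _ u]) (simp add: braid_equiv.refl)
  then show ?thesis using braid_equiv_length[OF m] unfolding len_def by fastforce
 qed
 obtain w s where w: "s \<in> S" "Suc (Max (len ` nonnull_classes m d J)) \<le> length w" "run act w s ~= None"
  using long by blast
 have "~ null_word m d J w" using nil_action_null[OF act _ w(1)] w(3) by auto
 then have "Collect (braid_equiv m J w) \<in> nonnull_classes m d J"
  unfolding nonnull_classes_def by blast
 then have "length w \<in> len ` nonnull_classes m d J"
  by (metis len imageI)
 then have "length w \<le> Max (len ` nonnull_classes m d J)" using fin by simp
 with w show False by simp
qed

text \<open>A local reason why the letter \<open>i\<close> annihilates the state \<open>x\<close>: a word leads to \<open>x\<close> which, followed by
 \<open>i\<close>, is forbidden, or is equivalent to a word with a prefix ending in a letter already known to annihilate.\<close>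
inductive dead ::
 "('i => 'i => enat) => ('i => nat) => 'i set set => 's set => ('i => 's => 's option) => 's => 'i => bool"
 for m :: "'i => 'i => enat" and d J S act where
 forbidden: "z \<in> S ==> run act g z = Some x ==> g @ [i] \<in> forbidden_words m d J ==>
  dead m d J S act x i"
| braid: "z \<in> S ==> run act g z = Some x ==> braid_equiv m J (g @ [i]) (p @ l # q) ==>
  run act p z = Some y ==> dead m d J S act y l ==> dead m d J S act x i"

text \<open>The conditions are local, which makes them checkable on infinite families and on tables: different
 letters leading to one state must come from a common state by equivalent words, and undefined values must
 have a reason. Induction along \<open>rk\<close> then identifies the states with the nonnull classes.\<close>
locale nil_model =
 fixes m :: "'i => 'i => enat" and d :: "'i => nat" and J :: "'i set set"
  and S :: "'s set" and act :: "'i => 's => 's option" and x0 :: 's and rk :: "'s => nat"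
 assumes action: "nil_action m d J S act"
  and source: "x0 \<in> S"
  and injective: "!!i x y z. x \<in> S ==> y \<in> S ==> act i x = Some z ==> act i y = Some z ==> x = y"
  and rank: "!!i x y. x \<in> S ==> act i x = Some y ==> rk x < rk y"
  and predecessor: "!!y. y \<in> S ==> y ~= x0 ==> \<exists>i. \<exists>x\<in>S. act i x = Some y"
  and diamond: "!!i j x x' y. x \<in> S ==> x' \<in> S ==> i ~= j ==> act i x = Some y ==> act j x' = Some y ==>
   \<exists>z\<in>S. \<exists>u v. braid_equiv m J (u @ [i]) (v @ [j]) & run act u z = Some x & run act v z = Some x'"
  and complete: "!!x i. x \<in> S ==> act i x = None ==> dead m d J S act x i"
begin

lemma reachable: "y \<in> S ==> \<exists>w. run act w x0 = Some y"
proof (induction "rk y" arbitrary: y rule: less_induct)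
 case less
 show ?case
 proof (cases "y = x0")
  case True
  then show ?thesis by (metis run.simps(1))
 next
  case False
  then obtain i x where x: "x \<in> S" "act i x = Some y" using predecessor less.prems by blast
  with less.hyps[OF rank[OF x]] obtain w where "run act w x0 = Some x" by blast
  then have "run act (w @ [i]) x0 = Some y" using x(2) by (simp add: run_append)
  then show ?thesis by blast
 qed
qed

lemma rank_run: "x \<in> S ==> run act w x = Some y ==> w ~= [] ==> rk x < rk y"
proof (induction w arbitrary: x)
 case (Cons i w)
 then obtain z where z: "act i x = Some z" "run act w z = Some y"
  by (auto simp: bind_eq_Some_conv)
 have "z \<in> S" using nil_action_closed[OF action Cons.prems(1), of "[i]" z] z(1) by simp
 with Cons.IH[of z] z rank[OF Cons.prems(1) z(1)] show ?case by (cases "w = []") auto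
qed simp

lemma run_unique:
 "run act u x0 = Some y ==> run act v x0 = Some y ==> braid_equiv m J u v"
proof (induction "rk y" arbitrary: y u v rule: less_induct)
 case less
 show ?case
 proof (cases "u = [] \<or> v = []")
  case True
  then have "y = x0" using less.prems by auto
  then have "u = []" "v = []" using less.prems rank_run[OF source] by blast+
  then show ?thesis by (simp add: braid_equiv.refl)
 next
  case False
  then obtain u' i v' j where uv: "u = u' @ [i]" "v = v' @ [j]"
   by (metis rev_exhaust)
  then obtain x x' where x: "run act u' x0 = Some x" "act i x = Some y"
   and x': "run act v' x0 = Some x'" "act j x' = Some y"
   using less.prems by (auto simp: run_append_Some bind_eq_Some_conv)
  have S: "x \<in> S" "x' \<in> S" using x x' nil_action_closed[OF action source] by blast+
  show ?thesis
  proof (cases "i = j")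
   case True
   then have "x = x'" using injective[OF S] x x' by blast
   then have "braid_equiv m J u' v'"
    using less.hyps[OF rank[OF S(1) x(2)] x(1)] x' by blast
   from braid_equiv_context[OF this, of "[]" "[i]"] show ?thesis using uv True by simp
  next
   case False
   from diamond[OF S False x(2) x'(2)] obtain z p q where z: "z \<in> S"
    "braid_equiv m J (p @ [i]) (q @ [j])" "run act p z = Some x" "run act q z = Some x'" by blast
   from reachable[OF z(1)] obtain w where w: "run act w x0 = Some z" by blast
   have "braid_equiv m J u' (w @ p)"
    by (rule less.hyps[OF rank[OF S(1) x(2)] x(1)]) (simp add: run_append w z)
   moreover have "braid_equiv m J (w @ q) v'"
    by (rule less.hyps[OF rank[OF S(2) x'(2)] _ x'(1)]) (simp add: run_append w z)
   ultimately have "braid_equiv m J u (w @ p @ [i])" "braid_equiv m J (w @ q @ [j]) v"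
    using braid_equiv_append[OF _ braid_equiv.refl, of m J u' "w @ p" "[i]"]
     braid_equiv_append[OF _ braid_equiv.refl, of m J "w @ q" v' "[j]"] by (simp_all add: uv)
   moreover have "braid_equiv m J (w @ p @ [i]) (w @ q @ [j])"
    using braid_equiv_context[OF z(2), of w "[]"] by simp
   ultimately show ?thesis using braid_equiv.trans by blast
  qed
 qed
qed

lemma dead_null:
 "dead m d J S act x i ==> run act u x0 = Some x ==> null_word m d J (u @ [i])"
proof (induction arbitrary: u rule: dead.induct)
 case (forbidden z g x i)
 from reachable[OF forbidden(1)] obtain w where w: "run act w x0 = Some z" by blast
 have "run act (w @ g) x0 = Some x" using w forbidden by (simp add: run_append)
 from run_unique[OF forbidden(4) this] have "braid_equiv m J (u @ [i]) ((w @ g) @ [i])"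
  by (rule braid_equiv_append[OF _ braid_equiv.refl])
 then have "braid_equiv m J (u @ [i]) (w @ (g @ [i]) @ [])" by simp
 then show ?case using forbidden(3) unfolding null_word_def by blast
next
 case (braid z g x i p l q y)
 from reachable[OF braid(1)] obtain w where w: "run act w x0 = Some z" by blast
 have "run act (w @ g) x0 = Some x" using w braid by (simp add: run_append)
 from run_unique[OF braid(7) this] have "braid_equiv m J (u @ [i]) ((w @ g) @ [i])"
  by (rule braid_equiv_append[OF _ braid_equiv.refl])
 moreover have "braid_equiv m J (w @ g @ [i]) (w @ p @ l # q)"
  using braid_equiv_context[OF braid(3), of w "[]"] by simp
 ultimately have "braid_equiv m J (u @ [i]) (w @ p @ l # q)"
  by (metis append_assoc braid_equiv.trans)
 then have eq: "braid_equiv m J (u @ [i]) (((w @ p) @ [l]) @ q)" by simp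
 have "run act (w @ p) x0 = Some y" using w braid by (simp add: run_append)
 from braid(6)[OF this] have "null_word m d J ((w @ p) @ [l])" .
 from null_word_append[OF this, of "[]" q] show ?case
  unfolding null_word_cong[OF eq] by simp
qed

lemma nonnull_iff_run: "~ null_word m d J w \<longleftrightarrow> run act w x0 ~= None"
proof
 show "run act w x0 ~= None ==> ~ null_word m d J w"
  using nil_action_null[OF action _ source] by auto
 show "~ null_word m d J w ==> run act w x0 ~= None"
 proof (induction w rule: rev_induct)
  case (snoc i w)
  have "~ null_word m d J w"
   using snoc.prems null_word_append[of m d J w "[]" "[i]"] by auto
  then obtain x where x: "run act w x0 = Some x" using snoc.IH by blast
  have "act i x ~= None"
  proof
   assume "act i x = None"
   from complete[OF nil_action_closed[OF action source x] this] snoc.prems show False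
    using dead_null[OF _ x] by simp
  qed
  then show ?case using x by (simp add: run_snoc)
 qed simp
qed

lemma nonnull_classes_bij:
 "\<exists>f. bij_betw f S (nonnull_classes m d J)"
proof -
 define word where "word y = (SOME w. run act w x0 = Some y)" for y
 have word: "run act (word y) x0 = Some y" if "y \<in> S" for y
  unfolding word_def by (rule someI_ex) (rule reachable[OF that])
 define f where "f y = Collect (braid_equiv m J (word y))" for y
 have "inj_on f S"
 proof (rule inj_onI)
  fix x y assume xy: "x \<in> S" "y \<in> S" "f x = f y"
  then have "braid_equiv m J (word x) (word y)"
   by (simp add: f_def Collect_braid_equiv_eq_iff)
  from nil_action_braid_equiv[OF action this source] show "x = y"
   using word xy by simp
 qed
 moreover have "f ` S = nonnull_classes m d J"
 proof
  show "f ` S \<subseteq> nonnull_classes m d J"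
  proof (rule image_subsetI)
   fix y assume "y \<in> S"
   then have "~ null_word m d J (word y)" unfolding nonnull_iff_run by (simp add: word)
   then show "f y \<in> nonnull_classes m d J" unfolding nonnull_classes_def f_def by blast
  qed
  show "nonnull_classes m d J \<subseteq> f ` S"
  proof
   fix C assume "C \<in> nonnull_classes m d J"
   then obtain u where u: "C = Collect (braid_equiv m J u)" "~ null_word m d J u"
    unfolding nonnull_classes_def by blast
   then obtain y where y: "run act u x0 = Some y" unfolding nonnull_iff_run by auto
   then have "y \<in> S" by (rule nil_action_closed[OF action source])
   moreover have "C = f y"
    using run_unique[OF y word[OF \<open>y \<in> S\<close>]] u(1)
    by (simp add: f_def Collect_braid_equiv_eq_iff)
   ultimately show "C \<in> f ` S" by blast
  qed
 qed
 ultimately show ?thesis unfolding bij_betw_def by blast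
qed

lemma card_nonnull_classes: "card (nonnull_classes m d J) = card S"
 using nonnull_classes_bij bij_betw_same_card by metis

lemma finite_nonnull_classes: "finite (nonnull_classes m d J) \<longleftrightarrow> finite S"
 using nonnull_classes_bij bij_betw_finite by metis

end

section \<open>Short braid relations\<close>

abbreviation short_pairs :: "('i => 'i => enat) => 'i set set" where
 "short_pairs m \<equiv> braid_pairs_less m 4"

lemma length_alternating_word [simp]: "length (alternating_word a b n) = n"
 by (induction n arbitrary: a b) auto

lemma coxeter_matrixD:
 assumes "coxeter_matrix m"
 shows "m i i = 1" "m i j = m j i" "i ~= j ==> m i j \<ge> 2"
 using assms by (auto simp: coxeter_matrix_def)

lemma braid_pairs_iff:
 assumes "coxeter_matrix m"
 shows "{a, b} \<in> braid_pairs m \<longleftrightarrow> a ~= b & m a b ~= \<infinity>"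
 using coxeter_matrixD(2)[OF assms] unfolding braid_pairs_def by (auto simp: doubleton_eq_iff)

lemma short_pairs_iff:
 assumes "coxeter_matrix m"
 shows "{a, b} \<in> short_pairs m \<longleftrightarrow> a ~= b & (m a b = 2 \<or> m a b = 3)"
proof -
 have "{a, b} \<in> short_pairs m \<longleftrightarrow> {a, b} \<in> braid_pairs m & the_enat (m a b) < 4"
 proof
  assume "{a, b} \<in> short_pairs m"
  then show "{a, b} \<in> braid_pairs m & the_enat (m a b) < 4"
   using coxeter_matrixD(2)[OF assms, of a b] unfolding braid_pairs_less_def braid_word_def
   by (auto simp: doubleton_eq_iff insert_commute)
 next
  assume "{a, b} \<in> braid_pairs m & the_enat (m a b) < 4"
  then show "{a, b} \<in> short_pairs m"
   unfolding braid_pairs_less_def braid_word_def by fastforce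
 qed
 also have "\<dots> \<longleftrightarrow> a ~= b & (m a b = 2 \<or> m a b = 3)"
 proof (cases "m a b")
  case (enat n)
  have "a ~= b ==> 2 \<le> n" using coxeter_matrixD(3)[OF assms, of a b] enat by (simp add: numeral_eq_enat)
  then show ?thesis unfolding braid_pairs_iff[OF assms] enat by (auto simp: numeral_eq_enat)
 next
  case infinity
  then show ?thesis unfolding braid_pairs_iff[OF assms] by (simp add: numeral_eq_enat)
 qed
 finally show ?thesis .
qed

lemma braid_word_2: "m a b = 2 ==> braid_word m a b = [a, b]"
 by (simp add: braid_word_def numeral_eq_enat eval_nat_numeral)

lemma braid_word_3: "m a b = 3 ==> braid_word m a b = [a, b, a]"
 by (simp add: braid_word_def numeral_eq_enat eval_nat_numeral)

lemma short_forbidden_words_iff: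
 assumes "coxeter_matrix m"
 shows "f \<in> forbidden_words m d (short_pairs m) \<longleftrightarrow>
  (\<exists>i. f = replicate (d i) i) \<or>
  (\<exists>a b n. a ~= b & m a b = enat n & 4 \<le> n & f = alternating_word a b n)"
proof -
 have long: "{a, b} \<in> braid_pairs m - short_pairs m \<longleftrightarrow> (\<exists>n\<ge>4. a ~= b & m a b = enat n)" for a b
 proof (cases "m a b")
  case (enat n)
  have "a ~= b ==> 2 \<le> n" using coxeter_matrixD(3)[OF assms, of a b] enat by (simp add: numeral_eq_enat)
  then show ?thesis
   unfolding Diff_iff braid_pairs_iff[OF assms] short_pairs_iff[OF assms] enat
   by (auto simp: numeral_eq_enat)
 next
  case infinity
  then show ?thesis unfolding Diff_iff braid_pairs_iff[OF assms] by simp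
 qed
 have "f \<in> forbidden_words m d (short_pairs m) \<longleftrightarrow>
  (\<exists>i. f = replicate (d i) i) \<or> (\<exists>a b. {a, b} \<in> braid_pairs m - short_pairs m & f = braid_word m a b)"
  unfolding forbidden_words_def by (auto simp del: Diff_iff)
 also have "(\<exists>a b. {a, b} \<in> braid_pairs m - short_pairs m & f = braid_word m a b) \<longleftrightarrow>
  (\<exists>a b n. a ~= b & m a b = enat n & 4 \<le> n & f = alternating_word a b n)"
 proof -
  have "({a, b} \<in> braid_pairs m - short_pairs m & f = braid_word m a b) \<longleftrightarrow>
   (\<exists>n. a ~= b & m a b = enat n & 4 \<le> n & f = alternating_word a b n)" for a b
   unfolding long braid_word_def by auto
  then show ?thesis by simp
 qed
 finally show ?thesis .
qed

lemma nil_action_short: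
 assumes m: "coxeter_matrix m"
  and closed: "!!s i t. s \<in> S ==> act i s = Some t ==> t \<in> S"
  and commute: "!!s a b. s \<in> S ==> a ~= b ==> m a b = 2 ==> run act [a, b] s = run act [b, a] s"
  and braid3: "!!s a b. s \<in> S ==> a ~= b ==> m a b = 3 ==> run act [a, b, a] s = run act [b, a, b] s"
  and long: "!!s a b n. s \<in> S ==> a ~= b ==> m a b = enat n ==> 4 \<le> n ==>
   run act (alternating_word a b n) s = None"
  and power: "!!s a. s \<in> S ==> run act (replicate (d a) a) s = None"
 shows "nil_action m d (short_pairs m) S act"
 unfolding nil_action_def
proof (intro conjI ballI allI impI)
 show "s \<in> S ==> act i s = Some t ==> t \<in> S" for s i t by (rule closed)
 show "run act (braid_word m a b) s = run act (braid_word m b a) s"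
  if "s \<in> S" "{a, b} \<in> short_pairs m" for s a b
 proof -
  have ab: "a ~= b" "m b a = m a b" "m a b = 2 \<or> m a b = 3"
   using that(2) coxeter_matrixD(2)[OF m, of b a] unfolding short_pairs_iff[OF m] by auto
  from ab(3) show ?thesis
  proof
   assume 2: "m a b = 2"
   with ab(2) have "m b a = 2" by simp
   then show ?thesis using commute[OF that(1) ab(1) 2] 2 by (simp only: braid_word_2)
  next
   assume 3: "m a b = 3"
   with ab(2) have "m b a = 3" by simp
   then show ?thesis using braid3[OF that(1) ab(1) 3] 3 by (simp only: braid_word_3)
  qed
 qed
 show "run act f s = None" if "s \<in> S" "f \<in> forbidden_words m d (short_pairs m)" for s f
  using that long power unfolding short_forbidden_words_iff[OF m] by auto
qed

lemma braid_equiv_2: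
 assumes "coxeter_matrix m" "a ~= b" "m a b = 2"
 shows "braid_equiv m (short_pairs m) [a, b] [b, a]"
 using braid_equiv.move[of a b "short_pairs m" m "[]" "[]"] assms coxeter_matrixD(2)[OF assms(1), of b a]
 by (simp add: short_pairs_iff braid_word_2)

lemma braid_equiv_3:
 assumes "coxeter_matrix m" "a ~= b" "m a b = 3"
 shows "braid_equiv m (short_pairs m) [a, b, a] [b, a, b]"
 using braid_equiv.move[of a b "short_pairs m" m "[]" "[]"] assms coxeter_matrixD(2)[OF assms(1), of b a]
 by (simp add: short_pairs_iff braid_word_3)

section \<open>The numbers game\<close>

text \<open>The off-diagonal entry \<open>2 cos (pi / m)\<close> of the symmetric Cartan matrix up to sign; it is -2 on the diagonal, so that one formula
 covers the fired node and its neighbours.\<close>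
definition bond_weight :: "enat => real" where
 "bond_weight e = (case e of enat n => 2 * cos (pi / real n) | \<infinity> => 2)"

definition fire :: "('i => 'i => enat) => 'i => ('i => real) => 'i => real" where
 "fire m i x = (%j. x j + bond_weight (m i j) * x i)"

definition game :: "('i => 'i => enat) => 'i => ('i => real) => ('i => real) option" where
 "game m i x = (if x i > 0 then Some (fire m i x) else None)"

text \<open>The coefficients in alternating firings of two nodes: \<open>sin (k pi / m) / sin (pi / m)\<close>, and \<open>k\<close> for an infinite label.\<close>
definition chebyshev :: "enat => nat => real" where
 "chebyshev e k = (case e of enat n => sin (real k * (pi / real n)) / sin (pi / real n) | \<infinity> => real k)"

lemma bond_weight_1 [simp]: "bond_weight 1 = -2"
 by (simp add: bond_weight_def one_enat_def)

lemma sin_pi_div_pos: "2 \<le> n ==> sin (pi / real n) > 0"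
 by (intro sin_gt_zero) (auto simp: field_simps)

lemma chebyshev_0 [simp]: "chebyshev e 0 = 0"
 by (cases e) (simp_all add: chebyshev_def)

lemma chebyshev_1: "e \<ge> 2 ==> chebyshev e (Suc 0) = 1"
proof (cases e)
 case (enat n)
 assume "e \<ge> 2"
 then have "2 \<le> n" by (simp add: enat numeral_eq_enat)
 from sin_pi_div_pos[OF this] show ?thesis by (simp add: enat chebyshev_def)
qed (simp add: chebyshev_def)

lemma chebyshev_rec:
 "chebyshev e (Suc (Suc k)) = bond_weight e * chebyshev e (Suc k) - chebyshev e k"
proof (cases e)
 case (enat n)
 define t where "t = pi / real n"
 have "sin (real (Suc (Suc k)) * t) = 2 * cos t * sin (real (Suc k) * t) - sin (real k * t)"
 proof -
  have 1: "real (Suc (Suc k)) * t = real (Suc k) * t + t" "real k * t = real (Suc k) * t - t"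
   by (simp_all add: algebra_simps)
  show ?thesis unfolding 1 by (simp only: sin_add sin_diff) (simp add: algebra_simps)
 qed
 then show ?thesis
  by (simp add: enat chebyshev_def bond_weight_def flip: t_def) (simp add: diff_divide_distrib)
qed (simp add: chebyshev_def bond_weight_def)

lemma chebyshev_nonneg: "2 \<le> e ==> enat k \<le> e ==> 0 \<le> chebyshev e k"
proof (cases e)
 case (enat n)
 assume "2 \<le> e" "enat k \<le> e"
 then have n: "2 \<le> n" "k \<le> n" by (simp_all add: enat numeral_eq_enat)
 have "0 \<le> sin (real k * (pi / real n))"
  using n by (intro sin_ge_zero) (auto simp: field_simps)
 then show ?thesis using sin_pi_div_pos[OF n(1)] by (simp add: enat chebyshev_def)
qed (simp add: chebyshev_def)

lemma chebyshev_pos: "2 \<le> e ==> 0 < k ==> enat k < e ==> 0 < chebyshev e k"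
proof (cases e)
 case (enat n)
 assume "2 \<le> e" "0 < k" "enat k < e"
 then have n: "2 \<le> n" "k < n" "0 < k" by (simp_all add: enat numeral_eq_enat)
 have "0 < sin (real k * (pi / real n))"
  using n by (intro sin_gt_zero) (auto simp: field_simps)
 then show ?thesis using sin_pi_div_pos[OF n(1)] by (simp add: enat chebyshev_def)
qed (simp add: chebyshev_def)

lemma chebyshev_period:
 assumes "2 \<le> n"
 shows "chebyshev (enat n) n = 0" "chebyshev (enat n) (Suc n) = -1" "chebyshev (enat n) (n - 1) = 1"
proof -
 have s: "sin (pi / real n) > 0" by (rule sin_pi_div_pos[OF assms])
 have 1: "real n * (pi / real n) = pi" "real (Suc n) * (pi / real n) = pi / real n + pi"
  "real (n - 1) * (pi / real n) = pi - pi / real n"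
 proof -
  have n0: "real n ~= 0" using assms by simp
  show 1: "real n * (pi / real n) = pi" using n0 by simp
  have "real (Suc n) * (pi / real n) = pi / real n + real n * (pi / real n)" by (simp only: of_nat_Suc distrib_right mult_1)
  then show "real (Suc n) * (pi / real n) = pi / real n + pi" unfolding 1 .
  have "real (n - 1) = real n - 1" using assms by simp
  then have "real (n - 1) * (pi / real n) = real n * (pi / real n) - pi / real n"
   by (simp only: left_diff_distrib mult_1)
  then show "real (n - 1) * (pi / real n) = pi - pi / real n" unfolding 1 .
 qed
 show "chebyshev (enat n) n = 0" by (simp only: chebyshev_def enat.case 1) simp
 show "chebyshev (enat n) (Suc n) = -1"
  using s by (simp only: chebyshev_def enat.case 1) simp
 show "chebyshev (enat n) (n - 1) = 1"
  using s by (simp only: chebyshev_def enat.case 1) simp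
qed

lemma bond_weight_bound:
 assumes n: "2 \<le> n"
 shows "bond_weight (enat n) * bond_weight (enat n) < 4"
proof -
 define c s where "c = cos (pi / real n)" and "s = sin (pi / real n)"
 have "0 < s * s" using sin_pi_div_pos[OF n] by (simp add: s_def)
 moreover have "s * s + c * c = 1"
  using sin_cos_squared_add[of "pi / real n"] by (simp add: s_def c_def power2_eq_square)
 moreover have "bond_weight (enat n) = 2 * c" by (simp add: bond_weight_def c_def)
 ultimately show ?thesis by simp
qed

subsection \<open>Alternating plays\<close>

abbreviation other :: "'i => 'i => nat => 'i" where
 "other a b n \<equiv> if even n then a else b"

lemma rev_alternating_word:
 "rev (alternating_word a b n) = (if even n then alternating_word b a n else alternating_word a b n)"
proof -
 have snoc: "alternating_word a b (Suc n) = alternating_word a b n @ [other a b n]" for a b :: 'a and n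
  by (induction n arbitrary: a b) auto
 show ?thesis
 proof (induction n arbitrary: a b)
  case (Suc n)
  have "rev (alternating_word a b (Suc n)) = rev (alternating_word b a n) @ [a]" by simp
  also have "\<dots> = (if even (Suc n) then alternating_word b a (Suc n) else alternating_word a b (Suc n))"
   unfolding Suc.IH snoc by simp
  finally show ?case .
 qed simp
qed

lemma alternating_word_snoc: "alternating_word a b (Suc n) = alternating_word a b n @ [other a b n]"
 by (induction n arbitrary: a b) auto

lemma alternating_word_add:
 "alternating_word a b (n + k) = alternating_word a b n @ alternating_word (other a b n) (other b a n) k"
 by (induction n arbitrary: a b) auto

lemma concat_replicate_pair: "concat (replicate n [a, b]) = alternating_word a b (2 * n)"
 by (induction n) auto

context
 fixes m :: "'i => 'i => enat"
 assumes m: "coxeter_matrix m"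
begin

lemma fire_fire [simp]: "fire m i (fire m i x) = x"
 using coxeter_matrixD(1)[OF m] by (auto simp: fire_def algebra_simps)

lemma fire_self [simp]: "fire m i x i = - x i"
 using coxeter_matrixD(1)[OF m] by (simp add: fire_def)

lemma fold_fire_rev: "fold (fire m) (rev w) (fold (fire m) w x) = x"
 by (induction w arbitrary: x) simp_all

lemma run_game: "run (game m) w x = Some y ==> y = fold (fire m) w x"
 by (induction w arbitrary: x) (auto simp: game_def bind_eq_Some_conv split: if_splits)

lemma fold_alternating:
 fixes f g :: 'i
 assumes "f ~= g"
 shows "fold (fire m) (alternating_word f g n) x (other f g n) =
   x f * chebyshev (m f g) (Suc n) + x g * chebyshev (m f g) n"
  and "fold (fire m) (alternating_word f g n) x (other g f n) =
   - (x f * chebyshev (m f g) n + x g * (bond_weight (m f g) * chebyshev (m f g) n - chebyshev (m f g) (Suc n)))"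
 using assms
proof (induction n arbitrary: f g x)
 case 0
 {
  case (1 f g x)
  then show ?case using chebyshev_1[OF coxeter_matrixD(3)[OF m 1]] by simp
 next
  case (2 f g x)
  then show ?case using chebyshev_1[OF coxeter_matrixD(3)[OF m 2]] by simp
 }
next
 case (Suc n)
 have sym: "m g f = m f g" for f g by (rule coxeter_matrixD(2)[OF m])
 have g: "fire m f x g = x g + bond_weight (m f g) * x f" for f g x by (simp add: fire_def)
 {
  case (1 f g x)
  then have gf: "g ~= f" by simp
  have "fold (fire m) (alternating_word f g (Suc n)) x (other f g (Suc n)) =
    fold (fire m) (alternating_word g f n) (fire m f x) (other g f n)" by simp
  also have "\<dots> = (x g + bond_weight (m f g) * x f) * chebyshev (m f g) (Suc n) + - x f * chebyshev (m f g) n"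
   unfolding Suc.IH(1)[OF gf] sym[of g f] fire_self g[of f x g] by simp
  finally show ?case by (simp only: chebyshev_rec) (simp add: algebra_simps)
 next
  case (2 f g x)
  then have gf: "g ~= f" by simp
  have "fold (fire m) (alternating_word f g (Suc n)) x (other g f (Suc n)) =
    fold (fire m) (alternating_word g f n) (fire m f x) (other f g n)" by simp
  also have "\<dots> = - ((x g + bond_weight (m f g) * x f) * chebyshev (m f g) n +
    - x f * (bond_weight (m f g) * chebyshev (m f g) n - chebyshev (m f g) (Suc n)))"
   unfolding Suc.IH(2)[OF gf] sym[of g f] fire_self g[of f x g] by simp
  finally show ?case by (simp only: chebyshev_rec) (simp add: algebra_simps)
 }
qed

lemma run_alternating_iff:
 assumes "f ~= g"
 shows "run (game m) (alternating_word f g n) x ~= None \<longleftrightarrow>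
  (\<forall>k<n. 0 < x f * chebyshev (m f g) (Suc k) + x g * chebyshev (m f g) k)"
 using assms
proof (induction n arbitrary: f g x)
 case (Suc n f g x)
 have sym: "m g f = m f g" by (rule coxeter_matrixD(2)[OF m])
 have f: "fire m f x f = - x f" by simp
 have g: "fire m f x g = x g + bond_weight (m f g) * x f" by (simp add: fire_def)
 have "run (game m) (alternating_word f g (Suc n)) x ~= None \<longleftrightarrow>
  0 < x f & run (game m) (alternating_word g f n) (fire m f x) ~= None"
  by (simp add: game_def)
 also have "run (game m) (alternating_word g f n) (fire m f x) ~= None \<longleftrightarrow>
  (\<forall>k<n. 0 < x f * chebyshev (m f g) (Suc (Suc k)) + x g * chebyshev (m f g) (Suc k))"
  unfolding Suc.IH[of g f "fire m f x", OF Suc.prems[symmetric]] sym f g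
  by (simp add: chebyshev_rec algebra_simps)
 also have "0 < x f \<longleftrightarrow> 0 < x f * chebyshev (m f g) (Suc 0) + x g * chebyshev (m f g) 0"
  using chebyshev_1[OF coxeter_matrixD(3)[OF m Suc.prems]] by simp
 finally show ?case by (simp only: All_less_Suc2)
qed simp

lemma fold_fire_dihedral:
 assumes "set w \<subseteq> {f, g}"
 shows "\<exists>A B. \<forall>j. fold (fire m) w x j = x j + bond_weight (m f j) * A + bond_weight (m g j) * B"
 using assms
proof (induction w arbitrary: x)
 case Nil
 show ?case by (intro exI[of _ 0]) simp
next
 case (Cons i w x)
 then obtain A B where AB:
  "\<forall>j. fold (fire m) w (fire m i x) j = fire m i x j + bond_weight (m f j) * A + bond_weight (m g j) * B"
  by fastforce
 have fire: "fire m k x j = x j + bond_weight (m k j) * x k" for k j by (simp add: fire_def)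
 from Cons.prems have "i = f \<or> i = g" by simp
 then show ?case
 proof
  assume "i = f"
  with AB show ?thesis
   by - (rule exI[of _ "A + x i"], rule exI[of _ B], simp add: fire algebra_simps)
 next
  assume "i = g"
  with AB show ?thesis
   by - (rule exI[of _ A], rule exI[of _ "B + x i"], simp add: fire algebra_simps)
 qed
qed

lemma set_alternating_word: "set (alternating_word a b n) \<subseteq> {a, b}"
 by (induction n arbitrary: a b) auto

lemma fold_fire_braid:
 assumes fg: "f ~= g" "m f g = enat n"
 shows "fold (fire m) (alternating_word f g n) x = fold (fire m) (alternating_word g f n) x"
proof -
 let ?y = "fold (fire m) (alternating_word f g n) x" and ?z = "fold (fire m) (alternating_word g f n) x"
 let ?c = "bond_weight (enat n)"
 have n: "2 \<le> n" using coxeter_matrixD(3)[OF m fg(1)] fg(2) by (simp add: numeral_eq_enat)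
 have sym: "m g f = enat n" using fg(2) coxeter_matrixD(2)[OF m] by simp
 have n1: "?c * 0 - -1 = (1::real)" by simp
 have "?y (other f g n) = - x f" "?y (other g f n) = - x g"
  using fold_alternating[OF fg(1), of n x] by (simp_all add: fg(2) chebyshev_period[OF n])
 moreover have "?z (other g f n) = - x g" "?z (other f g n) = - x f"
  using fold_alternating[OF fg(1)[symmetric], of n x] by (simp_all add: sym chebyshev_period[OF n])
 ultimately have eq: "?y f = ?z f" "?y g = ?z g"
  by (cases "even n"; simp)+
 obtain A B where AB: "!!j. ?y j = x j + bond_weight (m f j) * A + bond_weight (m g j) * B"
  using fold_fire_dihedral[OF set_alternating_word] by blast
 have "set (alternating_word g f n) \<subseteq> {f, g}" using set_alternating_word[of g f n] by blast
 then obtain A' B' where AB': "!!j. ?z j = x j + bond_weight (m f j) * A' + bond_weight (m g j) * B'"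
  using fold_fire_dihedral by blast
 have e1: "2 * (A - A') = ?c * (B - B')" "2 * (B - B') = ?c * (A - A')"
  using eq AB[of f] AB[of g] AB'[of f] AB'[of g] coxeter_matrixD(1)[OF m]
  by (simp_all add: fg(2) sym algebra_simps)
 have "4 * (A - A') = 2 * (2 * (A - A'))" by simp
 also have "\<dots> = ?c * (2 * (B - B'))" unfolding e1(1) by simp
 also have "\<dots> = ?c * ?c * (A - A')" unfolding e1(2) by simp
 finally have "(4 - ?c * ?c) * (A - A') = 0" by (simp add: algebra_simps)
 then have "A = A'" using bond_weight_bound[OF n] by simp
 with e1(2) have "B = B'" by simp
 with \<open>A = A'\<close> show ?thesis using AB AB' by auto
qed

lemma run_alternating_full:
 assumes fg: "f ~= g" "m f g = enat n"
 shows "run (game m) (alternating_word f g n) x ~= None \<longleftrightarrow> 0 < x f & 0 < x g"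
proof -
 have n: "2 \<le> n" using coxeter_matrixD(3)[OF m fg(1)] fg(2) by (simp add: numeral_eq_enat)
 let ?U = "chebyshev (enat n)"
 have e: "2 \<le> enat n" using n by (simp add: numeral_eq_enat)
 show ?thesis
  unfolding run_alternating_iff[OF fg(1)] fg(2)
 proof
  assume a: "\<forall>k<n. 0 < x f * ?U (Suc k) + x g * ?U k"
  have "0 < x f" using a[rule_format, of 0] n chebyshev_1[OF e] by simp
  moreover have "0 < x g" using a[rule_format, of "n - 1"] n chebyshev_period[OF n] by simp
  ultimately show "0 < x f & 0 < x g" by simp
 next
  assume p: "0 < x f & 0 < x g"
  show "\<forall>k<n. 0 < x f * ?U (Suc k) + x g * ?U k"
  proof (intro allI impI)
   fix k assume k: "k < n"
   show "0 < x f * ?U (Suc k) + x g * ?U k"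
   proof (cases "Suc k = n")
    case True
    then have "?U k = 1" "?U (Suc k) = 0" using chebyshev_period[OF n] by auto
    then show ?thesis using p by simp
   next
    case False
    then have "0 < ?U (Suc k)" "0 \<le> ?U k"
     using k e chebyshev_pos[of "enat n" "Suc k"] chebyshev_nonneg[of "enat n" k] by auto
    then show ?thesis using p by (intro add_pos_nonneg) auto
   qed
  qed
 qed
qed

lemma game_braid:
 assumes fg: "f ~= g" "m f g = enat n"
 shows "run (game m) (alternating_word f g n) x = run (game m) (alternating_word g f n) x"
proof -
 have gf: "g ~= f" "m g f = enat n" using fg coxeter_matrixD(2)[OF m, of g f] by auto
 have "(run (game m) (alternating_word f g n) x ~= None) = (run (game m) (alternating_word g f n) x ~= None)"
  unfolding run_alternating_full[OF fg] run_alternating_full[OF gf] by blast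
 then show ?thesis
  using run_game[of "alternating_word f g n" x] run_game[of "alternating_word g f n" x] fold_fire_braid[OF fg, of x]
  by (cases "run (game m) (alternating_word f g n) x"; cases "run (game m) (alternating_word g f n) x") auto
qed

lemma game_nil_action: "nil_action m (%_. 2) (braid_pairs m) UNIV (game m)"
 unfolding nil_action_def
proof (intro conjI ballI allI impI)
 fix s a b assume "{a, b} \<in> braid_pairs m"
 then obtain n where n: "a ~= b" "m a b = enat n" "m b a = enat n"
  using coxeter_matrixD(2)[OF m, of b a] unfolding braid_pairs_iff[OF m] by auto
 then show "run (game m) (braid_word m a b) s = run (game m) (braid_word m b a) s"
  using game_braid[OF n(1,2)] by (simp add: braid_word_def)
next
 fix s f assume "f \<in> forbidden_words m (%_. 2) (braid_pairs m)"
 then obtain i where "f = [i, i]" unfolding forbidden_words_def by (auto simp: eval_nat_numeral)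
 then show "run (game m) f s = None" by (simp add: game_def)
qed simp

text \<open>The exchange property: if a position reached by a legal play has a negative value at a node, the play can be
 rearranged by braid moves so that it ends by firing this node. It replaces the root system in the identification of words with group elements.\<close>
lemma legal_last_letter:
 assumes x0: "!!i. 0 < x0 i" and u: "run (game m) u x0 = Some y"
 shows "y j ~= 0 & (y j < 0 --> (\<exists>u'. braid_equiv m (braid_pairs m) u (u' @ [j])))"
 using u
proof (induction "length u" arbitrary: u y j rule: less_induct)
 case less
 let ?eq = "braid_equiv m (braid_pairs m)"
 show ?case
 proof (cases u rule: rev_cases)
  case Nil
  with less.prems x0[of j] show ?thesis by simp
 next
  case (snoc u1 i)
  then obtain x1 where x1: "run (game m) u1 x0 = Some x1" "game m i x1 = Some y"
   using less.prems by (auto simp: run_snoc bind_eq_Some_conv)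
  then have yi: "y i < 0" by (auto simp: game_def split: if_splits)
  show ?thesis
  proof (cases "i = j")
   case True
   then have "?eq u (u1 @ [j])" using snoc braid_equiv.refl by simp
   then show ?thesis using yi True by auto
  next
   case False
   define Q where "Q n \<longleftrightarrow> (\<exists>w. ?eq u (w @ rev (alternating_word i j n)))" for n
   have Q1: "Q 1" unfolding Q_def using snoc braid_equiv.refl by (intro exI[of _ u1]) auto
   have Qb: "n \<le> length u" if "Q n" for n
    using that braid_equiv_length[OF coxeter_matrixD(2)[OF m]] unfolding Q_def by fastforce
   define n where "n = (GREATEST n. Q n)"
   have Qn: "Q n" unfolding n_def by (rule GreatestI_nat[of Q 1 "length u"]) (use Q1 Qb in auto)
   have max: "~ Q (Suc n)"
    using Greatest_le_nat[of Q "Suc n" "length u"] Qb unfolding n_def by auto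
   have n: "1 \<le> n" unfolding n_def by (rule Greatest_le_nat[of Q 1 "length u"]) (use Q1 Qb in auto)
   define f g where "f = other j i n" and "g = other i j n"
   have fg: "f ~= g" "m f g = m i j" "other f g n = j"
    using False coxeter_matrixD(2)[OF m, of j i] by (auto simp: f_def g_def)
   have rev_n: "rev (alternating_word i j n) = alternating_word f g n"
    "rev (alternating_word i j (Suc n)) = alternating_word g f (Suc n)"
    unfolding rev_alternating_word f_def g_def by auto
   obtain w where w: "?eq u (w @ alternating_word f g n)" using Qn unfolding Q_def rev_n by blast
   have "run (game m) (w @ alternating_word f g n) x0 = Some y"
    using nil_action_braid_equiv[OF game_nil_action w] less.prems by simp
   then obtain z where z: "run (game m) w x0 = Some z" "run (game m) (alternating_word f g n) z = Some y"
    by (auto simp: run_append_Some)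
   have "length u = length w + n"
    using braid_equiv_length[OF coxeter_matrixD(2)[OF m] w] by simp
   then have lw: "length w < length u" using n by simp
   have zg: "0 < z g"
   proof (rule ccontr)
    assume "~ 0 < z g"
    with less.hyps[OF lw z(1), of g] obtain w' where "?eq w (w' @ [g])" by auto
    from braid_equiv_append[OF this braid_equiv.refl, of "alternating_word f g n"]
    have "?eq (w @ alternating_word f g n) (w' @ alternating_word g f (Suc n))" by simp
    then have "?eq u (w' @ alternating_word g f (Suc n))" using w braid_equiv.trans by blast
    then show False using max unfolding Q_def rev_n by blast
   qed
   have legal: "!!k. k < n ==> 0 < z f * chebyshev (m i j) (Suc k) + z g * chebyshev (m i j) k"
    using z(2) run_alternating_iff[OF fg(1), of n z] fg(2) by auto
   have e: "2 \<le> m i j" by (rule coxeter_matrixD(3)[OF m False])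
   have zf: "0 < z f" using legal[of 0] n chebyshev_1[OF e] by simp
   have yj: "y j = z f * chebyshev (m i j) (Suc n) + z g * chebyshev (m i j) n"
    using fold_alternating(1)[OF fg(1), of n z] run_game[OF z(2)] fg(2,3) by simp
   show ?thesis
   proof (cases "enat n < m i j")
    case True
    then have "enat (Suc n) \<le> m i j" by (metis Suc_ile_eq)
    then have "0 < chebyshev (m i j) n" "0 \<le> chebyshev (m i j) (Suc n)"
     using chebyshev_pos[OF e _ True] chebyshev_nonneg[OF e] n by auto
    then have "0 < y j" unfolding yj using zf zg by (intro add_nonneg_pos) auto
    then show ?thesis by simp
   next
    case False
    then obtain N where N: "m i j = enat N" "N \<le> n" by (cases "m i j") auto
    have N2: "2 \<le> N" using e N by (simp add: numeral_eq_enat)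
    have "~ N < n" using legal[of N] zf by (auto simp: N chebyshev_period[OF N2])
    then have "n = N" using N by simp
    have "y j = - z f" unfolding yj N(1) \<open>n = N\<close> by (simp add: chebyshev_period[OF N2])
    moreover have "\<exists>u'. ?eq u (u' @ [j])"
    proof -
     have fgp: "{f, g} \<in> braid_pairs m"
      unfolding braid_pairs_iff[OF m] using fg N(1) by simp
     have "m g f = enat N" using fg(2) N(1) coxeter_matrixD(2)[OF m, of g f] by simp
     then have "?eq (w @ alternating_word f g n) (w @ alternating_word g f n)"
      using braid_equiv.move[OF fgp, of m w "[]"] fg(2) N(1) \<open>n = N\<close> by (simp add: braid_word_def)
     then have "?eq u (w @ alternating_word g f n)" using w braid_equiv.trans by blast
     moreover obtain k where "n = Suc k" using n by (cases n) auto
     then have "\<exists>v. alternating_word g f n = v @ [j]"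
      using fg(3) by (auto simp: alternating_word_snoc f_def g_def simp del: alternating_word.simps split: if_splits)
     ultimately show ?thesis by (metis append_assoc)
    qed
    ultimately show ?thesis using zf by simp
   qed
  qed
 qed
qed

lemma nonnull_iff_legal:
 assumes x0: "!!i. 0 < x0 i"
 shows "~ null_word m (%_. 2) (braid_pairs m) w \<longleftrightarrow> run (game m) w x0 ~= None"
proof
 show "run (game m) w x0 ~= None ==> ~ null_word m (%_. 2) (braid_pairs m) w"
  using nil_action_null[OF game_nil_action, of w x0] by auto
 show "~ null_word m (%_. 2) (braid_pairs m) w ==> run (game m) w x0 ~= None"
 proof (induction w rule: rev_induct)
  case (snoc i w)
  have "~ null_word m (%_. 2) (braid_pairs m) w"
   using snoc.prems null_word_append[of m "%_. 2" "braid_pairs m" w "[]" "[i]"] by auto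
  then obtain y where y: "run (game m) w x0 = Some y" using snoc.IH by blast
  have "~ y i < 0"
  proof
   assume "y i < 0"
   then obtain u where "braid_equiv m (braid_pairs m) w (u @ [i])"
    using legal_last_letter[OF x0 y] by blast
   from braid_equiv_append[OF this braid_equiv.refl, of "[i]"]
   have "braid_equiv m (braid_pairs m) (w @ [i]) (u @ [i, i] @ [])" by simp
   moreover have "[i, i] \<in> forbidden_words m (%_. 2) (braid_pairs m)"
    unfolding forbidden_words_def by (auto simp: eval_nat_numeral)
   ultimately show False using snoc.prems unfolding null_word_def by blast
  qed
  then have "0 < y i" using legal_last_letter[OF x0 y, of i] by linarith
  then show ?case using y by (simp add: run_snoc) (simp add: game_def)
 qed simp
qed

lemma legal_unique:
 assumes x0: "!!i. 0 < x0 i"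
 shows "run (game m) u x0 = Some y ==> run (game m) v x0 = Some y ==> braid_equiv m (braid_pairs m) u v"
proof (induction u arbitrary: v y rule: rev_induct)
 case Nil
 have "v = []"
 proof (cases v rule: rev_cases)
  case (snoc v' i)
  then have "y i < 0" using Nil.prems(2) by (auto simp: run_snoc bind_eq_Some_conv game_def split: if_splits)
  then show ?thesis using Nil.prems(1) x0[of i] by simp
 qed simp
 then show ?case by (simp add: braid_equiv.refl)
next
 case (snoc i u)
 let ?eq = "braid_equiv m (braid_pairs m)"
 from snoc.prems(1) obtain x where x: "run (game m) u x0 = Some x" "game m i x = Some y"
  by (auto simp: run_snoc bind_eq_Some_conv)
 then have "y i < 0" by (auto simp: game_def split: if_splits)
 then obtain v' where v': "?eq v (v' @ [i])" using legal_last_letter[OF x0 snoc.prems(2)] by blast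
 then have "run (game m) (v' @ [i]) x0 = Some y"
  using nil_action_braid_equiv[OF game_nil_action v'] snoc.prems(2) by simp
 then obtain x' where x': "run (game m) v' x0 = Some x'" "game m i x' = Some y"
  by (auto simp: run_snoc bind_eq_Some_conv)
 have "y = fire m i x" "y = fire m i x'" using x(2) x'(2) by (simp_all add: game_def split: if_splits)
 then have "x = fire m i y" "x' = fire m i y" by (metis fire_fire)+
 then have "?eq u v'" using snoc.IH[OF x(1)] x'(1) by simp
 from braid_equiv_append[OF this braid_equiv.refl, of "[i]"] v' show ?case
  using braid_equiv.trans braid_equiv_sym by blast
qed

subsection \<open>The Coxeter group\<close>

lemma fold_fire_coxeter_equiv: "coxeter_equiv m u v ==> fold (fire m) u x = fold (fire m) v x"
proof (induction arbitrary: x rule: coxeter_equiv.induct)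
 case (relation i j u v)
 then obtain n where n: "m i j = enat n" by auto
 have "fold (fire m) (concat (replicate n [i, j])) x = x" for x
 proof (cases "i = j")
  case True
  then have "n = 1" using n coxeter_matrixD(1)[OF m, of i] by (simp add: one_enat_def)
  with True show ?thesis by simp
 next
  case False
  have "concat (replicate n [i, j]) = alternating_word i j n @ rev (alternating_word j i n)"
   using alternating_word_add[of i j n n] by (simp add: concat_replicate_pair rev_alternating_word mult_2)
  then show ?thesis using fold_fire_rev[of "alternating_word j i n" x] fold_fire_braid[OF False n] by simp
 qed
 then show ?case by (simp add: n)
qed auto

lemma coxeter_equiv_inverse: "coxeter_equiv m (rev u @ u) []"
proof (induction u)
 case (Cons i u)
 have "coxeter_equiv m ([i] @ [i]) []"
  using m coxeter_equiv.relation[of m i i "[]" "[]"] by (simp add: coxeter_matrix_def one_enat_def)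
 from coxeter_equiv_context[OF this, of "rev u" u]
 have "coxeter_equiv m (rev (i # u) @ (i # u)) (rev u @ u)" by simp
 then show ?case using Cons coxeter_equiv.trans by blast
qed (simp add: coxeter_equiv.refl)

lemma braid_equiv_coxeter_equiv: "braid_equiv m (braid_pairs m) u v ==> coxeter_equiv m u v"
proof (induction rule: braid_equiv.induct)
 case (move i j u v)
 then obtain n where n: "i ~= j" "m i j = enat n" "m j i = enat n"
  using coxeter_matrixD(2)[OF m, of j i] unfolding braid_pairs_iff[OF m] by auto
 let ?a = "alternating_word i j n" and ?b = "alternating_word j i n"
 have "concat (replicate n [i, j]) = ?a @ rev ?b"
  using alternating_word_add[of i j n n] by (simp add: concat_replicate_pair rev_alternating_word mult_2)
 then have "coxeter_equiv m (?a @ rev ?b @ ?b) ?b"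
  using coxeter_equiv.relation[of m i j "[]" ?b] n by simp
 moreover have "coxeter_equiv m (?a @ rev ?b @ ?b) ?a"
  using coxeter_equiv_context[OF coxeter_equiv_inverse[of ?b], of ?a "[]"] by simp
 ultimately have "coxeter_equiv m ?a ?b" using coxeter_equiv.trans coxeter_equiv.sym by blast
 then show ?case using coxeter_equiv_context n by (simp add: braid_word_def)
qed (auto intro: coxeter_equiv.refl coxeter_equiv.trans)

text \<open>A word is nonnull exactly if it is legal from a positive position, that is, reduced; two such words with the same final position
 are braid equivalent, and the final position depends on the group element only.\<close>
theorem nonnull_classes_coxeter_group:
 "\<exists>f. bij_betw f (nonnull_classes m (%_. 2) (braid_pairs m)) (carrier (coxeter_group m))"
proof -
 let ?null = "null_word m (%_. 2) (braid_pairs m)" and ?eq = "braid_equiv m (braid_pairs m)"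
 define rep where "rep C = (SOME u. ~ ?null u & C = Collect (?eq u))" for C
 have rep: "~ ?null (rep C)" "C = Collect (?eq (rep C))"
  if "C \<in> nonnull_classes m (%_. 2) (braid_pairs m)" for C
  using that someI_ex[of "%u. ~ ?null u & C = Collect (?eq u)"]
  unfolding rep_def nonnull_classes_def by blast+
 have x1: "!!i. (0::real) < (%_::'i. 1) i" by simp
 have cls: "coxeter_rel m `` {u} = coxeter_rel m `` {v} \<longleftrightarrow> coxeter_equiv m u v" for u v
  using eq_equiv_class_iff[OF equiv_coxeter_rel, of u v m] by (simp add: coxeter_rel_def)
 have inj: "?eq u v" if uv: "~ ?null u" "~ ?null v" "coxeter_equiv m u v" for u v
 proof -
  obtain y z where yz: "run (game m) u (%_. 1) = Some y" "run (game m) v (%_. 1) = Some z"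
   using uv(1,2) nonnull_iff_legal[OF x1, of u] nonnull_iff_legal[OF x1, of v] by auto
  moreover have "y = z" using run_game[OF yz(1)] run_game[OF yz(2)] fold_fire_coxeter_equiv[OF uv(3)] by simp
  ultimately show ?thesis using legal_unique[OF x1] by blast
 qed
 have surj: "\<exists>v. ~ ?null v & coxeter_equiv m u v" for u
 proof (induction "length u" arbitrary: u rule: less_induct)
  case less
  show ?case
  proof (cases "?null u")
   case False
   then show ?thesis using coxeter_equiv.refl by blast
  next
   case True
   then obtain x f y where f: "f \<in> forbidden_words m (%_. 2) (braid_pairs m)" "?eq u (x @ f @ y)"
    unfolding null_word_def by blast
   then obtain i where i: "f = [i, i]" unfolding forbidden_words_def by (auto simp: eval_nat_numeral)
   have "coxeter_equiv m [i, i] []" using coxeter_equiv_inverse[of "[i]"] by simp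
   from coxeter_equiv_context[OF this, of x y]
   have "coxeter_equiv m u (x @ y)"
    using coxeter_equiv.trans[OF braid_equiv_coxeter_equiv[OF f(2)]] i by simp
   moreover have "length (x @ y) < length u"
    using braid_equiv_length[OF coxeter_matrixD(2)[OF m] f(2)] i by simp
   ultimately show ?thesis using less[of "x @ y"] coxeter_equiv.trans by blast
  qed
 qed
 define f where "f C = coxeter_rel m `` {rep C}" for C
 have "inj_on f (nonnull_classes m (%_. 2) (braid_pairs m))"
 proof (rule inj_onI)
  fix C D assume CD: "C \<in> nonnull_classes m (%_. 2) (braid_pairs m)"
   "D \<in> nonnull_classes m (%_. 2) (braid_pairs m)" "f C = f D"
  then have "?eq (rep C) (rep D)" using inj rep(1) by (simp add: f_def cls)
  then show "C = D" using rep(2)[OF CD(1)] rep(2)[OF CD(2)] Collect_braid_equiv_eq_iff by metis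
 qed
 moreover have "f ` nonnull_classes m (%_. 2) (braid_pairs m) = carrier (coxeter_group m)"
 proof
  show "f ` nonnull_classes m (%_. 2) (braid_pairs m) \<subseteq> carrier (coxeter_group m)"
   by (auto simp: f_def coxeter_group_def quotient_def)
  show "carrier (coxeter_group m) \<subseteq> f ` nonnull_classes m (%_. 2) (braid_pairs m)"
  proof
   fix A assume "A \<in> carrier (coxeter_group m)"
   then obtain u where u: "A = coxeter_rel m `` {u}" by (auto simp: coxeter_group_def quotient_def)
   obtain v where v: "~ ?null v" "coxeter_equiv m u v" using surj by blast
   define C where "C = Collect (?eq v)"
   have C: "C \<in> nonnull_classes m (%_. 2) (braid_pairs m)"
    using v(1) unfolding C_def nonnull_classes_def by blast
   have "?eq v (rep C)" using rep(2)[OF C] Collect_braid_equiv_eq_iff unfolding C_def by metis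
   then have "coxeter_equiv m u (rep C)"
    using braid_equiv_coxeter_equiv v(2) coxeter_equiv.trans by blast
   then have "A = f C" by (simp add: u f_def cls)
   with C show "A \<in> f ` nonnull_classes m (%_. 2) (braid_pairs m)" by blast
  qed
 qed
 ultimately show ?thesis unfolding bij_betw_def by blast
qed

text \<open>The orbit of a point of the open chamber separates the elements of the group.\<close>
lemma finite_coxeter_groupI:
 assumes Y: "finite Y" "!!x i. x \<in> Y ==> fire m i x \<in> Y" and x0: "x0 \<in> Y" "!!i. 0 < x0 i"
 shows "finite (carrier (coxeter_group m))"
proof -
 let ?N = "nonnull_classes m (%_. 2) (braid_pairs m)"
 let ?st = "%C. fold (fire m) (SOME u. ~ null_word m (%_. 2) (braid_pairs m) u & C = Collect (braid_equiv m (braid_pairs m) u)) x0"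
 have rep: "\<exists>u. ~ null_word m (%_. 2) (braid_pairs m) u & C = Collect (braid_equiv m (braid_pairs m) u) &
   ?st C = fold (fire m) u x0" if "C \<in> ?N" for C
  using that someI_ex[of "%u. ~ null_word m (%_. 2) (braid_pairs m) u & C = Collect (braid_equiv m (braid_pairs m) u)"]
  unfolding nonnull_classes_def by blast
 have inY: "fold (fire m) u x0 \<in> Y" for u
  using Y(2) x0(1) by (induction u arbitrary: x0) auto
 have "inj_on ?st ?N"
 proof (rule inj_onI)
  fix C D assume CD: "C \<in> ?N" "D \<in> ?N" "?st C = ?st D"
  obtain u where u: "~ null_word m (%_. 2) (braid_pairs m) u" "C = Collect (braid_equiv m (braid_pairs m) u)"
   "?st C = fold (fire m) u x0" using rep[OF CD(1)] by blast
  obtain v where v: "~ null_word m (%_. 2) (braid_pairs m) v" "D = Collect (braid_equiv m (braid_pairs m) v)"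
   "?st D = fold (fire m) v x0" using rep[OF CD(2)] by blast
  obtain y z where yz: "run (game m) u x0 = Some y" "run (game m) v x0 = Some z"
   using u(1) v(1) nonnull_iff_legal[of x0 u, OF x0(2)] nonnull_iff_legal[of x0 v, OF x0(2)] by auto
  have "y = z" using run_game[OF yz(1)] run_game[OF yz(2)] u(3) v(3) CD(3) by simp
  then show "C = D"
   using legal_unique[of x0, OF x0(2)] yz by (simp add: u(2) v(2) Collect_braid_equiv_eq_iff)
 qed
 moreover have "?st ` ?N \<subseteq> Y"
 proof (rule image_subsetI)
  fix C show "?st C \<in> Y" by (rule inY)
 qed
 ultimately have "finite ?N" using Y(1) by (meson finite_imageD finite_subset)
 then show ?thesis using nonnull_classes_coxeter_group bij_betw_finite by metis
qed

text \<open>A nonnull word for the short relations never shows a side of a long relation, hence long braid moves are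
 never applicable to it.\<close>
lemma short_nonnull_braid_equiv:
 assumes "braid_equiv m (braid_pairs m) u v"
 shows "~ null_word m (%_. 2) (short_pairs m) u --> braid_equiv m (short_pairs m) u v"
 using assms
proof (induction rule: braid_equiv.induct)
 case (move a b u v)
 show ?case
 proof (cases "{a, b} \<in> short_pairs m")
  case True
  then show ?thesis by (simp add: braid_equiv.move)
 next
  case False
  with move have "braid_word m a b \<in> forbidden_words m (%_. 2) (short_pairs m)"
   unfolding forbidden_words_def by blast
  from null_word_append[OF null_word_forbidden[OF this]] show ?thesis by blast
 qed
next
 case (trans u v w)
 show ?case
 proof
  assume u: "~ null_word m (%_. 2) (short_pairs m) u"
  with trans.IH(1) have uv: "braid_equiv m (short_pairs m) u v" by simp
  from null_word_cong[OF this] u trans.IH(2) have "braid_equiv m (short_pairs m) v w" by simp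
  with uv show "braid_equiv m (short_pairs m) u w" by (rule braid_equiv.trans)
 qed
qed (simp add: braid_equiv.refl)

theorem finite_group_imp_finite_classes:
 assumes "finite (carrier (coxeter_group m))"
 shows "finite (nonnull_classes m (%_. 2) (short_pairs m))"
proof -
 have fin: "finite (nonnull_classes m (%_. 2) (braid_pairs m))"
  using assms nonnull_classes_coxeter_group bij_betw_finite by metis
 have sub: "braid_equiv m (braid_pairs m) u v" if "braid_equiv m (short_pairs m) u v" for u v
  using that
 proof (induction rule: braid_equiv.induct)
  case (move a b u v)
  then have "{a, b} \<in> braid_pairs m"
   unfolding braid_pairs_iff[OF m] short_pairs_iff[OF m] by (auto simp: numeral_eq_enat)
  then show ?case by (rule braid_equiv.move)
 qed (auto intro: braid_equiv.refl braid_equiv.trans)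
 have "Collect (braid_equiv m (short_pairs m) u) \<in> nonnull_classes m (%_. 2) (braid_pairs m)"
  if u: "~ null_word m (%_. 2) (short_pairs m) u" for u
 proof -
  have eq: "braid_equiv m (braid_pairs m) u v \<longleftrightarrow> braid_equiv m (short_pairs m) u v" for v
   using sub short_nonnull_braid_equiv u by blast
  have "~ null_word m (%_. 2) (braid_pairs m) u"
  proof
   assume "null_word m (%_. 2) (braid_pairs m) u"
   then obtain x f y where f: "f \<in> forbidden_words m (%_. 2) (braid_pairs m)"
    "braid_equiv m (short_pairs m) u (x @ f @ y)" unfolding null_word_def eq by blast
   then have "f \<in> forbidden_words m (%_. 2) (short_pairs m)" unfolding forbidden_words_def by blast
   with f(2) u show False unfolding null_word_def by blast
  qed
  moreover have "Collect (braid_equiv m (short_pairs m) u) = Collect (braid_equiv m (braid_pairs m) u)"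
   by (rule Collect_cong) (simp add: eq)
  ultimately show ?thesis unfolding nonnull_classes_def by blast
 qed
 then have "nonnull_classes m (%_. 2) (short_pairs m) \<subseteq> nonnull_classes m (%_. 2) (braid_pairs m)"
  unfolding nonnull_classes_def[of m "%_. 2" "short_pairs m"] by blast
 then show ?thesis using fin finite_subset by blast
qed

theorem simply_laced_classes:
 assumes "!!i j. i ~= j ==> m i j = 2 \<or> m i j = 3"
 shows "\<exists>f. bij_betw f (nonnull_classes m (%_. 2) (short_pairs m)) (carrier (coxeter_group m))"
proof -
 have "S \<in> short_pairs m \<longleftrightarrow> S \<in> braid_pairs m" for S
 proof
  assume "S \<in> short_pairs m"
  then show "S \<in> braid_pairs m" unfolding braid_pairs_less_def by blast
 next
  assume "S \<in> braid_pairs m"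
  then obtain a b where S: "S = {a, b}" "a ~= b" unfolding braid_pairs_def by blast
  then show "S \<in> short_pairs m" unfolding S(1) short_pairs_iff[OF m] using assms by blast
 qed
 then have "short_pairs m = braid_pairs m" by blast
 then show ?thesis using nonnull_classes_coxeter_group by simp
qed

end

section \<open>Infinite families of nonnull words\<close>

definition layer_act :: "(nat => 'i set) => 'i => nat \<times> 'i set => (nat \<times> 'i set) option" where
 "layer_act z i = (%(t, D). if i \<in> z t - D then
  Some (if insert i D = z t then (Suc t, {}) else (t, insert i D)) else None)"

lemma alternating_word_4:
 assumes "4 \<le> n"
 shows "\<exists>w. alternating_word a b n = [a, b, a, b] @ w"
proof -
 obtain k where "n = Suc (Suc (Suc (Suc k)))"
  using assms by (metis Suc_le_D numeral_eq_Suc pred_numeral_simps(2,3) semiring_norm(26,27) pred_numeral_simps(1) BitM.simps(1) Suc_le_mono)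
 then show ?thesis by simp
qed

lemma run_prefix: "run act (u @ v) s ~= None ==> run act u s ~= None"
 by (cases "run act u s") (simp_all add: run_append)

text \<open>An action that runs through layers of letters: a state records a layer and the letters of it already used, and
 the next layer opens when the present one is complete. Arbitrarily long plays survive if consecutive layers interact in the prescribed way.\<close>
locale layered =
 fixes m :: "'i => 'i => enat" and d :: "'i => nat" and z :: "nat => 'i set"
 assumes m: "coxeter_matrix m" and d: "!!i. 2 \<le> d i"
  and layer: "!!t. finite (z t)" "!!t. z t ~= {}"
  and within: "!!t i j. i \<in> z t ==> j \<in> z t ==> i ~= j ==> m i j = 2"
  and next_layer: "!!t i j. i \<in> z t ==> j \<in> z (Suc t) ==> m i j ~= 2"
  and three: "!!t i j. i \<in> z t ==> z (Suc t) = {j} ==> i \<in> z (Suc (Suc t)) ==> i ~= j ==> m i j ~= 3"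
  and four: "!!t i j. i \<in> z t ==> z (Suc t) = {j} ==> z (Suc (Suc t)) = {i} ==>
   j \<in> z (Suc (Suc (Suc t))) ==> i ~= j ==> m i j = \<infinity>"
  and square: "!!t i. i \<in> z t ==> i \<in> z (Suc t) ==> 3 \<le> d i"
  and cube: "!!t i. i \<in> z t ==> z (Suc t) = {i} ==> i \<notin> z (Suc (Suc t))"
begin

definition states :: "(nat \<times> 'i set) set" where
 "states = {(t, D). D \<subset> z t}"

lemma act_closed: "s \<in> states ==> layer_act z i s = Some s' ==> s' \<in> states"
 using layer(2)[of "Suc (fst s)"] layer(2)[of "Suc (fst s)", symmetric]
 by (auto simp: states_def layer_act_def psubset_eq split: if_splits)

lemma act_forced:
 assumes "(t, D) \<in> states" "layer_act z i (t, D) = Some s" "layer_act z j s = Some s'" "m i j ~= 2"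
 shows "i \<in> z t" "insert i D = z t" "s = (Suc t, {})" "j \<in> z (Suc t)"
proof -
 have i: "i \<in> z t - D" using assms(2) by (auto simp: layer_act_def split: if_splits)
 have "insert i D = z t"
 proof (rule ccontr)
  assume "insert i D ~= z t"
  then have "s = (t, insert i D)" using assms(2) i by (simp add: layer_act_def)
  then have "j \<in> z t" "i ~= j" using assms(3) by (auto simp: layer_act_def split: if_splits)
  then show False using within i assms(4) by blast
 qed
 with assms(2) i show "s = (Suc t, {})" by (simp add: layer_act_def)
 with assms(3) show "j \<in> z (Suc t)" by (simp add: layer_act_def split: if_splits)
 show "insert i D = z t" "i \<in> z t" using i \<open>insert i D = z t\<close> by auto
qed

lemma two_steps:
 assumes "s \<in> states" "run (layer_act z) [i, j] s ~= None" "m i j ~= 2"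
 shows "\<exists>t. i \<in> z t & j \<in> z (Suc t) & layer_act z i s = Some (Suc t, {})"
proof -
 obtain t D where s: "s = (t, D)" by fastforce
 obtain s1 s2 where 1: "layer_act z i s = Some s1" "layer_act z j s1 = Some s2"
  using assms(2) by (auto simp: bind_eq_Some_conv)
 show ?thesis using act_forced[OF assms(1)[unfolded s] 1[unfolded s] assms(3)] 1(1) by auto
qed

lemma three_steps:
 assumes "s \<in> states" "run (layer_act z) [i, j, k] s ~= None" "m i j ~= 2" "m j k ~= 2"
 shows "\<exists>t. i \<in> z t & z (Suc t) = {j} & k \<in> z (Suc (Suc t)) &
  run (layer_act z) [i, j] s = Some (Suc (Suc t), {})"
proof -
 obtain s1 s2 s3 where 1: "layer_act z i s = Some s1" "layer_act z j s1 = Some s2" "layer_act z k s2 = Some s3"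
  using assms(2) by (auto simp: bind_eq_Some_conv)
 obtain t where t: "i \<in> z t" "layer_act z i s = Some (Suc t, {})"
  using two_steps[OF assms(1) _ assms(3)] 1 by auto
 have s1: "s1 = (Suc t, {})" "s1 \<in> states" using t(2) 1(1) act_closed[OF assms(1)] by auto
 have "insert j {} = z (Suc t)" "s2 = (Suc (Suc t), {})" "k \<in> z (Suc (Suc t))"
  using act_forced[OF s1(2)[unfolded s1(1)] 1(2)[unfolded s1(1)] 1(3) assms(4)] by auto
 then show ?thesis using t 1(2) s1(1) by auto
qed

lemma neq_2: "a ~= b ==> m a b ~= 2 ==> m b a ~= 2"
 using coxeter_matrixD(2)[OF m] by metis

lemma m_self: "m a a ~= 2"
 using coxeter_matrixD(1)[OF m, of a] by (simp add: one_enat_def numeral_eq_enat)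

lemma nil_action: "nil_action m d (short_pairs m) states (layer_act z)"
proof (rule nil_action_short[OF m])
 show "s \<in> states ==> layer_act z i s = Some s' ==> s' \<in> states" for s i s' by (rule act_closed)
next
 fix s a b assume s: "s \<in> states" and ab: "a ~= b" "m a b = 2"
 obtain t D where st: "s = (t, D)" by fastforce
 have D: "D \<subset> z t" using s by (simp add: states_def st)
 have ba: "m b a = 2" using ab(2) coxeter_matrixD(2)[OF m] by simp
 have none: "run (layer_act z) [i, j] (t, D) = None" if "~ (i \<in> z t - D & j \<in> z t - D)" "m i j = 2" for i j
 proof (cases "i \<in> z t - D")
  case True
  have "j \<notin> z (Suc t)" using next_layer True that(2) by blast
  moreover have "j \<notin> z t - D" using that(1) True by blast
  ultimately show ?thesis using True by (auto simp: layer_act_def)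
 qed (simp add: layer_act_def)
 show "run (layer_act z) [a, b] s = run (layer_act z) [b, a] s"
 proof (cases "a \<in> z t - D & b \<in> z t - D")
  case True
  then have "insert a D ~= z t" "insert b D ~= z t" using ab(1) by auto
  moreover have "insert b (insert a D) = insert a (insert b D)" by (rule insert_commute)
  ultimately show ?thesis using True ab(1) by (simp add: st layer_act_def)
 next
  case False
  then show ?thesis using none[of a b] none[of b a] ab(2) ba by (auto simp: st)
 qed
next
 fix s a b assume s: "s \<in> states" and ab: "a ~= b" "m a b = 3"
 have ba: "m b a = 3" using ab(2) coxeter_matrixD(2)[OF m] by simp
 have none: "run (layer_act z) [i, j, i] s = None" if "i ~= j" "m i j = 3" "m j i = 3" for i j
 proof (rule ccontr)
  assume "run (layer_act z) [i, j, i] s ~= None"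
  from three_steps[OF s this] that obtain t where "i \<in> z t" "z (Suc t) = {j}" "i \<in> z (Suc (Suc t))"
   by (auto simp: numeral_eq_enat)
  with three that show False by blast
 qed
 show "run (layer_act z) [a, b, a] s = run (layer_act z) [b, a, b] s"
  using none ab ba by auto
next
 fix s a b n assume s: "s \<in> states" and ab: "a ~= b" "m a b = enat n" "4 \<le> n"
 have 2: "m a b ~= 2" "m b a ~= 2" using ab(2,3) coxeter_matrixD(2)[OF m, of b a] by (auto simp: numeral_eq_enat)
 show "run (layer_act z) (alternating_word a b n) s = None"
 proof (rule ccontr)
  from alternating_word_4[OF ab(3), of a b] obtain w where w: "alternating_word a b n = [a, b, a, b] @ w" ..
  assume "run (layer_act z) (alternating_word a b n) s ~= None"
  then have r4: "run (layer_act z) [a, b, a, b] s ~= None"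
   unfolding w by (rule run_prefix)
  then have "run (layer_act z) [a, b, a] s ~= None" by (auto simp: bind_eq_Some_conv)
  from three_steps[OF s this 2] obtain t where t: "a \<in> z t" "z (Suc t) = {b}" "a \<in> z (Suc (Suc t))"
   "run (layer_act z) [a, b] s = Some (Suc (Suc t), {})" by blast
  have "run (layer_act z) ([a, b] @ [a, b]) s ~= None" using r4 by simp
  then have ab2: "run (layer_act z) [a, b] (Suc (Suc t), {}) ~= None"
   unfolding run_append t(4) by simp
  have st: "(Suc (Suc t), {}) \<in> states" using layer(2) by (auto simp: states_def)
  obtain s1 s2 where 1: "layer_act z a (Suc (Suc t), {}) = Some s1" "layer_act z b s1 = Some s2"
   using ab2 by (auto simp: bind_eq_Some_conv)
  from act_forced[OF st 1 2(1)] have "z (Suc (Suc t)) = {a}" "b \<in> z (Suc (Suc (Suc t)))" by auto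
  with four[OF t(1,2) this ab(1)] ab(2) show False by simp
 qed
next
 fix s a assume s: "s \<in> states"
 show "run (layer_act z) (replicate (d a) a) s = None"
 proof (rule ccontr)
  assume r: "run (layer_act z) (replicate (d a) a) s ~= None"
  obtain k where k: "d a = Suc (Suc k)" using d[of a] by (metis add_2_eq_Suc le_Suc_ex)
  have "replicate (d a) a = [a, a] @ replicate k a" by (simp add: k)
  with r have "run (layer_act z) [a, a] s ~= None" by (metis run_prefix)
  from two_steps[OF s this m_self] obtain t where "a \<in> z t" "a \<in> z (Suc t)" by blast
  then obtain l where "k = Suc l" using square[of a t] k by (cases k) auto
  then have "replicate (d a) a = [a, a, a] @ replicate l a" by (simp add: k)
  with r have "run (layer_act z) [a, a, a] s ~= None" by (metis run_prefix)
  from three_steps[OF s this m_self m_self] cube show False by blast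
 qed
qed

lemma play_layer:
 "D \<subset> z t ==> \<exists>w. w ~= [] & run (layer_act z) w (t, D) = Some (Suc t, {})"
proof (induction "card (z t - D)" arbitrary: D rule: less_induct)
 case less
 obtain i where i: "i \<in> z t - D" using less.prems by blast
 show ?case
 proof (cases "insert i D = z t")
  case True
  then have "run (layer_act z) [i] (t, D) = Some (Suc t, {})" using i by (simp add: layer_act_def)
  then show ?thesis by blast
 next
  case False
  have "card (z t - insert i D) < card (z t - D)"
   using i layer(1) by (intro psubset_card_mono) auto
  moreover have "insert i D \<subset> z t" using False i less.prems by blast
  ultimately obtain w where "run (layer_act z) w (t, insert i D) = Some (Suc t, {})"
   using less.hyps by blast
  then have "run (layer_act z) (i # w) (t, D) = Some (Suc t, {})"
   using i False by (simp add: layer_act_def)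
  then show ?thesis by blast
 qed
qed

lemma infinite: "infinite (nonnull_classes m d (short_pairs m))"
proof (rule infinite_nonnull_classes[OF coxeter_matrixD(2)[OF m] nil_action])
 fix n
 have "\<exists>w. n \<le> length w & run (layer_act z) w (0, {}) = Some (n, {})"
 proof (induction n)
  case (Suc n)
  then obtain w where w: "n \<le> length w" "run (layer_act z) w (0, {}) = Some (n, {})" by blast
  obtain v where v: "v ~= []" "run (layer_act z) v (n, {}) = Some (Suc n, {})"
   using play_layer[of "{}" n] layer(2) by blast
  have "Suc n \<le> length (w @ v)" using w(1) v(1) by (cases v) auto
  moreover have "run (layer_act z) (w @ v) (0, {}) = Some (Suc n, {})" using w v by (simp add: run_append)
  ultimately show ?case by blast
 qed (intro exI[of _ "[]"], simp)
 moreover have "(0, {}) \<in> states" using layer(2) by (auto simp: states_def)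
 ultimately show "\<exists>w s. s \<in> states & n \<le> length w & run (layer_act z) w s ~= None" by blast
qed

end

text \<open>Layers of a single letter, for a walk along the diagram.\<close>
lemma walk_infinite:
 fixes w :: "nat => 'i"
 assumes m: "coxeter_matrix m" and d: "!!i. 2 \<le> d i"
  and adj: "!!t. w t ~= w (Suc t)" "!!t. m (w t) (w (Suc t)) ~= 2"
  and turn_back: "!!t. w (Suc (Suc t)) = w t ==> m (w t) (w (Suc t)) = \<infinity>"
 shows "infinite (nonnull_classes m d (short_pairs m))"
proof -
 interpret layered m d "%t. {w t}"
 proof
  show "m i j ~= 3" if "i \<in> {w t}" "{w (Suc t)} = {j}" "i \<in> {w (Suc (Suc t))}" "i ~= j" for t i j
   using that turn_back[of t] by auto
  show "m i j = \<infinity>" if "i \<in> {w t}" "{w (Suc t)} = {j}" "{w (Suc (Suc t))} = {i}"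
   "j \<in> {w (Suc (Suc (Suc t)))}" "i ~= j" for t i j
   using that turn_back[of t] by auto
  show "3 \<le> d i" if "i \<in> {w t}" "i \<in> {w (Suc t)}" for t i using that adj(1)[of t] by auto
  show "i \<notin> {w (Suc (Suc t))}" if "i \<in> {w t}" "{w (Suc t)} = {i}" for t i using that adj(1)[of t] by auto
 qed (use m d adj in auto)
 show ?thesis by (rule infinite)
qed

subsection \<open>Zigzags\<close>

text \<open>The layers of a path traversed back and forth between two reflecting ends.\<close>
fun bounce :: "nat => bool => bool => nat \<times> bool => nat \<times> bool" where
 "bounce n l r (k, True) = (if k < n then (Suc k, True) else if r then (k, False) else (k - 1, False))"
| "bounce n l r (k, False) = (if 0 < k then (k - 1, False) else if l then (k, True) else (Suc k, True))"

lemma zigzag_infinite: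
 fixes E :: "nat => 'i set"
 assumes m: "coxeter_matrix m" and d: "!!i. 2 \<le> d i"
  and layer: "!!k. k \<le> n ==> finite (E k)" "!!k. k \<le> n ==> E k ~= {}"
  and within: "!!k i j. k \<le> n ==> i \<in> E k ==> j \<in> E k ==> i ~= j ==> m i j = 2"
  and consecutive: "!!k i j. k < n ==> i \<in> E k ==> j \<in> E (Suc k) ==> i ~= j & m i j ~= 2"
  and straight: "!!k. Suc (Suc k) \<le> n ==> E k \<inter> E (Suc (Suc k)) = {}"
  and left: "if l then \<exists>x. E 0 = {x} & 3 \<le> d x else \<forall>x. E 0 = {x} --> (\<forall>y\<in>E 1. m x y ~= 3)"
  and right: "if r then \<exists>x. E n = {x} & 3 \<le> d x else \<forall>x. E n = {x} --> (\<forall>y\<in>E (n - 1). m x y ~= 3)"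
  and n: "1 \<le> n" "l \<or> r \<or> 2 \<le> n"
 shows "infinite (nonnull_classes m d (short_pairs m))"
proof -
 define s where "s t = (bounce n l r ^^ t) (0, True)" for t
 have s_Suc: "s (Suc t) = bounce n l r (s t)" for t by (simp add: s_def)
 have s_le: "fst (s t) \<le> n" for t
 proof (induction t)
  case (Suc t)
  obtain k b where kb: "s t = (k, b)" by fastforce
  with Suc n(1) show ?case unfolding s_Suc kb by (cases b) auto
 qed (simp add: s_def)
 define z where "z t = E (fst (s t))" for t
 have sym: "m i j = m j i" for i j by (rule coxeter_matrixD(2)[OF m])
 have self: "m i i ~= 2" for i using coxeter_matrixD(1)[OF m, of i] by (simp add: one_enat_def numeral_eq_enat)
 note S1 = arg_cong[OF s_Suc, of fst]
 have step: "(fst (s (Suc t)) = Suc (fst (s t)) & Suc (fst (s t)) \<le> n) \<or> Suc (fst (s (Suc t))) = fst (s t) \<or>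
   fst (s (Suc t)) = fst (s t) & (fst (s t) = 0 & l \<or> fst (s t) = n & r)" for t
 proof -
  obtain k b where kb: "s t = (k, b)" by fastforce
  have "k \<le> n" using s_le[of t] kb by simp
  then show ?thesis unfolding s_Suc kb using n(1) by (cases b) auto
 qed
 have turn: "E (fst (s t)) \<inter> E (fst (s (Suc (Suc t)))) = {} \<or>
   fst (s (Suc t)) = fst (s t) \<or> fst (s (Suc (Suc t))) = fst (s (Suc t)) \<or>
   fst (s (Suc t)) = 0 & ~ l & fst (s t) = 1 & s (Suc (Suc t)) = (1, True) \<or>
   fst (s (Suc t)) = n & ~ r & fst (s t) = n - 1 & s (Suc (Suc t)) = (n - 1, False)" for t
 proof -
  obtain k b where kb: "s t = (k, b)" by fastforce
  have k: "k \<le> n" using s_le[of t] kb by simp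
  show ?thesis
  proof (cases b)
   case True
   consider "Suc (Suc k) \<le> n" | "Suc k = n" | "k = n" using k by linarith
   then show ?thesis
   proof cases
    case 1
    then show ?thesis using straight[OF 1] by (auto simp: s_Suc kb True)
   next
    case 3
    show ?thesis
    proof (cases "r \<or> n = 1")
     case False
     then obtain j where j: "n = Suc (Suc j)" using n(1) by (metis One_nat_def Suc_le_D not0_implies_Suc)
     then show ?thesis using straight[of j] False 3 by (auto simp: s_Suc kb True Int_commute)
    qed (use 3 n in \<open>auto simp: s_Suc kb True\<close>)
   qed (auto simp: s_Suc kb True)
  next
   case False
   consider "2 \<le> k" | "k = 1" | "k = 0" by linarith
   then show ?thesis
   proof cases
    case 1
    then obtain j where j: "k = Suc (Suc j)" by (metis Suc_1 Suc_le_D less_eqE add_2_eq_Suc)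
    then show ?thesis using straight[of j] k by (auto simp: s_Suc kb False Int_commute)
   next
    case 3
    show ?thesis
    proof (cases "l \<or> n = 1")
     case nl: False
     then have "E 0 \<inter> E (Suc (Suc 0)) = {}" using straight[of 0] n by auto
     then show ?thesis using nl 3 n by (auto simp: s_Suc kb False)
    qed (use 3 n in \<open>auto simp: s_Suc kb False\<close>)
   qed (use n in \<open>auto simp: s_Suc kb False\<close>)
  qed
 qed
 have disjoint: "E k \<inter> E (Suc k) = {}" if "k < n" for k using consecutive[OF that] by blast
 have equal: "fst (s (Suc t)) = fst (s t)" if "i \<in> z t" "i \<in> z (Suc t)" for t i
  using step[of t]
 proof (elim disjE conjE)
  assume 1: "fst (s (Suc t)) = Suc (fst (s t))" "Suc (fst (s t)) \<le> n"
  then show ?thesis using disjoint[of "fst (s t)"] that by (simp add: z_def) blast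
 next
  assume 1: "Suc (fst (s (Suc t))) = fst (s t)"
  then show ?thesis using disjoint[of "fst (s (Suc t))"] that s_le[of t] by (simp add: z_def flip: 1) blast
 qed
 have repeat: "\<exists>x. z t = {x} & z (Suc t) = {x} & 3 \<le> d x" if "fst (s (Suc t)) = fst (s t)" for t
 proof -
  have "fst (s t) = 0 & l \<or> fst (s t) = n & r" using step[of t] that by linarith
  then show ?thesis using left right that by (elim disjE conjE) (simp_all add: z_def)
 qed
 have repeat2: "fst (s (Suc (Suc t))) ~= fst (s (Suc t))" if "fst (s (Suc t)) = fst (s t)" for t
 proof -
  obtain k b where kb: "s t = (k, b)" by fastforce
  have k: "k \<le> n" using s_le[of t] kb by simp
  show ?thesis
  proof (cases b)
   case True
   have "~ k < n" using that by (auto simp: s_Suc kb True)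
   then have "k = n" using k by simp
   with that n(1) have r by (simp add: s_Suc kb True split: if_splits)
   with \<open>k = n\<close> n(1) show ?thesis by (simp add: s_Suc kb True)
  next
   case False
   have "k = 0" using that by (simp add: s_Suc kb False split: if_splits)
   with that have l by (simp add: s_Suc kb False split: if_splits)
   with \<open>k = 0\<close> n(1) show ?thesis by (simp add: s_Suc kb False)
  qed
 qed
 have turn_back: "~ l & z (Suc t) = E 0 & z t = E 1 & s (Suc (Suc t)) = (1, True) \<or>
   ~ r & z (Suc t) = E n & z t = E (n - 1) & s (Suc (Suc t)) = (n - 1, False)"
  if "i \<in> z t" "z (Suc t) = {j}" "i \<in> z (Suc (Suc t))" "i ~= j" for t i j
 proof -
  have ne1: "fst (s (Suc t)) ~= fst (s t)"
  proof
   assume "fst (s (Suc t)) = fst (s t)"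
   then have "z (Suc t) = z t" by (simp add: z_def)
   then show False using that(1,2,4) by auto
  qed
  have ne2: "fst (s (Suc (Suc t))) ~= fst (s (Suc t))"
  proof
   assume "fst (s (Suc (Suc t))) = fst (s (Suc t))"
   then have "z (Suc (Suc t)) = z (Suc t)" by (simp add: z_def)
   then show False using that(2,3,4) by auto
  qed
  have "E (fst (s t)) \<inter> E (fst (s (Suc (Suc t)))) ~= {}" using that(1,3) by (auto simp: z_def)
  with turn[of t] ne1 ne2 show ?thesis by (elim disjE conjE) (simp_all add: z_def)
 qed
 interpret layered m d z
 proof
  show "coxeter_matrix m" by (rule m)
  show "2 \<le> d i" for i by (rule d)
  show "finite (z t)" "z t ~= {}" for t using layer s_le by (auto simp: z_def)
  show "m i j = 2" if "i \<in> z t" "j \<in> z t" "i ~= j" for t i j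
   using within[OF s_le] that by (auto simp: z_def)
  show "m i j ~= 2" if "i \<in> z t" "j \<in> z (Suc t)" for t i j
  proof (cases "i = j")
   case False
   from step[of t] show ?thesis
   proof (elim disjE conjE)
    assume "fst (s (Suc t)) = Suc (fst (s t))" "Suc (fst (s t)) \<le> n"
    then show ?thesis using consecutive[of "fst (s t)" i j] that by (auto simp: z_def)
   next
    assume "Suc (fst (s (Suc t))) = fst (s t)"
    then show ?thesis using consecutive[of "fst (s (Suc t))" j i] that s_le[of t] sym[of i j]
     by (auto simp: z_def)
   next
    assume "fst (s (Suc t)) = fst (s t)"
    from repeat[OF this] that False show ?thesis by auto
   next
    assume "fst (s (Suc t)) = fst (s t)"
    from repeat[OF this] that False show ?thesis by auto
   qed
  qed (simp add: self)
  show "m i j ~= 3" if "i \<in> z t" "z (Suc t) = {j}" "i \<in> z (Suc (Suc t))" "i ~= j" for t i j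
   using turn_back[OF that]
  proof (elim disjE conjE)
   assume "~ l" "z (Suc t) = E 0" "z t = E 1"
   then show ?thesis using left that(1,2) sym[of i j] by auto
  next
   assume "~ r" "z (Suc t) = E n" "z t = E (n - 1)"
   then show ?thesis using right that(1,2) sym[of i j] by auto
  qed
  show "m i j = \<infinity>" if h: "i \<in> z t" "z (Suc t) = {j}" "z (Suc (Suc t)) = {i}"
   "j \<in> z (Suc (Suc (Suc t)))" "i ~= j" for t i j
  proof -
   have "i \<in> z (Suc (Suc t))" "j \<in> z (Suc t)" using h by auto
   note b1 = turn_back[OF h(1,2) this(1) h(5)] and b2 = turn_back[OF this(2) h(3,4) h(5)[symmetric]]
   have False
    using b1
   proof (elim disjE conjE)
    assume l: "~ l" and s2: "s (Suc (Suc t)) = (1, True)"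
    have s3: "s (Suc (Suc (Suc t))) = bounce n l r (1, True)" unfolding s_Suc[of "Suc (Suc t)"] s2 ..
    from b2 show False
    proof (elim disjE conjE)
     assume "s (Suc (Suc (Suc t))) = (1, True)"
     then show False unfolding s3 by (simp split: if_splits)
    next
     assume "~ r" "s (Suc (Suc (Suc t))) = (n - 1, False)"
     then show False using l n unfolding s3 by (simp split: if_splits)
    qed
   next
    assume r: "~ r" and s2: "s (Suc (Suc t)) = (n - 1, False)"
    have s3: "s (Suc (Suc (Suc t))) = bounce n l r (n - 1, False)" unfolding s_Suc[of "Suc (Suc t)"] s2 ..
    from b2 show False
    proof (elim disjE conjE)
     assume "~ l" "s (Suc (Suc (Suc t))) = (1, True)"
     then show False using r n unfolding s3 by (simp split: if_splits)
    next
     assume "s (Suc (Suc (Suc t))) = (n - 1, False)"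
     then show False using n(1) unfolding s3 by (simp split: if_splits)
    qed
   qed
   then show ?thesis ..
  qed
  show "3 \<le> d i" if "i \<in> z t" "i \<in> z (Suc t)" for t i
   using repeat[OF equal[OF that]] that by auto
  show "i \<notin> z (Suc (Suc t))" if "i \<in> z t" "z (Suc t) = {i}" for t i
   using equal[of i t] equal[of i "Suc t"] repeat2[of t] that by auto
 qed
 show ?thesis by (rule infinite)
qed

subsection \<open>Finite automata with a cycle\<close>

definition moves_act :: "(nat \<times> nat) list list => nat => nat => nat option" where
 "moves_act M k = map_of (M ! k)"

definition moves_pair_ok :: "(nat \<times> nat) list list => (nat => nat => nat) => nat => nat => nat => bool" where
 "moves_pair_ok M L s k l \<longleftrightarrow>
  (if k = l then run (moves_act M) [k, k] s = None
   else if L k l = 2 then run (moves_act M) [k, l] s = run (moves_act M) [l, k] s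
   else if L k l = 3 then run (moves_act M) [k, l, k] s = run (moves_act M) [l, k, l] s
   else run (moves_act M) (alternating_word k l (L k l)) s = None)"

definition moves_ok :: "(nat \<times> nat) list list => (nat => nat => nat) => nat => bool" where
 "moves_ok M L N \<longleftrightarrow>
  list_all (list_all (%(s, t). s < N)) M &
  list_all (%s. list_all (%k. list_all (moves_pair_ok M L s k) [0..<length M]) [0..<length M]) [0..<N]"

text \<open>A finite automaton with a cycle, given as a list of transitions, whose compatibility with the relations is decidable.\<close>
lemma moves_infinite:
 fixes \<sigma> :: "nat => 'i"
 assumes m: "coxeter_matrix m" and d: "!!i. 2 \<le> d i"
  and ok: "moves_ok M L N" and cycle: "run (moves_act M) u 0 = Some 0" "u ~= []" "list_all (%k. k < length M) u"
  and \<sigma>: "inj_on \<sigma> {..<length M}"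
  and L: "!!k l. k < length M ==> l < length M ==> k ~= l ==>
   if L k l = 2 then m (\<sigma> k) (\<sigma> l) = 2 else if L k l = 3 then m (\<sigma> k) (\<sigma> l) = 3
   else 4 \<le> L k l & enat (L k l) \<le> m (\<sigma> k) (\<sigma> l)"
 shows "infinite (nonnull_classes m d (short_pairs m))"
proof -
 let ?r = "length M" and ?run = "run (moves_act M)"
 define act where "act a s = (if a \<in> \<sigma> ` {..<?r} then moves_act M (inv_into {..<?r} \<sigma> a) s else None)" for a s
 have act_\<sigma>: "act (\<sigma> k) s = moves_act M k s" if "k < ?r" for k s
  using that \<sigma> by (auto simp: act_def inv_into_f_f)
 have act_run: "run act (map \<sigma> w) s = ?run w s" if "list_all (%k. k < ?r) w" for w s
  using that by (induction w arbitrary: s) (auto simp: act_\<sigma> cong: Option.bind_cong)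
 have large: "moves_act M k s = None" if "N \<le> s" "k < ?r" for k s
 proof -
  have "list_all (%(s, t). s < N) (M ! k)"
   using ok that(2) unfolding moves_ok_def list_all_length by simp
  then have "s \<notin> fst ` set (M ! k)" using that(1) by (auto simp: list_all_iff)
  then show ?thesis unfolding moves_act_def by (simp add: map_of_eq_None_iff)
 qed
 have check: "moves_pair_ok M L s k l" if kl: "k < ?r" "l < ?r" for k l s
 proof (cases "s < N")
  case True
  have "list_all (%s. list_all (%k. list_all (moves_pair_ok M L s k) [0..<?r]) [0..<?r]) [0..<N]"
   using ok unfolding moves_ok_def by (rule conjunct2)
  then show ?thesis using kl True by (simp add: list_all_length)
 next
  case False
  then have none: "moves_act M k s = None" "moves_act M l s = None" using large kl by auto
  have "L k l ~= 0" if "k ~= l" using L[OF kl that] by (auto split: if_splits)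
  then have "k ~= l ==> \<exists>w. alternating_word k l (L k l) = k # w" by (cases "L k l") auto
  then show ?thesis using none by (auto simp: moves_pair_ok_def)
 qed
 have out: "act a s = None" if "a \<notin> \<sigma> ` {..<?r}" for a s using that by (simp add: act_def)
 have mid: "run act w s = None" if c: "c \<in> set w" "c \<notin> \<sigma> ` {..<?r}" for w c s
  using c(1)
 proof (induction w arbitrary: s)
  case (Cons a w)
  show ?case
  proof (cases "a = c")
   case True
   then show ?thesis by (simp add: out[OF c(2)])
  next
   case False
   with Cons have "run act w t = None" for t by simp
   then show ?thesis by (cases "act a s") simp_all
  qed
 qed simp
 have outside: "run act v s = None & run act w s = None"
  if "~ (a \<in> \<sigma> ` {..<?r} & b \<in> \<sigma> ` {..<?r})" "{a, b} \<subseteq> set v" "{a, b} \<subseteq> set w" for a b v w s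
 proof -
  from that(1) obtain c where "c \<in> {a, b}" "c \<notin> \<sigma> ` {..<?r}" by blast
  then show ?thesis using mid[of c v s] mid[of c w s] that(2,3) by blast
 qed
 have "nil_action m d (short_pairs m) UNIV act"
 proof (rule nil_action_short[OF m])
  fix s a b assume ab: "a ~= b" "m a b = 2"
  show "run act [a, b] s = run act [b, a] s"
  proof (cases "a \<in> \<sigma> ` {..<?r} & b \<in> \<sigma> ` {..<?r}")
   case True
   then obtain k l where kl: "k < ?r" "l < ?r" "a = \<sigma> k" "b = \<sigma> l" "k ~= l" using ab(1) by auto
   have "L k l = 2" using L[OF kl(1,2,5)] ab(2) by (auto simp: kl numeral_eq_enat split: if_splits)
   then show ?thesis using check[OF kl(1,2), of s, unfolded moves_pair_ok_def] kl(5) act_run[of "[k, l]" s] act_run[of "[l, k]" s] kl(1,2)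
    by (simp add: kl(3,4))
  next
   case False
   from outside[OF this, of "[a, b]" "[b, a]" s] show ?thesis by (simp del: run.simps)
  qed
 next
  fix s a b assume ab: "a ~= b" "m a b = 3"
  show "run act [a, b, a] s = run act [b, a, b] s"
  proof (cases "a \<in> \<sigma> ` {..<?r} & b \<in> \<sigma> ` {..<?r}")
   case True
   then obtain k l where kl: "k < ?r" "l < ?r" "a = \<sigma> k" "b = \<sigma> l" "k ~= l" using ab(1) by auto
   have "L k l = 3" using L[OF kl(1,2,5)] ab(2) by (auto simp: kl numeral_eq_enat split: if_splits)
   then show ?thesis using check[OF kl(1,2), of s, unfolded moves_pair_ok_def] kl(5) act_run[of "[k, l, k]" s] act_run[of "[l, k, l]" s] kl(1,2)
    by (simp add: kl(3,4))
  next
   case False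
   from outside[OF this, of "[a, b, a]" "[b, a, b]" s] show ?thesis by (simp del: run.simps)
  qed
 next
  fix s a b n assume ab: "a ~= b" "m a b = enat n" "4 \<le> n"
  from alternating_word_4[OF ab(3), of a b] obtain v where v: "alternating_word a b n = [a, b, a, b] @ v" ..
  show "run act (alternating_word a b n) s = None"
  proof (cases "a \<in> \<sigma> ` {..<?r} & b \<in> \<sigma> ` {..<?r}")
   case True
   then obtain k l where kl: "k < ?r" "l < ?r" "a = \<sigma> k" "b = \<sigma> l" "k ~= l" using ab(1) by auto
   have Lkl: "L k l ~= 2" "L k l ~= 3" "L k l \<le> n"
    using L[OF kl(1,2,5)] ab(2,3) by (auto simp: kl numeral_eq_enat split: if_splits)
   have alt: "alternating_word a b j = map \<sigma> (alternating_word k l j)" for j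
    unfolding kl by (induction j arbitrary: k l) auto
   have all: "list_all (%k. k < ?r) (alternating_word k l j)" for j
    using kl(1,2) by (induction j arbitrary: k l) auto
   have pre: "\<exists>w. alternating_word a b (j + i) = alternating_word a b j @ w" for j i and a b :: 'i
    by (induction j arbitrary: a b) auto
   obtain w where w: "alternating_word a b n = alternating_word a b (L k l) @ w"
    using pre[of a b "L k l" "n - L k l"] Lkl(3) by auto
   have "run act (alternating_word a b (L k l)) s = None"
    unfolding alt act_run[OF all] using check[OF kl(1,2), of s, unfolded moves_pair_ok_def] kl(5) Lkl by simp
   then show ?thesis unfolding w run_append by simp
  next
   case False
   from outside[OF this, of "alternating_word a b n" "alternating_word a b n" s] show ?thesis by (simp add: v del: run.simps)
  qed
 next
  fix s a
  obtain k where k: "d a = Suc (Suc k)" using d[of a] by (metis add_2_eq_Suc le_Suc_ex)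
  then have w: "replicate (d a) a = [a, a] @ replicate k a" by simp
  show "run act (replicate (d a) a) s = None"
  proof (cases "a \<in> \<sigma> ` {..<?r}")
   case True
   then obtain j where j: "j < ?r" "a = \<sigma> j" by auto
   have "run act [a, a] s = None" using check[OF j(1) j(1), of s, unfolded moves_pair_ok_def] act_run[of "[j, j]" s] j by simp
   then show ?thesis unfolding w run_append by simp
  next
   case False
   show ?thesis by (rule mid[OF _ False]) (simp add: k)
  qed
 qed simp
 moreover have "\<exists>w s. s \<in> (UNIV :: nat set) & n \<le> length w & run act w s ~= None" for n
 proof -
  have "\<exists>w. list_all (%k. k < ?r) w & n \<le> length w & ?run w 0 = Some 0"
  proof (induction n)
   case (Suc n)
   then obtain w where w: "list_all (%k. k < ?r) w" "n \<le> length w" "?run w 0 = Some 0" by blast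
   have "Suc n \<le> length (w @ u)" using w(2) cycle(2) by (cases u) auto
   moreover have "?run (w @ u) 0 = Some 0" "list_all (%k. k < ?r) (w @ u)"
    using w cycle by (simp_all add: run_append)
   ultimately show ?case by blast
  qed (intro exI[of _ "[]"], simp)
  then obtain w where "list_all (%k. k < ?r) w" "n \<le> length w" "?run w 0 = Some 0" by blast
  then have "n \<le> length (map \<sigma> w)" "run act (map \<sigma> w) 0 ~= None" using act_run by auto
  then show ?thesis by blast
 qed
 ultimately show ?thesis by (rule infinite_nonnull_classes[OF coxeter_matrixD(2)[OF m]])
qed

section \<open>Diagrams with finitely many nonnull words\<close>

locale finite_diagram =
 fixes m :: "'i::finite => 'i => enat" and d :: "'i => nat"
 assumes m: "coxeter_matrix m" and irreducible: "irreducible_coxeter m" and d: "!!i. 2 \<le> d i"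
  and finite: "finite (nonnull_classes m d (short_pairs m))"
begin

definition adj :: "'i => 'i => bool" where
 "adj a b \<longleftrightarrow> a ~= b & m a b ~= 2"

lemma sym: "m a b = m b a" by (rule coxeter_matrixD(2)[OF m])

lemma adj_sym: "adj a b \<longleftrightarrow> adj b a"
 using sym[of a b] by (auto simp: adj_def)

lemma adj_iff: "adj a b \<longleftrightarrow> 3 \<le> m a b"
proof (cases "a = b")
 case True
 then show ?thesis using coxeter_matrixD(1)[OF m, of a] by (simp add: adj_def one_enat_def numeral_eq_enat)
next
 case False
 have "2 \<le> m a b" by (rule coxeter_matrixD(3)[OF m False])
 then show ?thesis using False by (cases "m a b") (auto simp: adj_def numeral_eq_enat)
qed

lemma connected: "(a, b) \<in> {(a, b). adj a b}\<^sup>*"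
 using irreducible unfolding irreducible_coxeter_def adj_iff by simp

lemma label_finite: "m a b ~= \<infinity>"
proof
 assume inf: "m a b = \<infinity>"
 have "a ~= b" using inf coxeter_matrixD(1)[OF m, of a] by (auto simp: one_enat_def)
 then have "infinite (nonnull_classes m d (short_pairs m))"
  using inf sym[of a b] by (intro walk_infinite[OF m d, of "%t. if even t then a else b"]) auto
 with finite show False by simp
qed

lemma label_cases: "adj a b ==> m a b = 3 \<or> (\<exists>n\<ge>4. m a b = enat n)"
 using label_finite[of a b] by (cases "m a b") (auto simp: adj_iff numeral_eq_enat)

lemma no_walk:
 assumes "!!t. adj (w t) (w (Suc t))" "!!t. w (Suc (Suc t)) ~= w t"
 shows False
proof -
 have "infinite (nonnull_classes m d (short_pairs m))"
  by (rule walk_infinite[where w = w]) (use m d assms in \<open>auto simp: adj_def\<close>)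
 with finite show False by simp
qed

lemma no_cycle:
 assumes xs: "distinct xs" "successively adj xs" and len: "3 \<le> length xs" and close: "adj (last xs) (hd xs)"
 shows False
proof -
 let ?L = "length xs"
 have L: "0 < ?L" using len by linarith
 have mod_Suc: "Suc t mod ?L = (if Suc (t mod ?L) = ?L then 0 else Suc (t mod ?L))" for t
  by (simp add: mod_Suc)
 have adj: "adj (xs ! (t mod ?L)) (xs ! (Suc t mod ?L))" for t
 proof (cases "Suc (t mod ?L) = ?L")
  case True
  have "xs ! (t mod ?L) = last xs" using True len by (metis diff_Suc_1 last_conv_nth list.size(3) not_numeral_le_zero)
  moreover have "xs ! 0 = hd xs" using len by (cases xs) auto
  ultimately show ?thesis using True close by (simp add: mod_Suc)
 next
  case False
  have "t mod ?L < ?L" using L by simp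
  with False have "Suc (t mod ?L) < ?L" by simp
  then show ?thesis using xs(2) False by (simp add: mod_Suc successively_conv_nth)
 qed
 have ne: "xs ! (Suc (Suc t) mod ?L) ~= xs ! (t mod ?L)" for t
 proof -
  have "t mod ?L < ?L" "Suc (Suc t) mod ?L < ?L" using L by simp_all
  moreover have "Suc (Suc t) mod ?L ~= t mod ?L"
   unfolding mod_Suc[of "Suc t"] mod_Suc[of t] using len calculation by (simp split: if_splits)
  ultimately show ?thesis using xs(1) by (simp add: nth_eq_iff_index_eq)
 qed
 show False by (rule no_walk[of "%t. xs ! (t mod ?L)"]) (use adj ne in auto)
qed

lemma no_triangle: "adj a b ==> adj b c ==> ~ adj c a"
proof
 assume h: "adj a b" "adj b c" "adj c a"
 then have "a ~= b" "b ~= c" "c ~= a" by (auto simp: adj_def)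
 then show False using no_cycle[of "[a, b, c]"] h by auto
qed

text \<open>A walk whose far end turns it round: a long label or exponent reflects it directly, a branch point reflects it by running through the two other neighbours.\<close>
definition reflector_walk :: "'i => nat => (nat => 'i) => bool" where
 "reflector_walk c r p \<longleftrightarrow> p 0 = c & (\<forall>k<r. adj (p k) (p (Suc k))) &
  (3 \<le> d (p r) \<or> (\<exists>q. r = Suc q & m (p q) (p r) ~= 3))"

lemma straight_reflector_walk:
 assumes "reflector_walk c r p"
 shows "\<exists>r p. reflector_walk c r p & (\<forall>k. Suc (Suc k) \<le> r --> p (Suc (Suc k)) ~= p k)"
 using assms
proof (induction r arbitrary: p rule: less_induct)
 case (less r)
 show ?case
 proof (cases "\<forall>k. Suc (Suc k) \<le> r --> p (Suc (Suc k)) ~= p k")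
  case True
  then show ?thesis using less.prems by blast
 next
  case False
  then obtain k where k: "Suc (Suc k) \<le> r" "p (Suc (Suc k)) = p k" by blast
  note w = less.prems[unfolded reflector_walk_def]
  show ?thesis
  proof (cases "Suc (Suc k) = r")
   case end': True
   show ?thesis
   proof (cases "3 \<le> d (p r)")
    case True
    have "reflector_walk c k p" using w True k end' by (auto simp: reflector_walk_def)
    then show ?thesis using less.IH[of k p] end' by simp
   next
    case False
    with w end' have "m (p (Suc k)) (p r) ~= 3" by auto
    then have "m (p k) (p (Suc k)) ~= 3" using k(2) end' sym[of "p k" "p (Suc k)"] by auto
    then have "reflector_walk c (Suc k) p" using w end' by (auto simp: reflector_walk_def)
    then show ?thesis using less.IH[of "Suc k" p] end' by simp
   qed
  next
   case False
   define q where "q j = (if j \<le> k then p j else p (Suc (Suc j)))" for j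
   obtain s where s: "r = Suc (Suc (Suc s))" "k \<le> s"
    using k(1) False by (metis Suc_le_D Suc_le_mono le_SucE Suc_leI le_neq_implies_less)
   have "reflector_walk c (Suc s) q"
    unfolding reflector_walk_def
   proof (intro conjI allI impI)
    show "q 0 = c" using w by (simp add: q_def)
    show "adj (q j) (q (Suc j))" if "j < Suc s" for j
    proof (cases "j = k")
     case True
     have "adj (p (Suc (Suc k))) (p (Suc (Suc (Suc k))))" using w that s True by auto
     then show ?thesis using k(2) True by (simp add: q_def)
    next
     case False
     then show ?thesis using w that s by (auto simp: q_def)
    qed
    have qe: "q (Suc s) = p r" "q s = p (Suc (Suc s))"
     using s k(2) by (auto simp: q_def le_Suc_eq)
    show "3 \<le> d (q (Suc s)) \<or> (\<exists>q'. Suc s = Suc q' & m (q q') (q (Suc s)) ~= 3)"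
     using w unfolding qe s(1) by (auto simp: qe)
   qed
   then show ?thesis using less.IH[of "Suc s" q] s(1) by simp
  qed
 qed
qed

lemma walk_exists: "\<exists>r p. p 0 = a & p r = b & (\<forall>k<r. adj (p k) (p (Suc k)))"
 using connected[of a b]
proof (induction rule: rtrancl_induct)
 case base
 show ?case by (intro exI[of _ 0] exI[of _ "%_. a"]) simp
next
 case (step b c)
 then obtain r p where p: "p 0 = a" "p r = b" "\<forall>k<r. adj (p k) (p (Suc k))" by blast
 define q where "q k = (if k \<le> r then p k else c)" for k
 have "q 0 = a" "q (Suc r) = c" "\<forall>k<Suc r. adj (q k) (q (Suc k))"
  using p step.hyps(2) by (auto simp: q_def less_Suc_eq)
 then show ?case by blast
qed

lemma degree_le_2:
 assumes feature: "(\<exists>i. 3 \<le> d i) \<or> (\<exists>i j. adj i j & m i j ~= 3)"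
  and nb: "adj c x" "adj c y" "adj c w" "x ~= y" "x ~= w" "y ~= w"
 shows False
proof -
 have "\<exists>r p. reflector_walk c r p"
 proof (rule disjE[OF feature])
  assume "\<exists>i. 3 \<le> d i"
  then obtain i where i: "3 \<le> d i" ..
  from walk_exists[of c i] obtain r p where "p 0 = c" "p r = i" "\<forall>k<r. adj (p k) (p (Suc k))" by blast
  with i have "reflector_walk c r p" by (auto simp: reflector_walk_def)
  then show ?thesis by blast
 next
  assume "\<exists>i j. adj i j & m i j ~= 3"
  then obtain i j where ij: "adj i j" "m i j ~= 3" by blast
  from walk_exists[of c i] obtain r p where p: "p 0 = c" "p r = i" "\<forall>k<r. adj (p k) (p (Suc k))" by blast
  define q where "q k = (if k \<le> r then p k else j)" for k
  have "reflector_walk c (Suc r) q" using p ij by (auto simp: reflector_walk_def q_def less_Suc_eq)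
  then show ?thesis by blast
 qed
 then obtain r p where p: "reflector_walk c r p" "!!k. Suc (Suc k) \<le> r ==> p (Suc (Suc k)) ~= p k"
  using straight_reflector_walk by blast
 note w = p(1)[unfolded reflector_walk_def]
 have "\<exists>a b. adj c a & adj c b & a ~= b & a ~= p 1 & b ~= p 1" using nb by metis
 then obtain a b where ab: "adj c a" "adj c b" "a ~= b" "a ~= p 1" "b ~= p 1" by blast
 have "~ adj a b" using no_triangle[of c a b] ab adj_sym by blast
 then have mab: "m a b = 2" "m b a = 2" using ab(3) sym[of a b] by (auto simp: adj_def)
 define E where "E k = (case k of 0 => {a, b} | Suc j => {p j})" for k
 have "infinite (nonnull_classes m d (short_pairs m))"
 proof (rule zigzag_infinite[OF m d, where E = E and n = "Suc r" and l = False and r = "3 \<le> d (p r)"])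
  show "finite (E k)" "E k ~= {}" for k by (simp_all add: E_def split: nat.splits)
  show "m i j = 2" if "i \<in> E k" "j \<in> E k" "i ~= j" for k i j
   using that mab by (auto simp: E_def split: nat.splits)
  show "i ~= j & m i j ~= 2" if "k < Suc r" "i \<in> E k" "j \<in> E (Suc k)" for k i j
  proof -
   have "adj i j"
   proof (cases k)
    case 0
    then show ?thesis using that ab(1,2) w adj_sym by (auto simp: E_def)
   next
    case (Suc l)
    then show ?thesis using that w by (auto simp: E_def)
   qed
   then show ?thesis by (simp add: adj_def)
  qed
  show "E k \<inter> E (Suc (Suc k)) = {}" if "Suc (Suc k) \<le> Suc r" for k
  proof (cases k)
   case 0
   then show ?thesis using ab(4,5) by (auto simp: E_def)
  next
   case (Suc l)
   then show ?thesis using p(2)[of l] that by (auto simp: E_def)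
  qed
  show "if False then \<exists>x. E 0 = {x} & 3 \<le> d x else \<forall>x. E 0 = {x} --> (\<forall>y\<in>E 1. m x y ~= 3)"
   using ab(3) by (auto simp: E_def)
  show "if 3 \<le> d (p r) then \<exists>x. E (Suc r) = {x} & 3 \<le> d x
   else \<forall>x. E (Suc r) = {x} --> (\<forall>y\<in>E (Suc r - 1). m x y ~= 3)"
  proof (cases "3 \<le> d (p r)")
   case False
   with w obtain q where "r = Suc q" "m (p q) (p r) ~= 3" by auto
   then show ?thesis using False sym[of "p q" "p r"] by (simp add: E_def)
  qed (simp add: E_def)
  show "1 \<le> Suc r" by simp
  show "False \<or> 3 \<le> d (p r) \<or> 2 \<le> Suc r" using w by auto
 qed
 with finite show False by simp
qed

definition diagram_path :: "'i list => bool" where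
 "diagram_path xs \<longleftrightarrow> distinct xs & set xs = UNIV &
  (\<forall>i j. i < j --> j < length xs --> (adj (xs ! i) (xs ! j) \<longleftrightarrow> j = Suc i))"

lemma diagram_path_exists:
 assumes feature: "(\<exists>i. 3 \<le> d i) \<or> (\<exists>i j. adj i j & m i j ~= 3)"
 shows "\<exists>xs. diagram_path xs"
proof -
 define Q where "Q n \<longleftrightarrow> (\<exists>xs. length xs = n & distinct xs & successively adj xs)" for n
 have Qb: "n \<le> card (UNIV :: 'i set)" if "Q n" for n
  using that unfolding Q_def by (metis card_mono distinct_card finite_class.finite_UNIV subset_UNIV)
 have Q1: "Q 1" unfolding Q_def by (intro exI[of _ "[undefined]"]) simp
 define n where "n = (GREATEST n. Q n)"
 have Qn: "Q n" unfolding n_def by (rule GreatestI_nat[of Q 1 "card (UNIV :: 'i set)"]) (use Q1 Qb in auto)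
 have max: "length ys \<le> n" if "distinct ys" "successively adj ys" for ys
  unfolding n_def by (rule Greatest_le_nat[of Q _ "card (UNIV :: 'i set)"]) (use that Qb in \<open>auto simp: Q_def\<close>)
 have n1: "1 \<le> n" unfolding n_def by (rule Greatest_le_nat[of Q 1 "card (UNIV :: 'i set)"]) (use Q1 Qb in auto)
 obtain xs where xs: "length xs = n" "distinct xs" "successively adj xs" using Qn unfolding Q_def by blast
 have ne: "xs ~= []" using xs(1) n1 by auto
 have adj_nth: "adj (xs ! i) (xs ! Suc i)" if "Suc i < n" for i
  using xs that by (simp add: successively_conv_nth)
 have chord: "j = Suc i" if "i < j" "j < n" "adj (xs ! i) (xs ! j)" for i j
 proof (rule ccontr)
  assume "j ~= Suc i"
  define ys where "ys = drop i (take (Suc j) xs)"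
  have len: "length ys = Suc j - i" using that xs(1) by (simp add: ys_def)
  have nth: "ys ! k = xs ! (i + k)" if "k < length ys" for k
   using that len \<open>j < n\<close> xs(1) by (simp add: ys_def)
  have "distinct ys" using xs(2) by (simp add: ys_def)
  moreover have "successively adj ys"
   unfolding successively_conv_nth
  proof (intro allI impI)
   fix k assume "Suc k < length ys"
   then show "adj (ys ! k) (ys ! Suc k)" using adj_nth[of "i + k"] nth[of k] nth[of "Suc k"] len that by simp
  qed
  moreover have "3 \<le> length ys" using len that \<open>j ~= Suc i\<close> by simp
  moreover have "hd ys = xs ! i"
   using nth[of 0] len that by (simp add: hd_conv_nth flip: length_greater_0_conv)
  moreover have "last ys = xs ! j"
   using nth[of "j - i"] len that by (simp add: last_conv_nth flip: length_greater_0_conv)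
  moreover have "adj (xs ! j) (xs ! i)" using that(3) adj_sym by simp
  ultimately show False using no_cycle[of ys] by simp
 qed
 have inside: "u \<in> set xs" if vu: "v \<in> set xs" "adj v u" for u v
 proof (rule ccontr)
  assume u: "u \<notin> set xs"
  obtain i where i: "i < n" "v = xs ! i" using vu(1) xs(1) by (metis in_set_conv_nth)
  have i0: "i ~= 0"
  proof
   assume "i = 0"
   then have "v = hd xs" using i ne by (simp add: hd_conv_nth)
   then have "adj u (hd xs)" using vu(2) adj_sym[of v u] by simp
   then have "successively adj (u # xs)" using xs(3) ne by (cases xs) simp_all
   then show False using max[of "u # xs"] xs u by simp
  qed
  have il: "Suc i ~= n"
  proof
   assume "Suc i = n"
   then have "v = last xs" using i ne xs(1) by (metis diff_Suc_1 last_conv_nth)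
   then have "successively adj (xs @ [u])" using xs(3) vu(2) ne by (simp add: successively_append_iff)
   then show False using max[of "xs @ [u]"] xs u by simp
  qed
  obtain k where k: "i = Suc k" using i0 by (cases i) auto
  have "adj v (xs ! k)" using adj_nth[of k] i k adj_sym[of "xs ! k" v] by simp
  moreover have "adj v (xs ! Suc i)" using adj_nth[of i] i il by auto
  moreover have "xs ! k ~= xs ! Suc i" using xs i il k by (simp add: nth_eq_iff_index_eq)
  moreover have "u ~= xs ! k" "u ~= xs ! Suc i" using u xs(1) i il k by (auto simp: Suc_lessI)
  ultimately show False using degree_le_2[OF feature vu(2)] by blast
 qed
 have "set xs = UNIV"
 proof -
  have "v \<in> set xs" for v
   using connected[of "hd xs" v]
  proof (induction rule: rtrancl_induct)
   case base
   show ?case using ne by simp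
  qed (use inside in blast)
  then show ?thesis by blast
 qed
 then have "diagram_path xs"
  unfolding diagram_path_def using xs chord adj_nth by blast
 then show ?thesis by blast
qed

context
 fixes xs :: "'i list"
 assumes path: "diagram_path xs"
begin

lemma path_distinct: "distinct xs" and path_UNIV: "set xs = UNIV"
 using path unfolding diagram_path_def by auto

lemma path_adj: "i < length xs ==> j < length xs ==> adj (xs ! i) (xs ! j) \<longleftrightarrow> j = Suc i \<or> i = Suc j"
proof (induction i j rule: linorder_less_wlog)
 case (refl i)
 then show ?case by (simp add: adj_def)
next
 case (less i j)
 then show ?case using path unfolding diagram_path_def by auto
next
 case (sym i j)
 then show ?case using adj_sym by blast
qed

lemma path_inj: "i < length xs ==> j < length xs ==> xs ! i = xs ! j \<longleftrightarrow> i = j"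
 using path_distinct by (simp add: nth_eq_iff_index_eq)

lemma path_label:
 assumes "i < length xs" "j < length xs"
 shows "m (xs ! i) (xs ! j) = (if i = j then 1 else if j = Suc i \<or> i = Suc j then m (xs ! i) (xs ! j) else 2)"
 using path_adj[OF assms] path_inj[OF assms] coxeter_matrixD(1)[OF m] by (auto simp: adj_def)

lemma zigzag_along_path:
 assumes st: "s < t" "t < length xs" and refl: "l \<or> r \<or> Suc s < t"
  and left: "if l then 3 \<le> d (xs ! s) else m (xs ! s) (xs ! Suc s) ~= 3"
  and right: "if r then 3 \<le> d (xs ! t) else m (xs ! (t - 1)) (xs ! t) ~= 3"
 shows False
proof -
 define E where "E k = {xs ! (s + k)}" for k
 have "infinite (nonnull_classes m d (short_pairs m))"
 proof (rule zigzag_infinite[OF m d, where E = E and n = "t - s" and l = l and r = r])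
  show "i ~= j & m i j ~= 2" if "k < t - s" "i \<in> E k" "j \<in> E (Suc k)" for k i j
   using that st path_adj[of "s + k" "Suc (s + k)"] by (auto simp: E_def adj_def)
  show "E k \<inter> E (Suc (Suc k)) = {}" if "Suc (Suc k) \<le> t - s" for k
   using that st path_inj[of "s + k" "Suc (Suc (s + k))"] by (auto simp: E_def)
  show "if l then \<exists>x. E 0 = {x} & 3 \<le> d x else \<forall>x. E 0 = {x} --> (\<forall>y\<in>E 1. m x y ~= 3)"
   using left by (simp add: E_def)
  have "s + (t - s - 1) = t - 1" using st by simp
  moreover have "~ r ==> m (xs ! t) (xs ! (t - 1)) ~= 3"
   using right sym[of "xs ! (t - 1)" "xs ! t"] by simp
  ultimately show "if r then \<exists>x. E (t - s) = {x} & 3 \<le> d x else \<forall>x. E (t - s) = {x} --> (\<forall>y\<in>E (t - s - 1). m x y ~= 3)"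
   using right st by (cases r) (simp_all add: E_def)
 qed (use st refl in \<open>auto simp: E_def\<close>)
 with finite show False by simp
qed

lemma interior_exponent:
 assumes "Suc s < length xs" "0 < s"
 shows "d (xs ! s) = 2"
proof (rule ccontr)
 assume "d (xs ! s) ~= 2"
 then have d3: "3 \<le> d (xs ! s)" using d[of "xs ! s"] by simp
 obtain q where q: "s = Suc q" using assms(2) by (cases s) auto
 let ?a = "xs ! q" and ?b = "xs ! Suc s"
 have a: "adj (xs ! s) ?a" "adj (xs ! s) ?b" "~ adj ?a ?b" "?a ~= ?b"
  using assms q path_adj[of s q] path_adj[of s "Suc s"] path_adj[of q "Suc s"] path_inj[of q "Suc s"] by auto
 then have mab: "m ?a ?b = 2" "m ?b ?a = 2" using sym[of ?a ?b] by (auto simp: adj_def)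
 define E where "E k = (if k = 0 then {xs ! s} else {?a, ?b})" for k :: nat
 have "infinite (nonnull_classes m d (short_pairs m))"
  by (rule zigzag_infinite[OF m d, where E = E and n = 1 and l = True and r = False])
   (use a mab d3 in \<open>auto simp: E_def adj_def split: if_splits\<close>)
 with finite show False by simp
qed

lemma infinite_from_moves:
 assumes ok: "moves_ok M L N" and cycle: "run (moves_act M) u 0 = Some 0" "u ~= []" "list_all (%k. k < length M) u"
  and f: "!!k. k < length M ==> f k < length xs"
   "!!k l. k < length M ==> l < length M ==> k < l ==> f k ~= f l & L k l = L l k &
    (if f l = Suc (f k) \<or> f k = Suc (f l) then
     (if L k l = 3 then m (xs ! f k) (xs ! f l) = 3 else 4 \<le> L k l & enat (L k l) \<le> m (xs ! f k) (xs ! f l))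
    else L k l = 2)"
 shows False
proof -
 have two: "m (xs ! i) (xs ! j) = 2" if "i < length xs" "j < length xs" "i ~= j" "~ (j = Suc i \<or> i = Suc j)" for i j
  using path_label[OF that(1,2)] that(3,4) by simp
 have "infinite (nonnull_classes m d (short_pairs m))"
 proof (rule moves_infinite[OF m d ok cycle, where \<sigma> = "%k. xs ! f k"])
  have fne: "f k ~= f l" if "k < length M" "l < length M" "k ~= l" for k l
   using f(2)[of k l] f(2)[of l k] that by (cases "k < l") (auto simp: not_less)
  show "inj_on (%k. xs ! f k) {..<length M}"
  proof (rule inj_onI)
   fix k l assume "k \<in> {..<length M}" "l \<in> {..<length M}" "xs ! f k = xs ! f l"
   then show "k = l" using path_inj[OF f(1) f(1), of k l] fne[of k l] by auto
  qed
  have half: "if L k l = 2 then m (xs ! f k) (xs ! f l) = 2 else if L k l = 3 then m (xs ! f k) (xs ! f l) = 3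
   else 4 \<le> L k l & enat (L k l) \<le> m (xs ! f k) (xs ! f l)" if kl: "k < length M" "l < length M" "k < l" for k l
   using f(2)[OF kl] two[OF f(1)[OF kl(1)] f(1)[OF kl(2)]] by (auto split: if_splits)
  show "if L k l = 2 then m (xs ! f k) (xs ! f l) = 2 else if L k l = 3 then m (xs ! f k) (xs ! f l) = 3
   else 4 \<le> L k l & enat (L k l) \<le> m (xs ! f k) (xs ! f l)" if kl: "k < length M" "l < length M" "k ~= l" for k l
  proof (cases "k < l")
   case True
   then show ?thesis using half kl by simp
  next
   case False
   then have lk: "l < k" using kl(3) by simp
   have e: "L k l = L l k" "m (xs ! f k) (xs ! f l) = m (xs ! f l) (xs ! f k)"
    using f(2)[OF kl(2,1) lk] sym by simp_all
   show ?thesis unfolding e by (rule half[OF kl(2,1) lk])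
  qed
 qed
 with finite show False by simp
qed

lemma numbering_of_path:
 assumes "!!i. Suc i < length xs ==> m (xs ! i) (xs ! Suc i) = e (Suc i)"
 shows "coxeter_numbering (path_matrix e) (length xs) m (%i. xs ! (i - 1))"
 unfolding coxeter_numbering_def
proof (intro conjI ballI)
 have "bij_betw (%i. i - 1) {1..length xs} {..<length xs}"
  by (rule bij_betw_byWitness[where f' = Suc]) auto
 moreover have "bij_betw ((!) xs) {..<length xs} UNIV"
  using bij_betw_nth[OF path_distinct] path_UNIV by (simp add: lessThan_atLeast0)
 ultimately show "bij_betw (%i. xs ! (i - 1)) {1..length xs} UNIV"
  using bij_betw_trans by (fastforce simp: comp_def)
 fix i j assume "i \<in> {1..length xs}" "j \<in> {1..length xs}"
 then obtain k l where kl: "i = Suc k" "j = Suc l" "k < length xs" "l < length xs"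
  by (metis Suc_le_D Suc_le_lessD atLeastAtMost_iff One_nat_def)
 show "m (xs ! (i - 1)) (xs ! (j - 1)) = path_matrix e i j"
  using path_label[OF kl(3,4)] assms[of k] assms[of l] sym[of "xs ! k" "xs ! l"] kl
  by (auto simp: path_matrix_def)
qed

end

lemma diagram_path_rev: "diagram_path xs ==> diagram_path (rev xs)"
proof -
 assume path: "diagram_path xs"
 show ?thesis
  unfolding diagram_path_def
 proof (intro conjI allI impI)
  show "distinct (rev xs)" "set (rev xs) = UNIV" using path_distinct[OF path] path_UNIV[OF path] by auto
  fix i j assume ij: "i < j" "j < length (rev xs)"
  then show "adj (rev xs ! i) (rev xs ! j) \<longleftrightarrow> j = Suc i"
   using path_adj[OF path, of "length xs - Suc i" "length xs - Suc j"] by (auto simp: rev_nth)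
 qed
qed

text \<open>The node with the large exponent reflects zigzags. A second reflector, whether another large exponent, a long
 label or a branch point, gives infinitely many classes, and an interior node admits a walk in both directions.\<close>
theorem exponent_type_A:
 assumes "3 \<le> d i"
 shows "\<exists>n\<ge>1. \<exists>e>2. type_A_end_exponent m d n e"
proof -
 have "\<exists>xs. diagram_path xs" using assms by (intro diagram_path_exists) blast
 then obtain xs where path: "diagram_path xs" ..
 let ?n = "length xs"
 obtain s where s: "s < ?n" "i = xs ! s" using path_UNIV[OF path] by (metis UNIV_I in_set_conv_nth)
 have label: "m (xs ! k) (xs ! Suc k) = 3" if "Suc k < ?n" for k
 proof (rule ccontr)
  assume "m (xs ! k) (xs ! Suc k) ~= 3"
  then show False
   using zigzag_along_path[OF path, of s "Suc k" True False] zigzag_along_path[OF path, of k s False True] that s assms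
   by (cases "s < Suc k") (auto simp: not_less Suc_le_eq)
 qed
 have only: "d (xs ! k) = 2" if "k < ?n" "k ~= s" for k
 proof (rule ccontr)
  assume "d (xs ! k) ~= 2"
  then have "3 \<le> d (xs ! k)" using d[of "xs ! k"] by simp
  then show False
   using zigzag_along_path[OF path, of s k True True] zigzag_along_path[OF path, of k s True True] that s assms
   by (cases "s < k") auto
 qed
 have num: "coxeter_numbering matrix_A ?n m (%i. xs ! (i - 1))"
  unfolding matrix_A_def by (rule numbering_of_path[OF path]) (rule label)
 have s_end: "s = 0 \<or> Suc s = ?n"
  using interior_exponent[OF path, of s] s assms by fastforce
 have "type_A_end_exponent m d ?n (d i)"
  unfolding type_A_end_exponent_def
 proof (intro exI conjI)
  show "coxeter_numbering matrix_A ?n m (%i. xs ! (i - 1))" by (rule num)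
  show "d (xs ! (1 - 1)) = d i & (\<forall>k\<in>{2..?n}. d (xs ! (k - 1)) = 2) \<or>
   (\<forall>k\<in>{1..<?n}. d (xs ! (k - 1)) = 2) & d (xs ! (?n - 1)) = d i"
   using s_end
  proof
   assume "s = 0"
   then show ?thesis using only s by auto
  next
   assume "Suc s = ?n"
   then have "s = ?n - 1" by simp
   then show ?thesis using only s by auto
  qed
 qed
 moreover have "1 \<le> ?n" using s by simp
 ultimately show ?thesis using assms by (intro exI[of _ ?n] conjI exI[of _ "d i"]) auto
qed

end

section \<open>Diagrams with a label above 3\<close>

definition path_labels :: "nat list => nat => nat => nat" where
 "path_labels ls k l = (if l = Suc k then ls ! k else if k = Suc l then ls ! l else 2)"

text \<open>Automata for the minimal path diagrams that no zigzag excludes, named by their labels; each was found by searching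
 for a long cycle of nonnull words.\<close>
definition moves_63 :: "(nat \<times> nat) list list" where
 "moves_63 = [[(1, 2), (3, 4), (5, 0)], [(0, 1), (4, 5)], [(1, 3), (2, 4)]]"

definition moves_353 :: "(nat \<times> nat) list list" where
 "moves_353 = [[(0, 2), (6, 8), (7, 1)], [(1, 3), (2, 4), (5, 6)], [(4, 5), (6, 7), (8, 1)], [(1, 2), (3, 4), (7, 0)]]"

definition moves_3343 :: "(nat \<times> nat) list list" where
 "moves_3343 =
  [[(0, 4), (3, 7), (6, 10), (9, 13), (12, 16), (15, 19), (18, 23), (20, 22), (21, 1)],
  [(1, 5), (3, 6), (4, 8), (7, 9), (10, 13), (11, 12), (14, 15), (17, 20), (23, 2)],
  [(0, 3), (4, 7), (8, 11), (9, 12), (13, 16), (15, 18), (19, 23), (20, 21), (22, 1)],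
  [(1, 4), (5, 8), (11, 14), (12, 15), (16, 19), (21, 0)],
  [(2, 5), (14, 17), (15, 20), (18, 21), (19, 22), (23, 1)]]"

definition moves_5333 :: "(nat \<times> nat) list list" where
 "moves_5333 =
  [[(0, 5), (1, 4), (3, 7), (6, 10), (9, 13), (17, 22), (21, 25), (26, 29), (28, 32), (30, 33), (31, 35), (34, 37), (36, 39), (38, 2)],
  [(2, 3), (4, 8), (5, 6), (7, 11), (10, 14), (13, 17), (18, 21), (23, 26), (25, 28), (27, 30), (29, 31), (33, 36), (37, 1)],
  [(6, 9), (8, 12), (10, 13), (11, 15), (14, 18), (17, 21), (19, 23), (22, 25), (24, 27), (31, 34), (35, 37), (36, 38), (39, 2)],
  [(2, 5), (3, 6), (7, 10), (11, 14), (12, 16), (15, 19), (18, 23), (20, 24), (21, 26), (25, 29), (28, 31), (32, 35), (38, 0)],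
  [(1, 3), (4, 7), (8, 11), (12, 15), (16, 20), (19, 24), (23, 27), (26, 30), (29, 33), (31, 36), (34, 38), (35, 39), (37, 2)]]"

lemma moves_63_ok: "moves_ok moves_63 (path_labels [6, 3]) 6"
 by code_simp

lemma moves_353_ok: "moves_ok moves_353 (path_labels [3, 5, 3]) 9"
 by code_simp

lemma moves_3343_ok: "moves_ok moves_3343 (path_labels [3, 3, 4, 3]) 24"
 by code_simp

lemma moves_5333_ok: "moves_ok moves_5333 (path_labels [5, 3, 3, 3]) 40"
 by code_simp

lemma moves_cycles:
 "run (moves_act moves_63) [1, 0, 2, 1, 0] 0 = Some 0"
 "run (moves_act moves_353) [0, 1, 2, 1, 2, 3] 0 = Some 0"
 "run (moves_act moves_3343) [0, 1, 2, 1, 3, 2, 4, 3] 0 = Some 0"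
 "run (moves_act moves_5333) [0, 1, 0, 1, 2, 1, 0, 1, 3, 2, 4, 3] 0 = Some 0"
 by code_simp+

context finite_diagram
begin

lemma no_moves_on_path:
 assumes path: "diagram_path xs" and ok: "moves_ok M (path_labels ls) N"
  and cycle: "run (moves_act M) u 0 = Some 0" "u ~= []" "list_all (%k. k < length M) u"
  and len: "length M = Suc (length ls)" "a + length M \<le> length xs"
  and labels: "!!k. k < length ls ==> if ls ! k = 3 then m (xs ! (a + k)) (xs ! Suc (a + k)) = 3
   else 4 \<le> ls ! k & enat (ls ! k) \<le> m (xs ! (a + k)) (xs ! Suc (a + k))"
 shows False
proof (rule infinite_from_moves[OF path ok cycle, where f = "%k. a + k"])
 fix k l assume kl: "k < length M" "l < length M" "k < l"
 show "a + k ~= a + l & path_labels ls k l = path_labels ls l k &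
   (if a + l = Suc (a + k) \<or> a + k = Suc (a + l)
   then if path_labels ls k l = 3 then m (xs ! (a + k)) (xs ! (a + l)) = 3
      else 4 \<le> path_labels ls k l & enat (path_labels ls k l) \<le> m (xs ! (a + k)) (xs ! (a + l))
   else path_labels ls k l = 2)"
  using kl labels[of k] len by (auto simp: path_labels_def)
qed (use len in auto)

text \<open>Two long labels reflect zigzags, so exactly one label exceeds 3; the automata bound its position and size, which leaves the list.\<close>
theorem long_label_types:
 assumes long: "adj a b" "m a b ~= 3"
 shows "(\<exists>p\<ge>3. has_coxeter_type (matrix_I2 p) 2 m) \<or> (\<exists>n\<ge>2. has_coxeter_type (matrix_B n) n m) \<or>
  has_coxeter_type matrix_F4 4 m \<or> has_coxeter_type matrix_H 3 m \<or> has_coxeter_type matrix_H 4 m"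
proof -
 have "\<exists>xs. diagram_path xs" using long by (intro diagram_path_exists) blast
 then obtain xs0 where xs0: "diagram_path xs0" ..
 let ?edge = "%xs s. Suc s < length xs & m (xs ! s) (xs ! Suc s) ~= 3"
 have "\<exists>xs s. diagram_path xs & ?edge xs s & length xs - Suc (Suc s) \<le> s"
 proof -
  obtain i j where ij: "i < length xs0" "j < length xs0" "a = xs0 ! i" "b = xs0 ! j"
   using path_UNIV[OF xs0] by (metis UNIV_I in_set_conv_nth)
  then have "j = Suc i \<or> i = Suc j" using path_adj[OF xs0 ij(1,2)] long(1) by simp
  then have "?edge xs0 i \<or> ?edge xs0 j"
  proof
   assume "j = Suc i"
   then show ?thesis using ij long(2) by simp
  next
   assume "i = Suc j"
   then show ?thesis using ij long(2) sym[of "xs0 ! j" "xs0 ! i"] by simp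
  qed
  then obtain s where s: "?edge xs0 s" by blast
  show ?thesis
  proof (cases "length xs0 - Suc (Suc s) \<le> s")
   case True
   then show ?thesis using xs0 s by blast
  next
   case False
   define t where "t = length xs0 - Suc (Suc s)"
   have "rev xs0 ! t = xs0 ! Suc s" "rev xs0 ! Suc t = xs0 ! s"
    using s by (auto simp: rev_nth t_def Suc_diff_Suc)
   then have "?edge (rev xs0) t" using s sym[of "xs0 ! s" "xs0 ! Suc s"] False by (auto simp: t_def)
   moreover have "length (rev xs0) - Suc (Suc t) \<le> t" using s False by (auto simp: t_def)
   ultimately show ?thesis using diagram_path_rev[OF xs0] by blast
  qed
 qed
 then obtain xs s where path: "diagram_path xs" and s: "Suc s < length xs" "m (xs ! s) (xs ! Suc s) ~= 3"
  and near: "length xs - Suc (Suc s) \<le> s" by blast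
 let ?n = "length xs"
 define ys where "ys = rev xs"
 have path': "diagram_path ys" unfolding ys_def by (rule diagram_path_rev[OF path])
 have len': "length ys = ?n" by (simp add: ys_def)
 define t where "t = ?n - Suc (Suc s)"
 have st: "s + t + 2 = ?n" "t \<le> s" using s near by (auto simp: t_def)
 have others: "m (xs ! k) (xs ! Suc k) = 3" if "Suc k < ?n" "k ~= s" for k
 proof (rule ccontr)
  assume "m (xs ! k) (xs ! Suc k) ~= 3"
  then show False
   using zigzag_along_path[OF path, of s "Suc k" False False] zigzag_along_path[OF path, of k "Suc s" False False] that s
   by (cases "s < k") auto
 qed
 have ys_edge: "m (ys ! k) (ys ! Suc k) = m (xs ! (?n - Suc (Suc k))) (xs ! Suc (?n - Suc (Suc k)))" if "Suc k < ?n" for k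
  using that sym by (simp add: ys_def rev_nth Suc_diff_Suc)
 have ys_t: "m (ys ! t) (ys ! Suc t) = m (xs ! s) (xs ! Suc s)"
 proof -
  have "?n - Suc (Suc t) = s" using st by simp
  then show ?thesis using ys_edge[of t] st by simp
 qed
 have ys_others: "m (ys ! k) (ys ! Suc k) = 3" if "Suc k < ?n" "k ~= t" for k
  using ys_edge[OF that(1)] others[of "?n - Suc (Suc k)"] that st by auto
 have "adj (xs ! s) (xs ! Suc s)" using path_adj[OF path, of s "Suc s"] s by simp
 then obtain M where M: "m (xs ! s) (xs ! Suc s) = enat M" "4 \<le> M" using label_cases s(2) by blast
 have num: "coxeter_numbering (path_matrix e) ?n m (%i. xs ! (i - 1))"
  if "!!i. Suc i < ?n ==> m (xs ! i) (xs ! Suc i) = e (Suc i)" for e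
  by (rule numbering_of_path[OF path that])
 have num': "coxeter_numbering (path_matrix e) ?n m (%i. ys ! (i - 1))"
  if "!!i. Suc i < ?n ==> m (ys ! i) (ys ! Suc i) = e (Suc i)" for e
  using numbering_of_path[OF path', of e] that len' by simp
 show ?thesis
 proof (cases "?n = 2")
  case True
  then have "coxeter_numbering (matrix_I2 M) 2 m (%i. xs ! (i - 1))"
   using num[of "%_. enat M"] M(1) st by (simp add: matrix_I2_def)
  then show ?thesis using M(2) unfolding has_coxeter_type_def by (intro disjI1 exI[of _ M]) auto
 next
  case False
  then have s1: "1 \<le> s" using st by linarith
  consider "6 \<le> M" | "M = 5" "1 \<le> t" | "M = 5" "t = 0" | "M = 4" "1 \<le> t" | "M = 4" "t = 0" using M(2) by linarith
  then show ?thesis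
  proof cases
   case 1
   have labs: "if [6, 3] ! k = (3 :: nat) then m (ys ! (t + k)) (ys ! Suc (t + k)) = 3
    else (4::nat) \<le> [6, 3] ! k & enat ([6, 3] ! k) \<le> m (ys ! (t + k)) (ys ! Suc (t + k))" if "k < length [6, 3 :: nat]" for k
   proof -
    have "k = 0 \<or> k = 1" using that by auto
    then show ?thesis using ys_t M(1) 1 ys_others[of "t + 1"] s1 st by auto
   qed
   have False
    by (rule no_moves_on_path[OF path' moves_63_ok moves_cycles(1) _ _ _ _ labs]) (use st s1 len' in \<open>simp_all add: moves_63_def\<close>)
   then show ?thesis ..
  next
   case 2
   have labs: "if [3, 5, 3] ! k = (3 :: nat) then m (xs ! (s - 1 + k)) (xs ! Suc (s - 1 + k)) = 3
    else (4::nat) \<le> [3, 5, 3] ! k & enat ([3, 5, 3] ! k) \<le> m (xs ! (s - 1 + k)) (xs ! Suc (s - 1 + k))"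
    if "k < length [3, 5, 3 :: nat]" for k
   proof -
    have "k = 0 \<or> k = 1 \<or> k = 2" using that by auto
    then show ?thesis using M(1) 2 others[of "s - 1"] others[of "Suc s"] s1 st by auto
   qed
   have False
    by (rule no_moves_on_path[OF path moves_353_ok moves_cycles(2) _ _ _ _ labs]) (use st s1 2 in \<open>simp_all add: moves_353_def\<close>)
   then show ?thesis ..
  next
   case 3
   have num5: "coxeter_numbering matrix_H ?n m (%i. ys ! (i - 1))"
    unfolding matrix_H_def
   proof (rule num')
    fix i assume "Suc i < ?n"
    then show "m (ys ! i) (ys ! Suc i) = (if Suc i = 1 then 5 else 3)"
     using ys_t ys_others[of i] 3 M(1) by (cases "i = 0") (auto simp: numeral_eq_enat)
   qed
   have "?n \<le> 4"
   proof (rule ccontr)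
    assume n5: "~ ?n \<le> 4"
    have labs: "if [5, 3, 3, 3] ! k = (3 :: nat) then m (ys ! (0 + k)) (ys ! Suc (0 + k)) = 3
     else (4::nat) \<le> [5, 3, 3, 3] ! k & enat ([5, 3, 3, 3] ! k) \<le> m (ys ! (0 + k)) (ys ! Suc (0 + k))"
     if "k < length [5, 3, 3, 3 :: nat]" for k
    proof -
     have "k = 0 \<or> k = 1 \<or> k = 2 \<or> k = 3" using that by auto
     then show ?thesis using ys_t M(1) 3 ys_others[of k] n5 by (auto simp: eval_nat_numeral)
    qed
    show False
     by (rule no_moves_on_path[OF path' moves_5333_ok moves_cycles(4) _ _ _ _ labs]) (use n5 len' in \<open>simp_all add: moves_5333_def\<close>)
   qed
   then have "?n = 3 \<or> ?n = 4" using s1 st by linarith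
   then show ?thesis using num5 unfolding has_coxeter_type_def by auto
  next
   case 4
   show ?thesis
   proof (cases "?n = 4")
    case True
    then have s: "s = 1" using 4 st by linarith
    have "coxeter_numbering matrix_F4 ?n m (%i. xs ! (i - 1))"
     unfolding matrix_F4_def
    proof (rule num)
     fix i assume "Suc i < ?n"
     then show "m (xs ! i) (xs ! Suc i) = (if Suc i = 2 then 4 else 3)"
      using s others[of i] 4 M(1) by (cases "i = 1") (auto simp: numeral_eq_enat)
    qed
    then show ?thesis using True unfolding has_coxeter_type_def by auto
   next
    case False
    then have s2: "2 \<le> s" using 4 st by linarith
    have labs: "if [3, 3, 4, 3] ! k = (3 :: nat) then m (xs ! (s - 2 + k)) (xs ! Suc (s - 2 + k)) = 3
     else (4::nat) \<le> [3, 3, 4, 3] ! k & enat ([3, 3, 4, 3] ! k) \<le> m (xs ! (s - 2 + k)) (xs ! Suc (s - 2 + k))"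
     if "k < length [3, 3, 4, 3 :: nat]" for k
    proof -
     have "k = 0 \<or> k = 1 \<or> k = 2 \<or> k = 3" using that by auto
     moreover obtain q where "s = Suc (Suc q)" using s2 by (metis add_2_eq_Suc le_Suc_ex)
     ultimately show ?thesis
      using M(1) 4 others[of q] others[of "Suc q"] others[of "Suc s"] st by (auto simp: eval_nat_numeral)
    qed
    have False
     by (rule no_moves_on_path[OF path moves_3343_ok moves_cycles(3) _ _ _ _ labs]) (use st s2 4 in \<open>simp_all add: moves_3343_def\<close>)
    then show ?thesis ..
   qed
  next
   case 5
   have "coxeter_numbering (matrix_B ?n) ?n m (%i. xs ! (i - 1))"
    unfolding matrix_B_def
   proof (rule num)
    fix i assume "Suc i < ?n"
    then show "m (xs ! i) (xs ! Suc i) = (if Suc (Suc i) = ?n then 4 else 3)"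
     using others[of i] 5 M(1) st by (cases "i = s") (auto simp: numeral_eq_enat)
   qed
   then show ?thesis using st unfolding has_coxeter_type_def by (intro disjI2 disjI1 exI[of _ ?n]) auto
  qed
 qed
qed

end

section \<open>Finite Coxeter groups\<close>

lemma bond_weight_values:
 "bond_weight 2 = 0" "bond_weight 3 = 1"
 "bond_weight 4 * bond_weight 4 = 2" "bond_weight 4 > 0"
 "bond_weight 5 * bond_weight 5 = bond_weight 5 + 1" "bond_weight 5 > 0"
proof -
 have U: "chebyshev e 2 = bond_weight e" "chebyshev e 3 = bond_weight e * bond_weight e - 1"
  "chebyshev e 5 = bond_weight e * chebyshev e 4 - chebyshev e 3" if "2 \<le> e" for e
  using chebyshev_rec[of e 0] chebyshev_rec[of e 1] chebyshev_rec[of e 3] chebyshev_1[OF that]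
  by (simp_all add: eval_nat_numeral)
 note p = chebyshev_period
 have e: "(2::enat) = enat 2" "(3::enat) = enat 3" "(4::enat) = enat 4" "(5::enat) = enat 5"
  by (simp_all add: numeral_eq_enat)
 show "bond_weight 2 = 0" using U(1)[of 2] p(1)[of 2] by (simp add: e)
 show "bond_weight 3 = 1" using U(1)[of 3] p(3)[of 3] by (simp add: e)
 show "bond_weight 4 * bond_weight 4 = 2" using U(2)[of 4] p(3)[of 4] by (simp add: e)
 show "bond_weight 5 * bond_weight 5 = bond_weight 5 + 1"
  using U(2,3)[of 5] p(1)[of 5] p(3)[of 5] by (simp add: e)
 have "0 < cos (pi / real n)" if "4 \<le> n" for n
  using that by (intro cos_gt_zero) (auto simp: field_simps)
 from this[of 4] this[of 5] show "bond_weight 4 > 0" "bond_weight 5 > 0"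
  by (simp_all add: bond_weight_def e)
qed

text \<open>The numbers game may be played with linear coordinates on any set of vectors on which the generators act; a finite set suffices.\<close>
lemma finite_coxeter_group_by_vectors:
 fixes coord :: "'v => nat => real" and act :: "nat => 'v => 'v"
 assumes m: "coxeter_matrix m" and num: "coxeter_numbering C n m \<sigma>"
  and V: "finite V" "!!k v. k \<in> {1..n} ==> v \<in> V ==> act k v \<in> V"
  and coord: "!!k l v. k \<in> {1..n} ==> l \<in> {1..n} ==> v \<in> V ==>
   coord (act k v) l = coord v l + bond_weight (C k l) * coord v k"
  and start: "vstart \<in> V" "!!k. k \<in> {1..n} ==> 0 < coord vstart k"
 shows "finite (carrier (coxeter_group m))"
proof -
 have \<sigma>: "bij_betw \<sigma> {1..n} UNIV" "!!k l. k \<in> {1..n} ==> l \<in> {1..n} ==> m (\<sigma> k) (\<sigma> l) = C k l"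
  using num by (auto simp: coxeter_numbering_def)
 define \<tau> where "\<tau> = inv_into {1..n} \<sigma>"
 have \<tau>: "\<tau> a \<in> {1..n}" "\<sigma> (\<tau> a) = a" for a
 proof -
  have "a \<in> \<sigma> ` {1..n}" using \<sigma>(1) by (simp add: bij_betw_def)
  then show "\<tau> a \<in> {1..n}" "\<sigma> (\<tau> a) = a"
   unfolding \<tau>_def by (rule inv_into_into, rule f_inv_into_f)
 qed
 define st where "st v = (%a. coord v (\<tau> a))" for v
 have "fire m a (st v) = st (act (\<tau> a) v)" if "v \<in> V" for a v
 proof
  fix b
  have "m a b = C (\<tau> a) (\<tau> b)" using \<sigma>(2)[OF \<tau>(1) \<tau>(1), of a b] \<tau>(2) by simp
  then show "fire m a (st v) b = st (act (\<tau> a) v) b"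
   using coord[OF \<tau>(1) \<tau>(1) that, of a b] by (simp add: fire_def st_def)
 qed
 then have "fire m a y \<in> st ` V" if "y \<in> st ` V" for a y
  using that V(2)[OF \<tau>(1)] by (auto simp: image_iff)
 moreover have "0 < st vstart a" for a using start(2)[OF \<tau>(1)] by (simp add: st_def)
 ultimately show ?thesis using V(1) start(1) by (intro finite_coxeter_groupI[OF m, of "st ` V" "st vstart"]) auto
qed

text \<open>Signed permutations of the coordinates preserve a box of integer vectors.\<close>
lemma finite_type_B:
 assumes m: "coxeter_matrix m" and num: "coxeter_numbering (matrix_B n) n m \<sigma>"
 shows "finite (carrier (coxeter_group m))"
proof -
 define V :: "(nat => int) set" where "V = {1..n} \<rightarrow>\<^sub>E {- int n..int n}"
 define act where "act k v = (if k = n then v(n := - v n) else v(k := v (Suc k), Suc k := v k))" for k and v :: "nat => int"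
 define coord where "coord v k = (if k = n then bond_weight 4 * of_int (v n) else of_int (v k - v (Suc k)))" for v :: "nat => int" and k
 show ?thesis
 proof (rule finite_coxeter_group_by_vectors[OF m num, where V = V and act = act and coord = coord and vstart = "\<lambda>k\<in>{1..n}. int (Suc n - k)"])
  show "finite V" unfolding V_def by (rule finite_PiE) auto
  show "act k v \<in> V" if "k \<in> {1..n}" "v \<in> V" for k v
  proof (cases "k = n")
   case True
   have "v n \<in> {- int n..int n}" using that True unfolding V_def by (auto dest: PiE_mem)
   then have "- v n \<in> {- int n..int n}" by auto
   then show ?thesis using that True unfolding V_def act_def by (auto simp: PiE_iff extensional_def)
  next
   case False
   then have "Suc k \<in> {1..n}" "k \<in> {1..n}" using that by auto
   then show ?thesis using that False unfolding V_def act_def by (auto simp: PiE_iff extensional_def)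
  qed
  show "coord (act k v) l = coord v l + bond_weight (matrix_B n k l) * coord v k"
   if "k \<in> {1..n}" "l \<in> {1..n}" for k l v
  proof -
   have b4: "bond_weight 4 * (bond_weight 4 * x) = 2 * x" for x
    using bond_weight_values(3) by (simp flip: mult.assoc)
   consider "l = k" | "l = Suc k" | "k = Suc l" | "l ~= k" "l ~= Suc k" "k ~= Suc l" by blast
   then show ?thesis
   proof cases
    case 1
    then show ?thesis using that by (cases "k = n") (auto simp: matrix_B_def path_matrix_def coord_def act_def)
   next
    case 2
    then show ?thesis using that
     by (cases "l = n") (auto simp: matrix_B_def path_matrix_def coord_def act_def bond_weight_values algebra_simps)
   next
    case 3
    then show ?thesis using that
     by (cases "k = n") (auto simp: matrix_B_def path_matrix_def coord_def act_def bond_weight_values b4 algebra_simps)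
   next
    case 4
    then show ?thesis using that
     by (auto simp: matrix_B_def path_matrix_def coord_def act_def bond_weight_values)
   qed
  qed
  show "(\<lambda>k\<in>{1..n}. int (Suc n - k)) \<in> V" unfolding V_def by (auto simp: PiE_iff)
  show "0 < coord (\<lambda>k\<in>{1..n}. int (Suc n - k)) k" if "k \<in> {1..n}" for k
   using that bond_weight_values(4) by (auto simp: coord_def)
 qed
qed

lemma square_le_bound: "(x::int) * x \<le> q ==> \<bar>x\<bar> \<le> q"
proof -
 assume q: "x * x \<le> q"
 have "\<bar>x\<bar> \<le> \<bar>x\<bar> * \<bar>x\<bar>"
 proof (cases "x = 0")
  case False
  then have "1 \<le> \<bar>x\<bar>" by simp
  from mult_left_mono[OF this, of "\<bar>x\<bar>"] show ?thesis by simp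
 qed simp
 also have "\<dots> = x * x" by (rule abs_mult_self_eq)
 finally show ?thesis using q by simp
qed

text \<open>The lattice vectors of one fixed length; 252 is the squared length of a vector in the open chamber.\<close>
lemma finite_type_F4:
 assumes m: "coxeter_matrix m" and num: "coxeter_numbering matrix_F4 4 m \<sigma>"
 shows "finite (carrier (coxeter_group m))"
proof -
 let ?V = "{(a, b, c, d :: int). even (a + b) & even (a + c) & even (a + d) & a * a + b * b + c * c + d * d = 252}"
 define act where "act k = (%(a, b, c, d :: int). if k = 1 then (a, c, b, d) else if k = 2 then (a, b, d, c)
  else if k = 3 then (a, b, c, - d) else let t = (a - b - c - d) div 2 in (a - t, b + t, c + t, d + t))" for k :: nat
 define coord where "coord = (%(a, b, c, d :: int) k. if k = (1::nat) then of_int (b - c) else if k = 2 then of_int (c - d)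
  else if k = 3 then bond_weight 4 * of_int d else bond_weight 4 * of_int (a - b - c - d) / 2)"
 have k4: "k \<in> {1..4} \<longleftrightarrow> k = 1 \<or> k = 2 \<or> k = 3 \<or> k = 4" for k :: nat by auto
 have b4: "bond_weight 4 * (bond_weight 4 * x) = 2 * x" for x
  using bond_weight_values(3) by (simp flip: mult.assoc)
 show ?thesis
 proof (rule finite_coxeter_group_by_vectors[OF m num, where V = ?V and act = act and coord = coord and vstart = "(14, 6, 4, 2)"])
  have "?V \<subseteq> {-252..252} \<times> {-252..252} \<times> {-252..252} \<times> {-252..252}"
  proof
   fix v assume v: "v \<in> ?V"
   obtain a b c d where abcd: "v = (a, b, c, d)" by (cases v) auto
   have "a * a + b * b + c * c + d * d = 252" using v abcd by auto
   moreover have "0 \<le> a * a" "0 \<le> b * b" "0 \<le> c * c" "0 \<le> d * d" by simp_all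
   ultimately have "a * a \<le> 252" "b * b \<le> 252" "c * c \<le> 252" "d * d \<le> 252" by linarith+
   from this[THEN square_le_bound] show "v \<in> {-252..252} \<times> {-252..252} \<times> {-252..252} \<times> {-252..252}"
    unfolding abcd by (auto simp: abs_le_iff)
  qed
  then show "finite ?V" by (rule finite_subset) auto
  fix k :: nat and v assume k: "k \<in> {1..4}" and v: "v \<in> ?V"
  obtain a b c d where abcd: "v = (a, b, c, d)" by (cases v) auto
  have par: "even (a + b)" "even (a + c)" "even (a + d)" "a * a + b * b + c * c + d * d = 252" using v abcd by auto
  then have "even (a - b - c - d)" by presburger
  then obtain t where t: "a - b - c - d = 2 * t" by (elim evenE)
  have a: "a = b + c + d + 2 * t" using t by simp
  show "act k v \<in> ?V"
  proof -
   consider "k = 1" | "k = 2" | "k = 3" | "k = 4" using k unfolding k4 by blast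
   then show ?thesis
   proof cases
    case 4
    have "(a - t) * (a - t) + (b + t) * (b + t) + (c + t) * (c + t) + (d + t) * (d + t)
     = a * a + b * b + c * c + d * d - 2 * t * (a - b - c - d) + 4 * t * t" by (simp add: algebra_simps)
    then have "(a - t) * (a - t) + (b + t) * (b + t) + (c + t) * (c + t) + (d + t) * (d + t) = 252"
     unfolding t par(4) by simp
    moreover have "even (a - t + (b + t))" "even (a - t + (c + t))" "even (a - t + (d + t))"
     using par(1-3) by simp_all
    ultimately show ?thesis unfolding abcd by (simp only: act_def 4) (simp add: t)
   next
    case 3
    have "even (a + - d)" using par(3) by presburger
    then show ?thesis using par unfolding abcd by (simp add: act_def 3)
   qed (use par in \<open>simp_all add: act_def abcd\<close>)
  qed
  fix l :: nat assume l: "l \<in> {1..4}"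
  show "coord (act k v) l = coord v l + bond_weight (matrix_F4 k l) * coord v k"
  proof -
   have r4: "bond_weight 4 * bond_weight 4 = 2" by (rule bond_weight_values(3))
   have div: "(a - b - c - d) div 2 = t" using t by simp
   have real_t: "(of_int (a - b - c - d) :: real) = 2 * of_int t" unfolding t by simp
   consider "k = 1" | "k = 2" | "k = 3" | "k = 4" using k unfolding k4 by blast
   then show ?thesis
   proof cases
    case 1
    show ?thesis using l unfolding k4 abcd
     by (elim disjE) (simp_all add: 1 act_def coord_def matrix_F4_def path_matrix_def bond_weight_values(1,2))
   next
    case 2
    show ?thesis using l unfolding k4 abcd
     by (elim disjE) (simp_all add: 2 act_def coord_def matrix_F4_def path_matrix_def bond_weight_values(1,2) algebra_simps)
   next
    case 3
    show ?thesis using l unfolding k4 abcd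
     by (elim disjE) (simp_all add: 3 act_def coord_def matrix_F4_def path_matrix_def bond_weight_values(1,2) b4 r4 algebra_simps)
   next
    case 4
    have "coord (act k v) l = coord (a - t, b + t, c + t, d + t) l" by (simp add: act_def 4 abcd div)
    moreover have "coord v k = bond_weight 4 * of_int t"
     unfolding abcd using real_t by (simp add: coord_def 4)
    ultimately show ?thesis using l real_t unfolding k4 abcd
     by (elim disjE) (simp_all add: 4 coord_def matrix_F4_def path_matrix_def bond_weight_values(1,2) b4 r4 algebra_simps)
   qed
  qed
 next
  show "(14, 6, 4, 2) \<in> ?V" by simp
  show "0 < coord (14, 6, 4, 2) k" if "k \<in> {1..4}" for k
   using that bond_weight_values(4) unfolding k4 by (elim disjE) (simp_all add: coord_def)
 qed
qed

text \<open>The icosahedral groups act on the lattice \<open>E_8\<close> through its structure over the golden integers, each generator as a product of two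
 commuting reflections; 9200 is the squared length of a vector in the open chamber.\<close>
lemma finite_type_H:
 assumes m: "coxeter_matrix m" and num: "coxeter_numbering matrix_H n m \<sigma>" and n: "n \<le> 4"
 shows "finite (carrier (coxeter_group m))"
proof -
 let ?q = "9200 :: int"
 let ?V = "{(a, b, c, d, e, f, g, h :: int). even (a + b) & even (a + c) & even (a + d) & even (a + e) & even (a + f) &
  even (a + g) & even (a + h) & 4 dvd (a + b + c + d + e + f + g + h) &
  a * a + b * b + c * c + d * d + e * e + f * f + g * g + h * h = ?q}"
 define act where "act k = (%(a, b, c, d, e, f, g, h :: int).
  if k = 1 then (- b, - a, d, c, e, f, g, h) else if k = 2 then (a, c, b, e, d, f, g, h)
  else if k = 3 then (b, a, c, d, f, e, g, h)
  else let t = (a + h - b - c - d - e - f - g) div 4 in (a - t, b + t, c + t, d + t, e + t, g + t, f + t, h - t))" for k :: nat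
 define p where "p = bond_weight 5"
 define coord where "coord = (%(a, b, c, d, e, f, g, h :: int) k. if k = (1::nat) then of_int (a + b) + p * of_int (d - c)
  else if k = 2 then of_int (e - d) + p * of_int (c - b) else if k = 3 then of_int (f - e) + p * of_int (b - a)
  else of_int (g - f) + p * of_int (a + h - b - c - d - e - f - g) / 2)"
 have k4: "k = 1 \<or> k = 2 \<or> k = 3 \<or> k = 4" if "k \<in> {1..n}" for k :: nat using that n by auto
 have pp: "p * (p * x) = p * x + x" for x
  using bond_weight_values(5) by (simp add: p_def distrib_right flip: mult.assoc)
 show ?thesis
 proof (rule finite_coxeter_group_by_vectors[OF m num, where V = ?V and act = act and coord = coord and vstart = "(0, 4, 8, 12, 16, 20, 24, 88)"])
  have "?V \<subseteq> {-?q..?q} \<times> {-?q..?q} \<times> {-?q..?q} \<times> {-?q..?q} \<times> {-?q..?q} \<times> {-?q..?q} \<times> {-?q..?q} \<times> {-?q..?q}"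
  proof
   fix v assume v: "v \<in> ?V"
   obtain a b c d e f g h where abcd: "v = (a, b, c, d, e, f, g, h)" by (cases v) auto
   have "a * a + b * b + c * c + d * d + e * e + f * f + g * g + h * h = ?q" using v abcd by auto
   moreover have "0 \<le> a * a" "0 \<le> b * b" "0 \<le> c * c" "0 \<le> d * d" "0 \<le> e * e" "0 \<le> f * f" "0 \<le> g * g" "0 \<le> h * h"
    by simp_all
   ultimately have "a * a \<le> ?q" "b * b \<le> ?q" "c * c \<le> ?q" "d * d \<le> ?q" "e * e \<le> ?q" "f * f \<le> ?q" "g * g \<le> ?q" "h * h \<le> ?q"
    by linarith+
   from this[THEN square_le_bound]
   show "v \<in> {-?q..?q} \<times> {-?q..?q} \<times> {-?q..?q} \<times> {-?q..?q} \<times> {-?q..?q} \<times> {-?q..?q} \<times> {-?q..?q} \<times> {-?q..?q}"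
    unfolding abcd by (auto simp: abs_le_iff)
  qed
  then show "finite ?V" by (rule finite_subset) (intro finite_cartesian_product finite_atLeastAtMost_int)
  fix k :: nat and v assume k: "k \<in> {1..n}" and v: "v \<in> ?V"
  obtain a b c d e f g h where abcd: "v = (a, b, c, d, e, f, g, h)" by (cases v) auto
  have par: "even (a + b)" "even (a + c)" "even (a + d)" "even (a + e)" "even (a + f)" "even (a + g)" "even (a + h)"
   "4 dvd (a + b + c + d + e + f + g + h)" "a * a + b * b + c * c + d * d + e * e + f * f + g * g + h * h = ?q"
   using v abcd by auto
  have "4 dvd (a + h - b - c - d - e - f - g)"
  proof -
   have bc: "even (b + c)" using par(1,2) by presburger
   have de: "even (d + e)" using par(3,4) by presburger
   have fg: "even (f + g)" using par(5,6) by presburger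
   have "even ((b + c) + (d + e) + (f + g))" by (rule dvd_add[OF dvd_add[OF bc de] fg])
   then obtain x where "(b + c) + (d + e) + (f + g) = 2 * x" by (elim evenE)
   then have "2 * (b + c + d + e + f + g) = 4 * x" by simp
   then have "4 dvd 2 * (b + c + d + e + f + g)" by (rule dvdI)
   then have dv: "4 dvd (a + b + c + d + e + f + g + h) - 2 * (b + c + d + e + f + g)" using par(8) by (rule dvd_diff[rotated])
   have eq: "(a + b + c + d + e + f + g + h) - 2 * (b + c + d + e + f + g) = a + h - b - c - d - e - f - g" by simp
   show ?thesis using dv unfolding eq .
  qed
  then obtain t where t: "a + h - b - c - d - e - f - g = 4 * t" by (elim dvdE)
  have h: "h = 4 * t - a + b + c + d + e + f + g" using t by simp
  show "act k v \<in> ?V"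
  proof -
   consider "k = 1" | "k = 2" | "k = 3" | "k = 4" using k4[OF k] by blast
   then show ?thesis
   proof cases
    case 1
    obtain x where x: "a + b = 2 * x" using par(1) by (elim evenE)
    obtain y where y: "a + b + c + d + e + f + g + h = 4 * y" using par(8) by (elim dvdE)
    have "- b + - a + d + c + e + f + g + h = 4 * (y - x)" using x y by simp
    then have "4 dvd (- b + - a + d + c + e + f + g + h)" by (rule dvdI)
    moreover have "even (- b + - a)" using par(1) by presburger
    moreover have "even (- b + d)" using par(1,3) by presburger
    moreover have "even (- b + c)" using par(1,2) by presburger
    moreover have "even (- b + e)" using par(1,4) by presburger
    moreover have "even (- b + f)" using par(1,5) by presburger
    moreover have "even (- b + g)" using par(1,6) by presburger
    moreover have "even (- b + h)" using par(1,7) by presburger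
    ultimately show ?thesis using par(9) unfolding abcd by (simp add: act_def 1 algebra_simps)
   next
    case 2
    then show ?thesis using par unfolding abcd by (simp add: act_def ac_simps)
   next
    case 3
    have "even (b + a)" using par(1) by presburger
    moreover have "even (b + c)" using par(1,2) by presburger
    moreover have "even (b + d)" using par(1,3) by presburger
    moreover have "even (b + f)" using par(1,5) by presburger
    moreover have "even (b + e)" using par(1,4) by presburger
    moreover have "even (b + g)" using par(1,6) by presburger
    moreover have "even (b + h)" using par(1,7) by presburger
    moreover have "4 dvd (b + a + c + d + f + e + g + h)" using par(8) by (simp add: ac_simps)
    ultimately show ?thesis using par(9) unfolding abcd by (simp add: act_def 3 algebra_simps)
   next
    case 4
    have "(a - t) * (a - t) + (b + t) * (b + t) + (c + t) * (c + t) + (d + t) * (d + t) + (e + t) * (e + t) +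
     (g + t) * (g + t) + (f + t) * (f + t) + (h - t) * (h - t)
     = a * a + b * b + c * c + d * d + e * e + f * f + g * g + h * h
      - 2 * t * (a + h - b - c - d - e - f - g) + 8 * t * t" by (simp add: algebra_simps)
    then have norm: "(a - t) * (a - t) + (b + t) * (b + t) + (c + t) * (c + t) + (d + t) * (d + t) + (e + t) * (e + t) +
     (g + t) * (g + t) + (f + t) * (f + t) + (h - t) * (h - t) = ?q" unfolding t par(9) by simp
    have "a - t + (b + t) + (c + t) + (d + t) + (e + t) + (g + t) + (f + t) + (h - t) = (a + b + c + d + e + f + g + h) + 4 * t"
     by simp
    then have "4 dvd (a - t + (b + t) + (c + t) + (d + t) + (e + t) + (g + t) + (f + t) + (h - t))"
     using par(8) by (metis dvd_add dvd_triv_left)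
    moreover have "even (a - t + (b + t))" "even (a - t + (c + t))" "even (a - t + (d + t))" "even (a - t + (e + t))"
     "even (a - t + (g + t))" "even (a - t + (f + t))" "even (a - t + (h - t))" using par(1-7) by simp_all
    ultimately show ?thesis using norm unfolding abcd by (simp only: act_def 4) (simp add: t)
   qed
  qed
  fix l :: nat assume l: "l \<in> {1..n}"
  show "coord (act k v) l = coord v l + bond_weight (matrix_H k l) * coord v k"
  proof -
   have pp1: "p * p = p + 1" using bond_weight_values(5) by (simp add: p_def)
   have p5: "bond_weight 5 = p" by (simp add: p_def)
   have div: "(a + h - b - c - d - e - f - g) div 4 = t" using t by simp
   have real_t: "(of_int (a + h - b - c - d - e - f - g) :: real) = 4 * of_int t" unfolding t by simp
   consider "k = 1" | "k = 2" | "k = 3" | "k = 4" using k4[OF k] by blast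
   then show ?thesis
   proof cases
    case 1
    show ?thesis using k4[OF l] unfolding abcd
     by (elim disjE) (simp_all add: 1 act_def coord_def matrix_H_def path_matrix_def bond_weight_values(1,2) p5 pp pp1 algebra_simps)
   next
    case 2
    show ?thesis using k4[OF l] unfolding abcd
     by (elim disjE) (simp_all add: 2 act_def coord_def matrix_H_def path_matrix_def bond_weight_values(1,2) p5 pp pp1 algebra_simps)
   next
    case 3
    show ?thesis using k4[OF l] unfolding abcd
     by (elim disjE) (simp_all add: 3 act_def coord_def matrix_H_def path_matrix_def bond_weight_values(1,2) p5 pp pp1 field_simps)
   next
    case 4
    have "coord (act k v) l = coord (a - t, b + t, c + t, d + t, e + t, g + t, f + t, h - t) l"
     by (simp add: act_def 4 abcd div)
    moreover have "coord v k = of_int (g - f) + p * (2 * of_int t)"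
     unfolding abcd using real_t by (simp add: coord_def 4)
    ultimately show ?thesis using k4[OF l] unfolding abcd
     by (elim disjE) (simp_all add: 4 h coord_def matrix_H_def path_matrix_def bond_weight_values(1,2) p5 pp pp1 field_simps)
   qed
  qed
 next
  show "(0, 4, 8, 12, 16, 20, 24, 88) \<in> ?V" by simp
  show "0 < coord (0, 4, 8, 12, 16, 20, 24, 88) k" if "k \<in> {1..n}" for k
   using k4[OF that] bond_weight_values(6) by (elim disjE) (simp_all add: coord_def p_def)
 qed
qed

section \<open>Models along a path\<close>

text \<open>Nodes numbered from 0 along a path, so that states can be sequences indexed by positions.\<close>
locale path_diagram =
 fixes m :: "'i => 'i => enat" and d :: "'i => nat" and n :: nat and e :: "nat => enat"
  and \<sigma> :: "nat => 'i" and \<iota> :: "'i => nat"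
 assumes m: "coxeter_matrix m"
  and index: "!!a. \<iota> a < n" "!!a. \<sigma> (\<iota> a) = a" "!!q. q < n ==> \<iota> (\<sigma> q) = q"
  and label: "!!q. Suc q < n ==> m (\<sigma> q) (\<sigma> (Suc q)) = e q"
  and far: "!!p q. Suc p < q ==> q < n ==> m (\<sigma> p) (\<sigma> q) = 2"
  and e: "!!q. Suc q < n ==> e q = 3 \<or> e q = 4"
begin

lemma sym: "m a b = m b a" by (rule coxeter_matrixD(2)[OF m])

lemma \<sigma>_inj: "p < n ==> q < n ==> \<sigma> p = \<sigma> q \<longleftrightarrow> p = q"
 by (metis index(3))

lemma pair_cases:
 assumes "a ~= b"
 obtains p q where "{a, b} = {\<sigma> p, \<sigma> q}" "p < q" "q < n" "Suc p < q" "m (\<sigma> p) (\<sigma> q) = 2"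
 | q where "{a, b} = {\<sigma> q, \<sigma> (Suc q)}" "Suc q < n" "m (\<sigma> q) (\<sigma> (Suc q)) = e q"
proof -
 let ?D = "(\<exists>p q. {a, b} = {\<sigma> p, \<sigma> q} & p < q & q < n & Suc p < q & m (\<sigma> p) (\<sigma> q) = 2) \<or>
  (\<exists>q. {a, b} = {\<sigma> q, \<sigma> (Suc q)} & Suc q < n & m (\<sigma> q) (\<sigma> (Suc q)) = e q)"
 have ex: ?D if h: "p < q" "q < n" "{a, b} = {\<sigma> p, \<sigma> q}" for p q
 proof (cases "q = Suc p")
  case True
  then show ?thesis using h label[of p] by blast
 next
  case False
  then have "Suc p < q" using h(1) by simp
  then show ?thesis using h far[of p q] by blast
 qed
 have ne: "\<iota> a ~= \<iota> b" using assms index(2) by metis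
 have ab: "{a, b} = {\<sigma> (\<iota> a), \<sigma> (\<iota> b)}" "{a, b} = {\<sigma> (\<iota> b), \<sigma> (\<iota> a)}"
  unfolding index(2) by auto
 have ?D
 proof (cases "\<iota> a < \<iota> b")
  case True
  from ex[OF this index(1) ab(1)] show ?thesis .
 next
  case False
  then have "\<iota> b < \<iota> a" using ne by simp
  from ex[OF this index(1) ab(2)] show ?thesis .
 qed
 then show thesis
 proof (elim disjE exE conjE)
  fix p q assume "{a, b} = {\<sigma> p, \<sigma> q}" "p < q" "q < n" "Suc p < q" "m (\<sigma> p) (\<sigma> q) = 2"
  then show thesis by (rule that(1))
 next
  fix q assume "{a, b} = {\<sigma> q, \<sigma> (Suc q)}" "Suc q < n" "m (\<sigma> q) (\<sigma> (Suc q)) = e q"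
  then show thesis by (rule that(2))
 qed
qed

lemma run_\<sigma>: "set w \<subseteq> {..<n} ==> run (%a. act (\<iota> a)) (map \<sigma> w) s = run act w s"
 by (induction w arbitrary: s) (auto simp: index(3) cong: Option.bind_cong)

lemma commute_letters:
 assumes "p < n" "q < n" "Suc p < q \<or> Suc q < p"
 shows "braid_equiv m (short_pairs m) [\<sigma> p, \<sigma> q] [\<sigma> q, \<sigma> p]"
proof (rule braid_equiv_2[OF m])
 show "\<sigma> p ~= \<sigma> q" using assms by (auto simp: \<sigma>_inj)
 show "m (\<sigma> p) (\<sigma> q) = 2"
  using assms(3)
 proof
  assume "Suc q < p"
  then have "m (\<sigma> q) (\<sigma> p) = 2" using far assms(1) by blast
  then show ?thesis using sym[of "\<sigma> p" "\<sigma> q"] by simp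
 qed (use far assms(2) in blast)
qed

lemma neighbours:
 assumes "p < n" "q < n" "q = Suc p & e p = l \<or> p = Suc q & e q = l"
 shows "\<sigma> p ~= \<sigma> q" "m (\<sigma> p) (\<sigma> q) = l"
proof -
 show "\<sigma> p ~= \<sigma> q" using assms by (auto simp: \<sigma>_inj)
 show "m (\<sigma> p) (\<sigma> q) = l"
  using assms(3)
 proof
  assume "q = Suc p & e p = l"
  then show ?thesis using label[of p] assms(2) by simp
 next
  assume "p = Suc q & e q = l"
  then show ?thesis using label[of q] assms(1) sym[of "\<sigma> p" "\<sigma> q"] by simp
 qed
qed

lemma braid_letters:
 assumes "p < n" "q < n" "q = Suc p & e p = 3 \<or> p = Suc q & e q = 3"
 shows "braid_equiv m (short_pairs m) [\<sigma> p, \<sigma> q, \<sigma> p] [\<sigma> q, \<sigma> p, \<sigma> q]"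
 by (rule braid_equiv_3[OF m neighbours[OF assms]])

lemma path_nil_action:
 assumes closed: "!!s q t. s \<in> S ==> q < n ==> act q s = Some t ==> t \<in> S"
  and commute: "!!s p q. s \<in> S ==> Suc p < q ==> q < n ==> run act [p, q] s = run act [q, p] s"
  and braid3: "!!s q. s \<in> S ==> Suc q < n ==> e q = 3 ==> run act [q, Suc q, q] s = run act [Suc q, q, Suc q] s"
  and braid4: "!!s q. s \<in> S ==> Suc q < n ==> e q = 4 ==>
   run act [q, Suc q, q, Suc q] s = None & run act [Suc q, q, Suc q, q] s = None"
  and power: "!!s q. s \<in> S ==> q < n ==> run act (replicate (d (\<sigma> q)) q) s = None"
 shows "nil_action m d (short_pairs m) S (%a. act (\<iota> a))"
proof (rule nil_action_short[OF m])
 let ?run = "run (%a. act (\<iota> a))"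
 show "s \<in> S ==> act (\<iota> a) s = Some t ==> t \<in> S" for s a t by (rule closed[OF _ index(1)])
 have e2: "e q ~= 2" if "Suc q < n" for q using e[OF that] by auto
 show "?run [a, b] s = ?run [b, a] s" if h: "s \<in> S" "a ~= b" "m a b = 2" for s a b
  using h(2)
 proof (cases rule: pair_cases)
  case (1 p q)
  have "?run [\<sigma> p, \<sigma> q] s = ?run [\<sigma> q, \<sigma> p] s"
   using commute[OF h(1) 1(4,3)] run_\<sigma>[of "[p, q]" act s] run_\<sigma>[of "[q, p]" act s] 1(2,3) by simp
  then show ?thesis using 1(1) by (auto simp: doubleton_eq_iff)
 next
  case (2 q)
  then have "m a b = e q" using sym[of a b] by (auto simp: doubleton_eq_iff)
  then show ?thesis using e2[OF 2(2)] h(3) by simp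
 qed
 show "?run [a, b, a] s = ?run [b, a, b] s" if h: "s \<in> S" "a ~= b" "m a b = 3" for s a b
  using h(2)
 proof (cases rule: pair_cases)
  case (1 p q)
  then have "m a b = 2" using sym[of a b] by (auto simp: doubleton_eq_iff)
  then show ?thesis using h(3) by simp
 next
  case (2 q)
  then have "e q = 3" using h(3) sym[of a b] by (auto simp: doubleton_eq_iff)
  then have "?run [\<sigma> q, \<sigma> (Suc q), \<sigma> q] s = ?run [\<sigma> (Suc q), \<sigma> q, \<sigma> (Suc q)] s"
   using braid3[OF h(1) 2(2)] run_\<sigma>[of "[q, Suc q, q]" act s] run_\<sigma>[of "[Suc q, q, Suc q]" act s] 2(2) by simp
  then show ?thesis using 2(1) by (auto simp: doubleton_eq_iff)
 qed
 show "?run (alternating_word a b k) s = None" if h: "s \<in> S" "a ~= b" "m a b = enat k" "4 \<le> k" for s a b k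
  using h(2)
 proof (cases rule: pair_cases)
  case (1 p q)
  then have "m a b = 2" using sym[of a b] by (auto simp: doubleton_eq_iff)
  then show ?thesis using h(3,4) by (simp add: numeral_eq_enat)
 next
  case (2 q)
  then have "e q = enat k" using h(3) sym[of a b] by (auto simp: doubleton_eq_iff)
  then have "e q = 4" "k = 4" using e[OF 2(2)] h(4) by (auto simp: numeral_eq_enat)
  then have "?run [\<sigma> q, \<sigma> (Suc q), \<sigma> q, \<sigma> (Suc q)] s = None & ?run [\<sigma> (Suc q), \<sigma> q, \<sigma> (Suc q), \<sigma> q] s = None"
   using braid4[OF h(1) 2(2)] run_\<sigma>[of "[q, Suc q, q, Suc q]" act s] run_\<sigma>[of "[Suc q, q, Suc q, q]" act s] 2(2) by simp
  moreover have "alternating_word a b k = [a, b, a, b]" using \<open>k = 4\<close> by (simp add: eval_nat_numeral)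
  ultimately show ?thesis using 2(1) unfolding doubleton_eq_iff by (elim disjE conjE) (simp_all del: run.simps)
 qed
 show "?run (replicate (d a) a) s = None" if h: "s \<in> S" for s a
  using power[OF h index(1), of a] run_\<sigma>[of "replicate (d a) (\<iota> a)" act s] index(1)[of a]
  by (simp add: index(2) set_replicate_conv_if)
qed

text \<open>The forms that the reason for an undefined value takes along a path: a full power, a letter commuted to the
 left, a braid move of length 3, or a side of a relation of length 4.\<close>
inductive path_dead :: "'s set => (nat => 's => 's option) => 's => nat => bool" for S act where
 power: "z \<in> S ==> q < n ==> d (\<sigma> q) = Suc k ==> run act (replicate k q) z = Some x ==> path_dead S act x q"
| commute: "z \<in> S ==> p < n ==> q < n ==> Suc p < q \<or> Suc q < p ==> act p z = Some x ==> path_dead S act z q ==>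
  path_dead S act x q"
| braid: "z \<in> S ==> p < n ==> q < n ==> q = Suc p & e p = 3 \<or> p = Suc q & e q = 3 ==> run act [q, p] z = Some x ==>
  [p, q, p] = w @ l # v ==> run act w z = Some y ==> path_dead S act y l ==> path_dead S act x q"
| braid4: "z \<in> S ==> p < n ==> q < n ==> q = Suc p & e p = 4 \<or> p = Suc q & e q = 4 ==> run act [p, q, p] z = Some x ==>
  path_dead S act x q"

lemma path_dead_dead:
 assumes "path_dead S act x q"
 shows "q < n & dead m d (short_pairs m) S (%a. act (\<iota> a)) x (\<sigma> q)"
 using assms
proof (induction rule: path_dead.induct)
 case (power z q k x)
 have "run (%a. act (\<iota> a)) (replicate k (\<sigma> q)) z = Some x"
  using run_\<sigma>[of "replicate k q" act z] power by (simp add: set_replicate_conv_if)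
 moreover have "replicate k (\<sigma> q) @ [\<sigma> q] \<in> forbidden_words m d (short_pairs m)"
  unfolding short_forbidden_words_iff[OF m]
  by (rule disjI1, rule exI[of _ "\<sigma> q"]) (simp add: power(3) replicate_append_same)
 ultimately show ?case using power(1,2) dead.forbidden[of z S "%a. act (\<iota> a)" "replicate k (\<sigma> q)" x "\<sigma> q" m d "short_pairs m"] by simp
next
 case (commute z p q x)
 have r: "run (%a. act (\<iota> a)) [\<sigma> p] z = Some x" using commute index(3) by simp
 have b: "braid_equiv m (short_pairs m) ([\<sigma> p] @ [\<sigma> q]) ([] @ \<sigma> q # [\<sigma> p])"
  using commute_letters[OF commute(2,3,4)] by simp
 have n: "run (%a. act (\<iota> a)) [] z = Some z" by simp
 from dead.braid[OF commute(1) r b n] commute(3,7) show ?case by simp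
next
 case (braid z p q x w l v y)
 have "run (%a. act (\<iota> a)) [\<sigma> q, \<sigma> p] z = Some x" using run_\<sigma>[of "[q, p]" act z] braid by simp
 moreover have "braid_equiv m (short_pairs m) [\<sigma> q, \<sigma> p, \<sigma> q] [\<sigma> p, \<sigma> q, \<sigma> p]"
  using braid_equiv_sym[OF braid_letters[OF braid(2,3,4)]] .
 moreover have "[\<sigma> p, \<sigma> q, \<sigma> p] = map \<sigma> w @ \<sigma> l # map \<sigma> v"
  using arg_cong[OF braid(6), of "map \<sigma>"] by simp
 moreover have "set w \<subseteq> {..<n}"
 proof -
  have "set w \<subseteq> set [p, q, p]" unfolding braid(6) by auto
  then show ?thesis using braid(2,3) by auto
 qed
 then have "run (%a. act (\<iota> a)) (map \<sigma> w) z = Some y" using run_\<sigma>[of w act z] braid(7) by simp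
 ultimately have "braid_equiv m (short_pairs m) ([\<sigma> q, \<sigma> p] @ [\<sigma> q]) (map \<sigma> w @ \<sigma> l # map \<sigma> v)"
  "run (%a. act (\<iota> a)) [\<sigma> q, \<sigma> p] z = Some x" "run (%a. act (\<iota> a)) (map \<sigma> w) z = Some y" by simp_all
 from dead.braid[OF braid(1) this(2,1,3)] braid(3,9) show ?case by simp
next
 case (braid4 z p q x)
 have "run (%a. act (\<iota> a)) [\<sigma> p, \<sigma> q, \<sigma> p] z = Some x" using run_\<sigma>[of "[p, q, p]" act z] braid4 by simp
 moreover have "m (\<sigma> p) (\<sigma> q) = enat 4" "\<sigma> p ~= \<sigma> q" using neighbours[OF braid4(2,3,4)]
  by (auto simp: numeral_eq_enat)
 then have "[\<sigma> p, \<sigma> q, \<sigma> p] @ [\<sigma> q] \<in> forbidden_words m d (short_pairs m)"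
  unfolding short_forbidden_words_iff[OF m]
  by (intro disjI2 exI[of _ "\<sigma> p"] exI[of _ "\<sigma> q"] exI[of _ 4]) (auto simp: eval_nat_numeral)
 ultimately show ?case using dead.forbidden[OF braid4(1), of "%a. act (\<iota> a)" "[\<sigma> p, \<sigma> q, \<sigma> p]"] braid4(3) by simp
qed

lemma path_nil_model:
 assumes action: "nil_action m d (short_pairs m) S (%a. act (\<iota> a))"
  and source: "x0 \<in> S"
  and injective: "!!q x y z. q < n ==> x \<in> S ==> y \<in> S ==> act q x = Some z ==> act q y = Some z ==> x = y"
  and rank: "!!q x y. q < n ==> x \<in> S ==> act q x = Some y ==> rk x < (rk y :: nat)"
  and predecessor: "!!y. y \<in> S ==> y ~= x0 ==> \<exists>q<n. \<exists>x\<in>S. act q x = Some y"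
  and diamond: "!!p q x x' y. p < q ==> q < n ==> x \<in> S ==> x' \<in> S ==> act p x = Some y ==> act q x' = Some y ==>
   \<exists>z\<in>S. if q = Suc p then e p = 3 & run act [p, q] z = Some x & run act [q, p] z = Some x'
    else act q z = Some x & act p z = Some x'"
  and complete: "!!x q. x \<in> S ==> q < n ==> act q x = None ==> path_dead S act x q"
 shows "nil_model m d (short_pairs m) S (%a. act (\<iota> a)) x0 rk"
proof
 let ?act = "%a. act (\<iota> a)"
 let ?join = "%a b x x'. \<exists>z\<in>S. \<exists>u v. braid_equiv m (short_pairs m) (u @ [a]) (v @ [b]) & run ?act u z = Some x & run ?act v z = Some x'"
 have join: "?join (\<sigma> p) (\<sigma> q) x x' & ?join (\<sigma> q) (\<sigma> p) x' x"
  if h: "p < q" "q < n" "x \<in> S" "x' \<in> S" "act p x = Some y" "act q x' = Some y" for p q x x' y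
 proof -
  from diamond[OF h] obtain z where z: "z \<in> S" and
   zz: "if q = Suc p then e p = 3 & run act [p, q] z = Some x & run act [q, p] z = Some x'
    else act q z = Some x & act p z = Some x'" by blast
  have pn: "p < n" using h by simp
  obtain u v where uv: "braid_equiv m (short_pairs m) (u @ [\<sigma> p]) (v @ [\<sigma> q])" "run ?act u z = Some x" "run ?act v z = Some x'"
  proof (cases "q = Suc p")
   case True
   show thesis
   proof (rule that[of "[\<sigma> p, \<sigma> q]" "[\<sigma> q, \<sigma> p]"])
    show "braid_equiv m (short_pairs m) ([\<sigma> p, \<sigma> q] @ [\<sigma> p]) ([\<sigma> q, \<sigma> p] @ [\<sigma> q])"
     using braid_letters[OF pn h(2)] zz True by simp
    show "run ?act [\<sigma> p, \<sigma> q] z = Some x" "run ?act [\<sigma> q, \<sigma> p] z = Some x'"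
     using zz True run_\<sigma>[of "[p, q]" act z] run_\<sigma>[of "[q, p]" act z] pn h(2) by simp_all
   qed
  next
   case False
   show thesis
   proof (rule that[of "[\<sigma> q]" "[\<sigma> p]"])
    show "braid_equiv m (short_pairs m) ([\<sigma> q] @ [\<sigma> p]) ([\<sigma> p] @ [\<sigma> q])"
     using commute_letters[OF h(2) pn] h(1) False by simp
    show "run ?act [\<sigma> q] z = Some x" "run ?act [\<sigma> p] z = Some x'"
     using zz False index(3)[OF pn] index(3)[OF h(2)] by simp_all
   qed
  qed
  show ?thesis using z uv braid_equiv_sym[OF uv(1)] by blast
 qed
 show "nil_action m d (short_pairs m) S ?act" by (rule action)
 show "x0 \<in> S" by (rule source)
 show "x = y" if "x \<in> S" "y \<in> S" "act (\<iota> a) x = Some z" "act (\<iota> a) y = Some z" for a x y z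
  using injective[OF index(1) that] .
 show "rk x < rk y" if "x \<in> S" "act (\<iota> a) x = Some y" for a x y
  using rank[OF index(1) that] .
 show "\<exists>a. \<exists>x\<in>S. act (\<iota> a) x = Some y" if "y \<in> S" "y ~= x0" for y
 proof -
  from predecessor[OF that] obtain q x where "q < n" "x \<in> S" "act q x = Some y" by blast
  then show ?thesis using index(3)[of q] by (intro exI[of _ "\<sigma> q"] bexI[of _ x]) auto
 qed
 show "?join a b x x'"
  if "x \<in> S" "x' \<in> S" "a ~= b" "act (\<iota> a) x = Some y" "act (\<iota> b) x' = Some y" for a b x x' y
 proof -
  have "\<iota> a ~= \<iota> b" using that(3) index(2) by metis
  then consider "\<iota> a < \<iota> b" | "\<iota> b < \<iota> a" by linarith
  then show ?thesis
  proof cases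
   case 1
   from join[OF this index(1) that(1,2,4,5)] show ?thesis unfolding index(2) by (rule conjunct1)
  next
   case 2
   from join[OF this index(1) that(2,1,5,4)] show ?thesis unfolding index(2) by (rule conjunct2)
  qed
 qed
 show "dead m d (short_pairs m) S ?act x a" if "x \<in> S" "act (\<iota> a) x = None" for x a
  using path_dead_dead[OF complete[OF that(1) index(1) that(2)]] unfolding index(2) by (rule conjunct2)
qed

end

lemma path_diagram_numbering:
 assumes m: "coxeter_matrix m" and num: "coxeter_numbering (path_matrix f) n m \<tau>"
  and f: "!!i. 1 \<le> i ==> i < n ==> f i = 3 \<or> f i = 4"
 shows "path_diagram m n (%q. f (Suc q)) (%q. \<tau> (Suc q)) (%a. inv_into {1..n} \<tau> a - 1)"
proof -
 have \<tau>: "bij_betw \<tau> {1..n} UNIV" "!!i j. i \<in> {1..n} ==> j \<in> {1..n} ==> m (\<tau> i) (\<tau> j) = path_matrix f i j"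
  using num by (auto simp: coxeter_numbering_def)
 have inv: "inv_into {1..n} \<tau> a \<in> {1..n}" "\<tau> (inv_into {1..n} \<tau> a) = a" for a
 proof -
  have "a \<in> \<tau> ` {1..n}" using \<tau>(1) by (simp add: bij_betw_def)
  then show "inv_into {1..n} \<tau> a \<in> {1..n}" "\<tau> (inv_into {1..n} \<tau> a) = a"
   by (rule inv_into_into, rule f_inv_into_f)
 qed
 show ?thesis
 proof
  show "coxeter_matrix m" by (rule m)
  fix a
  have i1: "1 \<le> inv_into {1..n} \<tau> a" "inv_into {1..n} \<tau> a \<le> n" using inv(1)[of a] by auto
  then show "inv_into {1..n} \<tau> a - 1 < n" by linarith
  have "Suc (inv_into {1..n} \<tau> a - 1) = inv_into {1..n} \<tau> a" using i1 by simp
  then show "\<tau> (Suc (inv_into {1..n} \<tau> a - 1)) = a" using inv(2)[of a] by simp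
 next
  fix q assume "q < n"
  then have "Suc q \<in> {1..n}" by simp
  then have "inv_into {1..n} \<tau> (\<tau> (Suc q)) = Suc q" using \<tau>(1) by (simp add: bij_betw_def inv_into_f_f)
  then show "inv_into {1..n} \<tau> (\<tau> (Suc q)) - 1 = q" by simp
 next
  fix q assume q: "Suc q < n"
  then show "m (\<tau> (Suc q)) (\<tau> (Suc (Suc q))) = f (Suc q)" using \<tau>(2)[of "Suc q" "Suc (Suc q)"] by (simp add: path_matrix_def)
  show "f (Suc q) = 3 \<or> f (Suc q) = 4" using f[of "Suc q"] q by simp
 next
  fix p q assume "Suc p < q" "q < n"
  then show "m (\<tau> (Suc p)) (\<tau> (Suc q)) = 2" using \<tau>(2)[of "Suc p" "Suc q"] by (simp add: path_matrix_def)
 qed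
qed

section \<open>Sorting arrangements\<close>

definition swap_at :: "nat => (nat => 'b) => nat => 'b" where
 "swap_at q f = f(q := f (Suc q), Suc q := f q)"

lemma swap_at_apply: "swap_at q f x = (if x = q then f (Suc q) else if x = Suc q then f q else f x)"
 by (simp add: swap_at_def)

lemma swap_at_swap_at [simp]: "swap_at q (swap_at q f) = f"
 by (auto simp: swap_at_def)

lemma swap_at_commute: "Suc p < q \<or> Suc q < p ==> swap_at p (swap_at q f) = swap_at q (swap_at p f)"
 by (auto simp: swap_at_apply fun_eq_iff)

lemma swap_at_braid: "swap_at q (swap_at (Suc q) (swap_at q f)) = swap_at (Suc q) (swap_at q (swap_at (Suc q) f))"
 by (auto simp: swap_at_apply fun_eq_iff)

lemma swap_at_comp: "swap_at q f = f \<circ> Transposition.transpose q (Suc q)"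
 by (auto simp: swap_at_def fun_eq_iff Transposition.transpose_def)

text \<open>Moving a larger entry to the left increases this sum.\<close>
definition weight :: "nat => (nat => nat) => nat" where
 "weight N f = (\<Sum>x<N. (N - x) * f x)"

lemma weight_swap_at:
 assumes q: "Suc q < N" and less: "f q < f (Suc q)"
 shows "weight N f < weight N (swap_at q f)"
proof -
 have split: "weight N g = (\<Sum>x\<in>{..<N} - {q, Suc q}. (N - x) * g x) + ((N - q) * g q + (N - Suc q) * g (Suc q))" for g
 proof -
  have "weight N g = (\<Sum>x\<in>{..<N} - {q, Suc q}. (N - x) * g x) + (\<Sum>x\<in>{q, Suc q}. (N - x) * g x)"
   unfolding weight_def using q by (intro sum.subset_diff) auto
  then show ?thesis by simp
 qed
 have "(\<Sum>x\<in>{..<N} - {q, Suc q}. (N - x) * swap_at q f x) = (\<Sum>x\<in>{..<N} - {q, Suc q}. (N - x) * f x)"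
  by (intro sum.cong) (auto simp: swap_at_apply)
 moreover have "(N - q) * f q + (N - Suc q) * f (Suc q) < (N - q) * f (Suc q) + (N - Suc q) * f q"
 proof -
  have "N - q = Suc (N - Suc q)" using q by simp
  then show ?thesis using less by simp
 qed
 ultimately show ?thesis unfolding split[of f] split[of "swap_at q f"] by (simp add: swap_at_apply)
qed

subsection \<open>Type A with an exponent at the first node\<close>

text \<open>Permutations of \<open>{0..n}\<close> with a colour, which is 0 exactly if the entry 0 stands at the front.\<close>
definition coloured_arrangements :: "nat => nat => ((nat => nat) \<times> nat) set" where
 "coloured_arrangements n k = {(f, j). f permutes {..n} & (j = 0 \<longleftrightarrow> f 0 = 0) & j < k}"

text \<open>The letters swap neighbours at an ascent. The first letter, of exponent \<open>k\<close>, moves 0 away from the front,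
 then counts up to \<open>k - 1\<close> while 0 stays next to the front; in the remaining cases it swaps only if nothing has been counted.\<close>
fun coloured_sort :: "nat => nat => (nat => nat) \<times> nat => ((nat => nat) \<times> nat) option" where
 "coloured_sort k q (f, j) =
  (if q = 0 then
    if f 0 = 0 then Some (swap_at 0 f, 1)
    else if f 1 = 0 then if Suc j < k then Some (f, Suc j) else None
    else if j = 1 & f 0 < f 1 then Some (swap_at 0 f, j) else None
   else if f q < f (Suc q) then Some (swap_at q f, j) else None)"

lemma permutes_swap_at: "f permutes {..n} ==> q < n ==> swap_at q f permutes {..n}"
 unfolding swap_at_comp by (rule permutes_compose[OF permutes_swap_id]) auto

lemma permutes_neq: "f permutes A ==> f x = f y \<longleftrightarrow> x = y"
 by (metis permutes_inj injD)

lemma increasing_permutation: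
 assumes f: "f permutes {..n}" and inc: "!!q. q < n ==> f q < f (Suc q)"
 shows "f = id"
proof -
 have up: "x \<le> n ==> x \<le> f x" for x
 proof (induction x)
  case (Suc x)
  then have "x \<le> f x" "f x < f (Suc x)" using inc[of x] by simp_all
  then show ?case by simp
 qed simp
 have down': "x \<le> n ==> f (n - x) \<le> n - x" for x
 proof (induction x)
  case 0
  have "f n \<in> {..n}" using permutes_in_image[OF f, of n] by simp
  then show ?case by simp
 next
  case (Suc x)
  then have "Suc (n - Suc x) = n - x" by simp
  then have "f (n - Suc x) < f (n - x)" using inc[of "n - Suc x"] Suc.prems by simp
  moreover have "f (n - x) \<le> n - x" using Suc by simp
  ultimately show ?case by simp
 qed
 show ?thesis
 proof
  fix x show "f x = id x"
  proof (cases "x \<le> n")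
   case True
   then have "n - (n - x) = x" by simp
   then have "f x \<le> x" using down'[of "n - x"] by simp
   then show ?thesis using up[OF True] by simp
  next
   case False
   then show ?thesis using permutes_not_in[OF f, of x] by simp
  qed
 qed
qed

lemma card_coloured_arrangements:
 assumes "1 \<le> k"
 shows "card (coloured_arrangements n k) = fact n * (1 + n * (k - 1))"
proof -
 let ?P = "{f. f permutes {..n}}" and ?Fix = "{f. f permutes {1..n}}"
 have P0: "f permutes {1..n} \<longleftrightarrow> f permutes {..n} & f 0 = 0" for f :: "nat => nat"
 proof
  assume f: "f permutes {1..n}"
  have "f permutes {..n}" by (rule permutes_subset[OF f]) auto
  moreover have "f 0 = 0" by (rule permutes_not_in[OF f]) simp
  ultimately show "f permutes {..n} & f 0 = 0" ..
 next
  assume f: "f permutes {..n} & f 0 = 0"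
  show "f permutes {1..n}"
  proof (rule permutes_superset[OF conjunct1[OF f]])
   fix x assume "x \<in> {..n} - {1..n}"
   then have "x = 0" by auto
   with f show "f x = x" by simp
  qed
 qed
 have mem: "f \<in> ?Fix \<longleftrightarrow> f permutes {..n} & f 0 = 0" for f unfolding mem_Collect_eq by (rule P0)
 have fin: "finite ?P" by (rule finite_permutations) simp
 have sub: "?Fix \<subseteq> ?P"
 proof
  fix f assume "f \<in> ?Fix"
  then show "f \<in> ?P" unfolding mem by simp
 qed
 have decomposition: "coloured_arrangements n k = (%f. (f, 0)) ` ?Fix \<union> (?P - ?Fix) \<times> {1..<k}"
 proof (intro equalityI subsetI)
  fix s assume s: "s \<in> coloured_arrangements n k"
  obtain f j where "s = (f, j)" by fastforce
  with s have fj: "s = (f, j)" "f permutes {..n}" "j = 0 \<longleftrightarrow> f 0 = 0" "j < k"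
   by (auto simp: coloured_arrangements_def)
  show "s \<in> (%f. (f, 0)) ` ?Fix \<union> (?P - ?Fix) \<times> {1..<k}"
  proof (cases "j = 0")
   case True
   then have "f \<in> ?Fix" using fj(2,3) mem[of f] by simp
   then show ?thesis using fj(1) True by blast
  next
   case False
   then have "f \<notin> ?Fix" unfolding mem using fj(3) by simp
   moreover have "f \<in> ?P" using fj(2) by simp
   ultimately have "f \<in> ?P - ?Fix" by (rule DiffI[rotated])
   moreover have "j \<in> {1..<k}" using False fj(4) by simp
   ultimately have "s \<in> (?P - ?Fix) \<times> {1..<k}" unfolding fj(1) by (rule SigmaI)
   then show ?thesis by (rule UnI2)
  qed
 next
  fix s assume "s \<in> (%f. (f, 0)) ` ?Fix \<union> (?P - ?Fix) \<times> {1..<k}"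
  then show "s \<in> coloured_arrangements n k"
  proof
   assume "s \<in> (%f. (f, 0)) ` ?Fix"
   then obtain f where f: "s = (f, 0)" "f \<in> ?Fix" by (elim imageE) simp
   from f(2) show ?thesis unfolding mem f(1) coloured_arrangements_def using assms by simp
  next
   assume "s \<in> (?P - ?Fix) \<times> {1..<k}"
   then obtain f j where f: "s = (f, j)" "f \<in> ?P" "f \<notin> ?Fix" "1 \<le> j" "j < k" by (elim SigmaE) auto
   from f(2,3) have "f permutes {..n}" "f 0 ~= 0" unfolding mem by simp_all
   then show ?thesis unfolding f(1) coloured_arrangements_def using f(4,5) by simp
  qed
 qed
 have "card (coloured_arrangements n k) = card ((%f. (f, 0 :: nat)) ` ?Fix) + card ((?P - ?Fix) \<times> {1..<k})"
  unfolding decomposition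
 proof (rule card_Un_disjoint)
  show "finite ((%f. (f, 0 :: nat)) ` ?Fix)" by (rule finite_imageI[OF finite_subset[OF sub fin]])
  show "finite ((?P - ?Fix) \<times> {1..<k})" using fin by (intro finite_cartesian_product finite_Diff finite_atLeastLessThan)
  show "(%f. (f, 0)) ` ?Fix \<inter> (?P - ?Fix) \<times> {1..<k} = {}" by auto
 qed
 moreover have "card ((%f. (f, 0 :: nat)) ` ?Fix) = card ?Fix"
  by (rule card_image) (rule inj_onI, simp only: prod.inject)
 moreover have "card ((?P - ?Fix) \<times> {1..<k}) = (card ?P - card ?Fix) * (k - 1)"
  unfolding card_cartesian_product card_Diff_subset[OF finite_subset[OF sub fin] sub] card_atLeastLessThan
  by (rule HOL.refl)
 moreover have "card ?Fix = fact n" by (rule card_permutations) auto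
 moreover have "card ?P = fact (Suc n)" by (rule card_permutations) auto
 ultimately have "card (coloured_arrangements n k) = fact n + (fact (Suc n) - fact n) * (k - 1)" by presburger
 then show ?thesis by (simp add: algebra_simps)
qed

lemma swap_at_eq: "swap_at q f = swap_at q g \<longleftrightarrow> f = g"
 by (metis swap_at_swap_at)

text \<open>The only candidate for a state from which the letter \<open>q\<close> leads to the given one.\<close>
fun coloured_unsort :: "nat => (nat => nat) \<times> nat => (nat => nat) \<times> nat" where
 "coloured_unsort q (g, i) =
  (if q = 0 then if g 1 = 0 then if i = 1 then (swap_at 0 g, 0) else (g, i - 1) else (swap_at 0 g, 1)
   else (swap_at q g, i))"

lemma coloured_arrangementsD:
 assumes "(f, j) \<in> coloured_arrangements n k"
 shows "f permutes {..n}" "j = 0 \<longleftrightarrow> f 0 = 0" "j < k" "f x = f y \<longleftrightarrow> x = y"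
proof -
 show p: "f permutes {..n}" and "j = 0 \<longleftrightarrow> f 0 = 0" and "j < k"
  using assms by (simp_all add: coloured_arrangements_def)
 show "f x = f y \<longleftrightarrow> x = y" by (rule permutes_neq[OF p])
qed

lemma coloured_arrangementsI:
 "f permutes {..n} ==> (j = 0 \<longleftrightarrow> f 0 = 0) ==> j < k ==> (f, j) \<in> coloured_arrangements n k"
 by (simp add: coloured_arrangements_def)

lemma coloured_sort_closed:
 assumes "(f, j) \<in> coloured_arrangements n k" "q < n" "coloured_sort k q (f, j) = Some t" "2 \<le> k"
 shows "t \<in> coloured_arrangements n k"
proof -
 note fj = coloured_arrangementsD[OF assms(1)]
 have sw: "swap_at q f permutes {..n}" by (rule permutes_swap_at[OF fj(1) assms(2)])
 have n01: "f (Suc 0) = 0 ==> f 0 ~= 0" using fj(4)[of 0 "Suc 0"] by auto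
 show ?thesis
 proof (cases "q = 0")
  case True
  then show ?thesis using assms(3,4) sw fj(1,2,3) n01
   by (auto intro!: coloured_arrangementsI simp: swap_at_apply split: if_splits)
 next
  case False
  then show ?thesis using assms(3) sw fj(2,3)
   by (auto intro!: coloured_arrangementsI simp: swap_at_apply split: if_splits)
 qed
qed

lemma coloured_unsort_sort:
 assumes "(f, j) \<in> coloured_arrangements n k" "coloured_sort k q (f, j) = Some t"
 shows "coloured_unsort q t = (f, j)"
proof -
 note fj = coloured_arrangementsD[OF assms(1)]
 have n01: "f (Suc 0) = 0 ==> f 0 ~= 0" using fj(4)[of 0 "Suc 0"] by auto
 show ?thesis
  using assms(2) fj(2) n01 by (cases t) (auto simp: swap_at_apply split: if_splits)
qed

lemma coloured_unsort_in:
 assumes "(g, i) \<in> coloured_arrangements n k" "0 < q" "q < n"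
 shows "(swap_at q g, i) \<in> coloured_arrangements n k"
 using coloured_arrangementsD[OF assms(1)] permutes_swap_at[of g n q] assms(2,3)
 by (auto intro!: coloured_arrangementsI simp: swap_at_apply)

lemma coloured_sort_commute:
 assumes "Suc p < q" "(f, j) \<in> coloured_arrangements n k"
 shows "run (coloured_sort k) [p, q] (f, j) = run (coloured_sort k) [q, p] (f, j)"
proof -
 have "swap_at p (swap_at q f) = swap_at q (swap_at p f)" by (rule swap_at_commute) (use assms in simp)
 then show ?thesis using assms(1)
  by (cases "p = 0") (auto simp: swap_at_apply)
qed

lemma coloured_sort_braid:
 assumes "(f, j) \<in> coloured_arrangements n k" "2 \<le> k"
 shows "run (coloured_sort k) [q, Suc q, q] (f, j) = run (coloured_sort k) [Suc q, q, Suc q] (f, j)"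
proof -
 note fj = coloured_arrangementsD[OF assms(1)]
 have neq: "f 0 ~= f (Suc 0)" "f 0 ~= f (Suc (Suc 0))" "f (Suc 0) ~= f (Suc (Suc 0))"
  using fj(4) by auto
 show ?thesis
 proof (cases "q = 0")
  case False
  then show ?thesis using swap_at_braid[of q f] by (auto simp: swap_at_apply)
 next
  case True
  show ?thesis unfolding True
   using swap_at_braid[of 0 f] neq fj(2,3) assms(2) by (auto simp: swap_at_apply)
 qed
qed

lemma run_colour:
 assumes "f 0 ~= 0" "f (Suc 0) = 0" "j < k"
 shows "run (coloured_sort k) (replicate i 0) (f, j) = (if j + i < k then Some (f, j + i) else None)"
 using assms(3)
proof (induction i arbitrary: j)
 case (Suc i)
 then show ?case using assms(1,2) by (cases "Suc j < k") auto
qed simp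

lemma coloured_sort_power:
 assumes "(f, j) \<in> coloured_arrangements n k" "2 \<le> k"
 shows "run (coloured_sort k) (replicate (if q = 0 then k else 2) q) (f, j) = None"
proof (cases "q = 0")
 case False
 then show ?thesis by (auto simp: eval_nat_numeral swap_at_apply)
next
 case True
 note fj = coloured_arrangementsD[OF assms(1)]
 have n01: "f 0 ~= f (Suc 0)" using fj(4) by auto
 obtain k' where k': "k = Suc (Suc k')" using assms(2) by (metis add_2_eq_Suc le_Suc_ex)
 consider "f 0 = 0" | "f 0 ~= 0" "f (Suc 0) = 0" | "f 0 ~= 0" "f (Suc 0) ~= 0" by blast
 then show ?thesis
 proof cases
  case 1
  have "run (coloured_sort k) (replicate (Suc k') 0) (swap_at 0 f, 1) = None"
   by (subst run_colour) (use 1 n01 k' in \<open>auto simp: swap_at_apply\<close>)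
  moreover have "run (coloured_sort k) (replicate k 0) (f, j) = run (coloured_sort k) (replicate (Suc k') 0) (swap_at 0 f, 1)"
   unfolding k' replicate_Suc[of "Suc k'"] run.simps(2) using 1 by simp
  ultimately show ?thesis unfolding True by simp
 next
  case 2
  then have "run (coloured_sort k) (replicate k 0) (f, j) = None" using fj(2) by (subst run_colour[OF _ _ fj(3)]) auto
  then show ?thesis unfolding True by simp
 next
  case 3
  then show ?thesis unfolding True k' using n01 by (auto simp: swap_at_apply)
 qed
qed

lemma coloured_sort_rank:
 assumes "(f, j) \<in> coloured_arrangements n k" "q < n" "coloured_sort k q (f, j) = Some (g, i)"
 shows "weight (Suc n) f + j < weight (Suc n) g + i"
proof -
 note fj = coloured_arrangementsD[OF assms(1)]
 have n01: "f 0 ~= f (Suc 0)" using fj(4) by auto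
 have w: "f q < f (Suc q) ==> weight (Suc n) f < weight (Suc n) (swap_at q f)"
  using weight_swap_at[of q "Suc n" f] assms(2) by simp
 show ?thesis
  using assms(3) w fj(2) n01 by (auto split: if_splits)
qed

lemma coloured_sort_predecessor:
 assumes y: "(f, j) \<in> coloured_arrangements n k" and ne: "(f, j) ~= (id, 0)"
 shows "\<exists>q<n. \<exists>x\<in>coloured_arrangements n k. coloured_sort k q x = Some (f, j)"
proof -
 note fj = coloured_arrangementsD[OF y]
 have n01: "f 0 ~= f (Suc 0)" using fj(4) by auto
 show ?thesis
 proof (cases "\<exists>q. 0 < q & q < n & f (Suc q) < f q")
  case True
  then obtain q where q: "0 < q" "q < n" "f (Suc q) < f q" by blast
  have "coloured_sort k q (swap_at q f, j) = Some (f, j)" using q by (simp add: swap_at_apply)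
  then show ?thesis using coloured_unsort_in[OF y q(1,2)] q(2) by blast
 next
  case False
  have inc: "f q < f (Suc q)" if "0 < q" "q < n" for q
  proof -
   have "~ f (Suc q) < f q" using False that by blast
   then show ?thesis using fj(4)[of q "Suc q"] by simp
  qed
  have f0: "f 0 ~= 0"
  proof
   assume h: "f 0 = 0"
   have "f q < f (Suc q)" if "q < n" for q
    using inc[of q] that h n01 by (cases "q = 0") auto
   then have "f = id" by (rule increasing_permutation[OF fj(1)])
   then show False using ne fj(2) by simp
  qed
  obtain l where l: "f l = 0" using permutes_surj[OF fj(1)] by (metis surjD)
  have "l ~= 0" using l f0 by metis
  moreover have ln: "l \<le> n"
  proof (rule ccontr)
   assume "~ l \<le> n"
   then have "f l = l" using permutes_not_in[OF fj(1)] by simp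
   then show False using l \<open>l ~= 0\<close> by simp
  qed
  moreover have "~ 1 < l"
  proof
   assume "1 < l"
   then have "f (l - 1) < f (Suc (l - 1))" using ln by (intro inc) auto
   then show False using l \<open>1 < l\<close> by simp
  qed
  ultimately have "l = Suc 0" "0 < n" by auto
  then have f1: "f (Suc 0) = 0" and n: "0 < n" using l by simp_all
  show ?thesis
  proof (cases "j = 1")
   case True
   have "(swap_at 0 f, 0) \<in> coloured_arrangements n k"
    using permutes_swap_at[OF fj(1) n] fj(3) f1 by (intro coloured_arrangementsI) (auto simp: swap_at_apply)
   moreover have "coloured_sort k 0 (swap_at 0 f, 0) = Some (f, j)" using True f1 by (simp add: swap_at_apply)
   ultimately show ?thesis using n by blast
  next
   case False
   then have j: "2 \<le> j" using fj(2) f0 by simp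
   have "(f, j - 1) \<in> coloured_arrangements n k"
    using fj f0 j by (intro coloured_arrangementsI) auto
   moreover have "coloured_sort k 0 (f, j - 1) = Some (f, j)" using j f0 f1 fj(3) by simp
   ultimately show ?thesis using n by blast
  qed
 qed
qed

lemma coloured_sort_diamond:
 assumes pq: "p < q" "q < n" and x: "x \<in> coloured_arrangements n k" "x' \<in> coloured_arrangements n k"
  and y: "coloured_sort k p x = Some y" "coloured_sort k q x' = Some y" and k: "2 \<le> k"
 shows "\<exists>z\<in>coloured_arrangements n k.
  if q = Suc p then run (coloured_sort k) [p, q] z = Some x & run (coloured_sort k) [q, p] z = Some x'
  else coloured_sort k q z = Some x & coloured_sort k p z = Some x'"
proof -
 obtain g i h i' f j where xx: "x = (g, i)" "x' = (h, i')" "y = (f, j)"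
  by (metis surj_pair)
 have inx: "(g, i) = coloured_unsort p (f, j)" and inx': "(h, i') = coloured_unsort q (f, j)"
  using coloured_unsort_sort[of g i n k p y] coloured_unsort_sort[of h i' n k q y] x y xx by simp_all
 have q0: "q ~= 0" using pq by simp
 have hh: "h = swap_at q f" "i' = j" using inx' q0 by simp_all
 have dq: "f (Suc q) < f q" using y(2) q0 unfolding xx hh by (simp add: swap_at_apply split: if_splits)
 have yS: "(f, j) \<in> coloured_arrangements n k"
  using coloured_sort_closed[of h i' n k q y] x(2) y(2) pq(2) k unfolding xx by simp
 note fj = coloured_arrangementsD[OF yS]
 show ?thesis
 proof (cases "p = 0")
  case False
  have gg: "g = swap_at p f" "i = j" using inx False by simp_all
  have dp: "f (Suc p) < f p" using y(1) False unfolding xx gg by (simp add: swap_at_apply split: if_splits)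
  show ?thesis
  proof (cases "q = Suc p")
   case True
   let ?z = "(swap_at p (swap_at q (swap_at p f)), j)"
   have "?z \<in> coloured_arrangements n k"
    using False pq by (intro coloured_unsort_in yS) auto
   moreover have "run (coloured_sort k) [p, q] ?z = Some x" "run (coloured_sort k) [q, p] ?z = Some x'"
    unfolding xx gg hh using True False dp dq swap_at_braid[of p f] by (auto simp: swap_at_apply)
   ultimately show ?thesis using True
    by (intro bexI[of _ ?z]) (simp_all del: run.simps coloured_sort.simps)
  next
   case neq: False
   let ?z = "(swap_at p (swap_at q f), j)"
   have "?z \<in> coloured_arrangements n k"
    using False pq by (intro coloured_unsort_in yS) auto
   moreover have "coloured_sort k q ?z = Some x" "coloured_sort k p ?z = Some x'"
    unfolding xx gg hh using neq False dp dq pq swap_at_commute[of p q f] by (auto simp: swap_at_apply)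
   ultimately show ?thesis using neq
    by (intro bexI[of _ ?z]) (simp_all del: run.simps coloured_sort.simps)
  qed
 next
  case p0: True
  show ?thesis
  proof (cases "q = Suc 0")
   case False
   let ?z = "(swap_at q g, i)"
   have "?z \<in> coloured_arrangements n k"
    using x(1) pq q0 unfolding xx by (intro coloured_unsort_in) auto
   moreover have "g q = f q" "g (Suc q) = f (Suc q)" using inx p0 False q0
    by (auto simp: swap_at_apply split: if_splits)
   then have "coloured_sort k q ?z = Some x" unfolding xx using q0 dq by (auto simp: swap_at_apply)
   moreover have "coloured_sort k 0 ?z = Some x'"
   proof -
    have e: "swap_at q g 0 = g 0" "swap_at q g (Suc 0) = g (Suc 0)" using False q0 by (auto simp: swap_at_apply)
    have c: "swap_at 0 (swap_at q g) = swap_at q (swap_at 0 g)" by (rule swap_at_commute) (use False q0 in simp)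
    show ?thesis using y(1) unfolding xx hh p0 by (auto simp: e c split: if_splits)
   qed
   ultimately show ?thesis using False p0
    by (intro bexI[of _ ?z]) (simp_all del: run.simps coloured_sort.simps)
  next
   case True
   have d12: "f (Suc (Suc 0)) < f (Suc 0)" using dq True by simp
   have gg: "g = swap_at 0 f" "i = 1" using inx p0 d12 by auto
   have n01: "f 0 ~= f (Suc 0)" using fj(4) by auto
   have f0: "f 0 ~= 0" "f (Suc 0) < f 0" "j = 1"
    using y(1) d12 n01 unfolding xx gg p0
    by (auto simp: swap_at_apply fun_eq_iff split: if_splits dest!: spec[of _ 0])
   let ?f = "swap_at 0 (swap_at 1 (swap_at 0 f))"
   let ?z = "(?f, if f 2 = 0 then 0 else 1 :: nat)"
   have v: "?f 0 = f 2" "?f 1 = f 1" "?f 2 = f 0" by (simp_all add: swap_at_apply eval_nat_numeral)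
   have "?z \<in> coloured_arrangements n k"
    using permutes_swap_at fj(1) pq k True v(1) by (intro coloured_arrangementsI) auto
   moreover have "run (coloured_sort k) [0, 1] ?z = Some x" "run (coloured_sort k) [1, 0] ?z = Some x'"
    unfolding xx gg hh using True f0 d12 swap_at_braid[of 0 f] by (auto simp: swap_at_apply eval_nat_numeral)
   ultimately show ?thesis using True p0
    by (intro bexI[of _ ?z]) (simp_all del: run.simps coloured_sort.simps)
  qed
 qed
qed

locale coloured_path = path_diagram +
 fixes k :: nat
 assumes label3: "!!q. Suc q < n ==> e q = 3"
  and exponent: "!!q. q < n ==> d (\<sigma> q) = (if q = 0 then k else 2)"
  and k: "2 \<le> k"
begin

abbreviation "states \<equiv> coloured_arrangements n k"
abbreviation "stuck \<equiv> path_dead states (coloured_sort k)"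

lemma stuck_descent:
 assumes "(f, j) \<in> states" "0 < q" "q < n" "f (Suc q) < f q"
 shows "stuck (f, j) q"
proof (rule path_dead.power)
 show "(swap_at q f, j) \<in> states" by (rule coloured_unsort_in[OF assms(1-3)])
 show "d (\<sigma> q) = Suc 1" using exponent assms by simp
 show "run (coloured_sort k) (replicate 1 q) (swap_at q f, j) = Some (f, j)" using assms by (simp add: swap_at_apply)
qed (rule assms)

lemma stuck_last_colour:
 assumes "(f, k - 1) \<in> states" "0 < n" "f 1 = 0"
 shows "stuck (f, k - 1) 0"
proof (rule path_dead.power)
 note fj = coloured_arrangementsD[OF assms(1)]
 have f0: "f 0 ~= 0" using fj(2) k by simp
 show z: "(swap_at 0 f, 0) \<in> states"
  using permutes_swap_at[OF fj(1) assms(2)] k assms(3) by (intro coloured_arrangementsI) (auto simp: swap_at_apply)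
 show "d (\<sigma> 0) = Suc (k - 1)" using exponent assms k by simp
 have k1: "k - 1 = Suc (k - 2)" using k by simp
 have "run (coloured_sort k) (replicate (k - 1) 0) (swap_at 0 f, 0) = run (coloured_sort k) (replicate (k - 2) 0) (f, 1)"
  unfolding k1 using assms(3) by (simp add: swap_at_apply)
 also have "\<dots> = Some (f, k - 1)"
  by (subst run_colour) (use assms(3) f0 k in auto)
 finally show "run (coloured_sort k) (replicate (k - 1) 0) (swap_at 0 f, 0) = Some (f, k - 1)" .
qed (rule assms)

text \<open>The entry 0 stands in position 2. Undoing the letters 1 and 0 gives a state where the other side of the braid relation meets either an
 undefined letter 1 or the same situation with a smaller colour.\<close>
lemma stuck_2:
 assumes "(f, j) \<in> states" "2 \<le> n" "f 2 = 0" "j ~= 1 \<or> f 1 < f 0"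
 shows "stuck (f, j) 0"
 using assms
proof (induction j)
 case 0
 then have "f 0 = f 2" using coloured_arrangementsD(2)[OF 0(1)] by simp
 then show ?case using coloured_arrangementsD(4)[OF 0(1), of 0 2] by simp
next
 case (Suc j)
 note fj = coloured_arrangementsD[OF Suc.prems(1)]
 have ne: "f 0 ~= 0" "f (Suc 0) ~= 0" "f (Suc 0) ~= f 0"
  using fj(4)[of 0 2] fj(4)[of 1 2] fj(4)[of "Suc 0" 0] Suc.prems(3) by auto
 let ?f = "swap_at 0 (swap_at 1 f)"
 have v: "?f 0 = 0" "?f 1 = f 0" "?f 2 = f 1" using Suc.prems(3) by (simp_all add: swap_at_apply eval_nat_numeral)
 have z: "(?f, 0) \<in> states"
  using permutes_swap_at fj(1) Suc.prems(2) k v(1) by (intro coloured_arrangementsI) auto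
 show ?case
 proof (cases "j = 0")
  case True
  then have d: "f 1 < f 0" using Suc.prems by simp
  show ?thesis
  proof (rule path_dead.braid[where p = 1 and z = "(?f, 0)" and w = "[]" and l = 1 and v = "[0, 1]"])
   show "run (coloured_sort k) [0, 1] (?f, 0) = Some (f, Suc j)"
    using v True ne Suc.prems(3) by (simp add: swap_at_apply eval_nat_numeral)
   show "stuck (?f, 0) 1" by (rule stuck_descent[OF z]) (use v d Suc.prems(2) in \<open>simp_all add: eval_nat_numeral\<close>)
  qed (use z Suc.prems(2) label3[of 0] in auto)
 next
  case False
  let ?g = "swap_at 1 f"
  have vg: "?g 0 = f 0" "?g 1 = 0" "?g 2 = f 1" using Suc.prems(3) by (simp_all add: swap_at_apply eval_nat_numeral)
  have g: "(?g, j) \<in> states"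
   using permutes_swap_at fj(1,3) Suc.prems(2) k vg(1) ne False by (intro coloured_arrangementsI) auto
  have gx: "run (coloured_sort k) [0, 1] (?g, j) = Some (f, Suc j)"
   using vg ne False fj(3) Suc.prems(3) by (simp add: swap_at_apply eval_nat_numeral)
  have g1: "run (coloured_sort k) [1] (?g, j) = Some (f, j)"
   using vg ne False fj(3) Suc.prems(3) by (simp add: swap_at_apply eval_nat_numeral)
  have f: "(f, j) \<in> states" using fj ne False by (intro coloured_arrangementsI) auto
  show ?thesis
  proof (cases "j ~= 1 \<or> f 1 < f 0")
   case True
   show ?thesis
   proof (rule path_dead.braid[where p = 1 and z = "(?g, j)" and w = "[1]" and l = 0 and v = "[1]"])
    show "stuck (f, j) 0" using Suc.IH[OF f] Suc.prems(2,3) True by blast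
   qed (use g gx g1 Suc.prems(2) label3[of 0] in \<open>simp_all del: run.simps coloured_sort.simps\<close>)
  next
   case False
   let ?h = "swap_at 0 f"
   have h: "(?h, j) \<in> states"
    using permutes_swap_at fj(1,3) Suc.prems(2) k ne False by (intro coloured_arrangementsI) (auto simp: swap_at_apply)
   show ?thesis
   proof (rule path_dead.braid[where p = 1 and z = "(?g, j)" and w = "[1, 0]" and l = 1 and v = "[]"])
    have "run (coloured_sort k) ([1] @ [0]) (?g, j) = run (coloured_sort k) [0] (f, j)"
     by (simp only: run_append g1 Option.bind.simps)
    then have "run (coloured_sort k) [1, 0] (?g, j) = run (coloured_sort k) [0] (f, j)"
     by (simp only: append.simps)
    also have "\<dots> = Some (?h, j)" using False ne by simp
    finally show "run (coloured_sort k) [1, 0] (?g, j) = Some (?h, j)" .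
    show "stuck (?h, j) 1"
     by (rule stuck_descent[OF h]) (use Suc.prems(2,3) ne in \<open>simp_all add: swap_at_apply eval_nat_numeral\<close>)
   qed (use g gx Suc.prems(2) label3[of 0] in \<open>simp_all del: run.simps coloured_sort.simps\<close>)
  qed
 qed
qed

text \<open>An entry 0 further to the right is moved left by letters that commute with the first one.\<close>
lemma stuck_first:
 assumes "(f, j) \<in> states" "l \<le> n" "f (Suc (Suc i)) = 0" "l = Suc (Suc i)" "j ~= 1 \<or> f 1 < f 0"
 shows "stuck (f, j) 0"
 using assms
proof (induction i arbitrary: f l)
 case 0
 then show ?case using stuck_2[of f j] by (simp add: eval_nat_numeral)
next
 case (Suc i)
 let ?p = "Suc (Suc i)"
 let ?f = "swap_at ?p f"
 note fj = coloured_arrangementsD[OF Suc.prems(1)]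
 have "f ?p ~= f (Suc ?p)" unfolding fj(4) by simp
 then have p: "0 < f ?p" using Suc.prems(3) by simp
 have z: "(?f, j) \<in> states" by (rule coloured_unsort_in[OF Suc.prems(1)]) (use Suc.prems in auto)
 show ?case
 proof (rule path_dead.commute[where p = ?p and z = "(?f, j)"])
  show "coloured_sort k ?p (?f, j) = Some (f, j)" using p Suc.prems(3) by (simp add: swap_at_apply)
  show "stuck (?f, j) 0"
   by (rule Suc.IH[OF z _ _ HOL.refl]) (use Suc.prems in \<open>auto simp: swap_at_apply\<close>)
 qed (use z Suc.prems in auto)
qed

lemma stuck_if_undefined:
 assumes x: "(f, j) \<in> states" and q: "q < n" and none: "coloured_sort k q (f, j) = None"
 shows "stuck (f, j) q"
proof (cases "q = 0")
 case False
 then have "~ f q < f (Suc q)" using none by (simp split: if_splits)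
 moreover have "f q ~= f (Suc q)" unfolding coloured_arrangementsD(4)[OF x] by simp
 ultimately show ?thesis using stuck_descent[OF x] False q by simp
next
 case True
 note fj = coloured_arrangementsD[OF x]
 have ne: "f 0 ~= f (Suc 0)" unfolding fj(4) by simp
 have f0: "f 0 ~= 0"
 proof
  assume "f 0 = 0"
  then show False using none True by simp
 qed
 show ?thesis
 proof (cases "f (Suc 0) = 0")
  case f1: True
  then have "j = k - 1" using none True f0 fj(3) by (auto split: if_splits)
  then show ?thesis using stuck_last_colour[of f] x q True f1 by simp
 next
  case False
  then have j: "j ~= 1 \<or> f 1 < f 0" using none True f0 ne by (auto split: if_splits)
  obtain l where l: "f l = 0" using permutes_surj[OF fj(1)] by (metis surjD)
  have l2: "l ~= 0" "l ~= Suc 0" using l f0 False by metis+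
  have "l \<le> n"
  proof (rule ccontr)
   assume "~ l \<le> n"
   then have "f l = l" using permutes_not_in[OF fj(1)] by simp
   then show False using l l2 by simp
  qed
  moreover obtain i where "l = Suc (Suc i)" using l2 by (metis old.nat.exhaust)
  ultimately show ?thesis using stuck_first[OF x _ _ _ j] l True by blast
 qed
qed

theorem coloured_model:
 "nil_model m d (short_pairs m) states (%a. coloured_sort k (\<iota> a)) (id, 0) (%(f, j). weight (Suc n) f + j)"
proof (rule path_nil_model)
 show "nil_action m d (short_pairs m) states (%a. coloured_sort k (\<iota> a))"
 proof (rule path_nil_action)
  show "t \<in> states" if "s \<in> states" "q < n" "coloured_sort k q s = Some t" for s q t
   using coloured_sort_closed[of "fst s" "snd s" n k q t] that k by simp
  show "run (coloured_sort k) [p, q] s = run (coloured_sort k) [q, p] s" if "s \<in> states" "Suc p < q" "q < n" for s p q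
   using coloured_sort_commute[of p q "fst s" "snd s" n k] that by (simp del: run.simps)
  show "run (coloured_sort k) [q, Suc q, q] s = run (coloured_sort k) [Suc q, q, Suc q] s" if "s \<in> states" for s q
   using coloured_sort_braid[of "fst s" "snd s" n k q] that k by (simp del: run.simps)
  show "run (coloured_sort k) [q, Suc q, q, Suc q] s = None & run (coloured_sort k) [Suc q, q, Suc q, q] s = None"
   if "Suc q < n" "e q = 4" for s q
   using label3[OF that(1)] that(2) by simp
  show "run (coloured_sort k) (replicate (d (\<sigma> q)) q) s = None" if "s \<in> states" "q < n" for s q
   using coloured_sort_power[of "fst s" "snd s" n k q] that k exponent[OF that(2)] by (simp del: run.simps)
 qed
 show "(id, 0) \<in> states" using k by (intro coloured_arrangementsI) (auto simp: permutes_id)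
 show "x = y" if "x \<in> states" "y \<in> states" "coloured_sort k q x = Some z" "coloured_sort k q y = Some z" for q x y z
  using coloured_unsort_sort[of "fst x" "snd x" n k q z] coloured_unsort_sort[of "fst y" "snd y" n k q z] that by simp
 show "(case x of (f, j) => weight (Suc n) f + j) < (case y of (f, j) => weight (Suc n) f + j)"
  if "q < n" "x \<in> states" "coloured_sort k q x = Some y" for q x y
  using coloured_sort_rank[of "fst x" "snd x" n k q "fst y" "snd y"] that by (simp add: split_beta)
 show "\<exists>q<n. \<exists>x\<in>states. coloured_sort k q x = Some y" if "y \<in> states" "y ~= (id, 0)" for y
  using coloured_sort_predecessor[of "fst y" "snd y" n k] that by simp
 show "\<exists>z\<in>states. if q = Suc p then e p = 3 & run (coloured_sort k) [p, q] z = Some x & run (coloured_sort k) [q, p] z = Some x'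
   else coloured_sort k q z = Some x & coloured_sort k p z = Some x'"
  if h: "p < q" "q < n" "x \<in> states" "x' \<in> states" "coloured_sort k p x = Some y" "coloured_sort k q x' = Some y" for p q x x' y
 proof (cases "q = Suc p")
  case True
  then show ?thesis using coloured_sort_diamond[OF h k] label3[of p] h(2) by (simp del: run.simps)
 next
  case False
  then show ?thesis using coloured_sort_diamond[OF h k] by (simp del: run.simps)
 qed
 show "stuck x q" if "x \<in> states" "q < n" "coloured_sort k q x = None" for x q
  using stuck_if_undefined[of "fst x" "snd x" q] that by simp
qed

theorem coloured_classes:
 "finite (nonnull_classes m d (short_pairs m))"
 "card (nonnull_classes m d (short_pairs m)) = fact n * (1 + n * (k - 1))"
proof -
 have c: "card states = fact n * (1 + n * (k - 1))" by (rule card_coloured_arrangements) (use k in simp)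
 then have "0 < card states" by simp
 then have "finite states" by (rule card_ge_0_finite)
 then show "finite (nonnull_classes m d (short_pairs m))"
  using nil_model.finite_nonnull_classes[OF coloured_model] by simp
 show "card (nonnull_classes m d (short_pairs m)) = fact n * (1 + n * (k - 1))"
  using nil_model.card_nonnull_classes[OF coloured_model] c by simp
qed

end

subsection \<open>Type B and rook placements\<close>

text \<open>Partial injections of \<open>{..<n}\<close>, with the value \<open>n\<close> for a blank. Choosing the domain, the range and a bijection between them gives
 the terms of the sum below.\<close>
definition rook_placements :: "nat => (nat => nat) set" where
 "rook_placements n = {f \<in> {..<n} \<rightarrow>\<^sub>E {..n}. inj_on f {x. x < n & f x < n}}"

text \<open>The last letter erases the last entry, but only if all smaller values are present; this makes erasing reversible, since the
 erased value is the least one missing.\<close>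
definition rook_sort :: "nat => nat => (nat => nat) => (nat => nat) option" where
 "rook_sort n q f =
  (if Suc q = n then if f q < n & {..<f q} \<subseteq> f ` {..<n} then Some (f(q := n)) else None
   else if f q < f (Suc q) then Some (swap_at q f) else None)"

definition missing :: "nat => (nat => nat) => nat" where
 "missing n f = (LEAST v. v \<notin> f ` {..<n})"

definition insert_missing :: "nat => (nat => nat) => nat => nat" where
 "insert_missing n f = f(n - 1 := missing n f)"

lemma rook_placementsD:
 assumes "f \<in> rook_placements n"
 shows "x < n ==> f x \<le> n" "~ x < n ==> f x = undefined"
  "x < n ==> y < n ==> f x < n ==> f x = f y ==> x = y"
 using assms by (auto simp: rook_placements_def PiE_iff extensional_def inj_on_def)

lemma rook_placementsI:
 assumes "!!x. x < n ==> f x \<le> n" "!!x. ~ x < n ==> f x = undefined"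
  "!!x y. x < n ==> y < n ==> f x < n ==> f x = f y ==> x = y"
 shows "f \<in> rook_placements n"
 using assms by (auto simp: rook_placements_def PiE_iff extensional_def inj_on_def)

lemma swap_at_image: "Suc q < n ==> swap_at q f ` {..<n} = f ` {..<n}"
proof -
 assume q: "Suc q < n"
 have "f ` {..<n} \<subseteq> swap_at q f ` {..<n}" for f :: "nat => 'b"
 proof
  fix y assume "y \<in> f ` {..<n}"
  then obtain x where x: "x < n" "y = f x" by auto
  have y: "y = swap_at q f (if x = q then Suc q else if x = Suc q then q else x)" unfolding x(2) by (simp add: swap_at_apply)
  show "y \<in> swap_at q f ` {..<n}" by (rule image_eqI[where f = "swap_at q f", OF y]) (use x(1) q in auto)
 qed
 from this[of f] this[of "swap_at q f"] show ?thesis by simp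
qed

lemma swap_at_rook:
 assumes f: "f \<in> rook_placements n" and q: "Suc q < n"
 shows "swap_at q f \<in> rook_placements n"
proof (rule rook_placementsI)
 note D = rook_placementsD[OF f]
 show "x < n ==> swap_at q f x \<le> n" for x using D(1) q by (auto simp: swap_at_apply)
 show "~ x < n ==> swap_at q f x = undefined" for x using D(2) q by (auto simp: swap_at_apply)
 show "x = y" if h: "x < n" "y < n" "swap_at q f x < n" "swap_at q f x = swap_at q f y" for x y
 proof -
  let ?t = "%x. if x = q then Suc q else if x = Suc q then q else x"
  have t: "swap_at q f x = f (?t x)" for x by (auto simp: swap_at_apply)
  have "?t x < n" "?t y < n" using h q by auto
  from D(3)[OF this] h(3,4) have "?t x = ?t y" unfolding t by blast
  then show ?thesis by (auto split: if_splits)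
 qed
qed

lemma blank_rook:
 assumes f: "f \<in> rook_placements n" and q: "Suc q = n"
 shows "f(q := n) \<in> rook_placements n"
proof (rule rook_placementsI)
 note D = rook_placementsD[OF f]
 show "x < n ==> (f(q := n)) x \<le> n" for x using D(1) q by auto
 show "~ x < n ==> (f(q := n)) x = undefined" for x using D(2) q by auto
 show "x < n ==> y < n ==> (f(q := n)) x < n ==> (f(q := n)) x = (f(q := n)) y ==> x = y" for x y
  using D(3)[of x y] by (auto split: if_splits)
qed

lemma missing_notin:
 assumes "n \<in> f ` {..<n}"
 shows "missing n f \<notin> f ` {..<n}" "missing n f < n" "v < missing n f ==> v \<in> f ` {..<n}"
proof -
 have "\<exists>v<n. v \<notin> f ` {..<n}"
 proof (rule ccontr)
  assume "~ ?thesis"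
  then have "insert n {..<n} \<subseteq> f ` {..<n}" using assms by auto
  then have "card (insert n {..<n}) \<le> card (f ` {..<n})" by (intro card_mono) auto
  also have "\<dots> \<le> card {..<n}" by (rule card_image_le) simp
  finally show False by simp
 qed
 then obtain v where v: "v < n" "v \<notin> f ` {..<n}" by blast
 show "missing n f \<notin> f ` {..<n}" unfolding missing_def by (rule LeastI[of _ v], rule v(2))
 have "missing n f \<le> v" unfolding missing_def by (rule Least_le, rule v(2))
 then show "missing n f < n" using v(1) by simp
 show "v \<in> f ` {..<n}" if "v < missing n f" for v
  using not_less_Least[of v "%v. v \<notin> f ` {..<n}"] that unfolding missing_def by blast
qed

lemma insert_missing_image:
 assumes "Suc q = n" "f q = n"
 shows "insert_missing n f ` {..<n} = insert (missing n f) (f ` {..<q})" "f ` {..<n} = insert n (f ` {..<q})"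
proof -
 have e: "{..<n} = insert q {..<q}" using assms(1) by auto
 have "insert_missing n f ` {..<q} = f ` {..<q}" unfolding insert_missing_def using assms(1) by (intro image_cong) auto
 moreover have "insert_missing n f q = missing n f" unfolding insert_missing_def using assms(1) by auto
 ultimately show "insert_missing n f ` {..<n} = insert (missing n f) (f ` {..<q})" unfolding e by simp
 show "f ` {..<n} = insert n (f ` {..<q})" unfolding e using assms(2) by simp
qed

lemma insert_missing:
 assumes f: "f \<in> rook_placements n" and q: "Suc q = n" "f q = n"
 shows "insert_missing n f \<in> rook_placements n" "rook_sort n q (insert_missing n f) = Some f"
  "insert_missing n f q = missing n f" "x < q ==> insert_missing n f x = f x"
proof -
 note D = rook_placementsD[OF f]
 have qn: "q < n" using q(1) by simp
 have n: "n \<in> f ` {..<n}" using q(2) qn by (metis image_eqI lessThan_iff)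
 note M = missing_notin[OF n]
 have val: "insert_missing n f x = (if x = q then missing n f else f x)" for x
  unfolding insert_missing_def using q(1) by auto
 show "insert_missing n f q = missing n f" "x < q ==> insert_missing n f x = f x" by (simp_all add: val)
 show "insert_missing n f \<in> rook_placements n"
 proof (rule rook_placementsI)
  show "x < n ==> insert_missing n f x \<le> n" for x using D(1) M(2) by (auto simp: val)
  show "~ x < n ==> insert_missing n f x = undefined" for x using D(2) qn by (auto simp: val)
  show "x = y" if h: "x < n" "y < n" "insert_missing n f x < n" "insert_missing n f x = insert_missing n f y" for x y
  proof -
   have m: "missing n f ~= f z" "f z ~= missing n f" if "z < n" for z using M(1) that by force+
   show ?thesis using m D(3)[of x y] h unfolding val by (auto split: if_splits)
  qed
 qed
 have "{..<missing n f} \<subseteq> insert_missing n f ` {..<n}"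
 proof
  fix v assume v: "v \<in> {..<missing n f}"
  then have "v \<in> f ` {..<n}" using M(3) by simp
  moreover have "v ~= n" using v M(2) by auto
  ultimately show "v \<in> insert_missing n f ` {..<n}" unfolding insert_missing_image[of q n f, OF q] by simp
 qed
 moreover have "(insert_missing n f)(q := n) = f" by (rule ext) (simp add: val q(2))
 ultimately show "rook_sort n q (insert_missing n f) = Some f"
  unfolding rook_sort_def using q(1) M(2) by (simp add: val)
qed

lemma rook_sort_last:
 assumes f: "f \<in> rook_placements n" and q: "Suc q = n" and s: "rook_sort n q f = Some g"
 shows "g \<in> rook_placements n" "g q = n" "f = insert_missing n g"
proof -
 have h: "f q < n" "{..<f q} \<subseteq> f ` {..<n}" "g = f(q := n)" using s q by (auto simp: rook_sort_def split: if_splits)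
 show "g \<in> rook_placements n" unfolding h(3) by (rule blank_rook[OF f q])
 show gq: "g q = n" by (simp add: h(3))
 have qn: "q < n" using q by simp
 have nin: "f q \<notin> g ` {..<n}"
 proof
  assume "f q \<in> g ` {..<n}"
  then obtain x where x: "x < n" "f q = g x" by auto
  then have "x ~= q" using gq h(1) by auto
  then have "f q = f x" using x(2) h(3) by simp
  then show False using rook_placementsD(3)[OF f qn x(1) h(1)] \<open>x ~= q\<close> by simp
 qed
 have "missing n g = f q"
  unfolding missing_def
 proof (rule Least_equality[where P = "%v. v \<notin> g ` {..<n}", OF nin])
  fix v assume v: "v \<notin> g ` {..<n}"
  show "f q \<le> v"
  proof (rule ccontr)
   assume "~ f q \<le> v"
   then have "v \<in> f ` {..<n}" using h(2) by auto
   then obtain x where x: "x < n" "v = f x" by auto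
   then have "x ~= q" using \<open>~ f q \<le> v\<close> by auto
   then have "v = g x" using x(2) h(3) by simp
   then show False using v x(1) by blast
  qed
 qed
 then show "f = insert_missing n g" unfolding insert_missing_def h(3) using q by auto
qed

lemma rook_sort_swap: "Suc q < n ==> rook_sort n q f = (if f q < f (Suc q) then Some (swap_at q f) else None)"
 by (simp add: rook_sort_def)

lemma rook_sort_swap_last:
 assumes "Suc q = n" "Suc p < q"
 shows "rook_sort n q (swap_at p f) = map_option (swap_at p) (rook_sort n q f)"
proof -
 have "(swap_at p f)(q := n) = swap_at p (f(q := n))" using assms by (auto simp: swap_at_apply fun_eq_iff)
 moreover have "swap_at p f q = f q" using assms by (auto simp: swap_at_apply)
 moreover have "swap_at p f ` {..<n} = f ` {..<n}" using assms by (intro swap_at_image) simp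
 ultimately show ?thesis unfolding rook_sort_def using assms(1) by simp
qed

lemma rook_sort_commute:
 assumes "Suc p < q" "q < n"
 shows "run (rook_sort n) [p, q] f = run (rook_sort n) [q, p] f"
proof -
 have p: "Suc p < n" using assms by simp
 show ?thesis
 proof (cases "Suc q = n")
  case False
  have "swap_at p (swap_at q f) = swap_at q (swap_at p f)" by (rule swap_at_commute) (use assms in simp)
  then show ?thesis using assms False by (auto simp: rook_sort_def swap_at_apply)
 next
  case True
  have v: "rook_sort n q f = Some g ==> g p = f p & g (Suc p) = f (Suc p)" for g
   using assms True by (auto simp: rook_sort_def split: if_splits)
  show ?thesis
   using rook_sort_swap_last[OF True assms(1), of f] v
   by (cases "rook_sort n q f") (auto simp: rook_sort_swap[OF p])
 qed
qed

lemma rook_sort_braid: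
 assumes "Suc (Suc q) < n"
 shows "run (rook_sort n) [q, Suc q, q] f = run (rook_sort n) [Suc q, q, Suc q] f"
 using assms swap_at_braid[of q f] by (auto simp: rook_sort_def swap_at_apply)

lemma rook_sort_last_None: "Suc q = n ==> f q = n ==> rook_sort n q f = None"
 by (simp add: rook_sort_def)

text \<open>After a swap the erased value is the smaller of the last two entries, so the larger one no longer sees all smaller values.\<close>
lemma rook_sort_braid4:
 assumes f: "f \<in> rook_placements n" and q: "Suc (Suc q) = n"
 shows "run (rook_sort n) [q, Suc q, q, Suc q] f = None" "run (rook_sort n) [Suc q, q, Suc q, q] f = None"
proof -
 have sq: "Suc q < n" using q by simp
 have swap: "rook_sort n q g = Some h ==> h = swap_at q g & g q < g (Suc q)" for g h
  using sq by (auto simp: rook_sort_def split: if_splits)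
 have last: "rook_sort n (Suc q) g = Some h ==> h = g(Suc q := n) & {..<g (Suc q)} \<subseteq> g ` {..<n}" for g h
  using q by (auto simp: rook_sort_def split: if_splits)
 show "run (rook_sort n) [q, Suc q, q, Suc q] f = None"
 proof (rule ccontr)
  assume "run (rook_sort n) [q, Suc q, q, Suc q] f ~= None"
  then obtain g h u where r: "rook_sort n q f = Some g" "rook_sort n (Suc q) g = Some h"
   "rook_sort n q h = Some u" "rook_sort n (Suc q) u ~= None"
   by (auto simp: bind_eq_None_conv)
  note g = swap[OF r(1)] and h = last[OF r(2)] and u = swap[OF r(3)]
  have gS: "g \<in> rook_placements n" using g swap_at_rook[OF f sq] by simp
  have uq: "u (Suc q) = f (Suc q)" "u q = n" using g h u by (auto simp: swap_at_apply)
  have less: "f q < f (Suc q)" using g by simp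
  obtain w where "rook_sort n (Suc q) u = Some w" using r(4) by auto
  then have "{..<f (Suc q)} \<subseteq> u ` {..<n}" using last[of u w] uq by simp
  then obtain x where x: "x < n" "u x = f q" using less by auto
  have im: "g (Suc q) = f q" using g by (simp add: swap_at_apply)
  have fq: "f q < n" using less rook_placementsD(1)[OF f sq] by simp
  have "x ~= q" using x uq(2) fq by auto
  moreover have "x ~= Suc q" using x uq(1) less by auto
  ultimately have "u x = f x" using g h u by (simp add: swap_at_apply)
  then have "f q = f x" using x(2) by simp
  then show False using rook_placementsD(3)[OF f _ x(1) fq] \<open>x ~= q\<close> sq by simp
 qed
 show "run (rook_sort n) [Suc q, q, Suc q, q] f = None"
 proof (rule ccontr)
  assume "run (rook_sort n) [Suc q, q, Suc q, q] f ~= None"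
  then obtain g h u where r: "rook_sort n (Suc q) f = Some g" "rook_sort n q g = Some h"
   "rook_sort n (Suc q) h = Some u" "rook_sort n q u ~= None"
   by (auto simp: bind_eq_None_conv)
  note g = last[OF r(1)] and h = swap[OF r(2)] and u = last[OF r(3)]
  have "u q = n" "u (Suc q) = n" using g h u by (auto simp: swap_at_apply)
  then show False using r(4) sq by (simp add: rook_sort_def)
 qed
qed

lemma rook_sort_square: "f \<in> rook_placements n ==> q < n ==> run (rook_sort n) (replicate 2 q) f = None"
 by (auto simp: eval_nat_numeral rook_sort_def swap_at_apply)

lemma rook_sort_closed:
 assumes "f \<in> rook_placements n" "q < n" "rook_sort n q f = Some g"
 shows "g \<in> rook_placements n"
proof (cases "Suc q = n")
 case True
 then show ?thesis using rook_sort_last(1) assms by blast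
next
 case False
 then show ?thesis using swap_at_rook[of f n q] assms by (auto simp: rook_sort_def split: if_splits)
qed

definition rook_unsort :: "nat => nat => (nat => nat) => nat => nat" where
 "rook_unsort n q f = (if Suc q = n then insert_missing n f else swap_at q f)"

lemma rook_unsort_sort:
 assumes "f \<in> rook_placements n" "q < n" "rook_sort n q f = Some g"
 shows "f = rook_unsort n q g"
proof (cases "Suc q = n")
 case True
 then show ?thesis using rook_sort_last(3)[OF assms(1) True assms(3)] by (simp add: rook_unsort_def)
next
 case False
 then show ?thesis using assms(3) by (auto simp: rook_sort_def rook_unsort_def split: if_splits)
qed

lemma rook_sort_weight:
 assumes "q < n" "rook_sort n q f = Some g"
 shows "weight n f < weight n g"
proof (cases "Suc q = n")
 case True
 then have g: "g = f(q := n)" "f q < n" using assms by (auto simp: rook_sort_def split: if_splits)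
 have "weight n f = (n - q) * f q + (\<Sum>x\<in>{..<n} - {q}. (n - x) * f x)" for f
  unfolding weight_def using assms(1) by (intro sum.remove) auto
 moreover have "(\<Sum>x\<in>{..<n} - {q}. (n - x) * g x) = (\<Sum>x\<in>{..<n} - {q}. (n - x) * f x)"
  unfolding g by (intro sum.cong) auto
 ultimately show ?thesis using g assms(1) by simp
next
 case False
 then show ?thesis using assms weight_swap_at[of q n f] by (auto simp: rook_sort_def split: if_splits)
qed

lemma rook_predecessor:
 assumes f: "f \<in> rook_placements n" and q: "q < n" and "if Suc q = n then f q = n else f (Suc q) < f q"
 shows "rook_unsort n q f \<in> rook_placements n" "rook_sort n q (rook_unsort n q f) = Some f"
proof -
 show "rook_unsort n q f \<in> rook_placements n"
  using assms insert_missing(1)[OF f] swap_at_rook[OF f] by (auto simp: rook_unsort_def)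
 show "rook_sort n q (rook_unsort n q f) = Some f"
 proof (cases "Suc q = n")
  case True
  then show ?thesis using insert_missing(2)[OF f True] assms(3) by (simp add: rook_unsort_def)
 next
  case False
  then show ?thesis using assms by (simp add: rook_unsort_def rook_sort_def swap_at_apply)
 qed
qed

lemma rook_weakly_increasing:
 assumes f: "f \<in> rook_placements n" and inc: "!!q. Suc q < l ==> f q \<le> f (Suc q)" and ln: "l \<le> n"
  and x: "x < l" "f (l - 1) < n"
 shows "x \<le> f x & (\<forall>y<x. f y < f x) & f x < n"
proof -
 have mono: "i \<le> j ==> j < l ==> f i \<le> f j" for i j
 proof (induction j)
  case (Suc j)
  then show ?case using inc[of j] by (cases "i = Suc j") auto
 qed simp
 have bound: "f y < n" if "y < l" for y
 proof -
  have "y \<le> l - 1" "l - 1 < l" using that by simp_all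
  from mono[OF this] show ?thesis using x(2) by (rule le_less_trans)
 qed
 have strict: "f y < f z" if "y < z" "z < l" for y z
 proof -
  have "f y ~= f z" using rook_placementsD(3)[OF f, of y z] bound that ln by auto
  then show ?thesis using mono[of y z] that by simp
 qed
 have "x < l ==> x \<le> f x" for x
 proof (induction x)
  case (Suc x)
  then show ?case using strict[of x "Suc x"] by simp
 qed simp
 then show ?thesis using x strict bound by simp
qed

lemma rook_sorted_unique:
 assumes f: "f \<in> rook_placements n" and inc: "!!q. Suc q < n ==> f q \<le> f (Suc q)" and last: "f (n - 1) < n" and n: "0 < n"
 shows "f = (\<lambda>x\<in>{..<n}. x)"
proof
 note W = rook_weakly_increasing[OF f inc le_refl _ last]
 have up: "x < n ==> x \<le> f x" for x using W[of x] by blast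
 have down': "y < n ==> f (n - 1 - y) \<le> n - 1 - y" for y
 proof (induction y)
  case 0
  then show ?case using last by simp
 next
  case (Suc y)
  have "f (n - 1 - Suc y) < f (n - 1 - y)" using W[of "n - 1 - y"] Suc.prems by auto
  then show ?case using Suc by simp
 qed
 fix x
 show "f x = (\<lambda>x\<in>{..<n}. x) x"
 proof (cases "x < n")
  case True
  then have "n - 1 - (n - 1 - x) = x" by simp
  then have "f x \<le> x" using down'[of "n - 1 - x"] True by simp
  then show ?thesis using up[OF True] True by simp
 next
  case False
  then show ?thesis using rook_placementsD(2)[OF f] by simp
 qed
qed

lemma card_rook_placements: "card (rook_placements n) = (\<Sum>l=0..n. (n choose l)\<^sup>2 * fact l)"
proof -
 let ?F = "%D. {f \<in> rook_placements n. {x. x < n & f x < n} = D}"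
 let ?G = "%D. {g \<in> D \<rightarrow>\<^sub>E {..<n}. inj_on g D}"
 have fin: "finite (rook_placements n)"
  unfolding rook_placements_def by (rule finite_subset[of _ "{..<n} \<rightarrow>\<^sub>E {..n}"]) (auto intro!: finite_PiE)
 have cF: "card (?F D) = (n choose card D) * fact (card D)" if D: "D \<subseteq> {..<n}" for D
 proof -
  have fill: "bij_betw (%g x. if x \<in> D then g x else if x < n then n else undefined) (?G D) (?F D)"
  proof (rule bij_betw_byWitness[where f' = "%f. restrict f D"])
   show "\<forall>g\<in>?G D. restrict (%x. if x \<in> D then g x else if x < n then n else undefined) D = g"
    by (auto simp: fun_eq_iff PiE_iff extensional_def)
   show "\<forall>f\<in>?F D. (%x. if x \<in> D then restrict f D x else if x < n then n else undefined) = f"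
   proof
    fix f assume "f \<in> ?F D"
    then have f: "f \<in> rook_placements n" and fD: "!!x. x \<in> D \<longleftrightarrow> x < n & f x < n" by auto
    show "(%x. if x \<in> D then restrict f D x else if x < n then n else undefined) = f"
    proof
     fix x
     show "(if x \<in> D then restrict f D x else if x < n then n else undefined) = f x"
      using rook_placementsD(1,2)[OF f, of x] fD[of x] by (auto simp del: not_less)
    qed
   qed
   show "(%g x. if x \<in> D then g x else if x < n then n else undefined) ` ?G D \<subseteq> ?F D"
   proof
    fix f assume "f \<in> (%g x. if x \<in> D then g x else if x < n then n else undefined) ` ?G D"
    then obtain g where g: "g \<in> D \<rightarrow>\<^sub>E {..<n}" "inj_on g D"
     and f: "f = (%x. if x \<in> D then g x else if x < n then n else undefined)" by blast
    have gD: "!!x. x \<in> D ==> g x < n & x < n" using g(1) D by (auto simp: PiE_iff)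
    have "f \<in> rook_placements n"
    proof (rule rook_placementsI)
     show "x < n ==> f x \<le> n" for x using gD[of x] unfolding f by auto
     show "~ x < n ==> f x = undefined" for x using gD[of x] unfolding f by auto
     show "x < n ==> y < n ==> f x < n ==> f x = f y ==> x = y" for x y
      using gD g(2) unfolding f inj_on_def by (auto split: if_splits)
    qed
    moreover have "{x. x < n & f x < n} = D" unfolding f using gD by (auto split: if_splits)
    ultimately show "f \<in> ?F D" by simp
   qed
   show "(%f. restrict f D) ` ?F D \<subseteq> ?G D"
   proof
    fix g assume "g \<in> (%f. restrict f D) ` ?F D"
    then obtain f where f: "f \<in> rook_placements n" and fD: "{x. x < n & f x < n} = D" and g: "g = restrict f D"
     by (elim imageE) blast
    have "g \<in> D \<rightarrow>\<^sub>E {..<n}" unfolding g using fD by (intro restrict_PiE_iff[THEN iffD2] ballI) auto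
    moreover have "inj_on g D" unfolding g inj_on_restrict_eq using f unfolding rook_placements_def fD[symmetric] by blast
    ultimately show "g \<in> ?G D" by (intro CollectI conjI)
   qed
  qed
  have "card (?G D) = prod ((-) n) {0..<card D}"
   using card_inj_on_subset_funcset[OF finite_subset[OF D finite_lessThan] finite_lessThan[of n] order_refl]
   by (simp only: card_lessThan diff_self_eq_0 power_0 mult_1_left)
  moreover have "prod ((-) n) {0..<card D} = (n choose card D) * fact (card D)"
  proof -
   have "card D \<le> n" using card_mono[OF _ D] by simp
   moreover have "i \<le> n ==> prod ((-) n) {0..<i} * fact (n - i) = fact n" for i
   proof (induction i)
    case (Suc i)
    then have "n - i = Suc (n - Suc i)" by simp
    then have "fact (n - i) = (n - i) * fact (n - Suc i)" by (metis fact_Suc of_nat_id)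
    then show ?case using Suc by simp
   qed simp
   ultimately have "prod ((-) n) {0..<card D} * fact (n - card D) = (n choose card D) * fact (card D) * fact (n - card D)"
    using binomial_fact_lemma[of "card D" n] by (simp add: ac_simps)
   then show ?thesis by simp
  qed
  ultimately show ?thesis using bij_betw_same_card[OF fill] by (simp only:)
 qed
 have "rook_placements n = (\<Union>D\<in>Pow {..<n}. ?F D)"
 proof (intro equalityI subsetI)
  fix f assume "f \<in> rook_placements n"
  then show "f \<in> (\<Union>D\<in>Pow {..<n}. ?F D)" by (rule_tac a = "{x. x < n & f x < n}" in UN_I, blast, simp)
 qed (elim UN_E, simp)
 then have "card (rook_placements n) = card (\<Union>D\<in>Pow {..<n}. ?F D)" by simp
 also have "\<dots> = (\<Sum>D\<in>Pow {..<n}. card (?F D))"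
 proof (rule card_UN_disjoint)
  show "\<forall>D\<in>Pow {..<n}. finite (?F D)" by (intro ballI finite_subset[OF _ fin]) (rule subsetI, simp)
  show "\<forall>D\<in>Pow {..<n}. \<forall>E\<in>Pow {..<n}. D ~= E --> ?F D \<inter> ?F E = {}"
   by (intro ballI impI equalityI subsetI) simp_all
 qed simp
 also have "\<dots> = (\<Sum>D\<in>Pow {..<n}. (n choose card D) * fact (card D))"
  by (intro sum.cong) (auto simp: cF)
 also have "\<dots> = (\<Sum>l\<in>{0..n}. \<Sum>D\<in>{D \<in> Pow {..<n}. card D = l}. (n choose card D) * fact (card D))"
 proof (rule sum.group[symmetric])
  show "card ` Pow {..<n} \<subseteq> {0..n}"
  proof
   fix l assume "l \<in> card ` Pow {..<n}"
   then obtain D where D: "D \<subseteq> {..<n}" "l = card D" by blast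
   then show "l \<in> {0..n}" using card_mono[OF finite_lessThan D(1)] by simp
  qed
 qed simp_all
 also have "\<dots> = (\<Sum>l\<in>{0..n}. (n choose l)\<^sup>2 * fact l)"
 proof (rule sum.cong[OF HOL.refl])
  fix l
  have "(\<Sum>D\<in>{D \<in> Pow {..<n}. card D = l}. (n choose card D) * fact (card D)) =
   card {D. D \<subseteq> {..<n} & card D = l} * ((n choose l) * fact l)" by simp
  also have "card {D. D \<subseteq> {..<n} & card D = l} = n choose l" using n_subsets[of "{..<n}" l] by simp
  finally show "(\<Sum>D\<in>{D \<in> Pow {..<n}. card D = l}. (n choose card D) * fact (card D)) = (n choose l)\<^sup>2 * fact l"
   by (simp add: power2_eq_square ac_simps)
 qed
 finally show ?thesis .
qed

locale rook_path = path_diagram +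
 assumes labels: "!!q. Suc q < n ==> e q = (if Suc (Suc q) = n then 4 else 3)"
  and exponent: "!!q. q < n ==> d (\<sigma> q) = 2"
  and n: "2 \<le> n"
begin

abbreviation "states \<equiv> rook_placements n"
abbreviation "stuck \<equiv> path_dead states (rook_sort n)"

lemma stuck_successor:
 assumes "f \<in> states" "q < n" "if Suc q = n then f q = n else f (Suc q) < f q"
 shows "stuck f q"
proof (rule path_dead.power)
 show "rook_unsort n q f \<in> states" by (rule rook_predecessor(1)[OF assms])
 show "d (\<sigma> q) = Suc 1" using exponent assms by simp
 show "run (rook_sort n) (replicate 1 q) (rook_unsort n q f) = Some f" using rook_predecessor(2)[OF assms] by simp
qed (rule assms)

lemma stuck_if_undefined:
 assumes "f \<in> states" "q < n" "rook_sort n q f = None"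
 shows "stuck f q"
 using assms
proof (induction "weight n f" arbitrary: f q rule: less_induct)
 case (less f q)
 note f = less.prems(1) and q = less.prems(2) and none = less.prems(3)
 note D = rook_placementsD[OF f]
 obtain b where b: "n = Suc (Suc b)" using n by (metis add_2_eq_Suc le_Suc_ex)
 have IH: "stuck g r" if "rook_sort n r' h = Some f" "weight n g \<le> weight n h" "r' < n"
  "g \<in> states" "r < n" "rook_sort n r g = None" for g h r r'
  using less.hyps[of g r] rook_sort_weight[OF that(3,1)] that by simp
 show ?case
 proof (cases "Suc q = n")
  case last: True
  have qb: "q = Suc b" using last b by simp
  show ?thesis
  proof (cases "f q = n")
   case True
   then show ?thesis using stuck_successor[OF f q] last by simp
  next
   case False
   then have fq: "f q < n" using D(1)[OF q] by simp
   then obtain v where v: "v < f q" "v \<notin> f ` {..<n}" using none last by (auto simp: rook_sort_def subset_iff split: if_splits)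
   show ?thesis
   proof (cases "\<exists>p. Suc p < q & f (Suc p) < f p")
    case True
    then obtain p where p: "Suc p < q" "f (Suc p) < f p" by blast
    have pn: "p < n" "Suc p < n" "Suc p ~= n" using p q by auto
    have pr: "swap_at p f \<in> states" "rook_sort n p (swap_at p f) = Some f"
     using rook_predecessor[OF f pn(1)] p pn by (simp_all add: rook_unsort_def)
    have none': "rook_sort n q (swap_at p f) = None" using rook_sort_swap_last[OF last p(1), of f] none by simp
    have st: "stuck (swap_at p f) q" by (rule IH[OF pr(2) le_refl pn(1) pr(1) q none'])
    show ?thesis
     by (rule path_dead.commute[OF pr(1) pn(1) q _ pr(2) st]) (use p(1) in simp)
   next
    case no: False
    have inc: "f p \<le> f (Suc p)" if "Suc p < q" for p
    proof -
     have "~ f (Suc p) < f p" using no that by blast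
     then show ?thesis by simp
    qed
    have fb: "f b = n"
    proof (rule ccontr)
     assume "f b ~= n"
     then have fb: "f b < n" using D(1)[of b] b by simp
     have lt: "f x < n" if "x < n" for x
     proof (cases "x = q")
      case False
      then have "x < q" using that last by simp
      then show ?thesis using rook_weakly_increasing[OF f inc, of q x] q fb qb by simp
     qed (use fq in simp)
     have "inj_on f {..<n}" using D(3) lt by (intro inj_onI) auto
     then have "f ` {..<n} = {..<n}" using lt by (intro endo_inj_surj) auto
     then show False using v fq by auto
    qed
    let ?g = "swap_at b f"
    have bn: "b < n" "Suc b < n" "Suc b ~= n" using b by auto
    have g: "?g \<in> states" by (rule swap_at_rook[OF f bn(2)])
    have gq: "?g q = n" "?g b = f q" using fb qb by (simp_all add: swap_at_apply)
    note h = insert_missing[OF g last gq(1)]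
    have im: "?g ` {..<n} = f ` {..<n}" by (rule swap_at_image[OF bn(2)])
    have "missing n ?g \<le> v" unfolding missing_def by (rule Least_le) (use v(2) im in simp)
    then have mv: "missing n ?g < f q" using v(1) by simp
    let ?h = "insert_missing n ?g"
    have hv: "?h b = f q" "?h (Suc b) = missing n ?g" using h(3,4) gq qb by simp_all
    let ?z = "swap_at b ?h"
    have z: "?z \<in> states" by (rule swap_at_rook[OF h(1) bn(2)])
    have r1: "rook_sort n b ?z = Some ?h" using bn hv mv by (simp add: rook_sort_def swap_at_apply)
    have r3: "rook_sort n b ?g = Some f" using bn gq fb fq qb by (simp add: rook_sort_def swap_at_apply)
    have r: "run (rook_sort n) [b, q, b] ?z = Some f" using r1 h(2) r3 by simp
    show ?thesis
     by (rule path_dead.braid4[OF z bn(1) q _ r]) (use labels[OF bn(2)] b qb in simp)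
   qed
  qed
 next
  case False
  then have sq: "Suc q < n" using q by simp
  show ?thesis
  proof (cases "f (Suc q) < f q")
   case True
   then show ?thesis using stuck_successor[OF f q] False by simp
  next
   case eq: False
   then have e: "f q = f (Suc q)" using none False by (simp add: rook_sort_def split: if_splits)
   have blank: "f q = n" "f (Suc q) = n"
   proof -
    have "~ f q < n" using D(3)[OF q sq _ e] by auto
    then show "f q = n" using D(1)[OF q] by simp
    then show "f (Suc q) = n" using e by simp
   qed
   show ?thesis
   proof (cases "Suc (Suc q) = n")
    case True
    let ?g = "insert_missing n f"
    note g = insert_missing[OF f True blank(2)]
    have gq: "?g q = n" "?g (Suc q) = missing n f" using g(3,4) blank by simp_all
    have nn: "n \<in> f ` {..<n}" using blank(1) q by (metis image_eqI lessThan_iff)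
    note M = missing_notin[OF nn]
    let ?h = "swap_at q ?g"
    have h: "?h \<in> states" by (rule swap_at_rook[OF g(1) sq])
    have hq: "?h (Suc q) = n" "?h q = missing n f" using gq by (simp_all add: swap_at_apply)
    note z = insert_missing[OF h True hq(1)]
    let ?z = "insert_missing n ?h"
    have "rook_sort n q ?h = Some ?g" using hq M(2) False by (simp add: rook_sort_def)
    then have r: "run (rook_sort n) [Suc q, q, Suc q] ?z = Some f" using z(2) g(2) by simp
    show ?thesis
     by (rule path_dead.braid4[OF z(1) sq q _ r]) (use labels[OF sq] True in simp)
   next
    case far: False
    then have ssq: "Suc (Suc q) < n" using sq by simp
    show ?thesis
    proof (cases "f (Suc (Suc q)) < n")
     case True
     let ?g = "swap_at (Suc q) f" and ?h = "swap_at q (swap_at (Suc q) f)"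
     have g: "?g \<in> states" by (rule swap_at_rook[OF f ssq])
     have h: "?h \<in> states" by (rule swap_at_rook[OF g sq])
     have r: "rook_sort n q ?h = Some ?g" "rook_sort n (Suc q) ?g = Some f"
      using sq ssq True blank False far by (simp_all add: rook_sort_def swap_at_apply)
     have none': "rook_sort n (Suc q) ?h = None" using ssq far blank by (simp add: rook_sort_def swap_at_apply)
     have le: "weight n ?h \<le> weight n ?g" using rook_sort_weight[OF q r(1)] by simp
     have st: "stuck ?h (Suc q)" by (rule IH[OF r(2) le sq h sq none'])
     have r': "run (rook_sort n) [q, Suc q] ?h = Some f" using r by simp
     show ?thesis
      by (rule path_dead.braid[OF h sq q _ r' _ _ st, where w = "[]" and v = "[q, Suc q]"])
       (use labels[OF sq] far in simp_all)
    next
     case no: False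
     then have blank2: "f (Suc (Suc q)) = n" using D(1)[OF ssq] by simp
     have "\<exists>p. Suc q < p & p < n & (if Suc p = n then f p = n else f (Suc p) < f p)"
     proof (rule ccontr)
      assume none: "~ ?thesis"
      have blanks: "f (Suc (Suc q) + i) = n" if "Suc (Suc q) + i < n" for i
       using that
      proof (induction i)
       case (Suc i)
       let ?p = "Suc (Suc q) + i"
       have "~ (if Suc ?p = n then f ?p = n else f (Suc ?p) < f ?p)"
       proof
        assume c: "if Suc ?p = n then f ?p = n else f (Suc ?p) < f ?p"
        have "Suc q < ?p" "?p < n" using Suc.prems by simp_all
        with c none show False by blast
       qed
       then have "~ f (Suc ?p) < f ?p" using Suc.prems by auto
       then show ?case using Suc D(1)[of "Suc ?p"] by simp
      qed (use blank2 in simp)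
      have r: "n - 1 = Suc (Suc q) + (n - 1 - Suc (Suc q))" using ssq by arith
      have fn: "f (n - 1) = n" by (subst r, rule blanks) (use ssq in arith)
      have n1: "Suc (n - 1) = n" "Suc q < n - 1" "n - 1 < n" using ssq by arith+
      have "if Suc (n - 1) = n then f (n - 1) = n else f (Suc (n - 1)) < f (n - 1)"
       by (rule iffD2[OF if_P[OF n1(1)] fn])
      then show False using none n1(2,3) by blast
     qed
     then obtain p where p: "Suc q < p" "p < n" "if Suc p = n then f p = n else f (Suc p) < f p" by blast
     note pr = rook_predecessor[OF f p(2,3)]
     let ?g = "rook_unsort n p f"
     have "?g q = f q" "?g (Suc q) = f (Suc q)" using p by (auto simp: rook_unsort_def insert_missing_def swap_at_apply)
     then have none': "rook_sort n q ?g = None" using sq blank by (simp add: rook_sort_def)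
     have st: "stuck ?g q" by (rule IH[OF pr(2) le_refl p(2) pr(1) q none'])
     show ?thesis by (rule path_dead.commute[OF pr(1) p(2) q _ pr(2) st]) (use p(1) in simp)
    qed
   qed
  qed
 qed
qed

lemma diamond:
 assumes pq: "p < q" "q < n" and x: "x \<in> states" "x' \<in> states" and y: "rook_sort n p x = Some y" "rook_sort n q x' = Some y"
 shows "\<exists>z\<in>states. if q = Suc p then e p = 3 & run (rook_sort n) [p, q] z = Some x & run (rook_sort n) [q, p] z = Some x'
  else rook_sort n q z = Some x & rook_sort n p z = Some x'"
proof -
 have pn: "Suc p < n" "p < n" "Suc p ~= n" using pq by auto
 have xx: "x = swap_at p y" using rook_unsort_sort[OF x(1) pn(2) y(1)] pn(3) by (simp add: rook_unsort_def)
 have dp: "y (Suc p) < y p" using y(1) pn(3) unfolding xx by (auto simp: rook_sort_def swap_at_apply split: if_splits)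
 have yS: "y \<in> states" by (rule rook_sort_closed[OF x(1) pn(2) y(1)])
 have xx': "x' = rook_unsort n q y" by (rule rook_unsort_sort[OF x(2) pq(2) y(2)])
 show ?thesis
 proof (cases "Suc q = n")
  case True
  have yq: "y q = n" by (rule rook_sort_last(2)[OF x(2) True y(2)])
  have qp: "q ~= Suc p"
  proof
   assume "q = Suc p"
   then show False using dp yq rook_placementsD(1)[OF yS pn(2)] by simp
  qed
  then have pq': "Suc p < q" using pq by simp
  let ?z = "swap_at p x'"
  have z: "?z \<in> states" by (rule swap_at_rook[OF x(2) pn(1)])
  have "rook_sort n q ?z = Some x" using rook_sort_swap_last[OF True pq', of x'] y(2) xx by simp
  moreover have "x' p = y p" "x' (Suc p) = y (Suc p)"
   using pq' True unfolding xx' by (auto simp: rook_unsort_def insert_missing_def)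
  then have "rook_sort n p ?z = Some x'" using dp pn by (simp add: rook_sort_def swap_at_apply)
  ultimately show ?thesis using z qp by auto
 next
  case False
  then have sq: "Suc q < n" using pq by simp
  have x'': "x' = swap_at q y" using xx' False by (simp add: rook_unsort_def)
  have dq: "y (Suc q) < y q" using y(2) False unfolding x'' by (auto simp: rook_sort_def swap_at_apply split: if_splits)
  show ?thesis
  proof (cases "q = Suc p")
   case True
   let ?z = "swap_at p (swap_at q (swap_at p y))"
   have "?z \<in> states" using swap_at_rook yS pn(1) sq by blast
   moreover have "run (rook_sort n) [p, q] ?z = Some x" "run (rook_sort n) [q, p] ?z = Some x'"
    unfolding xx x'' using True dp dq sq swap_at_braid[of p y] by (auto simp: rook_sort_def swap_at_apply)
   moreover have "e p = 3" using labels[OF pn(1)] sq True by simp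
   ultimately show ?thesis using True by (intro bexI[of _ ?z]) (simp_all del: run.simps)
  next
   case neq: False
   let ?z = "swap_at p (swap_at q y)"
   have "?z \<in> states" using swap_at_rook yS pn(1) sq by blast
   moreover have "rook_sort n q ?z = Some x" "rook_sort n p ?z = Some x'"
    unfolding xx x'' using neq dp dq pq sq pn swap_at_commute[of p q y] by (auto simp: rook_sort_def swap_at_apply)
   ultimately show ?thesis using neq by (intro bexI[of _ ?z]) simp_all
  qed
 qed
qed

theorem rook_model:
 "nil_model m d (short_pairs m) states (%a. rook_sort n (\<iota> a)) (\<lambda>x\<in>{..<n}. x) (weight n)"
proof (rule path_nil_model)
 show "nil_action m d (short_pairs m) states (%a. rook_sort n (\<iota> a))"
 proof (rule path_nil_action)
  show "t \<in> states" if "s \<in> states" "q < n" "rook_sort n q s = Some t" for s q t by (rule rook_sort_closed[OF that])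
  show "run (rook_sort n) [p, q] s = run (rook_sort n) [q, p] s" if "s \<in> states" "Suc p < q" "q < n" for s p q
   by (rule rook_sort_commute[OF that(2,3)])
  show "run (rook_sort n) [q, Suc q, q] s = run (rook_sort n) [Suc q, q, Suc q] s" if "s \<in> states" "Suc q < n" "e q = 3" for s q
   by (rule rook_sort_braid) (use labels[OF that(2)] that in \<open>auto split: if_splits\<close>)
  show "run (rook_sort n) [q, Suc q, q, Suc q] s = None & run (rook_sort n) [Suc q, q, Suc q, q] s = None"
   if "s \<in> states" "Suc q < n" "e q = 4" for s q
  proof -
   have q: "Suc (Suc q) = n" using labels[OF that(2)] that(3) by (auto split: if_splits)
   show ?thesis by (rule conjI[OF rook_sort_braid4[OF that(1) q]])
  qed
  show "run (rook_sort n) (replicate (d (\<sigma> q)) q) s = None" if "s \<in> states" "q < n" for s q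
   unfolding exponent[OF that(2)] by (rule rook_sort_square[OF that])
 qed
 show "(\<lambda>x\<in>{..<n}. x) \<in> states" by (rule rook_placementsI) (simp_all add: restrict_def)
 show "x = y" if "q < n" "x \<in> states" "y \<in> states" "rook_sort n q x = Some z" "rook_sort n q y = Some z" for q x y z
  by (rule HOL.trans[OF rook_unsort_sort[OF that(2,1,4)] rook_unsort_sort[OF that(3,1,5), symmetric]])
 show "weight n x < weight n y" if "q < n" "rook_sort n q x = Some y" for q x y by (rule rook_sort_weight[OF that])
 show "\<exists>q<n. \<exists>x\<in>states. rook_sort n q x = Some y" if y: "y \<in> states" "y ~= (\<lambda>x\<in>{..<n}. x)" for y
 proof (cases "\<exists>q<n. if Suc q = n then y q = n else y (Suc q) < y q")
  case True
  then obtain q where q: "q < n" "if Suc q = n then y q = n else y (Suc q) < y q" by (elim exE conjE)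
  from rook_predecessor[OF y(1) q] q(1) show ?thesis by (intro exI[of _ q] conjI bexI[of _ "rook_unsort n q y"])
 next
  case False
  have inc: "y q \<le> y (Suc q)" if "Suc q < n" for q
  proof -
   have "~ (if Suc q = n then y q = n else y (Suc q) < y q)"
   proof
    assume "if Suc q = n then y q = n else y (Suc q) < y q"
    then show False using False Suc_lessD[OF that] by (elim notE, intro exI[of _ q] conjI)
   qed
   then show ?thesis using that by (simp split: if_splits)
  qed
  have last: "y (n - 1) < n"
  proof -
   have n1: "n - 1 < n" "Suc (n - 1) = n" using n by simp_all
   have "y (n - 1) ~= n"
   proof
    assume "y (n - 1) = n"
    from iffD2[OF if_P[OF n1(2)] this] n1(1) show False
     using False by (elim notE, intro exI[of _ "n - 1"] conjI)
   qed
   then show ?thesis using rook_placementsD(1)[OF y(1) n1(1)] by simp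
  qed
  have n0: "0 < n" using n by arith
  have "y = (\<lambda>x\<in>{..<n}. x)" by (rule rook_sorted_unique[OF y(1) inc last n0])
  with y(2) show ?thesis by (rule notE)
 qed
 show "\<exists>z\<in>states. if q = Suc p then e p = 3 & run (rook_sort n) [p, q] z = Some x & run (rook_sort n) [q, p] z = Some x'
   else rook_sort n q z = Some x & rook_sort n p z = Some x'"
  if "p < q" "q < n" "x \<in> states" "x' \<in> states" "rook_sort n p x = Some y" "rook_sort n q x' = Some y" for p q x x' y
  by (rule diamond[OF that])
 show "stuck x q" if "x \<in> states" "q < n" "rook_sort n q x = None" for x q
  by (rule stuck_if_undefined[OF that])
qed

theorem rook_classes: "card (nonnull_classes m d (short_pairs m)) = (\<Sum>l=0..n. (n choose l)\<^sup>2 * fact l)"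
 using nil_model.card_nonnull_classes[OF rook_model] card_rook_placements by simp

end

section \<open>Tabulated models\<close>

text \<open>States are numbered in base 16 by three digits in the order of their lengths, so that lookups in a table are
 rewriting steps by pattern matching.\<close>
datatype digit = D0 | D1 | D2 | D3 | D4 | D5 | D6 | D7 | D8 | D9 | DA | DB | DC | DD | DE | DF

datatype letter = L1 | L2 | L3 | L4

datatype state = Q digit digit digit

text \<open>The letter leads to a longer state, comes from a shorter one, or leads to zero from a state that it does not reach.\<close>
datatype entry = U digit digit digit | D digit digit digit | F

datatype row = R entry entry entry entry

datatype bond = Two | Three | Four | Five

type_synonym table = "digit => digit => digit => row"

primrec column :: "letter => row => entry" where
 "column L1 r = (case r of R x y z w => x)"
| "column L2 r = (case r of R x y z w => y)"
| "column L3 r = (case r of R x y z w => z)"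
| "column L4 r = (case r of R x y z w => w)"

primrec table_entry :: "table => letter => state => entry" where
 "table_entry T i (Q x y z) = column i (T x y z)"

definition up :: "table => letter => state => state option" where
 "up T i s = (case table_entry T i s of U x y z => Some (Q x y z) | _ => None)"

definition down :: "table => letter => state => state option" where
 "down T i s = (case table_entry T i s of D x y z => Some (Q x y z) | _ => None)"

primrec digit_value :: "digit => nat" where
 "digit_value D0 = 0" | "digit_value D1 = 1" | "digit_value D2 = 2" | "digit_value D3 = 3"
| "digit_value D4 = 4" | "digit_value D5 = 5" | "digit_value D6 = 6" | "digit_value D7 = 7"
| "digit_value D8 = 8" | "digit_value D9 = 9" | "digit_value DA = 10" | "digit_value DB = 11"
| "digit_value DC = 12" | "digit_value DD = 13" | "digit_value DE = 14" | "digit_value DF = 15"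

primrec state_rank :: "state => nat" where
 "state_rank (Q x y z) = 256 * digit_value x + 16 * digit_value y + digit_value z"

fun state_less :: "state => state => bool" where
 "state_less (Q x y z) (Q x' y' z') \<longleftrightarrow>
  (if x = x' then if y = y' then digit_value z < digit_value z' else digit_value y < digit_value y'
   else digit_value x < digit_value x')"

definition forward_ok :: "table => bond => letter => letter => state => bool" where
 "forward_ok T e i j s \<longleftrightarrow>
  (case e of
   Two => run (up T) [i, j] s = run (up T) [j, i] s
  | Three => run (up T) [i, j, i] s = run (up T) [j, i, j] s
  | Four => run (up T) [i, j, i, j] s = None & run (up T) [j, i, j, i] s = None
  | Five => run (up T) [i, j, i, j, i] s = None & run (up T) [j, i, j, i, j] s = None)"

definition backward_ok :: "table => bond => letter => letter => state => bool" where
 "backward_ok T e i j s \<longleftrightarrow> down T i s = None \<or> down T j s = None \<or>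
  (case e of
   Two => run (down T) [i, j] s = run (down T) [j, i] s & run (down T) [i, j] s ~= None
  | Three => run (down T) [i, j, i] s = run (down T) [j, i, j] s & run (down T) [i, j, i] s ~= None
  | _ => False)"

text \<open>The reason for an undefined letter \<open>i\<close>, found by undoing letters: a commutation, a braid move of length 3, or a complete side of a relation
 of length 4 or 5.\<close>
definition dead_ok :: "table => bond => letter => letter => state => bool" where
 "dead_ok T e i c s \<longleftrightarrow>
  (case e of
   Two => (case down T c s of None => False | Some t => up T i t = None)
  | Three => (case run (down T) [c, i] s of None => False | Some t =>
    (case up T c t of None => True | Some r => state_less r s & up T i r = None))
  | Four => run (down T) [c, i, c] s ~= None
  | Five => run (down T) [c, i, c, i] s ~= None)"

definition entry_ok :: "table => (letter => letter => bond) => letter list => state => state => letter => bool" where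
 "entry_ok T C ls N s i \<longleftrightarrow>
  (case table_entry T i s of
   U x y z => state_less s (Q x y z) & state_less (Q x y z) N & down T i (Q x y z) = Some s
  | D x y z => state_less (Q x y z) s & up T i (Q x y z) = Some s
  | F => list_ex (%c. c ~= i & dead_ok T (C i c) i c s) ls)"

definition state_ok :: "table => (letter => letter => bond) => letter list => (letter \<times> letter) list =>
  state => state => bool" where
 "state_ok T C ls ps N s \<longleftrightarrow> state_less s N -->
  list_all (entry_ok T C ls N s) ls &
  list_all (%(i, j). forward_ok T (C i j) i j s & backward_ok T (C i j) i j s) ps &
  (s = Q D0 D0 D0 \<or> list_ex (%i. down T i s ~= None) ls)"

primrec bond_label :: "bond => enat" where
 "bond_label Two = 2" | "bond_label Three = 3" | "bond_label Four = 4" | "bond_label Five = 5"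

lemma digit_value_less: "digit_value x < 16"
 by (cases x) auto

lemma digit_value_inject [simp]: "digit_value x = digit_value y \<longleftrightarrow> x = y"
 by (cases x; cases y) auto

lemma state_less_iff: "state_less s t \<longleftrightarrow> state_rank s < state_rank t"
proof (cases s; cases t)
 fix x y z x' y' z' assume s: "s = Q x y z" "t = Q x' y' z'"
 have b: "digit_value v < 16" for v by (rule digit_value_less)
 have ne: "x ~= x' \<longleftrightarrow> digit_value x ~= digit_value x'" "y ~= y' \<longleftrightarrow> digit_value y ~= digit_value y'"
  by simp_all
 show ?thesis
  using b[of x] b[of y] b[of z] b[of x'] b[of y'] b[of z'] unfolding s
  by (cases "x = x'"; cases "y = y'") (auto simp: ne simp del: digit_value_inject)
qed

lemma card_states_below: "card {s. state_less s t} = state_rank t"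
proof -
 have inj: "inj state_rank"
 proof (rule injI)
  fix s t assume st: "state_rank s = state_rank t"
  then have "~ state_less s t" "~ state_less t s" by (simp_all add: state_less_iff)
  then show "s = t"
   by (cases s; cases t) (auto split: if_splits simp: not_less order.antisym
     simp flip: digit_value_inject)
 qed
 have digit: "\<exists>x. digit_value x = n" if "n < 16" for n
 proof -
  have "n = 0 \<or> n = 1 \<or> n = 2 \<or> n = 3 \<or> n = 4 \<or> n = 5 \<or> n = 6 \<or> n = 7 \<or> n = 8 \<or> n = 9 \<or> n = 10 \<or> n = 11 \<or> n = 12 \<or> n = 13 \<or> n = 14 \<or> n = 15"
   using that by arith
  then show ?thesis by (elim disjE) (metis digit_value.simps)+
 qed
 have "state_rank ` {s. state_less s t} = {..<state_rank t}"
 proof (intro equalityI subsetI)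
  fix n assume "n \<in> {..<state_rank t}"
  then have n: "n < state_rank t" by simp
  also have "state_rank t < 4096"
  proof (cases t)
   case (Q x y z)
   then show ?thesis
    using digit_value_less[of x] digit_value_less[of y] digit_value_less[of z] by simp
  qed
  finally have "n div 256 < 16" "n div 16 mod 16 < 16" "n mod 16 < 16" by auto
  then obtain x y z where "digit_value x = n div 256" "digit_value y = n div 16 mod 16"
   "digit_value z = n mod 16" using digit by metis
  moreover have "n = 256 * (n div 256) + 16 * (n div 16 mod 16) + n mod 16"
  proof -
   have "n div 256 = n div 16 div 16" using div_mult2_eq[of n 16 16] by simp
   moreover have "n = n div 16 * 16 + n mod 16" "n div 16 = n div 16 div 16 * 16 + n div 16 mod 16"
    by (rule div_mult_mod_eq[symmetric])+
   ultimately show ?thesis by linarith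
  qed
  ultimately have "state_rank (Q x y z) = n" by simp
  then show "n \<in> state_rank ` {s. state_less s t}"
   using n by (intro image_eqI[of _ _ "Q x y z"]) (auto simp: state_less_iff simp del: state_rank.simps)
 qed (auto simp: state_less_iff)
 then have "card {s. state_less s t} = card {..<state_rank t}"
  by (metis card_image inj inj_on_subset subset_UNIV)
 then show ?thesis by simp
qed

lemma run_map: "run act (map f w) s = run (%a. act (f a)) w s"
 by (induction w arbitrary: s) (auto cong: Option.bind_cong)

lemma entry_up_down:
 "table_entry T i s = U x y z \<longleftrightarrow> up T i s = Some (Q x y z)"
 "table_entry T i s = D x y z \<longleftrightarrow> down T i s = Some (Q x y z)"
 "table_entry T i s = F \<longleftrightarrow> up T i s = None & down T i s = None"
 by (auto simp: up_def down_def split: entry.splits)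

lemma forward_ok_sym: "forward_ok T e i j s = forward_ok T e j i s"
 by (cases e) (auto simp: forward_ok_def)

lemma backward_ok_sym: "backward_ok T e i j s = backward_ok T e j i s"
 by (cases e) (auto simp: backward_ok_def)

text \<open>The conditions of a model are local, hence a conjunction over states and pairs of letters.\<close>
theorem table_nil_model:
 fixes m :: "'i => 'i => enat" and index :: "'i => letter"
 assumes ok: "!!s. state_ok T C ls ps N s"
  and ps: "!!i j. i \<in> set ls ==> j \<in> set ls ==> i ~= j ==> (i, j) \<in> set ps \<or> (j, i) \<in> set ps"
  and C: "!!i j. C i j = C j i"
  and N: "state_less (Q D0 D0 D0) N"
  and index: "bij_betw index UNIV (set ls)"
  and m: "coxeter_matrix m" "!!a b. a ~= b ==> m a b = bond_label (C (index a) (index b))"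
  and d: "!!a. d a = 2"
 shows "nil_model m d (short_pairs m) {s. state_less s N} (%a. up T (index a)) (Q D0 D0 D0) state_rank"
proof -
 define S where "S = {s. state_less s N}"
 let ?act = "%a. up T (index a)"
 have idx: "index a \<in> set ls" for a using index by (auto simp: bij_betw_def)
 have idx_neq: "index a ~= index b" if "a ~= b" for a b
  using index that by (auto simp: bij_betw_def dest: injD)
 have idx_ex: "\<exists>a. i = index a" if "i \<in> set ls" for i
  using index that by (auto simp: bij_betw_def)
 have ent: "entry_ok T C ls N s (index a)" if "s \<in> S" for s a
  using ok[of s] that idx[of a] unfolding state_ok_def S_def by (auto simp: list_all_iff)
 have fwd: "forward_ok T (C (index a) (index b)) (index a) (index b) s"
  and bwd: "backward_ok T (C (index a) (index b)) (index a) (index b) s" if "s \<in> S" "a ~= b" for s a b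
  using ok[of s] that(1) ps[OF idx idx idx_neq[OF that(2)]] forward_ok_sym backward_ok_sym C
  unfolding state_ok_def S_def by (fastforce simp: list_all_iff)+
 have up: "t \<in> S & state_rank s < state_rank t & down T (index a) t = Some s"
  if "s \<in> S" "up T (index a) s = Some t" for s t a
  using ent[OF that(1), of a] that(2)
  by (cases t) (simp add: entry_ok_def flip: entry_up_down, simp add: S_def state_less_iff)
 have down: "t \<in> S & up T (index a) t = Some s"
  if "s \<in> S" "down T (index a) s = Some t" for s t a
  using ent[OF that(1), of a] that
  by (cases t) (simp add: entry_ok_def flip: entry_up_down, simp add: S_def state_less_iff)
 have run_down: "t \<in> S & run ?act (rev w) t = Some s"
  if "s \<in> S" "run (down T) (map index w) s = Some t" for s t w
  using that
 proof (induction w arbitrary: s)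
  case (Cons a w)
  then obtain r where "down T (index a) s = Some r" "run (down T) (map index w) r = Some t"
   by (auto simp: bind_eq_Some_conv)
  with Cons.IH[of r] Cons.prems(1) down[of s a r] show ?case by (auto simp: run_snoc)
 qed simp
 have run_act: "run ?act w s = run (up T) (map index w) s" for w s by (simp add: run_map)
 have up_down_None: "down T (index a) s = None" if "up T (index a) s = Some t" for s t a
  using that by (auto simp: up_def down_def split: entry.splits)
 have label: "m a b = bond_label (C (index a) (index b))" if "a ~= b" for a b by (rule m(2)[OF that])
 have act: "nil_action m d (short_pairs m) S ?act"
 proof (rule nil_action_short[OF m(1)])
  show "t \<in> S" if "s \<in> S" "up T (index a) s = Some t" for s a t using up[OF that] by blast
  show "run ?act [a, b] s = run ?act [b, a] s" if "s \<in> S" "a ~= b" "m a b = 2" for s a b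
   using fwd[OF that(1,2)] that(3) unfolding label[OF that(2)] run_act
   by (cases "C (index a) (index b)") (simp_all add: forward_ok_def)
  show "run ?act [a, b, a] s = run ?act [b, a, b] s" if "s \<in> S" "a ~= b" "m a b = 3" for s a b
   using fwd[OF that(1,2)] that(3) unfolding label[OF that(2)] run_act
   by (cases "C (index a) (index b)") (simp_all add: forward_ok_def)
  show "run ?act (alternating_word a b n) s = None" if "s \<in> S" "a ~= b" "m a b = enat n" "4 \<le> n" for s a b n
   using fwd[OF that(1,2)] that(3,4) unfolding label[OF that(2)] run_act
   by (cases "C (index a) (index b)") (auto simp: forward_ok_def numeral_eq_enat eval_nat_numeral)
  show "run ?act (replicate (d a) a) s = None" if "s \<in> S" for s a
  proof (cases "up T (index a) s")
   case (Some t)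
   have "up T (index a) t = None"
    using up[OF that Some] by (auto simp: up_def down_def split: entry.splits)
   with Some show ?thesis by (simp add: d eval_nat_numeral)
  qed (simp add: d eval_nat_numeral)
 qed
 have "nil_model m d (short_pairs m) S ?act (Q D0 D0 D0) state_rank"
 proof
  show "nil_action m d (short_pairs m) S ?act" by (rule act)
  show "Q D0 D0 D0 \<in> S" using N by (simp add: S_def)
  show "s = t" if "s \<in> S" "t \<in> S" "up T (index a) s = Some r" "up T (index a) t = Some r" for a s t r
   using up[OF that(1,3)] up[OF that(2,4)] by simp
  show "state_rank s < state_rank t" if "s \<in> S" "up T (index a) s = Some t" for a s t
   using up[OF that] by blast
  show "\<exists>a. \<exists>s\<in>S. up T (index a) s = Some t" if tS: "t \<in> S" "t ~= Q D0 D0 D0" for t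
  proof -
   obtain i s where "i \<in> set ls" "down T i t = Some s"
    using ok[of t] tS unfolding state_ok_def S_def by (auto simp: list_ex_iff)
   then show ?thesis using idx_ex down[OF tS(1)] by blast
  qed
  show "\<exists>r\<in>S. \<exists>u v. braid_equiv m (short_pairs m) (u @ [a]) (v @ [b]) & run ?act u r = Some s & run ?act v r = Some s'"
   if "s \<in> S" "s' \<in> S" "a ~= b" "up T (index a) s = Some t" "up T (index b) s' = Some t" for a b s s' t
  proof -
   have t: "t \<in> S" "down T (index a) t = Some s" "down T (index b) t = Some s'"
    using up[OF that(1,4)] up[OF that(2,5)] by auto
   note b = bwd[OF t(1) that(3), unfolded backward_ok_def t]
   show ?thesis
   proof (cases "C (index a) (index b)")
    case Two
    with b t have "run (down T) (map index [b]) s = run (down T) (map index [a]) s'"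
     "run (down T) (map index [b]) s ~= None" by (simp_all, elim conjE exE, simp)
    then obtain r where "run (down T) (map index [b]) s = Some r" "run (down T) (map index [a]) s' = Some r"
     by (metis option.exhaust)
    with run_down[OF that(1)] run_down[OF that(2)]
    have r: "r \<in> S" "run ?act [b] r = Some s" "run ?act [a] r = Some s'" by fastforce+
    have "m b a = 2" "b ~= a" using label[OF that(3)] Two that(3) coxeter_matrixD(2)[OF m(1), of b a] by auto
    from braid_equiv_2[OF m(1) this(2,1)]
    have "braid_equiv m (short_pairs m) ([b] @ [a]) ([a] @ [b])" by simp
    with r show ?thesis by blast
   next
    case Three
    with b t have "run (down T) (map index [b, a]) s = run (down T) (map index [a, b]) s'"
     "run (down T) (map index [b, a]) s ~= None" by (simp_all, elim conjE exE, simp)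
    then obtain r where "run (down T) (map index [b, a]) s = Some r" "run (down T) (map index [a, b]) s' = Some r"
     by (metis option.exhaust)
    with run_down[OF that(1)] run_down[OF that(2)]
    have r: "r \<in> S" "run ?act [a, b] r = Some s" "run ?act [b, a] r = Some s'" by fastforce+
    have "m a b = 3" using label[OF that(3)] Three by simp
    from braid_equiv_3[OF m(1) that(3) this]
    have "braid_equiv m (short_pairs m) ([a, b] @ [a]) ([b, a] @ [b])" by simp
    with r show ?thesis by blast
   qed (use b in simp_all)
  qed
  show "dead m d (short_pairs m) S ?act s a" if "s \<in> S" "up T (index a) s = None" for s a
   using that
  proof (induction "state_rank s" arbitrary: s a rule: less_induct)
   case less
   let ?dead = "dead m d (short_pairs m) S ?act"
   have lower: "state_rank t < state_rank s" if "t \<in> S" "run ?act w t = Some s" "w ~= []" for t w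
    using that
   proof (induction w arbitrary: t)
    case (Cons c w)
    then obtain r where r: "up T (index c) t = Some r" "run ?act w r = Some s"
     by (auto simp: bind_eq_Some_conv)
    with up[OF Cons.prems(1) r(1)] Cons.IH[of r] show ?case by (cases "w = []") auto
   qed simp
   have power: "[a] @ [a] \<in> forbidden_words m d (short_pairs m)"
    unfolding short_forbidden_words_iff[OF m(1)] by (auto simp: d eval_nat_numeral)
   show ?case
   proof (cases "table_entry T (index a) s")
    case (U x y z)
    then show ?thesis using less.prems by (simp add: entry_up_down)
   next
    case (D x y z)
    then have t: "Q x y z \<in> S" "run ?act [a] (Q x y z) = Some s"
     using down[OF less.prems(1), of a] by (simp_all add: entry_up_down)
    show ?thesis by (rule dead.forbidden[OF t power])
   next
    case F
    with ent[OF less.prems(1), of a] obtain i where i: "i \<in> set ls" "i ~= index a"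
     "dead_ok T (C (index a) i) (index a) i s"
     unfolding entry_ok_def by (auto simp: list_ex_iff)
    then obtain c where c: "i = index c" "c ~= a" using idx_ex by blast
    note dok = i(3)[unfolded c(1) dead_ok_def]
    have lab: "m c a = bond_label (C (index a) (index c))" using label[OF c(2)] C by simp
    show ?thesis
    proof (cases "C (index a) (index c)")
     case Two
     with dok obtain t where t: "down T (index c) s = Some t" "up T (index a) t = None"
      by (auto split: option.splits)
     from down[OF less.prems(1) t(1)] have ts: "t \<in> S" "run ?act [c] t = Some s" by auto
     have "braid_equiv m (short_pairs m) ([c] @ [a]) ([] @ a # [c])"
      using braid_equiv_2[OF m(1) c(2)] lab Two by simp
     from dead.braid[OF ts this run.simps(1) less.hyps[OF lower[OF ts] ts(1) t(2)]]
     show ?thesis by simp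
    next
     case Three
     with dok obtain t where t: "run (down T) (map index [c, a]) s = Some t"
      "!!r. up T (index c) t = Some r ==> state_less r s & up T (index a) r = None"
      by (auto simp: c(1) split: option.splits)
     from run_down[OF less.prems(1) t(1)] have ts: "t \<in> S" "run ?act [a, c] t = Some s" by auto
     have eq: "braid_equiv m (short_pairs m) [a, c, a] [c, a, c]"
      using braid_equiv.trans braid_equiv_sym braid_equiv_3[OF m(1) c(2)] lab Three by auto
     show ?thesis
     proof (cases "up T (index c) t")
      case None
      have "braid_equiv m (short_pairs m) ([a, c] @ [a]) ([] @ c # [a, c])" using eq by simp
      from dead.braid[OF ts this run.simps(1) less.hyps[OF lower[OF ts] ts(1) None]]
      show ?thesis by simp
     next
      case (Some r)
      from t(2)[OF this] have r: "state_rank r < state_rank s" "up T (index a) r = None"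
       by (simp_all add: state_less_iff)
      from up[OF ts(1) Some] have rS: "r \<in> S" by blast
      have "braid_equiv m (short_pairs m) ([a, c] @ [a]) ([c] @ a # [c])" using eq by simp
      moreover have "run ?act [c] t = Some r" using Some by simp
      moreover have "?dead r a"
       by (rule less.hyps[OF r(1) rS r(2)])
      ultimately show ?thesis using dead.braid[OF ts] by blast
     qed
    next
     case Four
     then have lab': "m c a = enat 4" using lab by (simp add: numeral_eq_enat)
     from Four dok obtain t where t: "run (down T) (map index [c, a, c]) s = Some t" by auto
     from run_down[OF less.prems(1) t] have ts: "t \<in> S" "run ?act [c, a, c] t = Some s" by auto
     have "[c, a, c] @ [a] \<in> forbidden_words m d (short_pairs m)"
      unfolding short_forbidden_words_iff[OF m(1)] using c(2) lab'
      by (intro disjI2 exI[of _ c] exI[of _ a] exI[of _ 4]) (simp add: eval_nat_numeral)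
     from dead.forbidden[OF ts this] show ?thesis .
    next
     case Five
     then have lab': "m a c = enat 5" using label[of a c] c(2) by (simp add: numeral_eq_enat)
     from Five dok obtain t where t: "run (down T) (map index [c, a, c, a]) s = Some t" by auto
     from run_down[OF less.prems(1) t] have ts: "t \<in> S" "run ?act [a, c, a, c] t = Some s" by auto
     have "[a, c, a, c] @ [a] \<in> forbidden_words m d (short_pairs m)"
      unfolding short_forbidden_words_iff[OF m(1)] using c(2) lab'
      by (intro disjI2 exI[of _ a] exI[of _ c] exI[of _ 5]) (simp add: eval_nat_numeral)
     from dead.forbidden[OF ts this] show ?thesis .
    qed
   qed
  qed
 qed
 then show ?thesis by (simp add: S_def)
qed

definition digits :: "digit list" where
 "digits = [D0, D1, D2, D3, D4, D5, D6, D7, D8, D9, DA, DB, DC, DD, DE, DF]"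

lemma digits: "x \<in> set digits"
 by (cases x) (simp_all add: digits_def)

lemma state_okI:
 assumes blocks: "!!x. digit_value x \<le> digit_value x' ==>
   list_all (%y. list_all (%z. state_ok T C ls ps (Q x' y' z') (Q x y z)) digits) digits"
 shows "state_ok T C ls ps (Q x' y' z') s"
proof (cases s)
 case (Q x y z)
 show ?thesis
 proof (cases "digit_value x \<le> digit_value x'")
  case True
  from blocks[OF this] show ?thesis using digits unfolding Q list_all_iff by blast
 next
  case False
  then show ?thesis by (auto simp: Q state_ok_def)
 qed
qed

fun path_bond :: "bond => bond => bond => letter => letter => bond" where
 "path_bond e f g L1 L2 = e" | "path_bond e f g L2 L1 = e"
| "path_bond e f g L2 L3 = f" | "path_bond e f g L3 L2 = f"
| "path_bond e f g L3 L4 = g" | "path_bond e f g L4 L3 = g"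
| "path_bond e f g _ _ = Two"

context
begin

text \<open>The tables of \<open>H_3\<close>, \<open>F_4\<close> and \<open>H_4\<close>. The name of a row lists the kinds of its entries, the digits of the target states follow.\<close>
private abbreviation (input) "no_row == R F F F F"
private abbreviation (input) "no_rows == %_. R F F F F"
private abbreviation (input) "no_block == %_ _. R F F F F"
private abbreviation (input) "A == D0"
private abbreviation (input) "B == D1"
private abbreviation (input) "C == D2"
private abbreviation (input) "E == D3"
private abbreviation (input) "G == D4"
private abbreviation (input) "W == D5"
private abbreviation (input) "I == D6"
private abbreviation (input) "J == D7"
private abbreviation (input) "K == D8"
private abbreviation (input) "L == D9"
private abbreviation (input) "M == DA"
private abbreviation (input) "N == DB"
private abbreviation (input) "V == DC"
private abbreviation (input) "P == DD"
private abbreviation (input) "S == DE"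
private abbreviation (input) "T == DF"
private abbreviation (input) "DDFF x0 y0 z0 x1 y1 z1 == R (D x0 y0 z0) (D x1 y1 z1) F F"
private abbreviation (input) "DDFU x0 y0 z0 x1 y1 z1 x3 y3 z3 == R (D x0 y0 z0) (D x1 y1 z1) F (U x3 y3 z3)"
private abbreviation (input) "DDUD x0 y0 z0 x1 y1 z1 x2 y2 z2 x3 y3 z3 == R (D x0 y0 z0) (D x1 y1 z1) (U x2 y2 z2) (D x3 y3 z3)"
private abbreviation (input) "DDUF x0 y0 z0 x1 y1 z1 x2 y2 z2 == R (D x0 y0 z0) (D x1 y1 z1) (U x2 y2 z2) F"
private abbreviation (input) "DDUU x0 y0 z0 x1 y1 z1 x2 y2 z2 x3 y3 z3 == R (D x0 y0 z0) (D x1 y1 z1) (U x2 y2 z2) (U x3 y3 z3)"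
private abbreviation (input) "DFFF x0 y0 z0 == R (D x0 y0 z0) F F F"
private abbreviation (input) "DFFU x0 y0 z0 x3 y3 z3 == R (D x0 y0 z0) F F (U x3 y3 z3)"
private abbreviation (input) "DFUD x0 y0 z0 x2 y2 z2 x3 y3 z3 == R (D x0 y0 z0) F (U x2 y2 z2) (D x3 y3 z3)"
private abbreviation (input) "DFUF x0 y0 z0 x2 y2 z2 == R (D x0 y0 z0) F (U x2 y2 z2) F"
private abbreviation (input) "DFUU x0 y0 z0 x2 y2 z2 x3 y3 z3 == R (D x0 y0 z0) F (U x2 y2 z2) (U x3 y3 z3)"
private abbreviation (input) "DUDD x0 y0 z0 x1 y1 z1 x2 y2 z2 x3 y3 z3 == R (D x0 y0 z0) (U x1 y1 z1) (D x2 y2 z2) (D x3 y3 z3)"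
private abbreviation (input) "DUDF x0 y0 z0 x1 y1 z1 x2 y2 z2 == R (D x0 y0 z0) (U x1 y1 z1) (D x2 y2 z2) F"
private abbreviation (input) "DUDU x0 y0 z0 x1 y1 z1 x2 y2 z2 x3 y3 z3 == R (D x0 y0 z0) (U x1 y1 z1) (D x2 y2 z2) (U x3 y3 z3)"
private abbreviation (input) "DUFD x0 y0 z0 x1 y1 z1 x3 y3 z3 == R (D x0 y0 z0) (U x1 y1 z1) F (D x3 y3 z3)"
private abbreviation (input) "DUFF x0 y0 z0 x1 y1 z1 == R (D x0 y0 z0) (U x1 y1 z1) F F"
private abbreviation (input) "DUFU x0 y0 z0 x1 y1 z1 x3 y3 z3 == R (D x0 y0 z0) (U x1 y1 z1) F (U x3 y3 z3)"
private abbreviation (input) "DUUD x0 y0 z0 x1 y1 z1 x2 y2 z2 x3 y3 z3 == R (D x0 y0 z0) (U x1 y1 z1) (U x2 y2 z2) (D x3 y3 z3)"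
private abbreviation (input) "DUUF x0 y0 z0 x1 y1 z1 x2 y2 z2 == R (D x0 y0 z0) (U x1 y1 z1) (U x2 y2 z2) F"
private abbreviation (input) "DUUU x0 y0 z0 x1 y1 z1 x2 y2 z2 x3 y3 z3 == R (D x0 y0 z0) (U x1 y1 z1) (U x2 y2 z2) (U x3 y3 z3)"
private abbreviation (input) "FDFF x1 y1 z1 == R F (D x1 y1 z1) F F"
private abbreviation (input) "FDFU x1 y1 z1 x3 y3 z3 == R F (D x1 y1 z1) F (U x3 y3 z3)"
private abbreviation (input) "FDUD x1 y1 z1 x2 y2 z2 x3 y3 z3 == R F (D x1 y1 z1) (U x2 y2 z2) (D x3 y3 z3)"
private abbreviation (input) "FDUF x1 y1 z1 x2 y2 z2 == R F (D x1 y1 z1) (U x2 y2 z2) F"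
private abbreviation (input) "FDUU x1 y1 z1 x2 y2 z2 x3 y3 z3 == R F (D x1 y1 z1) (U x2 y2 z2) (U x3 y3 z3)"
private abbreviation (input) "FFDD x2 y2 z2 x3 y3 z3 == R F F (D x2 y2 z2) (D x3 y3 z3)"
private abbreviation (input) "FFDF x2 y2 z2 == R F F (D x2 y2 z2) F"
private abbreviation (input) "FFDU x2 y2 z2 x3 y3 z3 == R F F (D x2 y2 z2) (U x3 y3 z3)"
private abbreviation (input) "FFFD x3 y3 z3 == R F F F (D x3 y3 z3)"
private abbreviation (input) "FFUD x2 y2 z2 x3 y3 z3 == R F F (U x2 y2 z2) (D x3 y3 z3)"
private abbreviation (input) "FUDD x1 y1 z1 x2 y2 z2 x3 y3 z3 == R F (U x1 y1 z1) (D x2 y2 z2) (D x3 y3 z3)"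
private abbreviation (input) "FUDF x1 y1 z1 x2 y2 z2 == R F (U x1 y1 z1) (D x2 y2 z2) F"
private abbreviation (input) "FUDU x1 y1 z1 x2 y2 z2 x3 y3 z3 == R F (U x1 y1 z1) (D x2 y2 z2) (U x3 y3 z3)"
private abbreviation (input) "FUFD x1 y1 z1 x3 y3 z3 == R F (U x1 y1 z1) F (D x3 y3 z3)"
private abbreviation (input) "FUUD x1 y1 z1 x2 y2 z2 x3 y3 z3 == R F (U x1 y1 z1) (U x2 y2 z2) (D x3 y3 z3)"
private abbreviation (input) "UDDD x0 y0 z0 x1 y1 z1 x2 y2 z2 x3 y3 z3 == R (U x0 y0 z0) (D x1 y1 z1) (D x2 y2 z2) (D x3 y3 z3)"
private abbreviation (input) "UDDF x0 y0 z0 x1 y1 z1 x2 y2 z2 == R (U x0 y0 z0) (D x1 y1 z1) (D x2 y2 z2) F"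
private abbreviation (input) "UDDU x0 y0 z0 x1 y1 z1 x2 y2 z2 x3 y3 z3 == R (U x0 y0 z0) (D x1 y1 z1) (D x2 y2 z2) (U x3 y3 z3)"
private abbreviation (input) "UDFD x0 y0 z0 x1 y1 z1 x3 y3 z3 == R (U x0 y0 z0) (D x1 y1 z1) F (D x3 y3 z3)"
private abbreviation (input) "UDFF x0 y0 z0 x1 y1 z1 == R (U x0 y0 z0) (D x1 y1 z1) F F"
private abbreviation (input) "UDFU x0 y0 z0 x1 y1 z1 x3 y3 z3 == R (U x0 y0 z0) (D x1 y1 z1) F (U x3 y3 z3)"
private abbreviation (input) "UDUD x0 y0 z0 x1 y1 z1 x2 y2 z2 x3 y3 z3 == R (U x0 y0 z0) (D x1 y1 z1) (U x2 y2 z2) (D x3 y3 z3)"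
private abbreviation (input) "UDUF x0 y0 z0 x1 y1 z1 x2 y2 z2 == R (U x0 y0 z0) (D x1 y1 z1) (U x2 y2 z2) F"
private abbreviation (input) "UDUU x0 y0 z0 x1 y1 z1 x2 y2 z2 x3 y3 z3 == R (U x0 y0 z0) (D x1 y1 z1) (U x2 y2 z2) (U x3 y3 z3)"
private abbreviation (input) "UFDD x0 y0 z0 x2 y2 z2 x3 y3 z3 == R (U x0 y0 z0) F (D x2 y2 z2) (D x3 y3 z3)"
private abbreviation (input) "UFDF x0 y0 z0 x2 y2 z2 == R (U x0 y0 z0) F (D x2 y2 z2) F"
private abbreviation (input) "UFDU x0 y0 z0 x2 y2 z2 x3 y3 z3 == R (U x0 y0 z0) F (D x2 y2 z2) (U x3 y3 z3)"
private abbreviation (input) "UFFD x0 y0 z0 x3 y3 z3 == R (U x0 y0 z0) F F (D x3 y3 z3)"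
private abbreviation (input) "UFUD x0 y0 z0 x2 y2 z2 x3 y3 z3 == R (U x0 y0 z0) F (U x2 y2 z2) (D x3 y3 z3)"
private abbreviation (input) "UUDD x0 y0 z0 x1 y1 z1 x2 y2 z2 x3 y3 z3 == R (U x0 y0 z0) (U x1 y1 z1) (D x2 y2 z2) (D x3 y3 z3)"
private abbreviation (input) "UUDF x0 y0 z0 x1 y1 z1 x2 y2 z2 == R (U x0 y0 z0) (U x1 y1 z1) (D x2 y2 z2) F"
private abbreviation (input) "UUDU x0 y0 z0 x1 y1 z1 x2 y2 z2 x3 y3 z3 == R (U x0 y0 z0) (U x1 y1 z1) (D x2 y2 z2) (U x3 y3 z3)"
private abbreviation (input) "UUUD x0 y0 z0 x1 y1 z1 x2 y2 z2 x3 y3 z3 == R (U x0 y0 z0) (U x1 y1 z1) (U x2 y2 z2) (D x3 y3 z3)"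
private abbreviation (input) "UUUF x0 y0 z0 x1 y1 z1 x2 y2 z2 == R (U x0 y0 z0) (U x1 y1 z1) (U x2 y2 z2) F"
private abbreviation (input) "UUUU x0 y0 z0 x1 y1 z1 x2 y2 z2 x3 y3 z3 == R (U x0 y0 z0) (U x1 y1 z1) (U x2 y2 z2) (U x3 y3 z3)"

primrec p00 :: "digit => row" where
"p00 A=UUUF A A B A A C A A E"
|"p00 B=DUUF A A A A A G A A W"
|"p00 C=UDUF A A I A A A A A J"
|"p00 E=UUDF A A W A A K A A A"
|"p00 G=UDUF A A L A A B A A M"
|"p00 W=DUDF A A E A A N A A B"
|"p00 I=DUUF A A C A A V A A P"
|"p00 J=UUDF A A P A A S A A C"
|"p00 K=UDUF A A T A A E A A S"
|"p00 L=DUUF A A G A B A A B B"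
|"p00 M=UUDF A B B A B C A A G"
|"p00 N=UDUF A B E A A W A B C"
|"p00 V=UDUF A B G A A I A B W"
|"p00 P=DUDF A A J A B I A A I"
|"p00 S=UDDF A B J A A J A A K"
|"p00 T=DUUF A A K A B K A B J"
primrec p01 :: "digit => row" where
"p01 A=FDUF A A L A B L"
|"p01 B=DUDF A A M A B M A A L"
|"p01 C=UDDF A B N A A M A A N"
|"p01 E=DUUF A A N A B V A B N"
|"p01 G=DFUF A A V A B P"
|"p01 W=UUDF A B P A B S A A V"
|"p01 I=UDUF A B T A A P A B S"
|"p01 J=DUDF A A S A C A A A T"
|"p01 K=UDUF A C B A A T A C C"
|"p01 L=FUDF A C E A B A"
|"p01 M=UDUF A C G A B B A C E"
|"p01 N=DUDF A B C A C W A B E"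
|"p01 V=FDUF A B E A C I"
|"p01 P=DUDF A B W A C J A B G"
|"p01 S=UDDF A C K A B W A B I"
|"p01 T=DUUF A B I A C L A C K"
primrec p02 :: "digit => row" where
"p02 A=UDUF A C M A B J A C N"
|"p02 B=DFUF A B K A C V"
|"p02 C=UUDF A C V A C N A B K"
|"p02 E=UDDF A C P A B L A B M"
|"p02 G=DUUF A B M A C S A C P"
|"p02 W=UDUF A C T A B N A E A"
|"p02 I=FUDF A E A A B V"
|"p02 J=UDFF A E B A B P"
|"p02 K=DUDF A B S A E C A B T"
|"p02 L=FDUF A B T A E E"
|"p02 M=DFUF A C A A E G"
|"p02 N=UDDF A E G A C C A C A"
|"p02 V=DUDF A C C A E W A C B"
|"p02 P=DUDF A C E A E I A C G"
|"p02 S=FDUF A C G A E J"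
|"p02 T=DFUF A C W A E K"
primrec p03 :: "digit => row" where
"p03 A=UDDF A E K A C I A C W"
|"p03 B=DUFF A C J A E L"
|"p03 C=UDUF A E M A C K A E N"
|"p03 E=FUDF A E N A C L"
|"p03 G=DUDF A C N A E V A C M"
|"p03 W=UDFF A E P A C V"
|"p03 I=UDUF A E S A C P A E T"
|"p03 J=FUDF A E T A C S"
|"p03 K=DUDF A E A A G A A C T"
|"p03 L=FDUF A E B A G B"
|"p03 M=DFUF A E C A G C"
|"p03 N=UDDF A G C A E E A E C"
|"p03 V=UDFF A G E A E G"
|"p03 P=DUFF A E W A G G"
|"p03 S=DFUF A E I A G W"
|"p03 T=UDDF A G W A E J A E I"
primrec p04 :: "digit => row" where
"p04 A=UDFF A G I A E K"
|"p04 B=FFDF A E L"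
|"p04 C=DUDF A E N A G J A E M"
|"p04 E=DFFF A E V"
|"p04 G=FDUF A E P A G K"
|"p04 W=DUDF A E T A G L A E S"
|"p04 I=DFFF A G A"
|"p04 J=UDFF A G M A G C"
|"p04 K=FFDF A G G"
|"p04 L=UDFF A G N A G W"
|"p04 M=DFFF A G J"
|"p04 N=DFFF A G L"
|"p04 V=no_row"
|"p04 P=no_row"
|"p04 S=no_row"
|"p04 T=no_row"
primrec h30 :: "digit => digit => row" where
"h30 D0 = p00"
|"h30 D1 = p01"
|"h30 D2 = p02"
|"h30 D3 = p03"
|"h30 D4 = p04"
|"h30 D5 = no_rows"
|"h30 D6 = no_rows"
|"h30 D7 = no_rows"
|"h30 D8 = no_rows"
|"h30 D9 = no_rows"
|"h30 DA = no_rows"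
|"h30 DB = no_rows"
|"h30 DC = no_rows"
|"h30 DD = no_rows"
|"h30 DE = no_rows"
|"h30 DF = no_rows"
primrec h3 :: "digit => digit => digit => row" where
"h3 D0 = h30"
|"h3 D1 = no_block"
|"h3 D2 = no_block"
|"h3 D3 = no_block"
|"h3 D4 = no_block"
|"h3 D5 = no_block"
|"h3 D6 = no_block"
|"h3 D7 = no_block"
|"h3 D8 = no_block"
|"h3 D9 = no_block"
|"h3 DA = no_block"
|"h3 DB = no_block"
|"h3 DC = no_block"
|"h3 DD = no_block"
|"h3 DE = no_block"
|"h3 DF = no_block"

lemma h3_block0: "list_all (%y. list_all (%z. state_ok h3 (path_bond Five Three Two) [L1, L2, L3] [(L1, L2), (L1, L3), (L2, L3)] (Q D0 D4 DC) (Q D0 y z)) digits) digits"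
 by code_simp

lemma h3_ok: "state_ok h3 (path_bond Five Three Two) [L1, L2, L3] [(L1, L2), (L1, L3), (L2, L3)] (Q D0 D4 DC) s"
proof (rule state_okI)
 fix x assume x: "digit_value x \<le> digit_value D0"
 show "list_all (%y. list_all (%z. state_ok h3 (path_bond Five Three Two) [L1, L2, L3] [(L1, L2), (L1, L3), (L2, L3)] (Q D0 D4 DC) (Q x y z)) digits) digits"
 proof (cases x)
  case D0 show ?thesis unfolding D0 by (rule h3_block0)
 qed (use x in simp_all)
qed

primrec q00 :: "digit => row" where
"q00 A=UUUU A A B A A C A A E A A G"
|"q00 B=DUUU A A A A A W A A I A A J"
|"q00 C=UDUU A A K A A A A A L A A M"
|"q00 E=UUDU A A I A A N A A A A A V"
|"q00 G=UUUD A A J A A M A A P A A A"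
|"q00 W=UDUU A A S A A B A A T A B A"
|"q00 I=DUDU A A E A B B A A B A B C"
|"q00 J=DUUD A A G A B A A B E A A B"
|"q00 K=DUUU A A C A A S A B G A B W"
|"q00 L=UUDU A B G A B I A A C A B J"
|"q00 M=UDUD A B W A A G A B K A A C"
|"q00 N=UDUU A B L A A E A B M A B N"
|"q00 V=UUUD A B C A B N A B V A A E"
|"q00 P=UUDU A B E A B P A A G A B V"
|"q00 S=DDUU A A W A A K A B S A B T"
|"q00 T=UUDU A B S A C A A A W A C B"
primrec q01 :: "digit => row" where
"q01 A=UDUD A B T A A J A C C A A W"
|"q01 B=UDUU A C E A A I A C G A C W"
|"q01 C=DUUD A A V A C W A C I A A I"
|"q01 E=DUDU A A P A C J A A J A C I"
|"q01 G=DUDU A A L A C K A A K A C L"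
|"q01 W=DUUD A A M A B T A C M A A K"
|"q01 I=UDFU A C N A A L A C V"
|"q01 J=UUUD A C L A C V A C P A A L"
|"q01 K=UUDU A C M A C S A A M A C P"
|"q01 L=DUUU A A N A C E A C T A E A"
|"q01 M=UFDU A C T A A N A E B"
|"q01 N=UDUD A E A A A V A E C A A N"
|"q01 V=UUDD A C I A E E A A V A A P"
|"q01 P=UDUU A E G A A P A E W A E E"
|"q01 S=DUDU A A T A E I A A S A E J"
|"q01 T=DDUD A B A A B W A E K A A S"
primrec q02 :: "digit => row" where
"q02 A=UDFU A E L A A T A E M"
|"q02 B=UUUD A E J A E M A E N A A T"
|"q02 C=UUDU A E K A E V A B A A E N"
|"q02 E=DDUU A B B A B L A E P A E S"
|"q02 G=UFDU A E P A B B A E T"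
|"q02 W=UDUD A E S A B C A G A A B B"
|"q02 I=DUDD A B V A G B A B C A B E"
|"q02 J=UDUU A G C A B E A G E A G B"
|"q02 K=UDUU A G G A B G A G W A G I"
|"q02 L=DUUD A B J A G I A G J A B G"
|"q02 M=DUDU A B K A G K A B W A G J"
|"q02 N=DUFU A B I A G G A G L"
|"q02 V=UDUD A G L A B J A G M A B I"
|"q02 P=UUDD A G J A G N A B J A B K"
|"q02 S=UDFU A G V A B K A G N"
|"q02 T=DUDU A B M A G P A B L A G S"
primrec q03 :: "digit => row" where
"q03 A=DUUD A B N A E S A G T A B L"
|"q03 B=UFUD A G S A W A A B M"
|"q03 C=UUDU A G T A W B A B N A W A"
|"q03 E=UDUD A W C A B V A W E A B P"
|"q03 G=DUUU A B P A G C A W G A W C"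
|"q03 W=UFDU A W G A B P A W W"
|"q03 I=UDFU A W I A B S A W J"
|"q03 J=DUUD A C B A W J A W K A B S"
|"q03 K=DUDU A C C A W L A B T A W K"
|"q03 L=DUFU A C A A W I A W M"
|"q03 M=UDUD A W M A C B A W N A C A"
|"q03 N=UUDD A W K A W V A C B A C C"
|"q03 V=UDFU A W P A C C A W V"
|"q03 P=DUDU A C G A W S A C E A W T"
|"q03 S=DDUD A C W A E A A I A A C E"
|"q03 T=UFUD A W T A I B A C G"
primrec q04 :: "digit => row" where
"q04 A=UUDU A I A A I C A C W A I B"
|"q04 B=UDUD A I E A C I A I G A C J"
|"q04 C=DDUU A C J A E G A I W A I E"
|"q04 E=UFDU A I W A C J A I I"
|"q04 G=DDUU A C K A C N A I J A I K"
|"q04 W=UFDU A I J A C K A I L"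
|"q04 I=UDUD A I K A C L A I M A C K"
|"q04 J=DUDD A C P A I N A C L A C M"
|"q04 K=UDUU A I V A C M A I P A I N"
|"q04 L=DUUD A C V A I K A I S A C N"
|"q04 M=UUDF A I S A I T A C V"
|"q04 N=UDUD A J A A C P A J B A C S"
|"q04 V=DUFU A C S A I V A J A"
|"q04 P=FDUU A C T A J C A J E"
|"q04 S=DUUD A E B A J E A J G A C T"
|"q04 T=DUDU A E C A J W A E A A J G"
primrec q05 :: "digit => row" where
"q05 A=UUDD A J G A J I A E B A E C"
|"q05 B=UDFU A J J A E C A J I"
|"q05 C=DUUD A E E A I E A J K A E G"
|"q05 E=UFDU A J K A E E A J L"
|"q05 G=DUDU A E W A J M A E G A J N"
|"q05 W=UFUD A J N A J L A E W"
|"q05 I=DDFU A E I A E L A J V"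
|"q05 J=UDUD A J V A E J A J P A E I"
|"q05 K=DUDD A E N A J S A E J A E K"
|"q05 L=UDFU A J T A E K A J S"
|"q05 M=DUUD A E M A J V A K A A E L"
|"q05 N=UUDF A K A A K B A E M"
|"q05 V=UDUD A K C A E N A K E A E V"
|"q05 P=DUFU A E V A J T A K C"
|"q05 S=FDFU A E P A K G"
|"q05 T=DUUD A E T A K G A K W A E P"
primrec q06 :: "digit => row" where
"q06 A=DUDU A G A A K I A E S A K W"
|"q06 B=UUDD A K W A K J A E T A G A"
|"q06 C=UDFU A K K A G A A K J"
|"q06 E=DDUD A G B A W C A K L A G C"
|"q06 G=UFDU A K L A G B A K M"
|"q06 W=DUDU A G E A K N A G C A K V"
|"q06 I=UFUD A K V A K M A G E"
|"q06 J=DUDU A G W A K P A G G A K S"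
|"q06 K=DDUD A G I A G L A K T A G G"
|"q06 L=UFUD A K S A L A A G W"
|"q06 M=UUDU A K T A L B A G I A L A"
|"q06 N=UDUD A L C A G J A L E A G K"
|"q06 V=DDUU A G K A G V A L G A L C"
|"q06 P=UFDU A L G A G K A L W"
|"q06 S=DUDF A G M A L I A G L"
|"q06 T=UDFF A L J A G M"
primrec q07 :: "digit => row" where
"q07 A=DUUD A G N A L C A L K A G V"
|"q07 B=UFDF A L K A G N"
|"q07 C=FFDU A G P A L L"
|"q07 E=FDUD A G S A L M A G P"
|"q07 G=DUDD A W A A L N A G S A G T"
|"q07 W=UDUU A L V A G T A L P A L N"
|"q07 I=UDUD A L S A W A A L T A W B"
|"q07 J=DUFU A W B A L V A L S"
|"q07 K=DUDU A W E A M A A W C A M B"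
|"q07 L=UFDD A M B A W W A W E"
|"q07 M=FDUU A W G A M C A M E"
|"q07 N=DUUD A W W A M E A M B A W G"
|"q07 V=DDUD A W J A W M A M G A W I"
|"q07 P=UUDF A M G A M W A W J"
|"q07 S=UDUD A M I A W K A M J A W L"
|"q07 T=DDFU A W L A W P A M I"
primrec q08 :: "digit => row" where
"q08 A=DUDF A W N A M K A W M"
|"q08 B=UDFF A M L A W N"
|"q08 C=DUUD A W V A M I A M M A W P"
|"q08 E=UFDF A M M A W V"
|"q08 G=FDUD A W T A M N A W S"
|"q08 W=DUDD A I B A M V A W T A I A"
|"q08 I=UDFU A M P A I A A M V"
|"q08 J=UDUD A M S A I B A M T A I C"
|"q08 K=DUFU A I C A M P A M S"
|"q08 L=DUDU A I G A N A A I E A N B"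
|"q08 M=UFDD A N B A I I A I G"
|"q08 N=FDFU A I W A N C"
|"q08 V=DUUD A I I A N C A N B A I W"
|"q08 P=FDFU A I J A N E"
|"q08 S=DUUD A I L A N E A N G A I J"
|"q08 T=DUDU A I M A N W A I K A N G"
primrec q09 :: "digit => row" where
"q09 A=UUDD A N G A N I A I L A I M"
|"q09 B=UDFU A N J A I M A N I"
|"q09 C=DDUD A I N A J A A N K A I V"
|"q09 E=UFDU A N K A I N A N L"
|"q09 G=DUDU A I P A N M A I V A N N"
|"q09 W=UFUD A N N A N L A I P"
|"q09 I=UDUF A N V A I S A N P"
|"q09 J=DUFF A I T A N V"
|"q09 K=DUDF A J B A N S A J A"
|"q09 L=FFUD A N T A J C"
|"q09 M=FUDU A V A A J E A N T"
|"q09 N=UDUD A V B A J G A V C A J W"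
|"q09 V=DDUU A J W A J J A V E A V B"
|"q09 P=UFDU A V E A J W A V G"
|"q09 S=DUUD A J I A V B A V W A J J"
|"q09 T=UFDF A V W A J I"
primrec q0A :: "digit => row" where
"q0A A=FDUU A J K A V I A V J"
|"q0A B=DUDD A J L A V J A J N A J K"
|"q0A C=FFDU A J M A V K"
|"q0A E=FDUD A J N A V L A J M"
|"q0A G=DUDF A J P A V M A J V"
|"q0A W=UDFF A V N A J P"
|"q0A I=DDUD A J S A K C A V V A J T"
|"q0A J=UFDF A V V A J S"
|"q0A K=UDUF A V P A K A A V S"
|"q0A L=DUFF A K B A V P"
|"q0A M=DUDF A K E A V T A K C"
|"q0A N=FUDF A P A A K G"
|"q0A V=UDUD A P B A K W A P C A K I"
|"q0A P=DDFU A K I A K K A P B"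
|"q0A S=DUUD A K J A P B A P E A K K"
|"q0A T=UFDF A P E A K J"
primrec q0B :: "digit => row" where
"q0B A=FDFU A K L A P G"
|"q0B B=DUDD A K M A P G A K V A K L"
|"q0B C=FDUD A K V A P W A K N"
|"q0B E=FDUD A K S A P I A K P"
|"q0B G=DUDD A L A A P J A K S A K T"
|"q0B W=UDFU A P K A K T A P J"
|"q0B I=UDUD A P L A L A A P M A L B"
|"q0B J=DUFU A L B A P K A P L"
|"q0B K=DUDU A L E A P N A L C A P V"
|"q0B L=UFDD A P V A L W A L E"
|"q0B M=FDFU A L G A P P"
|"q0B N=DUUD A L W A P P A P V A L G"
|"q0B V=DDUF A L I A L J A P S"
|"q0B P=UFDU A P S A L I A P T"
|"q0B S=FDUF A L K A S A"
|"q0B T=FUDD A S B A L L A L M"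
primrec q0C :: "digit => row" where
"q0C A=UDFU A S C A L M A S B"
|"q0C B=DDUD A L N A L S A S E A L V"
|"q0C C=UFDU A S E A L N A S G"
|"q0C E=DUDU A L P A S W A L V A S I"
|"q0C G=UFUD A S I A S G A L P"
|"q0C W=DUDF A L T A S J A L S"
|"q0C I=FFDU A M A A S K"
|"q0C J=FDUD A M B A S L A M A"
|"q0C K=FFUD A S M A M C"
|"q0C L=FUDU A S N A M E A S M"
|"q0C M=UDFF A S V A M G"
|"q0C N=DUFF A M W A S V"
|"q0C V=DUDF A M J A S P A M I"
|"q0C P=DDUF A M K A M L A S S"
|"q0C S=UFDU A S S A M K A S T"
|"q0C T=FDUF A M M A T A"
primrec q0D :: "digit => row" where
"q0D A=UDFF A T B A M N"
|"q0D B=DDUD A M V A M S A T C A M P"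
|"q0D C=UFDF A T C A M V"
|"q0D E=DUDF A M T A T E A M S"
|"q0D G=FDUD A N B A T G A N A"
|"q0D W=FUDF A T W A N C"
|"q0D I=FUDF A T I A N E"
|"q0D J=UDUD A T J A N G A T K A N W"
|"q0D K=DDFU A N W A N J A T J"
|"q0D L=DUUD A N I A T J A T L A N J"
|"q0D M=UFDF A T L A N I"
|"q0D N=FDFU A N K A T M"
|"q0D V=DUDD A N L A T M A N N A N K"
|"q0D P=FDUD A N N A T N A N M"
|"q0D S=DUDU A N P A T V A N V A T P"
|"q0D T=UFFD A T P A N P"
primrec q0E :: "digit => row" where
"q0E A=FFDU A N S A T S"
|"q0E B=UDUD A T T A N T B A A A V A"
|"q0E C=DFFU A V A A T T"
|"q0E E=DUDU A V C B A B A V B B A C"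
|"q0E G=UFDD B A C A V G A V C"
|"q0E W=FDFU A V E B A E"
|"q0E I=DUUD A V G B A E B A C A V E"
|"q0E J=FDUF A V W B A G"
|"q0E K=FFUD B A W A V I"
|"q0E L=FFDU A V J B A W"
|"q0E M=FUDD B A I A V K A V L"
|"q0E N=UDFU B A J A V L B A I"
|"q0E V=DDFF A V M A V N"
|"q0E P=FDFF A V V"
|"q0E S=DUDU A V S B A K A V P B A L"
|"q0E T=UFFD B A L A V S"
primrec q0F :: "digit => row" where
"q0F A=FFDU A V T B A M"
|"q0F B=DFFF A P A"
|"q0F C=DUDF A P C B A N A P B"
|"q0F E=FDUF A P E B A V"
|"q0F G=FFDF A P G"
|"q0F W=UDFF B A P A P W"
|"q0F I=UDFF B A S A P I"
|"q0F J=DDUD A P J A P L B A T A P K"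
|"q0F K=UFDF B A T A P J"
|"q0F L=DUDF A P M B B A A P L"
|"q0F M=FDUD A P V B B B A P N"
|"q0F N=FUDF B B C A P P"
|"q0F V=FDFU A P S B B E"
|"q0F P=DUFD A P T B B E A P S"
|"q0F S=FFFD A S A"
|"q0F T=DFUD A S B B B G A S C"
primrec f40 :: "digit => digit => row" where
"f40 D0 = q00"
|"f40 D1 = q01"
|"f40 D2 = q02"
|"f40 D3 = q03"
|"f40 D4 = q04"
|"f40 D5 = q05"
|"f40 D6 = q06"
|"f40 D7 = q07"
|"f40 D8 = q08"
|"f40 D9 = q09"
|"f40 DA = q0A"
|"f40 DB = q0B"
|"f40 DC = q0C"
|"f40 DD = q0D"
|"f40 DE = q0E"
|"f40 DF = q0F"
primrec q10 :: "digit => row" where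
"q10 A=UFDF B B G A S B"
|"q10 B=FDFU A S E B B W"
|"q10 C=DUDD A S G B B W A S I A S E"
|"q10 E=FDUD A S I B B I A S W"
|"q10 G=FFDU A S J B B J"
|"q10 W=FFDD A S K A S L"
|"q10 I=UDUD B B K A S M B B L A S N"
|"q10 J=DFFU A S N B B K"
|"q10 K=FDFU A S S B B M"
|"q10 L=DUFD A S T B B M A S S"
|"q10 M=FFFD A T A"
|"q10 N=FDFF A T C"
|"q10 V=FFDU A T E B B N"
|"q10 P=DFFF A T W"
|"q10 S=DFFF A T I"
|"q10 T=DUDF A T K B B V A T J"
primrec q11 :: "digit => row" where
"q11 A=FDUF A T L B B P"
|"q11 B=FFDF A T M"
|"q11 C=UDFF B B S A T N"
|"q11 E=FDUD A T P B B T A T V"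
|"q11 G=DUDF B A A B C A A T T"
|"q11 W=FDUD B A C B C B B A B"
|"q11 I=FUDF B C C B A E"
|"q11 J=FFFD B A G"
|"q11 K=DFUD B A I B C E B A J"
|"q11 L=UFDF B C E B A I"
|"q11 M=FDUD B A L B C G B A K"
|"q11 N=FFFD B A V"
|"q11 V=FDFF B A T"
|"q11 P=FFDU B B A B C W"
|"q11 S=DFFF B B C"
|"q11 T=FUDF B C I B B E"
primrec q12 :: "digit => row" where
"q12 A=FDUF B B G B C J"
|"q12 B=FFDF B B W"
|"q12 C=UDFF B C K B B I"
|"q12 E=DUDF B B L B C L B B K"
|"q12 G=FUDF B C M B B M"
|"q12 W=FFFD B B P"
|"q12 I=UDFF B C N B B T"
|"q12 J=FFDU B C A B C V"
|"q12 K=DFFF B C C"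
|"q12 L=FDUF B C E B C P"
|"q12 M=UDFF B C S B C G"
|"q12 N=DFFF B C I"
|"q12 V=FFFD B C J"
|"q12 P=FFDU B C L B C T"
|"q12 S=DFFF B C M"
|"q12 T=FFFD B C P"
primrec f41 :: "digit => digit => row" where
"f41 D0 = q10"
|"f41 D1 = q11"
|"f41 D2 = q12"
|"f41 D3 = no_rows"
|"f41 D4 = no_rows"
|"f41 D5 = no_rows"
|"f41 D6 = no_rows"
|"f41 D7 = no_rows"
|"f41 D8 = no_rows"
|"f41 D9 = no_rows"
|"f41 DA = no_rows"
|"f41 DB = no_rows"
|"f41 DC = no_rows"
|"f41 DD = no_rows"
|"f41 DE = no_rows"
|"f41 DF = no_rows"
primrec f4 :: "digit => digit => digit => row" where
"f4 D0 = f40"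
|"f4 D1 = f41"
|"f4 D2 = no_block"
|"f4 D3 = no_block"
|"f4 D4 = no_block"
|"f4 D5 = no_block"
|"f4 D6 = no_block"
|"f4 D7 = no_block"
|"f4 D8 = no_block"
|"f4 D9 = no_block"
|"f4 DA = no_block"
|"f4 DB = no_block"
|"f4 DC = no_block"
|"f4 DD = no_block"
|"f4 DE = no_block"
|"f4 DF = no_block"

lemma f4_block0: "list_all (%y. list_all (%z. state_ok f4 (path_bond Three Four Three) [L1, L2, L3, L4] [(L1, L2), (L1, L3), (L1, L4), (L2, L3), (L2, L4), (L3, L4)] (Q D1 D3 D0) (Q D0 y z)) digits) digits"
 by code_simp

lemma f4_block1: "list_all (%y. list_all (%z. state_ok f4 (path_bond Three Four Three) [L1, L2, L3, L4] [(L1, L2), (L1, L3), (L1, L4), (L2, L3), (L2, L4), (L3, L4)] (Q D1 D3 D0) (Q D1 y z)) digits) digits"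
 by code_simp

lemma f4_ok: "state_ok f4 (path_bond Three Four Three) [L1, L2, L3, L4] [(L1, L2), (L1, L3), (L1, L4), (L2, L3), (L2, L4), (L3, L4)] (Q D1 D3 D0) s"
proof (rule state_okI)
 fix x assume x: "digit_value x \<le> digit_value D1"
 show "list_all (%y. list_all (%z. state_ok f4 (path_bond Three Four Three) [L1, L2, L3, L4] [(L1, L2), (L1, L3), (L1, L4), (L2, L3), (L2, L4), (L3, L4)] (Q D1 D3 D0) (Q x y z)) digits) digits"
 proof (cases x)
  case D0 show ?thesis unfolding D0 by (rule f4_block0)
 next
  case D1 show ?thesis unfolding D1 by (rule f4_block1)
 qed (use x in simp_all)
qed

primrec r00 :: "digit => row" where
"r00 A=UUUU A A B A A C A A E A A G"
|"r00 B=DUUU A A A A A W A A I A A J"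
|"r00 C=UDUU A A K A A A A A L A A M"
|"r00 E=UUDU A A I A A N A A A A A V"
|"r00 G=UUUD A A J A A M A A P A A A"
|"r00 W=UDUU A A S A A B A A T A B A"
|"r00 I=DUDU A A E A B B A A B A B C"
|"r00 J=DUUD A A G A B A A B E A A B"
|"r00 K=DUUU A A C A B G A B W A B I"
|"r00 L=UUDU A B W A B J A A C A B K"
|"r00 M=UDUD A B I A A G A B L A A C"
|"r00 N=UDUU A B M A A E A B J A B N"
|"r00 V=UUUD A B C A B N A B V A A E"
|"r00 P=UUDU A B E A B P A A G A B V"
|"r00 S=DUUU A A W A B S A B T A C A"
|"r00 T=UUDU A B T A C B A A W A C C"
primrec r01 :: "digit => row" where
"r01 A=UDUD A C A A A J A C E A A W"
|"r01 B=UDUU A C G A A I A C B A C W"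
|"r01 C=DUUD A A V A C W A C I A A I"
|"r01 E=DUDU A A P A C J A A J A C I"
|"r01 G=UDUU A C K A A K A C L A C M"
|"r01 W=DUDU A A L A C N A A K A C V"
|"r01 I=DUUD A A M A C M A C P A A K"
|"r01 J=UDDU A C S A A L A A N A C T"
|"r01 K=UUUD A C V A C T A E A A A L"
|"r01 L=UUDU A C P A E B A A M A E A"
|"r01 M=DUUU A A N A E C A C S A E E"
|"r01 N=UDUD A E E A A V A E G A A N"
|"r01 V=UUDD A C I A E W A A V A A P"
|"r01 P=UDUU A E I A A P A E B A E W"
|"r01 S=FDUU A A S A E J A E K"
|"r01 T=DUDU A A T A E L A A S A E M"
primrec r02 :: "digit => row" where
"r02 A=DUUD A B A A E K A E N A A S"
|"r02 B=UDDU A E V A A T A B B A E P"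
|"r02 C=UUUD A E M A E P A E S A A T"
|"r02 E=UUDU A E N A E T A B A A E S"
|"r02 G=DUUU A B B A G A A E V A G B"
|"r02 W=UDUD A G B A B C A G C A B B"
|"r02 I=DUDD A B V A G E A B C A B E"
|"r02 J=UDUU A G G A B E A E T A G E"
|"r02 K=DFUU A B G A G W A G I"
|"r02 L=UUDU A G W A G J A B G A G K"
|"r02 M=UDUD A G I A B I A G L A B G"
|"r02 N=UDUU A G M A B W A G J A G N"
|"r02 V=DUUD A B K A G N A G V A B W"
|"r02 P=DUDU A B L A G P A B I A G V"
|"r02 S=DUDU A B J A G S A B M A G T"
|"r02 T=UDUD A G T A B K A W A A B J"
primrec r03 :: "digit => row" where
"r03 A=UUDD A G V A W B A B K A B L"
|"r03 B=UDDU A W C A B L A B P A W B"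
|"r03 C=UDUU A W E A B M A W G A W W"
|"r03 E=DUUD A B N A W W A W I A B M"
|"r03 G=UUDU A W I A W J A B N A W A"
|"r03 W=UDUD A W K A B V A W J A B P"
|"r03 I=DUUU A B P A W L A W C A W K"
|"r03 J=FUDU A W M A B S A W N"
|"r03 K=FDUD A C A A W V A B S"
|"r03 L=UDUU A W P A B T A W M A W S"
|"r03 M=DUUD A C C A W S A W T A B T"
|"r03 N=DUDU A C E A I A A C A A W T"
|"r03 V=DUDU A C B A I B A C G A I C"
|"r03 P=UDUD A I C A C C A I E A C B"
|"r03 S=UUDD A W T A I G A C C A C E"
|"r03 T=UDDU A I W A C E A C J A I G"
primrec r04 :: "digit => row" where
"r04 A=FDUU A C G A I I A I J"
|"r04 B=DUUD A C W A I J A I K A C G"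
|"r04 C=UUDU A I K A I L A C W A I E"
|"r04 E=UDUD A I M A C I A I L A C J"
|"r04 G=DUUU A C J A I N A I W A I M"
|"r04 W=DUDU A C L A I V A C K A I P"
|"r04 I=DFUD A C M A I S A C K"
|"r04 J=UDDU A I T A C L A C N A J A"
|"r04 K=UUUD A I P A J A A J B A C L"
|"r04 L=UUDU A I S A J C A C M A J B"
|"r04 M=DUUU A C N A J E A I T A J G"
|"r04 N=UDUD A J G A C V A J W A C N"
|"r04 V=DUDD A E A A J I A C V A C P"
|"r04 P=UDUU A J J A C P A J C A J I"
|"r04 S=UDUU A J K A C S A J L A J M"
|"r04 T=DUUD A C T A J M A J N A C S"
primrec r05 :: "digit => row" where
"r05 A=UUDD A J N A J V A C T A E G"
|"r05 B=UDUD A J P A E A A J V A E B"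
|"r05 C=DUDU A E B A J S A E I A J P"
|"r05 E=DFUU A E C A J T A K A"
|"r05 G=UUDU A J T A J L A E C A K B"
|"r05 W=UDUD A K A A E E A K C A E C"
|"r05 I=DUDU A E G A K E A E E A J N"
|"r05 J=UDDU A K G A E G A E W A J V"
|"r05 K=DUUD A E W A K W A K G A E I"
|"r05 L=UDUU A K I A E I A K J A K W"
|"r05 M=UDDU A K K A E J A E L A K L"
|"r05 N=FUUD A K L A K M A E J"
|"r05 V=FUDU A K N A E K A K M"
|"r05 P=DUUU A E L A K V A K K A K P"
|"r05 S=UDUD A K P A E M A K S A E L"
|"r05 T=DUDD A E S A K T A E M A E N"
primrec r06 :: "digit => row" where
"r06 A=UDUU A L A A E N A K N A K T"
|"r06 B=UDUU A L B A E V A L C A L E"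
|"r06 C=DUUD A E P A L E A L G A E V"
|"r06 E=UUDD A L G A L W A E P A G C"
|"r06 G=UDUD A L I A E S A L W A E T"
|"r06 W=DUDU A E T A L J A G G A L I"
|"r06 I=FUDU A L C A G A A L K"
|"r06 J=FDUD A G B A L L A G A"
|"r06 K=DUDU A G C A L M A G B A L G"
|"r06 L=UDDU A L N A G C A G E A L W"
|"r06 M=DUUD A G E A L V A L N A G G"
|"r06 N=FDUU A G G A L P A L V"
|"r06 V=UDFU A L S A G W A L T"
|"r06 P=DUUD A G K A L T A M A A G W"
|"r06 S=DUDU A G L A M B A G I A M A"
|"r06 T=DUDU A G J A M C A G M A M E"
primrec r07 :: "digit => row" where
"r07 A=UDUD A M E A G K A M G A G J"
|"r07 B=UUDD A M A A M W A G K A G L"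
|"r07 C=UDDU A M I A G L A G P A M W"
|"r07 E=FDUU A G M A M J A M K"
|"r07 G=DUUD A G N A M K A M L A G M"
|"r07 W=UUDU A M L A M M A G N A M G"
|"r07 I=UDUD A M N A G V A M M A G P"
|"r07 J=DUUU A G P A M V A M I A M N"
|"r07 K=DFUU A G S A M P A M S"
|"r07 L=UDDU A M P A W G A G S A M T"
|"r07 M=UDUD A M S A G T A N A A G S"
|"r07 N=DUDD A W A A N B A G T A W I"
|"r07 V=UDDD A N C A W A A W B A W J"
|"r07 P=DUUD A W B A N E A N C A W C"
|"r07 S=UDUU A N G A W C A N W A N E"
|"r07 T=DUDU A W G A N I A W E A N J"
primrec r08 :: "digit => row" where
"r08 A=DFUD A W W A N K A W E"
|"r08 B=UUUD A N J A M T A N L A W G"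
|"r08 C=UUDU A N K A N M A W W A N L"
|"r08 E=UDUU A N N A W I A N M A N B"
|"r08 G=DUDU A W J A N V A W K A N C"
|"r08 W=UDUD A N P A W K A N S A W L"
|"r08 I=DFUU A W L A N T A N P"
|"r08 J=UUDU A N T A N W A W L A V A"
|"r08 K=DUDU A W M A V B A W P A V C"
|"r08 L=UDUD A V C A W N A V E A W M"
|"r08 M=FUDD A V G A W N A W V"
|"r08 N=UDDU A V W A W V A I A A V G"
|"r08 V=FDUU A W P A V I A V J"
|"r08 P=DUUD A W S A V J A V K A W P"
|"r08 S=UUDU A V K A V L A W S A V E"
|"r08 T=UDUD A V M A W T A V L A I A"
primrec r09 :: "digit => row" where
"r09 A=DUUU A I A A V N A V W A V M"
|"r09 B=DFUU A I B A V V A V P"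
|"r09 C=UDDU A V V A I I A I B A V S"
|"r09 E=UDUD A V P A I C A V T A I B"
|"r09 G=DUDD A I E A P A A I C A I K"
|"r09 W=UDDD A P B A I E A I G A I L"
|"r09 I=DUUD A I G A P C A P B A I W"
|"r09 J=UDUU A P E A I W A P G A P C"
|"r09 K=FUUD A V S A P W A I I"
|"r09 L=FUDU A P I A I J A P W"
|"r09 M=UDUU A P J A I K A P I A P A"
|"r09 N=DUDU A I L A P K A I M A P B"
|"r09 V=FDUD A I M A P L A I N"
|"r09 P=FUDU A P G A I N A P M"
|"r09 S=DUFU A I V A P N A P V"
|"r09 T=UDUD A P V A I P A P P A I V"
primrec r0A :: "digit => row" where
"r0A A=DUDD A J B A P S A I P A I S"
|"r0A B=UDFU A P T A I S A P S"
|"r0A C=UDUU A S A A I T A S B A S C"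
|"r0A E=DUUD A J A A S C A S E A I T"
|"r0A G=UUDD A S E A S G A J A A J W"
|"r0A W=UDUD A S W A J B A S G A J C"
|"r0A I=DUDU A J C A S I A J J A S W"
|"r0A J=FUDU A S B A J E A S J"
|"r0A K=FDUD A J G A S K A J E"
|"r0A L=DUDU A J W A S L A J G A S E"
|"r0A M=UDDU A S M A J W A J I A S G"
|"r0A N=DUUD A J I A S N A S M A J J"
|"r0A V=FDUU A J J A S V A S N"
|"r0A P=DUDU A J L A S P A J K A S S"
|"r0A S=DFUD A J M A S T A J K"
|"r0A T=UDUD A S S A K B A T A A J L"
primrec r0B :: "digit => row" where
"r0B A=UUDU A S T A T B A J M A T A"
|"r0B B=UDUD A T C A J N A T B A K E"
|"r0B C=DUDD A J V A T E A J P A K G"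
|"r0B E=UDUD A T G A J P A T W A J S"
|"r0B G=DFUU A J S A T I A T G"
|"r0B W=UDDU A T I A K J A J S A T J"
|"r0B I=UDFU A T K A J T A T L"
|"r0B J=DUUD A K B A T L A T M A J T"
|"r0B K=DUDU A K C A T N A K A A T M"
|"r0B L=UUDD A T M A T V A K B A K C"
|"r0B M=UDDU A T P A K C A K E A T V"
|"r0B N=DUUU A K E A T S A T P A T C"
|"r0B V=UDUU A T T A K G B A A A T E"
|"r0B P=DFUD A K W B A B A K I"
|"r0B S=UUDU B A B B A A A K W B A C"
|"r0B T=DUDU A K J B A E A K I B A G"
primrec r0C :: "digit => row" where
"r0C A=UUUD B A G A T J B A C A K J"
|"r0C B=UDUU B A W A K K B A I B A J"
|"r0C C=DUUD A K L B A J B A K A K K"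
|"r0C E=UUDD B A K B A L A K L A K S"
|"r0C G=UDUD B A M A K M B A L A K N"
|"r0C W=DUDU A K N B A N A L A B A M"
|"r0C I=FUDU B A I A K V B A V"
|"r0C J=FDUD A K P B A P A K V"
|"r0C K=DUDU A K S B A S A K P B A K"
|"r0C L=UDDU B A T A K S A K T B A L"
|"r0C M=DUUD A K T B B A B A T A L A"
|"r0C N=FDUU A L A B B B B B A"
|"r0C V=DUDU A L C B B C A L B B B E"
|"r0C P=DFUD A L E B B G A L B"
|"r0C S=UDUD B B E A L K B B W A L C"
|"r0C T=UUDU B B G B B I A L E B B W"
primrec r0D :: "digit => row" where
"r0D A=UDUD B B J A L G B B I A L M"
|"r0D B=DUDD A L W B B K A L I A L N"
|"r0D C=UDUD B B L A L I B B M A L J"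
|"r0D E=DFUU A L J B B N B B L"
|"r0D G=UDDU B B N A L P A L J B B V"
|"r0D W=FUDD B B P A L K A L L"
|"r0D I=UDDU B B S A L L A L M B B P"
|"r0D J=DUUU A L M B B T B B S B B J"
|"r0D K=UDUU B C A A L N B C B B B K"
|"r0D L=FUDU B C B A L V B C C"
|"r0D M=FUUD B B V B C C A L P"
|"r0D N=FDUU A L S B C E B C G"
|"r0D V=DUUD A L T B C G B C W A L S"
|"r0D P=UUDF B C W B C I A L T"
|"r0D S=UDUD B C J A M A B C I A M B"
|"r0D T=DUFU A M B B C K B C J"
primrec r0E :: "digit => row" where
"r0E A=DFUU A M C B C L B C M"
|"r0E B=UDDU B C L A M J A M C B C N"
|"r0E C=UDUD B C M A M E B C V A M C"
|"r0E E=DUDD A M G B C P A M E A M L"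
|"r0E G=UDDD B C S A M G A M W A M M"
|"r0E W=DUUD A M W B C T B C S A M I"
|"r0E I=UDUU B E A A M I B E B B C T"
|"r0E J=FUUD B C N B E C A M J"
|"r0E K=FUDU B E E A M K B E C"
|"r0E L=UDUU B E G A M L B E E B C P"
|"r0E M=DUDU A M M B E W A M N B C S"
|"r0E N=FDUD A M N B E I A M V"
|"r0E V=FUDU B E B A M V B E J"
|"r0E P=UDFU B E K A M P B E L"
|"r0E S=DUUD A M T B E L B E M A M P"
|"r0E T=DUDU A N A B E N A M S B E M"
primrec r0F :: "digit => row" where
"r0F A=UUDD B E M B E V A M T A N A"
|"r0F B=UDDU B E P A N A A N B B E V"
|"r0F C=DUUD A N B B E S B E P A N N"
|"r0F E=UDUD B E T A N C B G A A N V"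
|"r0F G=DFUD A N E B G B A N G"
|"r0F W=UUDU B G B B G A A N E B G C"
|"r0F I=DUDU A N W B G E A N G B G G"
|"r0F J=UDUD B G G A V A B G C A N W"
|"r0F K=DUFU A N I B G W B G I"
|"r0F L=UDUD B G I A N J B G J A N I"
|"r0F M=DUDD A N L B G K A N J A N K"
|"r0F N=UDFU B G L A N K B G K"
|"r0F V=UDUD B G M A N L B E V A N M"
|"r0F P=DUDU A N M B G N A N N B G M"
|"r0F S=FDUU A N N B G V B E S"
|"r0F T=DFUU A N V B G P B E T"
primrec h40 :: "digit => digit => row" where
"h40 D0 = r00"
|"h40 D1 = r01"
|"h40 D2 = r02"
|"h40 D3 = r03"
|"h40 D4 = r04"
|"h40 D5 = r05"
|"h40 D6 = r06"
|"h40 D7 = r07"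
|"h40 D8 = r08"
|"h40 D9 = r09"
|"h40 DA = r0A"
|"h40 DB = r0B"
|"h40 DC = r0C"
|"h40 DD = r0D"
|"h40 DE = r0E"
|"h40 DF = r0F"
primrec r10 :: "digit => row" where
"r10 A=UDDU B G P A N S A N V B G S"
|"r10 B=DUDU A N S B G T A N P B W A"
|"r10 C=UUDD B W A B G S A V A A N S"
|"r10 E=UDFU B W B A N T B W C"
|"r10 G=DUUD A V A B W C B W A A N T"
|"r10 W=DFUU A V B B W E B W G"
|"r10 I=UDDU B W E A V I A V B B W W"
|"r10 J=UDUD B W G A V C B W I A V B"
|"r10 K=DUDD A V E B W J A V C A V K"
|"r10 L=UDDD B W K A V E A V G A V L"
|"r10 M=DUUD A V G B W L B W K A V W"
|"r10 N=UDUU B W M A V W B W N B W L"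
|"r10 V=FUUD B W W B W V A V I"
|"r10 P=FUDU B W P A V J B W V"
|"r10 S=UDUU B W S A V K B W P B W J"
|"r10 T=DUDU A V L B W T A V M B W K"
primrec r11 :: "digit => row" where
"r11 A=FDUD A V M B I A A V N"
|"r11 B=FUDU B W N A V N B I B"
|"r11 C=UDFU B I C A V V B I E"
|"r11 E=DUUD A V S B I E B I G A V V"
|"r11 G=DUDU A V T B I W A V P B I G"
|"r11 W=UUDD B I G B I I A V S A V T"
|"r11 I=UDDU B I J A V T A P A B I I"
|"r11 J=DUUD A P A B I K B I J A P J"
|"r11 K=UDUD B I L A P B B I M A P K"
|"r11 L=DFUD A P C B I N A P E"
|"r11 M=UUDU B I N B I M A P C B I V"
|"r11 N=DUDU A P G B I P A P E B I S"
|"r11 V=UDUD B I S A P M B I V A P G"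
|"r11 P=UDUD B I T A P W B I I A P I"
|"r11 S=DUDU A P I B J A A P J B I T"
|"r11 T=FDUU A P J B J B B I K"
primrec r12 :: "digit => row" where
"r12 A=DFUU A P K B J C B I L"
|"r12 B=UDDU B J C A P L A P K B J E"
|"r12 C=FUDD B J E A P M A P L"
|"r12 E=FFDU A P N B J G"
|"r12 G=FDUD A P V B J W A P N"
|"r12 W=DUDF A P P B J I A P V"
|"r12 I=UDDF B J J A P P A P S"
|"r12 J=DUUD A P S B J K B J J A P T"
|"r12 K=FDUU A P T B J L B J K"
|"r12 L=DUDU A S B B J M A S A B J N"
|"r12 M=DFUD A S C B J V A S A"
|"r12 N=UDUD B J N A S J B J P A S B"
|"r12 V=UUDU B J V B J S A S C B J P"
|"r12 P=UDUD B J T A S E B J S A S L"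
|"r12 S=DUDD A S G B K A A S W A S M"
|"r12 T=UDUD B K B A S W B K C A S I"
primrec r13 :: "digit => row" where
"r13 A=DFUU A S I B K E B K B"
|"r13 B=UDDU B K E A S V A S I B K G"
|"r13 C=FUDD B K W A S J A S K"
|"r13 E=UDDU B K I A S K A S L B K W"
|"r13 G=DUUU A S L B K J B K I B J T"
|"r13 W=UDUU B K K A S M B K L B K A"
|"r13 I=FUDU B K L A S N B K M"
|"r13 J=FUUD B K G B K M A S V"
|"r13 K=DFFU A S P B K N"
|"r13 L=UDUD B K N A S S B K V A S P"
|"r13 M=DUDD A T A B K P A S S A S T"
|"r13 N=UDFU B K S A S T B K P"
|"r13 V=UDDD B K T A T A A T V A T B"
|"r13 P=DUDU A T B B L A A T C B K T"
|"r13 S=FDUD A T C B L B A T S"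
|"r13 T=DFUD A T E B L C A T T"
primrec r14 :: "digit => row" where
"r14 A=UDDU B L C A T W A T E B L E"
|"r14 B=DUDU A T W B L G A T G B L W"
|"r14 C=UUDD B L W B L E A T J A T W"
|"r14 E=UDFU B L I A T I B L J"
|"r14 G=DUUD A T J B L J B L W A T I"
|"r14 W=FDUU A T K B L K B L L"
|"r14 I=DUUD A T L B L L B L M A T K"
|"r14 J=UUDF B L M B L N A T L"
|"r14 K=UDUD B L V A T M B L N A T N"
|"r14 L=DUFU A T N B L P B L V"
|"r14 M=DUUD A T V B L S B K T A T P"
|"r14 N=UDUU B L T A T P B M A B L S"
|"r14 V=FUDU B M A A T S B M B"
|"r14 P=DUDU B A A B M C A T T B M E"
|"r14 S=UDUD B M E B A C B L E B A A"
|"r14 T=UDFU B M G B A B B M W"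
primrec r15 :: "digit => row" where
"r15 A=DUDD B A C B M W B A G B A B"
|"r15 B=DUFU B A E B M I B M J"
|"r15 C=UDUD B M J B A G B M K B A E"
|"r15 E=DUDU B A I B M L B A W B M M"
|"r15 G=DFUD B A J B M N B A W"
|"r15 W=UDUD B M M B A V B M V B A I"
|"r15 I=UUDU B M N B M P B A J B M V"
|"r15 J=UDUD B M S B A K B M P B A S"
|"r15 K=DUDD B A L B M T B A M B A T"
|"r15 L=UDUD B N A B A M B N B B A N"
|"r15 M=DFUU B A N B N C B N A"
|"r15 N=UDDU B N C B B B B A N B N E"
|"r15 V=FUDD B N G B A V B A P"
|"r15 P=UDDU B N W B A P B A S B N G"
|"r15 S=DUUU B A S B N I B N W B M S"
|"r15 T=UDUU B N J B A T B N K B M T"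
primrec r16 :: "digit => row" where
"r16 A=FUDU B N K B B A B N L"
|"r16 B=FUUD B N E B N L B B B"
|"r16 C=DFFU B B C B N M"
|"r16 E=UDUD B N M B B E B N N B B C"
|"r16 G=DUDD B B W B N V B B E B B G"
|"r16 W=UDFU B N P B B G B N V"
|"r16 I=UDDD B N S B B W B B P B B I"
|"r16 J=DUDU B B I B N T B B J B N S"
|"r16 K=FDUD B B J B V A B B T"
|"r16 L=DFUD B B K B V B B C A"
|"r16 M=UDDU B V B B B M B B K B V C"
|"r16 N=DUDU B B M B V E B B L B V G"
|"r16 V=UUDD B V G B V C B B V B B M"
|"r16 P=UDFU B V W B B N B V I"
|"r16 S=DUUD B B V B V I B V G B B N"
|"r16 T=DUUD B B P B V J B N S B B S"
primrec r17 :: "digit => row" where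
"r17 A=UDUU B V K B B S B V L B V J"
|"r17 B=FUDU B V L B B T B V M"
|"r17 C=DUDU B C B B V N B C A B V V"
|"r17 E=UDUD B V V B C C B V C B C B"
|"r17 G=FFUD B V P B C E"
|"r17 W=FUDU B V S B C G B V P"
|"r17 I=UDUF B V T B C W B V S"
|"r17 J=DUDF B C I B P A B C J"
|"r17 K=FDUD B C J B P B B C K"
|"r17 L=FFDU B C K B P C"
|"r17 M=UDFU B P E B C L B P G"
|"r17 N=DUUD B C N B P G B P W B C L"
|"r17 V=DUDU B C V B P I B C M B P W"
|"r17 P=UUDD B P W B P J B C N B C V"
|"r17 S=UDDU B P K B C V B C P B P J"
|"r17 T=DUUD B C P B P L B P K B E G"
primrec r18 :: "digit => row" where
"r18 A=UDUD B P M B C S B P N B E W"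
|"r18 B=DFUD B C T B P V B E A"
|"r18 C=UUDU B P V B P N B C T B P P"
|"r18 E=DUDU B E B B P S B E A B P T"
|"r18 G=UDUD B P T B E J B P P B E B"
|"r18 W=UDUD B S A B E C B P J B E E"
|"r18 I=DUDU B E E B S B B E G B S A"
|"r18 J=FDUU B E G B S C B P L"
|"r18 K=DFUU B E W B S E B P M"
|"r18 L=UDDU B S E B E I B E W B S G"
|"r18 M=FUDD B S G B E J B E I"
|"r18 N=DFUD B E L B S W B E K"
|"r18 V=UUDF B S W B S I B E L"
|"r18 P=UDUD B S J B E M B S I B E N"
|"r18 S=DUFU B E N B S K B S J"
|"r18 T=DUDD B E V B S L B G M B E P"
primrec r19 :: "digit => row" where
"r19 A=UDUU B S M B E P B S N B S L"
|"r19 B=FUDU B S N B E S B S V"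
|"r19 C=DUDU B G A B S P B E T B S S"
|"r19 E=UDDD B S S B G C B G S B G A"
|"r19 G=UDFU B S T B G B B T A"
|"r19 W=DUDD B G C B T A B G G B G B"
|"r19 I=DFFU B G E B T B"
|"r19 J=UDUD B T B B G G B T C B G E"
|"r19 K=FFDU B G W B T E"
|"r19 L=FDUD B G I B T G B G W"
|"r19 M=DUDF B G J B T W B G I"
|"r19 N=UDDF B T I B G J B G K"
|"r19 V=DUUD B G K B T J B T I B G L"
|"r19 P=FDUU B G L B T K B T J"
|"r19 S=UDUD B T L B G M B T M B G N"
|"r19 T=DFUU B G N B T N B T L"
primrec r1A :: "digit => row" where
"r1A A=UDDU B T N B G V B G N B T V"
|"r1A B=FUUD B T V B S V B G V"
|"r1A C=UDFU B T P B G P B T S"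
|"r1A E=DUUD B G S B T S B S S B G P"
|"r1A G=DUFU B G T B T T C A A"
|"r1A W=UDUD C A A B W A C A B B G T"
|"r1A I=FDUU B W B C A C C A E"
|"r1A J=DUUD B W C C A E C A G B W B"
|"r1A K=UUDF C A G C A B B W C"
|"r1A L=UDFU C A W B W E C A I"
|"r1A M=DUUD B W W C A I C A J B W E"
|"r1A N=DUDU B W I C A K B W G C A J"
|"r1A V=UUDD C A J C A L B W W B W I"
|"r1A P=UDDU C A M B W I B W J C A L"
|"r1A S=DUUD B W J C A N C A M B W S"
|"r1A T=UDUD C A V B W K C A P B W T"
primrec r1B :: "digit => row" where
"r1B A=DFUD B W L C A S B W M"
|"r1B B=UUDU C A S C A P B W L C A T"
|"r1B C=DUDU B W N C B A B W M C B B"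
|"r1B E=UDUD C B B B I B C A T B W N"
|"r1B G=UDUD C B C B W V C A L B W P"
|"r1B W=DUDU B W P C B E B W S C B C"
|"r1B I=FDUU B W S C B G C A N"
|"r1B J=DFUU B W T C B W C A V"
|"r1B K=UDDU C B W B I A B W T C B I"
|"r1B L=FUDD C B I B I B B I A"
|"r1B M=DFUD B I E C B J B I C"
|"r1B N=UUDF C B J C B K B I E"
|"r1B V=UDUD C B L B I G C B K B I W"
|"r1B P=DUFU B I W C B M C B L"
|"r1B S=DUDD B I I C B N B I T B I J"
|"r1B T=UDUU C B V B I J C B P C B N"
primrec r1C :: "digit => row" where
"r1C A=FUDU C B P B I K C B S"
|"r1C B=DUDU B I M C B T B I L C C A"
|"r1C C=UDDD C C A B I V B J E B I M"
|"r1C E=UDFU C C B B I N C C C"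
|"r1C G=DUDD B I V C C C B I S B I N"
|"r1C W=DFFU B I P C C E"
|"r1C I=UDUD C C E B I S C C G B I P"
|"r1C J=UDUD C C W B I T C C I B J A"
|"r1C K=DFUU B J A C C J C C W"
|"r1C L=UDDU C C J B J B B J A C C K"
|"r1C M=FUUD C C K C B S B J B"
|"r1C N=UDFU C C L B J C C C M"
|"r1C V=DUUD B J E C C M C C A B J C"
|"r1C P=FUDD C C N B J G B J W"
|"r1C S=UDDU C C V B J W B J I C C N"
|"r1C T=DUUF B J I C C P C C V"
primrec r1D :: "digit => row" where
"r1D A=UDUF C C S B J J C C T"
|"r1D B=FUDU C C T B J K C E A"
|"r1D C=FFUD C E A B J L"
|"r1D E=DFFU B J M C E B"
|"r1D G=UDUD C E B B J N C E C B J M"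
|"r1D W=DUDD B J P C E E B J N B J V"
|"r1D I=UDFU C E G B J V C E E"
|"r1D J=UDDD C E W B J P B K W B J S"
|"r1D K=DUDU B J S C E I B J T C E W"
|"r1D L=FDUD B J T C E J B K J"
|"r1D M=DFUD B K A C E K B K K"
|"r1D N=UDDU C E K B K C B K A C E L"
|"r1D V=DUDU B K C C E M B K B C E N"
|"r1D P=UUDD C E N C E L B K G B K C"
|"r1D S=UDFU C E V B K E C E P"
|"r1D T=DUUD B K G C E P C E N B K E"
primrec r1E :: "digit => row" where
"r1E A=DUUD B K W C E S C E W B K I"
|"r1E B=UDUU C E T B K I C G A C E S"
|"r1E C=FUDU C G A B K J C G B"
|"r1E E=DUDU B K L C G C B K K C G E"
|"r1E G=UDUD C G E B K M C E L B K L"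
|"r1E W=DUDF B K V C G G B K N"
|"r1E I=UDDF C G W B K V B K P"
|"r1E J=DUUD B K P C G I C G W B K S"
|"r1E K=FDUU B K S C G J C G I"
|"r1E L=UDUD C G K B K T C G L B L A"
|"r1E M=DFUU B L A C G M C G K"
|"r1E N=UDDU C G M B L B B L A C G N"
|"r1E V=FUDD C G N B M B B L B"
|"r1E P=UDFU C G V B L C C G P"
|"r1E S=DUDD B L E C G P B M E B L C"
|"r1E T=DUFU B L G C G S C G T"
primrec r1F :: "digit => row" where
"r1F A=UDUD C G T B L W C W A B L G"
|"r1F B=DFUD B L J C W B B L I"
|"r1F C=UUDF C W B C W A B L J"
|"r1F E=FFUD C W C B L K"
|"r1F G=FUDU C W E B L L C W C"
|"r1F W=UDUF C W G B L M C W E"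
|"r1F I=DUDF B L N C W W B L V"
|"r1F J=FDUD B L V C W I B L P"
|"r1F K=FFDU B L P C W J"
|"r1F L=DFUD B L S C W K B L T"
|"r1F M=UUDU C W K C G L B L S C W L"
|"r1F N=DUDU B M A C W M B L T C W N"
|"r1F V=UDUD C W N B M B C W L B M A"
|"r1F P=DFFU B M C C W V"
|"r1F S=UDUD C W V B M E C W P B M C"
|"r1F T=FDUU B M G C W S C W T"
primrec h41 :: "digit => digit => row" where
"h41 D0 = r10"
|"h41 D1 = r11"
|"h41 D2 = r12"
|"h41 D3 = r13"
|"h41 D4 = r14"
|"h41 D5 = r15"
|"h41 D6 = r16"
|"h41 D7 = r17"
|"h41 D8 = r18"
|"h41 D9 = r19"
|"h41 DA = r1A"
|"h41 DB = r1B"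
|"h41 DC = r1C"
|"h41 DD = r1D"
|"h41 DE = r1E"
|"h41 DF = r1F"
primrec r20 :: "digit => row" where
"r20 A=DUUD B M W C W T C I A B M G"
|"r20 B=UDDF C I A B M K B M W"
|"r20 C=FFDU B M I C I B"
|"r20 E=FDUD B M J C I C B M I"
|"r20 G=DUDF B M K C I E B M J"
|"r20 W=DFFU B M L C I G"
|"r20 I=UDUD C I G B M M C I W B M L"
|"r20 J=DUDD B M V C I I B M M B M N"
|"r20 K=UDFU C I J B M N C I I"
|"r20 L=UDDD C I K B M V B N G B M P"
|"r20 M=DUDU B M P C I L B M S C I K"
|"r20 N=FDUD B M S C I M B N I"
|"r20 V=DFUD B M T C I N B N J"
|"r20 P=UDDU C I N B N B B M T C I V"
|"r20 S=DUDU B N B C I P B N A C I S"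
|"r20 T=UUDD C I S C I V B N E B N B"
primrec r21 :: "digit => row" where
"r21 A=UDFU C I T B N C C J A"
|"r21 B=DUUD B N E C J A C I S B N C"
|"r21 C=DUUD B N G C J B C I K B N W"
|"r21 E=UDUU C J C B N W C J E C J B"
|"r21 G=FUDU C J E B N I C J G"
|"r21 W=DUDU B N K C J W B N J C J I"
|"r21 I=UDUD C J I B N L C I V B N K"
|"r21 J=DUDF B N N C J J B N M"
|"r21 K=UDDF C J K B N N B N V"
|"r21 L=DUUD B N V C J L C J K B N P"
|"r21 M=FDUU B N P C J M C J L"
|"r21 N=UDUD C J N B N S C J V B N T"
|"r21 V=DFUU B N T C J P C J N"
|"r21 P=UDDU C J P B V A B N T C J S"
|"r21 S=FUDD C J S B V M B V A"
|"r21 T=UDFU C J T B V B C K A"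
primrec r22 :: "digit => row" where
"r22 A=DUDD B V C C K A B V V B V B"
|"r22 B=DUFU B V E C K B C K C"
|"r22 C=UDUD C K C B V G C K E B V E"
|"r22 E=DFUD B V I C K G B V W"
|"r22 G=UUDF C K G C K E B V I"
|"r22 W=DFUD B V J C K W B V K"
|"r22 I=UUDU C K W C J V B V J C K I"
|"r22 J=DUDU B V L C K J B V K C K K"
|"r22 K=UDUD C K K B V M C K I B V L"
|"r22 L=DFFU B V N C K L"
|"r22 M=UDUD C K L B V V C K M B V N"
|"r22 N=UDFD C K N B V P B V S"
|"r22 V=DUDU B V S C K V B V T C K N"
|"r22 P=FDUF B V T C K P"
|"r22 S=DFUF B P A C K S"
|"r22 T=UDDU C K S B P B B P A C K T"
primrec r23 :: "digit => row" where
"r23 A=FUDD C K T B P C B P B"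
|"r23 B=DFUD B P G C L A B P E"
|"r23 C=UUDF C L A C L B B P G"
|"r23 E=UDUD C L C B P W C L B B P I"
|"r23 G=DUFU B P I C L E C L C"
|"r23 W=DUDD B P J C L G B S A B P K"
|"r23 I=UDUU C L W B P K C L I C L G"
|"r23 J=FUDU C L I B P L C L J"
|"r23 K=DUDU B P N C L K B P M C L L"
|"r23 L=UDDD C L L B P P B S G B P N"
|"r23 M=UDFU C L M B P V C L N"
|"r23 N=DUDD B P P C L N B P T B P V"
|"r23 V=DFFU B P S C L V"
|"r23 P=UDUD C L V B P T C L P B P S"
|"r23 S=UDUD C L S B S A C L T B S B"
|"r23 T=DFUU B S B C M A C L S"
primrec r24 :: "digit => row" where
"r24 A=UDDU C M A B S C B S B C M B"
|"r24 B=FUUD C M B C L J B S C"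
|"r24 C=UDFU C M C B S E C M E"
|"r24 E=DUUD B S G C M E C L L B S E"
|"r24 G=UDFF C M G B S W"
|"r24 W=DUDF B S I C M W B S J"
|"r24 I=FDUD B S J C M I B S K"
|"r24 J=FFDU B S K C M J"
|"r24 K=DFUD B S L C M K B S M"
|"r24 L=UDDU C M K B T M B S L C M L"
|"r24 M=DUDU B S N C M M B S M C M N"
|"r24 N=UDUD C M N B S V C M L B S N"
|"r24 V=DFFU B S P C M V"
|"r24 P=UDUD C M V B S S C M P B S P"
|"r24 S=FDUU B S T C M S C M T"
|"r24 T=DUUD B T A C M T C N A B S T"
primrec r25 :: "digit => row" where
"r25 A=UDDF C N A B T C B T A"
|"r25 B=DUDF B T C C N B B T B"
|"r25 C=FUDD C N C B T E B T G"
|"r25 E=UDDU C N E B T G B T W C N C"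
|"r25 G=DUUF B T W C N G C N E"
|"r25 W=UDUF C N W B T I C N I"
|"r25 I=FUDU C N I B T J C N J"
|"r25 J=FFUD C N J B T K"
|"r25 K=DUDU B T M C N K B T L C N L"
|"r25 L=UUDD C N L C M L B T V B T M"
|"r25 M=UDFU C N M B T N C N N"
|"r25 N=DUUD B T V C N N C N L B T N"
|"r25 V=DFUD B T S C N V B T P"
|"r25 P=UUDF C N V C M P B T S"
|"r25 S=FFDU B T T C N P"
|"r25 T=FDUD C A A C N S B T T"
primrec r26 :: "digit => row" where
"r26 A=DUDF C A B C N T C A A"
|"r26 B=FFUD C V A C A C"
|"r26 C=FUDU C V B C A E C V A"
|"r26 E=UDUF C V C C A G C V B"
|"r26 G=DFUD C A I C V E C A W"
|"r26 W=UUDF C V E C V G C A I"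
|"r26 I=UDUD C V W C A J C V G C A K"
|"r26 J=DUFU C A K C V I C V W"
|"r26 K=DUDD C A L C V J C B C C A M"
|"r26 L=UDUU C V K C A M C V L C V J"
|"r26 M=FUDU C V L C A N C V M"
|"r26 N=DUDU C A P C V N C A V C V V"
|"r26 V=UDDD C V V C A T C B I C A P"
|"r26 P=UDFU C V P C A S C V S"
|"r26 S=DUDD C A T C V S C B B C A S"
|"r26 T=DFFU C B A C V T"
primrec r27 :: "digit => row" where
"r27 A=UDUD C V T C B B C P A C B A"
|"r27 B=UDUD C P B C B C C P C C B E"
|"r27 C=DFUU C B E C P E C P B"
|"r27 E=UDDU C P E C B G C B E C P G"
|"r27 G=FUUD C P G C V M C B G"
|"r27 W=UDFU C P W C B W C P I"
|"r27 I=DUUD C B I C P I C V V C B W"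
|"r27 J=UDFF C P J C B J"
|"r27 K=DUDF C B K C P K C B L"
|"r27 L=FDUD C B L C P L C B M"
|"r27 M=FFDU C B M C P M"
|"r27 N=DFUD C B N C P N C B V"
|"r27 V=UDDU C P N C C I C B N C P V"
|"r27 P=DUDU C B P C P P C B V C P S"
|"r27 S=UDUD C P S C B S C P V C B P"
|"r27 T=DFFU C B T C P T"
primrec r28 :: "digit => row" where
"r28 A=UDUD C P T C C A C S A C B T"
|"r28 B=FDUU C C B C S B C S C"
|"r28 C=DUUD C C C C S C C S E C C B"
|"r28 E=UDDF C S E C C G C C C"
|"r28 G=DUDF C C G C S G C C E"
|"r28 W=DUDU C C I C S W C C W C S I"
|"r28 I=UUDD C S I C P V C C K C C I"
|"r28 J=UDFU C S J C C J C S K"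
|"r28 K=DUUD C C K C S K C S I C C J"
|"r28 L=DFUD C C M C S L C C L"
|"r28 M=UUDF C S L C S A C C M"
|"r28 N=DUFD C C N C S M C C V"
|"r28 V=UDUU C S N C C V C S V C S M"
|"r28 P=FUDU C S V C C P C S P"
|"r28 S=DUDU C C T C S S C C S C S T"
|"r28 T=UDFD C S T C E A C C T"
primrec r29 :: "digit => row" where
"r29 A=DUDF C E C C T A C E B"
|"r29 B=UDDF C T B C E C C E E"
|"r29 C=DUUD C E E C T C C T B C E G"
|"r29 E=FDUU C E G C T E C T C"
|"r29 G=UDUD C T G C E W C T W C E I"
|"r29 W=DFUU C E I C T I C T G"
|"r29 I=UDDU C T I C E J C E I C T J"
|"r29 J=FUDD C T J C G B C E J"
|"r29 K=UDFU C T K C E K C T L"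
|"r29 L=DUDD C E L C T L C G E C E K"
|"r29 M=DUFU C E M C T M C T N"
|"r29 N=UDUD C T N C E N C T V C E M"
|"r29 V=DFUD C E P C T P C E V"
|"r29 P=UUDF C T P C T V C E P"
|"r29 S=DFUD C E S C T S C E T"
|"r29 T=UUDU C T S C T W C E S C T T"
primrec r2A :: "digit => row" where
"r2A A=DUDU C G A E A A C E T E A B"
|"r2A B=UDUD E A B C G B C T T C G A"
|"r2A C=DFFU C G C E A C"
|"r2A E=UDUD E A C C G E E A E C G C"
|"r2A G=DUFF C G G E A G"
|"r2A W=UDUF E A W C G W E A I"
|"r2A I=FUDU E A I C G I E A J"
|"r2A J=FFUD E A J C G J"
|"r2A K=DUDU C G L E A K C G K E A L"
|"r2A L=UDDD E A L C W L C G N C G L"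
|"r2A M=UDFU E A M C G M E A N"
|"r2A N=DUUD C G N E A N E A L C G M"
|"r2A V=DFUD C G P E A V C G V"
|"r2A P=UDDF E A V C W P C G P"
|"r2A S=FFDU C G S E A P"
|"r2A T=FDUD C G T E A S C G S"
primrec r2B :: "digit => row" where
"r2B A=DUDF C W A E A T C G T"
|"r2B B=UDFF E B A C W B"
|"r2B C=UDFD E B B C W C C W E"
|"r2B E=DUDU C W E E B C C W G E B B"
|"r2B G=FDUF C W G E B E"
|"r2B W=DFUF C W W E B G"
|"r2B I=UDDU E B G C W I C W W E B W"
|"r2B J=FUDD E B W C W J C W I"
|"r2B K=UDFU E B I C W K E B J"
|"r2B L=DUDD C W L E B J C W N C W K"
|"r2B M=DFFU C W M E B K"
|"r2B N=UDUD E B K C W N E B L C W M"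
|"r2B V=DUDF C W P E B M C W V"
|"r2B P=FFUD E B N C W S"
|"r2B S=FUDU E B V C W T E B N"
|"r2B T=UDUF E B P C I A E B V"
primrec r2C :: "digit => row" where
"r2C A=FUDD E B S C I B C I C"
|"r2C B=UDDU E B T C I C C I E E B S"
|"r2C C=DUUF C I E E C A E B T"
|"r2C E=DUDF C I W E C B C I G"
|"r2C G=UDDF E C C C I W C I I"
|"r2C W=DUUD C I I E C E E C C C I J"
|"r2C I=FDUU C I J E C G E C E"
|"r2C J=UDUD E C W C I K E C I C I L"
|"r2C K=DFUU C I L E C J E C W"
|"r2C L=UDDU E C J C I M C I L E C K"
|"r2C M=FUDD E C K C J G C I M"
|"r2C N=UDFU E C L C I N E C M"
|"r2C V=DUDD C I V E C M C J I C I N"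
|"r2C P=DUFU C I P E C N E C V"
|"r2C S=UDUD E C V C I S E C P C I P"
|"r2C T=DFUD C J A E C S C I T"
primrec r2D :: "digit => row" where
"r2D A=UUDF E C S E C P C J A"
|"r2D B=DFUD C J B E C T C J C"
|"r2D C=UUDU E C T E C I C J B E E A"
|"r2D E=DUDU C J E E E B C J C E E C"
|"r2D G=UDUD E E C C J G E E A C J E"
|"r2D W=DFFU C J W E E E"
|"r2D I=UDUD E E E C J I E E G C J W"
|"r2D J=DUFF C J J E E W"
|"r2D K=UDUF E E I C J K E E J"
|"r2D L=FUDU E E J C J L E E K"
|"r2D M=FFUD E E K C J M"
|"r2D N=DUDU C J V E E L C J N E E M"
|"r2D V=UDDD E E M C K I C J S C J V"
|"r2D P=UDFU E E N C J P E E V"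
|"r2D S=DUUD C J S E E V E E M C J P"
|"r2D T=DFUD C K A E E P C J T"
primrec r2E :: "digit => row" where
"r2E A=UDDF E E P C K M C K A"
|"r2E B=FFDU C K B E E S"
|"r2E C=FDUD C K C E E T C K B"
|"r2E E=DUDF C K E E G A C K C"
|"r2E G=UDFF E G B C K G"
|"r2E W=UDFU E G C C K W E G E"
|"r2E I=DUDD C K I E G E C K K C K W"
|"r2E J=DFFU C K J E G G"
|"r2E K=UDUD E G G C K K E G W C K J"
|"r2E L=DUDF C K M E G I C K L"
|"r2E M=UDUD E G J C K N E G K C K V"
|"r2E N=DFUU C K V E G L E G J"
|"r2E V=UDDU E G L C K P C K V E G M"
|"r2E P=FUFD E G M C K P"
|"r2E S=UDFU E G N C K S E G V"
|"r2E T=DUFD C K T E G V C K S"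
primrec r2F :: "digit => row" where
"r2F A=UDFF E G P C L A"
|"r2F B=DUDF C L B E G S C L C"
|"r2F C=FDUD C L C E G T C L E"
|"r2F E=FFDU C L E E W A"
|"r2F G=DFUD C L G E W B C L W"
|"r2F W=UDDU E W B C L T C L G E W C"
|"r2F I=DUDU C L I E W E C L W E W G"
|"r2F J=UDUD E W G C L J E W C C L I"
|"r2F K=DFFU C L K E W W"
|"r2F L=UDUD E W W C L L E W I C L K"
|"r2F M=FDUU C L M E W J E W K"
|"r2F N=DUUD C L N E W K E W L C L M"
|"r2F V=UDDF E W L C L P C L N"
|"r2F P=DUDF C L P E W M C L V"
|"r2F S=DUDU C L T E W N C L S E W V"
|"r2F T=UUDD E W V E W C C M B C L T"
primrec h42 :: "digit => digit => row" where
"h42 D0 = r20"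
|"h42 D1 = r21"
|"h42 D2 = r22"
|"h42 D3 = r23"
|"h42 D4 = r24"
|"h42 D5 = r25"
|"h42 D6 = r26"
|"h42 D7 = r27"
|"h42 D8 = r28"
|"h42 D9 = r29"
|"h42 DA = r2A"
|"h42 DB = r2B"
|"h42 DC = r2C"
|"h42 DD = r2D"
|"h42 DE = r2E"
|"h42 DF = r2F"
primrec r30 :: "digit => row" where
"r30 A=UDFU E W P C M A E W S"
|"r30 B=DUUD C M B E W S E W V C M A"
|"r30 C=DFUD C M E E W T C M C"
|"r30 E=UUDF E W T E W I C M E"
|"r30 G=FDUF C M G E I A"
|"r30 W=DFUF C M W E I B"
|"r30 I=UDDU E I B C M I C M W E I C"
|"r30 J=FUDD E I C C M J C M I"
|"r30 K=UDFU E I E C M K E I G"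
|"r30 L=DUDD C M L E I G C M N C M K"
|"r30 M=DFFU C M M E I W"
|"r30 N=UDUD E I W C M N E I I C M M"
|"r30 V=DUDF C M P E I J C M V"
|"r30 P=FFUD E I K C M S"
|"r30 S=FUDU E I L C M T E I K"
|"r30 T=UDUF E I M C N A E I L"
primrec r31 :: "digit => row" where
"r31 A=DUFF C N B E I N"
|"r31 B=DUFD C N C E I V C N E"
|"r31 C=UDUU E I P C N E E I S E I V"
|"r31 E=FUDU E I S C N G E I T"
|"r31 G=DUDU C N I E J A C N W E J B"
|"r31 W=UDFD E J B C N J C N I"
|"r31 I=DUFU C N K E J C E J E"
|"r31 J=UDUD E J E C N L E J G C N K"
|"r31 K=DFUD C N N E J W C N M"
|"r31 L=UUDF E J W E J G C N N"
|"r31 M=UDFF E J I C N V"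
|"r31 N=FUDD E J J C N P C N S"
|"r31 V=UDDU E J K C N S C N T E J J"
|"r31 P=DFUF C N T E J K"
|"r31 S=UDFD E J L C V A C V B"
|"r31 T=DUDU C V B E J M C V C E J L"
primrec r32 :: "digit => row" where
"r32 A=FDUF C V C E J N"
|"r32 B=UDFF E J V C V E"
|"r32 C=DUDF C V G E J P C V W"
|"r32 E=FDUD C V W E J S C V I"
|"r32 G=FFDU C V I E J T"
|"r32 W=DFUD C V J E K A C V K"
|"r32 I=UDDU E K A C P C C V J E K B"
|"r32 J=DUDU C V L E K C C V K E K E"
|"r32 K=UDUD E K E C V M E K B C V L"
|"r32 L=DFFU C V N E K G"
|"r32 M=UDUD E K G C V V E K W C V N"
|"r32 N=FDUU C V P E K I E K J"
|"r32 V=DUUD C V S E K J E K K C V P"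
|"r32 P=UDDF E K K C P A C V S"
|"r32 S=DUDF C P A E K L C V T"
|"r32 T=DUDU C P C E K M C P B E K N"
primrec r33 :: "digit => row" where
"r33 A=UUDD E K N E K B C P G C P C"
|"r33 B=UDFU E K V C P E E K P"
|"r33 C=DUUD C P G E K P E K N C P E"
|"r33 E=DFUD C P I E K S C P W"
|"r33 G=UUDF E K S E K W C P I"
|"r33 W=FDUF C P J E K T"
|"r33 I=DFUF C P K E L A"
|"r33 J=UDDU E L A C P L C P K E L B"
|"r33 K=FUDD E L B C P M C P L"
|"r33 L=UDFU E L C C P N E L E"
|"r33 M=DUDD C P V E L E C P S C P N"
|"r33 N=DFFU C P P E L G"
|"r33 V=UDUD E L G C P S E L W C P P"
|"r33 P=DUDF C S A E L I C P T"
|"r33 S=FFUD E L J C S B"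
|"r33 T=FUDU E L K C S C E L J"
primrec r34 :: "digit => row" where
"r34 A=UDUF E L L C S E E L K"
|"r34 B=DUFF C S G E L M"
|"r34 C=DUFU C S W E L N E L V"
|"r34 E=UDUD E L V C S I E L P C S W"
|"r34 G=DFUD C S K E L S C S J"
|"r34 W=UUDF E L S E L P C S K"
|"r34 I=UDFF E L T C S L"
|"r34 J=DFUD C S M E M A C S N"
|"r34 K=UFDU E M A C S M E M B"
|"r34 L=DUDU C S V E M C C S N E M E"
|"r34 M=UDUD E M E C S P E M B C S V"
|"r34 N=DFFU C S S E M G"
|"r34 V=UDUD E M G C S T E M W C S S"
|"r34 P=DUFF C T A E M I"
|"r34 S=UDUF E M J C T B E M K"
|"r34 T=FUDU E M K C T C E M L"
primrec r35 :: "digit => row" where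
"r35 A=FFUD E M L C T E"
|"r35 B=DUDU C T W E M M C T G E M N"
|"r35 C=UDDD E M N C T T C T J C T W"
|"r35 E=UDFU E M V C T I E M P"
|"r35 G=DUUD C T J E M P E M N C T I"
|"r35 W=DFUD C T L E M S C T K"
|"r35 I=UDDF E M S E A E C T L"
|"r35 J=FFDU C T M E M T"
|"r35 K=FDUD C T N E N A C T M"
|"r35 L=DUDF C T V E N B C T N"
|"r35 M=UDFF E N C C T P"
|"r35 N=UDFU E N E C T S E N G"
|"r35 V=DUDD C T T E N G E A B C T S"
|"r35 P=DFFU E A A E N W"
|"r35 S=UDUD E N W E A B E N I E A A"
|"r35 T=DUDF E A E E N J E A C"
primrec r36 :: "digit => row" where
"r36 A=FFDU E A G E N K"
|"r36 B=DUDU E A I E N L E A W E N M"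
|"r36 C=UDFD E N M E A J E A I"
|"r36 E=DFFU E A K E N N"
|"r36 G=UDUD E N N E A L E N V E A K"
|"r36 W=DFUD E A N E N P E A M"
|"r36 I=UUDF E N P E N V E A N"
|"r36 J=UDFF E N S E A V"
|"r36 K=FUDD E N T E A P E A S"
|"r36 L=UDDU E V A E A S E A T E N T"
|"r36 M=DFUF E A T E V A"
|"r36 N=FDUF E B A E V B"
|"r36 V=UDUD E V C E B B E V E E B C"
|"r36 P=DFUU E B C E V G E V C"
|"r36 S=UDDU E V G E B E E B C E V W"
|"r36 T=FUFD E V W E B E"
primrec r37 :: "digit => row" where
"r37 A=UDFU E V I E B G E V J"
|"r37 B=DUFD E B W E V J E B G"
|"r37 C=FDUU E B I E V K E V L"
|"r37 E=DUUD E B J E V L E V M E B I"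
|"r37 G=UDDF E V M E B L E B J"
|"r37 W=DUDF E B L E V N E B K"
|"r37 I=DUFF E B M E V V"
|"r37 J=UDFD E V P E B N E B V"
|"r37 K=DUDU E B V E V S E B P E V P"
|"r37 L=DUFD E B S E V T E B T"
|"r37 M=UDUU E P A E B T E P B E V T"
|"r37 N=FUDU E P B E C A E P C"
|"r37 V=DUFF E C B E P E"
|"r37 P=UDUF E P G E C C E P W"
|"r37 S=FUDU E P W E C E E P I"
|"r37 T=FFUD E P I E C G"
primrec r38 :: "digit => row" where
"r38 A=DUDU E C I E P J E C W E P K"
|"r38 B=UDDD E P K E E A E C K E C I"
|"r38 C=UDFU E P L E C J E P M"
|"r38 E=DUUD E C K E P M E P K E C J"
|"r38 G=DFUD E C M E P N E C L"
|"r38 W=UDDF E P N E E G E C M"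
|"r38 I=FFDU E C N E P V"
|"r38 J=FDUD E C V E P P E C N"
|"r38 K=DUDF E C P E P S E C V"
|"r38 L=UDFF E P T E C S"
|"r38 M=UDFU E S A E C T E S B"
|"r38 N=DUDD E E A E S B E E C E C T"
|"r38 V=DFFU E E B E S C"
|"r38 P=UDUD E S C E E C E S E E E B"
|"r38 S=DUDF E E G E S G E E E"
|"r38 T=FFDU E E W E S W"
primrec r39 :: "digit => row" where
"r39 A=DUDU E E J E S I E E I E S J"
|"r39 B=UDFD E S J E E K E E J"
|"r39 C=DFFU E E L E S K"
|"r39 E=UDUD E S K E E M E S L E E L"
|"r39 G=DFUD E E V E S M E E N"
|"r39 W=UUDF E S M E S L E E V"
|"r39 I=UDFF E S N E E P"
|"r39 J=FUDD E S V E E S E E T"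
|"r39 K=UDDU E S P E E T E G A E S V"
|"r39 L=DFUF E G A E S P"
|"r39 M=FDUF E G B E S S"
|"r39 N=FDUU E G C E S T E T A"
|"r39 V=DUUD E G E E T A E T B E G C"
|"r39 P=UDDF E T B E G W E G E"
|"r39 S=DUDF E G W E T C E G G"
|"r39 T=DUFF E G I E T E"
primrec r3A :: "digit => row" where
"r3A A=DUDU E G K E T G E G J E T W"
|"r3A B=UFDD E T W E G M E G K"
|"r3A C=UDFU E T I E G L E T J"
|"r3A E=DUUD E G M E T J E T W E G L"
|"r3A G=DFUD E G V E T K E G N"
|"r3A W=UFDF E T K E G V"
|"r3A I=FDUF E G P E T L"
|"r3A J=DFUF E G S E T M"
|"r3A K=UDDU E T M E G T E G S E T N"
|"r3A L=FUDD E T N E W A E G T"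
|"r3A M=UDFU E T V E W B E T P"
|"r3A N=DUDD E W C E T P E W G E W B"
|"r3A V=DFFU E W E E T S"
|"r3A P=UDUD E T S E W G E T T E W E"
|"r3A S=DUDF E W I G A A E W W"
|"r3A T=FFUD G A B E W J"
primrec r3B :: "digit => row" where
"r3B A=FUDU G A C E W K G A B"
|"r3B B=UDUF G A E E W L G A C"
|"r3B C=DUFF E W M G A G"
|"r3B E=DUFU E W N G A W G A I"
|"r3B G=UDUD G A I E W V G A J E W N"
|"r3B W=DFUD E W S G A K E W P"
|"r3B I=UUDF G A K G A J E W S"
|"r3B J=UDFF G A L E W T"
|"r3B K=FFFD E I A"
|"r3B L=UDFU G A M E I B G A N"
|"r3B M=DUFD E I C G A N E I B"
|"r3B N=DFUD E I G G A V E I E"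
|"r3B V=UDDF G A V E I I E I G"
|"r3B P=DUDF E I I G A P E I W"
|"r3B S=DFFF E I J"
|"r3B T=UDFD G A S E I K E I L"
primrec r3C :: "digit => row" where
"r3C A=DUDU E I L G A T E I M G A S"
|"r3C B=FFDU E I N G B A"
|"r3C C=DFUD E I V G B B E I P"
|"r3C E=UFDU G B B E I V G B C"
|"r3C G=DUDU E I S G B E E I P G B G"
|"r3C W=UDUD G B G E I T G B C E I S"
|"r3C I=DFFU E J A G B W"
|"r3C J=UDUD G B W E J B G B I E J A"
|"r3C K=FFDU E J C G B J"
|"r3C L=FDUD E J E G B K E J C"
|"r3C M=DUDF E J G G B L E J E"
|"r3C N=UDFF G B M E J W"
|"r3C V=FDUF E J I G B N"
|"r3C P=DUFD E J J G B V E J K"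
|"r3C S=UDFU G B P E J K G B V"
|"r3C T=UDUD G B S E J L G B T E J M"
primrec r3D :: "digit => row" where
"r3D A=DFUU E J M G C A G B S"
|"r3D B=UDDU G C A E J N E J M G C B"
|"r3D C=FUFD G C B E J N"
|"r3D E=FDUF E J V G C C"
|"r3D G=DFUF E J P G C E"
|"r3D W=UDDU G C E E J S E J P G C G"
|"r3D I=FUDD G C G E J T E J S"
|"r3D J=UDFU G C W E K A G C I"
|"r3D K=DUDD E K B G C I E K E E K A"
|"r3D L=DFFU E K C G C J"
|"r3D M=UDUD G C J E K E G C K E K C"
|"r3D N=DUDF E K W G C L E K G"
|"r3D V=FFUD G C M E K I"
|"r3D P=FUDU G C N E K J G C M"
|"r3D S=UDUF G C V E K K G C N"
|"r3D T=DUFF E K L G C P"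
primrec r3E :: "digit => row" where
"r3E A=DUFU E K M G C S G C T"
|"r3E B=UDUD G C T E K N G E A E K M"
|"r3E C=DFUD E K P G E B E K V"
|"r3E E=UUDF G E B G E A E K P"
|"r3E G=UDFF G E C E K S"
|"r3E W=FFFD E K T"
|"r3E I=UDFU G E E E L A G E G"
|"r3E J=DUFD E L B G E G E L A"
|"r3E K=DFUD E L E G E W E L C"
|"r3E L=UDDF G E W E L W E L E"
|"r3E M=DUDF E L W G E I E L G"
|"r3E N=DFFF E L I"
|"r3E V=UDFD G E J E L J E L K"
|"r3E P=DUDU E L K G E K E L L G E J"
|"r3E S=FFDU E L M G E L"
|"r3E T=FFDU E L N G E M"
primrec r3F :: "digit => row" where
"r3F A=FDUD E L V G E N E L N"
|"r3F B=DUDF E L P G E V E L V"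
|"r3F C=UDFF G E P E L S"
|"r3F E=FDUF E L T G E S"
|"r3F G=UDFU G E T E M A G G A"
|"r3F W=DUDD E M B G G A E M E E M A"
|"r3F I=DFFU E M C G G B"
|"r3F J=UDUD G G B E M E G G C E M C"
|"r3F K=DUDF E M W G G E E M G"
|"r3F L=FFDU E M I G G G"
|"r3F M=DUDU E M K G G W E M J G G I"
|"r3F N=UDFD G G I E M L E M K"
|"r3F V=DFFU E M M G G J"
|"r3F P=UDUD G G J E M N G G K E M M"
|"r3F S=DFUD E M P G G L E M V"
|"r3F T=UUDF G G L G G K E M P"
primrec h43 :: "digit => digit => row" where
"h43 D0 = r30"
|"h43 D1 = r31"
|"h43 D2 = r32"
|"h43 D3 = r33"
|"h43 D4 = r34"
|"h43 D5 = r35"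
|"h43 D6 = r36"
|"h43 D7 = r37"
|"h43 D8 = r38"
|"h43 D9 = r39"
|"h43 DA = r3A"
|"h43 DB = r3B"
|"h43 DC = r3C"
|"h43 DD = r3D"
|"h43 DE = r3E"
|"h43 DF = r3F"
primrec r40 :: "digit => row" where
"r40 A=UDFF G G M E M S"
|"r40 B=FUDD G G N E M T E N A"
|"r40 C=UDDU G G V E N A E N B G G N"
|"r40 E=DFUF E N B G G V"
|"r40 G=FDUF E N C G G P"
|"r40 W=FDUU E N E G G S G G T"
|"r40 I=DUUD E N G G G T G W A E N E"
|"r40 J=UDDF G W A E N I E N G"
|"r40 K=DUDF E N I G W B E N W"
|"r40 L=DUFF E N J G W C"
|"r40 M=DFFU E N L G W E"
|"r40 N=UDUD G W E E N M G W G E N L"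
|"r40 V=DUDF E N V G W W E N N"
|"r40 P=UDFF G W I E N P"
|"r40 S=DUFD E N T G W J E V A"
|"r40 T=UDFU G W K E V A G W J"
primrec r41 :: "digit => row" where
"r41 A=FFFD E V B"
|"r41 B=DUDU E V E G W L E V C G W M"
|"r41 C=UFDD G W M E V W E V E"
|"r41 E=UDFU G W N E V G G W V"
|"r41 G=DUUD E V W G W V G W M E V G"
|"r41 W=DFUD E V J G W P E V I"
|"r41 I=UFDF G W P E V J"
|"r41 J=FFUD G W S E V K"
|"r41 K=FUDU G W T E V L G W S"
|"r41 L=UDUF G I A E V M G W T"
|"r41 M=DUFF E V N G I B"
|"r41 N=FFDU E V V G I C"
|"r41 V=UDUD G I E E V P G I G E V S"
|"r41 P=DFFU E V S G I E"
|"r41 S=DFUD E V T G I W E P A"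
|"r41 T=UFDU G I W E V T G I I"
primrec r42 :: "digit => row" where
"r42 A=DUDU E P B G I J E P A G I K"
|"r42 B=UDUD G I K E P C G I I E P B"
|"r42 C=FFDU E P E G I L"
|"r42 E=DUDU E P W G I M E P G G I N"
|"r42 G=UDFD G I N E P I E P W"
|"r42 W=DFFU E P J G I V"
|"r42 I=UDUD G I V E P K G I P E P J"
|"r42 J=DFUD E P M G I S E P L"
|"r42 K=UUDF G I S G I P E P M"
|"r42 L=UDFF G I T E P N"
|"r42 M=FUDD G J A E P V E P P"
|"r42 N=UDDU G J B E P P E P S G J A"
|"r42 V=DFUF E P S G J B"
|"r42 P=FDUF E P T G J C"
|"r42 S=FDUU E S A G J E G J G"
|"r42 T=DUUD E S B G J G G J W E S A"
primrec r43 :: "digit => row" where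
"r43 A=UDDF G J W E S E E S B"
|"r43 B=DUDF E S E G J I E S C"
|"r43 C=DUFF E S G G J J"
|"r43 E=DFFU E S I G J K"
|"r43 G=UDUD G J K E S J G J L E S I"
|"r43 W=DUDF E S L G J M E S K"
|"r43 I=UDFF G J N E S M"
|"r43 J=DUFD E S V G J V E S P"
|"r43 K=UDFU G J P E S P G J V"
|"r43 L=FFFD E S S"
|"r43 M=FFUD G J S E S T"
|"r43 N=FUDU G J T E T A G J S"
|"r43 V=UDUF G K A E T B G J T"
|"r43 P=DUFF E T C G K B"
|"r43 S=FFDU E T E G K C"
|"r43 T=DUFU E T G G K E G K G"
primrec r44 :: "digit => row" where
"r44 A=UDUD G K G E T W G K W E T G"
|"r44 B=DFUD E T J G K I E T I"
|"r44 C=UUDF G K I G K W E T J"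
|"r44 E=UDFF G K J E T K"
|"r44 G=FFFD E T L"
|"r44 W=UDFU G K K E T M G K L"
|"r44 I=DUFD E T N G K L E T M"
|"r44 J=DFUD E T P G K M E T V"
|"r44 K=UDDF G K M E T T E T P"
|"r44 L=DUDF E T T G K N E T S"
|"r44 M=DFFF G A A"
|"r44 N=UDFD G K V G A B G A C"
|"r44 V=DUDU G A C G K P G A E G K V"
|"r44 P=FFDU G A G G K S"
|"r44 S=FFDU G A W G K T"
|"r44 T=FDUD G A I G L A G A W"
primrec r45 :: "digit => row" where
"r45 A=DUDF G A J G L B G A I"
|"r45 B=UDFF G L C G A K"
|"r45 C=FDUF G A L G L E"
|"r45 E=DFUD G A N G L G G A M"
|"r45 G=UFDF G L G G A N"
|"r45 W=UDFF G L W G A V"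
|"r45 I=DUFF G A P G L I"
|"r45 J=UDUD G L J G A S G L K G A T"
|"r45 K=DFFU G A T G L J"
|"r45 L=UDFU G L L G B B G L M"
|"r45 M=DUDD G B C G L M G B G G B B"
|"r45 N=DFFU G B E G L N"
|"r45 V=UDUD G L N G B G G L V G B E"
|"r45 P=DUDF G B I G L P G B W"
|"r45 S=FUDD G L S G B J G B K"
|"r45 T=UDDU G L T G B K G B L G L S"
primrec r46 :: "digit => row" where
"r46 A=DFUF G B L G L T"
|"r46 B=FDUF G B M G M A"
|"r46 C=FFFD G B N"
|"r46 E=DFUD G B V G M B G B P"
|"r46 G=UFDF G M B G B V"
|"r46 W=DUDU G B T G M C G B S G M E"
|"r46 I=UFDD G M E G C B G B T"
|"r46 J=UDFU G M G G C A G M W"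
|"r46 K=DUUD G C B G M W G M E G C A"
|"r46 L=FFFD G C C"
|"r46 M=UDFU G M I G C E G M J"
|"r46 N=DUFD G C G G M J G C E"
|"r46 V=DFUD G C I G M K G C W"
|"r46 P=UDDF G M K G C K G C I"
|"r46 S=DUDF G C K G M L G C J"
|"r46 T=DFFF G C L"
primrec r47 :: "digit => row" where
"r47 A=UDFD G M M G C M G C N"
|"r47 B=DUDU G C N G M N G C V G M M"
|"r47 C=FFDU G C P G M V"
|"r47 E=FFDU G C S G M P"
|"r47 G=FDUD G C T G M S G C S"
|"r47 W=DUDF G E A G M T G C T"
|"r47 I=UDFF G N A G E B"
|"r47 J=FDUF G E C G N B"
|"r47 K=DFUD G E G G N C G E E"
|"r47 L=UFDF G N C G E G"
|"r47 M=UDFF G N E G E W"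
|"r47 N=DUFF G E I G N G"
|"r47 V=UDUD G N W G E J G N I G E K"
|"r47 P=DFFU G E K G N W"
|"r47 S=FUDD G N J G E M G E N"
|"r47 T=UDDU G N K G E N G E V G N J"
primrec r48 :: "digit => row" where
"r48 A=DFUF G E V G N K"
|"r48 B=FDUF G E P G N L"
|"r48 C=FFFD G E S"
|"r48 E=FDUU G E T G N M G N N"
|"r48 G=DUUD G G A G N N G N V G E T"
|"r48 W=UDDF G N V G G C G G A"
|"r48 I=DUDF G G C G N P G G B"
|"r48 J=DUFF G G E G N S"
|"r48 K=DFFU G G W G N T"
|"r48 L=UDUD G N T G G I G V A G G W"
|"r48 M=DUDF G G K G V B G G J"
|"r48 N=UDFF G V C G G L"
|"r48 V=DUFD G G N G V E G G V"
|"r48 P=UDFU G V G G G V G V E"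
|"r48 S=FFFD G G P"
|"r48 T=FFUD G V W G G S"
primrec r49 :: "digit => row" where
"r49 A=FUDU G V I G G T G V W"
|"r49 B=UDUF G V J G W A G V I"
|"r49 C=DUFF G W B G V K"
|"r49 E=FFDU G W C G V L"
|"r49 G=DUDF G W G G V M G W E"
|"r49 W=DFFF G W W"
|"r49 I=FDUF G W I G V N"
|"r49 J=DFUD G W J G V V G W K"
|"r49 K=UFDF G V V G W J"
|"r49 L=DUFU G W L G V P G V S"
|"r49 M=UDUD G V S G W M G V T G W L"
|"r49 N=DFUD G W V G P A G W N"
|"r49 V=UUDF G P A G V T G W V"
|"r49 P=UDFF G P B G W P"
|"r49 S=UDFD G P C G W S G W T"
|"r49 T=DUDU G W T G P E G I A G P C"
primrec r4A :: "digit => row" where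
"r4A A=FFDU G I B G P G"
|"r4A B=DUDF G I G G P W G I E"
|"r4A C=UDFU G P I G I W G P J"
|"r4A E=DUDD G I I G P J G I K G I W"
|"r4A G=DFFU G I J G P K"
|"r4A W=UDUD G P K G I K G P L G I J"
|"r4A I=DFFU G I M G P M"
|"r4A J=UDUD G P M G I N G P N G I M"
|"r4A K=DUDF G I P G P V G I V"
|"r4A L=UDFF G P P G I S"
|"r4A M=DUFD G J A G P S G J B"
|"r4A N=UDFU G P T G J B G P S"
|"r4A V=FFFD G J C"
|"r4A P=FFUD G S A G J E"
|"r4A S=FUDU G S B G J G G S A"
|"r4A T=UDUF G S C G J W G S B"
primrec r4B :: "digit => row" where
"r4B A=DUFF G J I G S E"
|"r4B B=FFDU G J J G S G"
|"r4B C=DUDF G J L G S W G J K"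
|"r4B E=DFFF G J M"
|"r4B G=FDUF G J N G S I"
|"r4B W=DFUD G J V G S J G J P"
|"r4B I=UFDF G S J G J V"
|"r4B J=UDFD G S K G J S G J T"
|"r4B K=DUDU G J T G S L G K A G S K"
|"r4B L=FFDU G K B G S M"
|"r4B M=FFDU G K E G S N"
|"r4B N=FDUD G K G G S V G K E"
|"r4B V=DUDF G K W G S P G K G"
|"r4B P=UDFF G S S G K I"
|"r4B S=FDUF G K J G S T"
|"r4B T=DFUD G K L G T A G K K"
primrec r4C :: "digit => row" where
"r4C A=UFDF G T A G K L"
|"r4C B=UDFF G T B G K M"
|"r4C C=DUFF G K N G T C"
|"r4C E=UDUD G T E G K V G T G G K P"
|"r4C G=DFFU G K P G T E"
|"r4C W=FUDD G T W G K T G L A"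
|"r4C I=UDDU G T I G L A G L B G T W"
|"r4C J=DFUF G L B G T I"
|"r4C K=FDUF G L C G T J"
|"r4C L=FFFD G L E"
|"r4C M=UDFF G T K G L G"
|"r4C N=FFDU G L I G T L"
|"r4C V=DUDF G L K G T M G L J"
|"r4C P=FDUU G L L G T N G T V"
|"r4C S=DUUD G L M G T V G T P G L L"
|"r4C T=UDDF G T P G L V G L M"
primrec r4D :: "digit => row" where
"r4D A=DUDF G L V G T S G L N"
|"r4D B=DUFF G L P G T T"
|"r4D C=DUFD G L S W A A G L T"
|"r4D E=UDFU W A B G L T W A A"
|"r4D G=FFFD G M A"
|"r4D W=UDFF W A C G M B"
|"r4D I=DUFU G M C W A E W A G"
|"r4D J=UDUD W A G G M E W A W G M C"
|"r4D K=DFUD G M W W A I G M G"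
|"r4D L=UUDF W A I W A W G M W"
|"r4D M=DFUD G M J W A J G M I"
|"r4D N=UFDF W A J G M J"
|"r4D V=UDFF W A K G M K"
|"r4D P=DUFF G M L W A L"
|"r4D S=UDUD W A M G M M W A N G M N"
|"r4D T=DFFU G M N W A M"
primrec r4E :: "digit => row" where
"r4E A=FUDD W A V G M P G M S"
|"r4E B=UDDU W A P G M S G M T W A V"
|"r4E C=DFUF G M T W A P"
|"r4E E=FDUF G N A W A S"
|"r4E G=FFFD G N B"
|"r4E W=UDFF W A T G N C"
|"r4E I=FFDU G N G W B A"
|"r4E J=DUDF G N I W B B G N W"
|"r4E K=DUFD G N J W B C G N K"
|"r4E L=UDFU W B E G N K W B C"
|"r4E M=FFFD G N L"
|"r4E N=FFUD W B G G N M"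
|"r4E V=FUDU W B W G N N W B G"
|"r4E P=UDUF W B I G N V W B W"
|"r4E S=DUFF G N P W B J"
|"r4E T=FFDU G N S W B K"
primrec r4F :: "digit => row" where
"r4F A=DUDF G V A W B L G N T"
|"r4F B=DFFF G V B"
|"r4F C=FDUF G V C W B M"
|"r4F E=DFUD G V E W B N G V G"
|"r4F G=UFDF W B N G V E"
|"r4F W=UDFD W B V G V W G V I"
|"r4F I=DUDU G V I W B P G V J W B V"
|"r4F J=FFDU G V K W B S"
|"r4F K=DUFF G V M W B T"
|"r4F L=FFFD G V N"
|"r4F M=UDFF W C A G V V"
|"r4F N=FFDU G V P W C B"
|"r4F V=FDUD G V S W C C G V P"
|"r4F P=DUDF G V T W C E G V S"
|"r4F S=UDFF W C G G P A"
|"r4F T=FDUF G P B W C W"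
primrec h44 :: "digit => digit => row" where
"h44 D0 = r40"
|"h44 D1 = r41"
|"h44 D2 = r42"
|"h44 D3 = r43"
|"h44 D4 = r44"
|"h44 D5 = r45"
|"h44 D6 = r46"
|"h44 D7 = r47"
|"h44 D8 = r48"
|"h44 D9 = r49"
|"h44 DA = r4A"
|"h44 DB = r4B"
|"h44 DC = r4C"
|"h44 DD = r4D"
|"h44 DE = r4E"
|"h44 DF = r4F"
primrec r50 :: "digit => row" where
"r50 A=UDUD W C I G P C W C J G P E"
|"r50 B=DFFU G P E W C I"
|"r50 C=DUFF G P W W C K"
|"r50 E=FDUU G P I W C L W C M"
|"r50 G=DUUD G P J W C M W C N G P I"
|"r50 W=UDDF W C N G P L G P J"
|"r50 I=DUDF G P L W C V G P K"
|"r50 J=DUDF G P N W C P G P M"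
|"r50 K=DFFF G P V"
|"r50 L=FDUF G P P W C S"
|"r50 M=DFUD G P S W C T G P T"
|"r50 N=UFDF W C T G P S"
|"r50 V=UDFD W E A G S A G S B"
|"r50 P=DUDU G S B W E B G S C W E A"
|"r50 S=FFDU G S E W E C"
|"r50 T=DUFF G S W W E E"
primrec r51 :: "digit => row" where
"r51 A=FFFD G S I"
|"r51 B=UDFF W E G G S J"
|"r51 C=UDUD W E W G S K W E I G S L"
|"r51 E=DFFU G S L W E W"
|"r51 G=FUDD W E J G S N G S V"
|"r51 W=UDDU W E K G S V G S P W E J"
|"r51 I=DFUF G S P W E K"
|"r51 J=FDUF G S S W E L"
|"r51 K=FFFD G S T"
|"r51 L=UDFF W E M G T A"
|"r51 M=FFDU G T C W E N"
|"r51 N=DUDF G T G W E V G T E"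
|"r51 V=DUFD G T W W E P G T I"
|"r51 P=UDFU W E S G T I W E P"
|"r51 S=FFFD G T J"
|"r51 T=FDUF G T K W E T"
primrec r52 :: "digit => row" where
"r52 A=DUFF G T M W G A"
|"r52 B=FFUD W G B G T N"
|"r52 C=FUDU W G C G T V W G B"
|"r52 E=UDUF W G E G T P W G C"
|"r52 G=DUFF G T S W G G"
|"r52 W=FFDU G T T W G W"
|"r52 I=DFUD W A A W G I W A B"
|"r52 J=UFDF W G I W A A"
|"r52 K=FDUF W A C W G J"
|"r52 L=FFDU W A E W G K"
|"r52 M=FDUD W A G W G L W A E"
|"r52 N=DUDF W A W W G M W A G"
|"r52 V=UDFF W G N W A I"
|"r52 P=UDFF W G V W A J"
|"r52 S=FFDU W A L W G P"
|"r52 T=DUDF W A N W G S W A M"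
primrec r53 :: "digit => row" where
"r53 A=DUFD W A V W G T W A P"
|"r53 B=UDFU W W A W A P W G T"
|"r53 C=FFFD W A S"
|"r53 E=FDUF W A T W W B"
|"r53 G=DUFF W B B W W C"
|"r53 W=DFUD W B C W W E W B E"
|"r53 I=UFDF W W E W B C"
|"r53 J=UDFD W W G W B G W B W"
|"r53 K=DUDU W B W W W W W B I W W G"
|"r53 L=FFDU W B J W W I"
|"r53 M=DUFF W B L W W J"
|"r53 N=FFFD W B M"
|"r53 V=UDFF W W K W B N"
|"r53 P=UDUD W W L W B V W W M W B P"
|"r53 S=DFFU W B P W W L"
|"r53 T=FFDU W B T W W N"
primrec r54 :: "digit => row" where
"r54 A=FDUF W C A W W V"
|"r54 B=FUDD W W P W C B W C C"
|"r54 C=UDDU W W S W C C W C E W W P"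
|"r54 E=DFUF W C E W W S"
|"r54 G=FDUF W C G W W T"
|"r54 W=FFFD W C W"
|"r54 I=DUDF W C J W I A W C I"
|"r54 J=FFDU W C K W I B"
|"r54 K=FFUD W I C W C L"
|"r54 L=FUDU W I E W C M W I C"
|"r54 M=UDUF W I G W C N W I E"
|"r54 N=DUFF W C V W I W"
|"r54 V=DUFF W C P W I I"
|"r54 P=FFFD W C S"
|"r54 S=UDFF W I J W C T"
|"r54 T=UDUD W I K W E A W I L W E B"
primrec r55 :: "digit => row" where
"r55 A=DFFU W E B W I K"
|"r55 B=FFDU W E E W I M"
|"r55 C=FDUF W E G W I N"
|"r55 E=DUDF W E I W I V W E W"
|"r55 G=DUFD W E J W I P W E K"
|"r55 W=UDFU W I S W E K W I P"
|"r55 I=FFFD W E L"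
|"r55 J=FDUF W E M W I T"
|"r55 K=DUFF W E V W J A"
|"r55 L=DFUD W E P W J B W E S"
|"r55 M=UFDF W J B W E P"
|"r55 N=FFFD W E T"
|"r55 V=FFDU W G A W J C"
|"r55 P=UDFD W J E W G B W G C"
|"r55 S=DUDU W G C W J G W G E W J E"
|"r55 T=FFDU W G G W J W"
primrec r56 :: "digit => row" where
"r56 A=UDFF W J I W G I"
|"r56 B=FFFD W G J"
|"r56 C=FUDD W J J W G K W G L"
|"r56 E=UDDU W J K W G L W G M W J J"
|"r56 G=DFUF W G M W J K"
|"r56 W=FDUF W G N W J L"
|"r56 I=FDUF W G V W J M"
|"r56 J=DUFF W G S W J N"
|"r56 K=DFUD W G T W J V W W A"
|"r56 L=UFDF W J V W G T"
|"r56 M=FFFD W W B"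
|"r56 N=FFDU W W C W J P"
|"r56 V=UDFF W J S W W E"
|"r56 P=UDUD W J T W W G W K A W W W"
|"r56 S=DFFU W W W W J T"
|"r56 T=FFDU W W J W K B"
primrec r57 :: "digit => row" where
"r57 A=FDUF W W K W K C"
|"r57 B=DUDF W W M W K E W W L"
|"r57 C=FFFD W W V"
|"r57 E=DUFD W W P W K G W W S"
|"r57 G=UDFU W K W W W S W K G"
|"r57 W=FFFD W W T"
|"r57 I=DUFF W I A W K I"
|"r57 J=UDFD W K J W I C W I E"
|"r57 K=DUDU W I E W K K W I G W K J"
|"r57 L=FFDU W I W W K L"
|"r57 M=FFDU W I I W K M"
|"r57 N=FDUF W I J W K N"
|"r57 V=DUDF W I L W K V W I K"
|"r57 P=FFFD W I N"
|"r57 S=DUFF W I V W K P"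
|"r57 T=DFUD W I P W K S W I S"
primrec r58 :: "digit => row" where
"r58 A=UFDF W K S W I P"
|"r58 B=FFFD W I T"
|"r58 C=FFDU W J A W K T"
|"r58 E=UDFF W L A W J B"
|"r58 G=UDUD W L B W J E W L C W J G"
|"r58 W=DFFU W J G W L B"
|"r58 I=FDUF W J I W L E"
|"r58 J=DUFD W J J W L G W J K"
|"r58 K=UDFU W L W W J K W L G"
|"r58 L=FFFD W J L"
|"r58 M=FFFD W J M"
|"r58 N=FFDU W J N W L I"
|"r58 V=UDFF W L J W J V"
|"r58 P=FDUF W J S W L K"
|"r58 S=DUDF W K A W L L W J T"
|"r58 T=FFFD W K C"
primrec r59 :: "digit => row" where
"r59 A=DUFF W K E W L M"
|"r59 B=DFUD W K G W L N W K W"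
|"r59 C=UFDF W L N W K G"
|"r59 E=FFDU W K I W L V"
|"r59 G=UDUD W L P W K J W L S W K K"
|"r59 W=DFFU W K K W L P"
|"r59 I=FFFD W K N"
|"r59 J=DUFF W K V W L T"
|"r59 K=FFDU W K P W M A"
|"r59 L=UDFF W M B W K S"
|"r59 M=FDUF W L A W M C"
|"r59 N=DUDF W L C W M E W L B"
|"r59 V=FFFD W L E"
|"r59 P=DFUD W L G W M G W L W"
|"r59 S=UFDF W M G W L G"
|"r59 T=FDUF W L J W M W"
primrec r5A :: "digit => row" where
"r5A A=FFFD W L K"
|"r5A B=DUFF W L L W M I"
|"r5A C=FFDU W L M W M J"
|"r5A E=UDFF W M K W L N"
|"r5A G=DUDF W L S W M L W L P"
|"r5A W=FFDU W L T W M M"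
|"r5A I=FDUF W M B W M N"
|"r5A J=FFFD W M C"
|"r5A K=DUFF W M E W M V"
|"r5A L=UDFF W M P W M G"
|"r5A M=FFFD W M W"
|"r5A N=FFDU W M I W M S"
|"r5A V=FDUF W M K W M T"
|"r5A P=DUFF W M L W N A"
|"r5A S=FFFD W M N"
|"r5A T=FFDU W M V W N B"
primrec r5B :: "digit => row" where
"r5B A=FDUF W M P W N C"
|"r5B B=FFFD W M T"
|"r5B C=FFDU W N A W N E"
|"r5B E=FFFD W N C"
|"r5B G=no_row"
|"r5B W=no_row"
|"r5B I=no_row"
|"r5B J=no_row"
|"r5B K=no_row"
|"r5B L=no_row"
|"r5B M=no_row"
|"r5B N=no_row"
|"r5B V=no_row"
|"r5B P=no_row"
|"r5B S=no_row"
|"r5B T=no_row"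
primrec h45 :: "digit => digit => row" where
"h45 D0 = r50"
|"h45 D1 = r51"
|"h45 D2 = r52"
|"h45 D3 = r53"
|"h45 D4 = r54"
|"h45 D5 = r55"
|"h45 D6 = r56"
|"h45 D7 = r57"
|"h45 D8 = r58"
|"h45 D9 = r59"
|"h45 DA = r5A"
|"h45 DB = r5B"
|"h45 DC = no_rows"
|"h45 DD = no_rows"
|"h45 DE = no_rows"
|"h45 DF = no_rows"
primrec h4 :: "digit => digit => digit => row" where
"h4 D0 = h40"
|"h4 D1 = h41"
|"h4 D2 = h42"
|"h4 D3 = h43"
|"h4 D4 = h44"
|"h4 D5 = h45"
|"h4 D6 = no_block"
|"h4 D7 = no_block"
|"h4 D8 = no_block"
|"h4 D9 = no_block"
|"h4 DA = no_block"
|"h4 DB = no_block"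
|"h4 DC = no_block"
|"h4 DD = no_block"
|"h4 DE = no_block"
|"h4 DF = no_block"

lemma h4_block0: "list_all (%y. list_all (%z. state_ok h4 (path_bond Five Three Three) [L1, L2, L3, L4] [(L1, L2), (L1, L3), (L1, L4), (L2, L3), (L2, L4), (L3, L4)] (Q D5 DB D4) (Q D0 y z)) digits) digits"
 by code_simp

lemma h4_block1: "list_all (%y. list_all (%z. state_ok h4 (path_bond Five Three Three) [L1, L2, L3, L4] [(L1, L2), (L1, L3), (L1, L4), (L2, L3), (L2, L4), (L3, L4)] (Q D5 DB D4) (Q D1 y z)) digits) digits"
 by code_simp

lemma h4_block2: "list_all (%y. list_all (%z. state_ok h4 (path_bond Five Three Three) [L1, L2, L3, L4] [(L1, L2), (L1, L3), (L1, L4), (L2, L3), (L2, L4), (L3, L4)] (Q D5 DB D4) (Q D2 y z)) digits) digits"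
 by code_simp

lemma h4_block3: "list_all (%y. list_all (%z. state_ok h4 (path_bond Five Three Three) [L1, L2, L3, L4] [(L1, L2), (L1, L3), (L1, L4), (L2, L3), (L2, L4), (L3, L4)] (Q D5 DB D4) (Q D3 y z)) digits) digits"
 by code_simp

lemma h4_block4: "list_all (%y. list_all (%z. state_ok h4 (path_bond Five Three Three) [L1, L2, L3, L4] [(L1, L2), (L1, L3), (L1, L4), (L2, L3), (L2, L4), (L3, L4)] (Q D5 DB D4) (Q D4 y z)) digits) digits"
 by code_simp

lemma h4_block5: "list_all (%y. list_all (%z. state_ok h4 (path_bond Five Three Three) [L1, L2, L3, L4] [(L1, L2), (L1, L3), (L1, L4), (L2, L3), (L2, L4), (L3, L4)] (Q D5 DB D4) (Q D5 y z)) digits) digits"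
 by code_simp

lemma h4_ok: "state_ok h4 (path_bond Five Three Three) [L1, L2, L3, L4] [(L1, L2), (L1, L3), (L1, L4), (L2, L3), (L2, L4), (L3, L4)] (Q D5 DB D4) s"
proof (rule state_okI)
 fix x assume x: "digit_value x \<le> digit_value D5"
 show "list_all (%y. list_all (%z. state_ok h4 (path_bond Five Three Three) [L1, L2, L3, L4] [(L1, L2), (L1, L3), (L1, L4), (L2, L3), (L2, L4), (L3, L4)] (Q D5 DB D4) (Q x y z)) digits) digits"
 proof (cases x)
  case D0 show ?thesis unfolding D0 by (rule h4_block0)
 next
  case D1 show ?thesis unfolding D1 by (rule h4_block1)
 next
  case D2 show ?thesis unfolding D2 by (rule h4_block2)
 next
  case D3 show ?thesis unfolding D3 by (rule h4_block3)
 next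
  case D4 show ?thesis unfolding D4 by (rule h4_block4)
 next
  case D5 show ?thesis unfolding D5 by (rule h4_block5)
 qed (use x in simp_all)
qed

end

section \<open>Dihedral diagrams\<close>

lemma nth_alternating_word: "i < n ==> alternating_word a b n ! i = (if even i then a else b)"
proof (induction n arbitrary: a b i)
 case (Suc n a b i)
 then show ?case by (cases i) auto
qed simp

lemma null_square: "null_word m (%_. 2) J (u @ [x, x] @ v)"
proof (rule null_word_append, rule null_word_forbidden)
 have "[x, x] = replicate 2 x" by (simp add: eval_nat_numeral)
 then show "[x, x] \<in> forbidden_words m (%_. 2) J" unfolding forbidden_words_def by blast
qed

text \<open>Over two letters only alternating words avoid squares.\<close>
lemma two_letter_words:
 assumes "UNIV = {a, b}"
 shows "(\<exists>u x v. w = u @ [x, x] @ v) \<or> w = alternating_word a b (length w) \<or> w = alternating_word b a (length w)"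
proof (induction w)
 case (Cons x w)
 have x: "x = a \<or> x = b" using assms by blast
 from Cons show ?case
 proof (elim disjE exE)
  fix u y v assume "w = u @ [y, y] @ v"
  then have "x # w = (x # u) @ [y, y] @ v" by simp
  then show ?thesis by blast
 next
  assume w: "w = alternating_word a b (length w)"
  show ?thesis
  proof (cases "x = b")
   case True
   then show ?thesis using w by simp
  next
   case False
   then have xa: "x = a" using x by simp
   show ?thesis
   proof (cases "length w")
    case 0
    then show ?thesis using xa by simp
   next
    case (Suc l)
    then have "x # w = [] @ [a, a] @ alternating_word b a l" using w xa by simp
    then show ?thesis by blast
   qed
  qed
 next
  assume w: "w = alternating_word b a (length w)"
  show ?thesis
  proof (cases "x = a")
   case True
   then show ?thesis using w by simp
  next
   case False
   then have xb: "x = b" using x by simp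
   show ?thesis
   proof (cases "length w")
    case 0
    then show ?thesis using xb by simp
   next
    case (Suc l)
    then have "x # w = [] @ [b, b] @ alternating_word a b l" using w xb by simp
    then show ?thesis by blast
   qed
  qed
 qed
qed simp

lemma alternating_word_append_ex:
 "k \<le> n ==> \<exists>v. alternating_word a b n = alternating_word a b k @ v"
proof (induction k arbitrary: n a b)
 case (Suc k n a b)
 then obtain n' where n': "n = Suc n'" by (metis Suc_le_D)
 then obtain v where "alternating_word b a n' = alternating_word b a k @ v" using Suc by fastforce
 then show ?case using n' by simp
qed simp

lemma dihedral_numbering:
 assumes "has_coxeter_type (matrix_I2 p) 2 m"
 obtains a b where "UNIV = {a, b}" "a ~= b" "m a b = enat p" "m b a = enat p"
proof -
 from assms obtain \<sigma> where \<sigma>: "bij_betw \<sigma> {1..2} UNIV" "!!i j. i \<in> {1..2} ==> j \<in> {1..2} ==> m (\<sigma> i) (\<sigma> j) = matrix_I2 p i j"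
  unfolding has_coxeter_type_def coxeter_numbering_def by blast
 have s: "{1..2 :: nat} = {1, 2}" by auto
 have "UNIV = {\<sigma> 1, \<sigma> 2}" "\<sigma> 1 ~= \<sigma> 2" using \<sigma>(1) unfolding s bij_betw_def by (auto simp: inj_on_def)
 moreover have "m (\<sigma> 1) (\<sigma> 2) = enat p" "m (\<sigma> 2) (\<sigma> 1) = enat p"
  using \<sigma>(2)[of 1 2] \<sigma>(2)[of 2 1] by (simp_all add: matrix_I2_def path_matrix_def)
 ultimately show thesis by (rule that)
qed

text \<open>An alternating word longer than the label becomes one with a square by a braid move.\<close>
lemma finite_type_I2:
 fixes m :: "'i::finite => 'i => enat"
 assumes m: "coxeter_matrix m" and type: "has_coxeter_type (matrix_I2 p) 2 m"
 shows "finite (carrier (coxeter_group m))"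
proof -
 from type obtain a b where ab: "UNIV = {a, b}" "a ~= b" "m a b = enat p" "m b a = enat p"
  by (rule dihedral_numbering)
 let ?J = "braid_pairs m"
 have long: "null_word m (%_. 2) ?J (alternating_word x y n)" if xy: "x ~= y" "m x y = enat p" "m y x = enat p" and n: "p < n" for x y n
 proof -
  have p0: "0 < p" using coxeter_matrixD(3)[OF m xy(1)] xy(2) by (simp add: numeral_eq_enat)
  then obtain p' where p': "p = Suc p'" by (metis gr0_implies_Suc)
  obtain v where v: "alternating_word x y n = alternating_word x y (Suc p) @ v"
   using alternating_word_append_ex[of "Suc p" n x y] n by auto
  have "{y, x} \<in> ?J" using xy(1,3) unfolding braid_pairs_iff[OF m] by auto
  then have "braid_equiv m ?J ([x] @ braid_word m y x @ v) ([x] @ braid_word m x y @ v)" by (rule braid_equiv.move)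
  then have eq: "braid_equiv m ?J (alternating_word x y n) ([] @ [x, x] @ (alternating_word y x p' @ v))"
   unfolding v braid_word_def xy using p' by simp
  show ?thesis by (rule iffD2[OF null_word_cong[OF eq] null_square])
 qed
 have "nonnull_classes m (%_. 2) ?J \<subseteq> (%u. Collect (braid_equiv m ?J u)) ` {u. set u \<subseteq> UNIV & length u \<le> p}"
  unfolding nonnull_classes_def
 proof (rule image_mono, rule subsetI)
  fix w assume "w \<in> {u. ~ null_word m (%_. 2) ?J u}"
  then have w: "~ null_word m (%_. 2) ?J w" by simp
  have "~ p < length w"
  proof
   assume l: "p < length w"
   from two_letter_words[OF ab(1), of w] show False
   proof (elim disjE exE)
    fix u x v assume "w = u @ [x, x] @ v"
    then show False using w by (simp only: null_square not_True_eq_False)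
   next
    assume "w = alternating_word a b (length w)"
    then show False using w long[OF ab(2,3,4) l] by simp
   next
    assume "w = alternating_word b a (length w)"
    then show False using w long[OF not_sym[OF ab(2)] ab(4,3) l] by simp
   qed
  qed
  then show "w \<in> {u. set u \<subseteq> UNIV & length u \<le> p}" by simp
 qed
 then have "finite (nonnull_classes m (%_. 2) ?J)"
  by (rule finite_subset) (intro finite_imageI finite_lists_length_le finite)
 then show ?thesis using nonnull_classes_coxeter_group[OF m] bij_betw_finite by metis
qed

text \<open>There are no short relations, so the nonnull words are the alternating words of length below \<open>p\<close>: the two sides of the braid relation,
 which form the longest element of the group, vanish.\<close>
lemma card_classes_I2:
 fixes m :: "'i::finite => 'i => enat"
 assumes m: "coxeter_matrix m" and type: "has_coxeter_type (matrix_I2 p) 2 m" and p: "4 \<le> p"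
 shows "card (nonnull_classes m (%_. 2) (short_pairs m)) = 2 * p - 1"
proof -
 from type obtain a b where ab: "UNIV = {a, b}" "a ~= b" "m a b = enat p" "m b a = enat p"
  by (rule dihedral_numbering)
 have cases: "x = a & y = b \<or> x = b & y = a" if "x ~= y" for x y using ab(1) that by (metis UNIV_I insertE singletonD)
 have lab: "m x y = enat p" if "x ~= y" for x y using cases[OF that] ab(3,4) by blast
 have no_moves: "braid_equiv m (short_pairs m) u v \<longleftrightarrow> u = v" for u v
 proof
  assume "braid_equiv m (short_pairs m) u v"
  then show "u = v"
  proof (induction rule: braid_equiv.induct)
   case (move x y u v)
   then have "x ~= y" "m x y = 2 \<or> m x y = 3" unfolding short_pairs_iff[OF m] by simp_all
   then show ?case using lab[of x y] p by (auto simp: numeral_eq_enat)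
  qed simp_all
 qed (simp add: braid_equiv.refl)
 let ?W = "insert [] (alternating_word a b ` {1..<p} \<union> alternating_word b a ` {1..<p})"
 have null: "null_word m (%_. 2) (short_pairs m) w \<longleftrightarrow>
   (\<exists>u x v. w = u @ [x, x] @ v) \<or> (\<exists>u x y v. x ~= y & w = u @ alternating_word x y p @ v)" for w
 proof -
  have F: "f \<in> forbidden_words m (%_. 2) (short_pairs m) \<longleftrightarrow> (\<exists>x. f = [x, x]) \<or> (\<exists>x y. x ~= y & f = alternating_word x y p)" for f
  proof -
   have "replicate 2 x = [x, x]" for x :: 'i by (simp add: eval_nat_numeral)
   then show ?thesis unfolding short_forbidden_words_iff[OF m] using lab p by (metis enat.inject)
  qed
  show ?thesis
  proof
   assume "null_word m (%_. 2) (short_pairs m) w"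
   then obtain u f v where f: "f \<in> forbidden_words m (%_. 2) (short_pairs m)" "w = u @ f @ v"
    unfolding null_word_def no_moves by (elim exE conjE) (rule that)
   from f(1)[unfolded F] show "(\<exists>u x v. w = u @ [x, x] @ v) \<or> (\<exists>u x y v. x ~= y & w = u @ alternating_word x y p @ v)"
   proof (elim disjE exE conjE)
    fix x assume "f = [x, x]"
    then have "w = u @ [x, x] @ v" using f(2) by simp
    then show ?thesis by (intro disjI1 exI)
   next
    fix x y assume xy: "x ~= y" "f = alternating_word x y p"
    have "w = u @ alternating_word x y p @ v" using f(2) unfolding xy(2) .
    with xy(1) show ?thesis by (intro disjI2 exI conjI)
   qed
  next
   assume "(\<exists>u x v. w = u @ [x, x] @ v) \<or> (\<exists>u x y v. x ~= y & w = u @ alternating_word x y p @ v)"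
   then obtain u f v where w: "w = u @ f @ v" and f: "(\<exists>x. f = [x, x]) \<or> (\<exists>x y. x ~= y & f = alternating_word x y p)"
   proof (elim disjE exE conjE)
    fix u x v assume "w = u @ [x, x] @ v"
    then show thesis by (rule that) simp
   next
    fix u x y v assume xy: "x ~= y" and w: "w = u @ alternating_word x y p @ v"
    show thesis by (rule that[OF w]) (intro disjI2 exI[of _ x] exI[of _ y] conjI xy HOL.refl)
   qed
   show "null_word m (%_. 2) (short_pairs m) w" unfolding null_word_def no_moves
    by (intro exI[of _ u] exI[of _ f] exI[of _ v] conjI iffD2[OF F f] w)
  qed
 qed
 have alt: "~ null_word m (%_. 2) (short_pairs m) (alternating_word x y k)" if xy: "x ~= y" and k: "k < p" for x y k
  unfolding null
 proof (intro notI, elim disjE exE conjE)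
  fix u z v assume w: "alternating_word x y k = u @ [z, z] @ v"
  then have "k = length (u @ [z, z] @ v)" using length_alternating_word[of x y k] by simp
  then have l: "length u < k" "Suc (length u) < k" by simp_all
  have "alternating_word x y k ! length u = z" "alternating_word x y k ! Suc (length u) = z"
   unfolding w by (simp_all add: nth_append)
  then show False using nth_alternating_word[OF l(1), of x y] nth_alternating_word[OF l(2), of x y] xy
   by (simp split: if_splits)
 next
  fix u x' y' v assume w: "alternating_word x y k = u @ alternating_word x' y' p @ v"
  have "k = length (u @ alternating_word x' y' p @ v)" unfolding w[symmetric] by simp
  then show False using k by simp
 qed
 have W: "{u. ~ null_word m (%_. 2) (short_pairs m) u} = ?W"
 proof (intro equalityI subsetI)
  fix w assume "w \<in> {u. ~ null_word m (%_. 2) (short_pairs m) u}"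
  then have w: "~ null_word m (%_. 2) (short_pairs m) w" by simp
  have short: "length w < p" if "w = alternating_word x y (length w)" "x ~= y" for x y
  proof (rule ccontr)
   assume "~ length w < p"
   then obtain v where v: "alternating_word x y (length w) = alternating_word x y p @ v"
    using alternating_word_append_ex[of p "length w" x y] by auto
   have "w = [] @ alternating_word x y p @ v" using that(1) v by simp
   with that(2) have "null_word m (%_. 2) (short_pairs m) w" unfolding null by (intro disjI2 exI conjI)
   with w show False by (rule notE)
  qed
  have img: "w \<in> insert [] (alternating_word x y ` {1..<p})" if h: "w = alternating_word x y (length w)" "x ~= y" for x y
  proof (cases "length w = 0")
   case False
   then have "length w \<in> {1..<p}" using short[OF h] by (simp add: Suc_le_eq)
   then show ?thesis by (intro insertI2 image_eqI[where f = "alternating_word x y", OF h(1)])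
  qed simp
  from two_letter_words[OF ab(1), of w] show "w \<in> ?W"
  proof (elim disjE exE)
   fix u x v assume "w = u @ [x, x] @ v"
   then show "w \<in> ?W" using w by (simp only: null_square not_True_eq_False)
  next
   assume "w = alternating_word a b (length w)"
   from img[OF this ab(2)] show "w \<in> ?W" by blast
  next
   assume "w = alternating_word b a (length w)"
   from img[OF this not_sym[OF ab(2)]] show "w \<in> ?W" by blast
  qed
 next
  fix w assume "w \<in> ?W"
  then have "\<exists>x y k. x ~= y & k < p & w = alternating_word x y k"
  proof (elim insertE UnE imageE)
   assume "w = []"
   then have "w = alternating_word a b 0" by simp
   then show ?thesis using ab(2) p by (metis gr0I not_numeral_le_zero)
  next
   fix k assume "w = alternating_word a b k" "k \<in> {1..<p}"
   then show ?thesis using ab(2) by auto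
  next
   fix k assume "w = alternating_word b a k" "k \<in> {1..<p}"
   then show ?thesis using not_sym[OF ab(2)] by auto
  qed
  then show "w \<in> {u. ~ null_word m (%_. 2) (short_pairs m) u}" using alt by blast
 qed
 have "card (nonnull_classes m (%_. 2) (short_pairs m)) = card ?W"
  unfolding nonnull_classes_def W by (rule card_image) (simp add: inj_on_def no_moves set_eq_iff)
 also have "\<dots> = 2 * p - 1"
 proof -
  have inj: "inj_on (alternating_word x y) {1..<p}" for x y :: 'i
   by (rule inj_onI) (metis length_alternating_word)
  have "card (alternating_word x y ` {1..<p}) = p - 1" for x y :: 'i
   unfolding card_image[OF inj] by simp
  moreover have "alternating_word a b ` {1..<p} \<inter> alternating_word b a ` {1..<p} = {}"
  proof (rule equals0I, elim IntE imageE)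
   fix w i j assume h: "w = alternating_word a b i" "w = alternating_word b a j" "i \<in> {1..<p}" "j \<in> {1..<p}"
   then have "w ! 0 = a" "w ! 0 = b" using nth_alternating_word[of 0 i a b] nth_alternating_word[of 0 j b a] by simp_all
   then show False using ab(2) by simp
  qed
  ultimately have "card (alternating_word a b ` {1..<p} \<union> alternating_word b a ` {1..<p}) = (p - 1) + (p - 1)"
   by (subst card_Un_disjoint) auto
  moreover have "[] \<notin> alternating_word a b ` {1..<p} \<union> alternating_word b a ` {1..<p}"
  proof
   assume "[] \<in> alternating_word a b ` {1..<p} \<union> alternating_word b a ` {1..<p}"
   then show False
   proof (elim UnE imageE)
    fix k assume "[] = alternating_word a b k" "k \<in> {1..<p}"
    then show False by (cases k) simp_all
   next
    fix k assume "[] = alternating_word b a k" "k \<in> {1..<p}"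
    then show False by (cases k) simp_all
   qed
  qed
  ultimately show ?thesis using p by (subst card_insert_disjoint) auto
 qed
 finally show ?thesis .
qed

section \<open>Counting in each type\<close>

lemma coloured_path_classes:
 assumes m: "coxeter_matrix m" and num: "coxeter_numbering (path_matrix f) n m \<tau>"
  and f: "!!i. 1 \<le> i ==> i < n ==> f i = 3"
  and d: "!!i. i \<in> {1..n} ==> d (\<tau> i) = (if i = 1 then k else 2)" and k: "2 \<le> k"
 shows "finite (nonnull_classes m d (short_pairs m))"
  "card (nonnull_classes m d (short_pairs m)) = fact n * (1 + n * (k - 1))"
proof -
 have path: "path_diagram m n (%q. f (Suc q)) (%q. \<tau> (Suc q)) (%a. inv_into {1..n} \<tau> a - 1)"
  by (rule path_diagram_numbering[OF m num]) (use f in blast)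
 have c: "coloured_path m d n (%q. f (Suc q)) (%q. \<tau> (Suc q)) (%a. inv_into {1..n} \<tau> a - 1) k"
  by (intro coloured_path.intro coloured_path_axioms.intro path) (use f d k in auto)
 show "finite (nonnull_classes m d (short_pairs m))"
  "card (nonnull_classes m d (short_pairs m)) = fact n * (1 + n * (k - 1))"
  by (rule coloured_path.coloured_classes[OF c])+
qed

lemma reverse_numbering_A:
 assumes "coxeter_numbering matrix_A n m \<tau>"
 shows "coxeter_numbering matrix_A n m (%i. \<tau> (Suc n - i))"
proof -
 have "bij_betw (%i. Suc n - i) {1..n} {1..n}"
  by (rule bij_betw_byWitness[where f' = "%i. Suc n - i"]) auto
 from bij_betw_trans[OF this] assms have "bij_betw (%i. \<tau> (Suc n - i)) {1..n} UNIV"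
  unfolding coxeter_numbering_def comp_def by blast
 moreover have "m (\<tau> (Suc n - i)) (\<tau> (Suc n - j)) = matrix_A i j" if "i \<in> {1..n}" "j \<in> {1..n}" for i j
 proof -
  have r: "Suc n - i \<in> {1..n}" "Suc n - j \<in> {1..n}" using that by auto
  then have "m (\<tau> (Suc n - i)) (\<tau> (Suc n - j)) = matrix_A (Suc n - i) (Suc n - j)"
   using assms unfolding coxeter_numbering_def by blast
  also have "\<dots> = matrix_A i j"
  proof -
   have b: "i \<le> n" "j \<le> n" using that by simp_all
   have h: "(Suc n - i = Suc n - j) = (i = j)" "(Suc n - j = Suc (Suc n - i)) = (i = Suc j)"
    "(Suc n - i = Suc (Suc n - j)) = (j = Suc i)" using b by arith+
   show ?thesis unfolding matrix_A_def path_matrix_def h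
    by (cases "j = Suc i"; cases "i = Suc j"; simp only: if_True if_False if_cancel simp_thms)
  qed
  finally show ?thesis .
 qed
 ultimately show ?thesis unfolding coxeter_numbering_def by blast
qed

lemma type_A_end_exponent_classes:
 assumes m: "coxeter_matrix m" and type: "type_A_end_exponent m d n e" and e: "2 \<le> e"
 shows "finite (nonnull_classes m d (short_pairs m)) &
  card (nonnull_classes m d (short_pairs m)) = fact n * (1 + n * (e - 1))"
proof -
 from type obtain \<tau> where num: "coxeter_numbering matrix_A n m \<tau>"
  and d: "d (\<tau> 1) = e & (\<forall>i\<in>{2..n}. d (\<tau> i) = 2) \<or> (\<forall>i\<in>{1..<n}. d (\<tau> i) = 2) & d (\<tau> n) = e"
  unfolding type_A_end_exponent_def by blast
 have "\<exists>\<rho>. coxeter_numbering matrix_A n m \<rho> & (\<forall>i\<in>{1..n}. d (\<rho> i) = (if i = 1 then e else 2))"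
  using d
 proof
  assume h: "d (\<tau> 1) = e & (\<forall>i\<in>{2..n}. d (\<tau> i) = 2)"
  have "d (\<tau> i) = (if i = 1 then e else 2)" if "i \<in> {1..n}" for i using h that by auto
  then show ?thesis using num by blast
 next
  assume h: "(\<forall>i\<in>{1..<n}. d (\<tau> i) = 2) & d (\<tau> n) = e"
  have "d (\<tau> (Suc n - i)) = (if i = 1 then e else 2)" if "i \<in> {1..n}" for i
  proof (cases "i = 1")
   case True
   then show ?thesis using h by simp
  next
   case False
   then have "Suc n - i \<in> {1..<n}" using that by auto
   then show ?thesis using h False by simp
  qed
  then show ?thesis using reverse_numbering_A[OF num] by blast
 qed
 then obtain \<rho> where \<rho>: "coxeter_numbering (path_matrix (%_. 3)) n m \<rho>" "!!i. i \<in> {1..n} ==> d (\<rho> i) = (if i = 1 then e else 2)"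
  unfolding matrix_A_def by blast
 show ?thesis
 proof (rule conjI)
  show "finite (nonnull_classes m d (short_pairs m))"
   by (rule coloured_path_classes(1)[OF m \<rho>(1), where k = e]) (rule HOL.refl, erule \<rho>(2), rule e)
  show "card (nonnull_classes m d (short_pairs m)) = fact n * (1 + n * (e - 1))"
   by (rule coloured_path_classes(2)[OF m \<rho>(1), where k = e]) (rule HOL.refl, erule \<rho>(2), rule e)
 qed
qed

lemma card_classes_B:
 assumes m: "coxeter_matrix m" and type: "has_coxeter_type (matrix_B n) n m" and n: "2 \<le> n"
 shows "card (nonnull_classes m (%_. 2) (short_pairs m)) = (\<Sum>l=0..n. (n choose l)\<^sup>2 * fact l)"
proof -
 let ?f = "%i. if Suc i = n then 4 else 3 :: enat"
 from type obtain \<tau> where num: "coxeter_numbering (path_matrix ?f) n m \<tau>"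
  unfolding has_coxeter_type_def matrix_B_def by blast
 have path: "path_diagram m n (%q. ?f (Suc q)) (%q. \<tau> (Suc q)) (%a. inv_into {1..n} \<tau> a - 1)"
  by (rule path_diagram_numbering[OF m num]) auto
 have c: "rook_path m (%_. 2) n (%q. ?f (Suc q)) (%q. \<tau> (Suc q)) (%a. inv_into {1..n} \<tau> a - 1)"
  by (intro rook_path.intro rook_path_axioms.intro path) (use n in auto)
 show ?thesis by (rule rook_path.rook_classes[OF c])
qed

definition nth_letter :: "nat => letter" where
 "nth_letter i = (if i = 1 then L1 else if i = 2 then L2 else if i = 3 then L3 else L4)"

lemma card_table_classes:
 assumes m: "coxeter_matrix m" and num: "coxeter_numbering M n m \<tau>"
  and letters: "bij_betw nth_letter {1..n} (set ls)"
  and labels: "!!i j. i \<in> {1..n} ==> j \<in> {1..n} ==> i ~= j ==> M i j = bond_label (C (nth_letter i) (nth_letter j))"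
  and ok: "!!s. state_ok T C ls ps N s"
  and ps: "!!i j. i \<in> set ls ==> j \<in> set ls ==> i ~= j ==> (i, j) \<in> set ps \<or> (j, i) \<in> set ps"
  and C: "!!i j. C i j = C j i" and N: "state_less (Q D0 D0 D0) N"
 shows "card (nonnull_classes m (%_. 2) (short_pairs m)) = state_rank N"
proof -
 let ?index = "nth_letter \<circ> inv_into {1..n} \<tau>"
 have \<tau>: "bij_betw \<tau> {1..n} UNIV" using num unfolding coxeter_numbering_def by blast
 have inv: "inv_into {1..n} \<tau> a \<in> {1..n}" "\<tau> (inv_into {1..n} \<tau> a) = a" for a
 proof -
  have "a \<in> \<tau> ` {1..n}" using \<tau> by (simp add: bij_betw_def)
  then show "inv_into {1..n} \<tau> a \<in> {1..n}" "\<tau> (inv_into {1..n} \<tau> a) = a"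
   by (rule inv_into_into, rule f_inv_into_f)
 qed
 have "m a b = bond_label (C (?index a) (?index b))" if "a ~= b" for a b
 proof -
  have ne: "inv_into {1..n} \<tau> a ~= inv_into {1..n} \<tau> b" using that inv(2) by metis
  have "m (\<tau> (inv_into {1..n} \<tau> a)) (\<tau> (inv_into {1..n} \<tau> b)) = M (inv_into {1..n} \<tau> a) (inv_into {1..n} \<tau> b)"
   by (rule bspec[OF bspec[OF conjunct2[OF num[unfolded coxeter_numbering_def]] inv(1)] inv(1)])
  then have "m a b = M (inv_into {1..n} \<tau> a) (inv_into {1..n} \<tau> b)" unfolding inv(2) .
  then show ?thesis using labels[OF inv(1) inv(1) ne] by simp
 qed
 then have "nil_model m (%_. 2) (short_pairs m) {s. state_less s N} (%a. up T (?index a)) (Q D0 D0 D0) state_rank"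
  by (intro table_nil_model[where ls = ls and ps = ps and C = C] ok C N m bij_betw_trans[OF bij_betw_inv_into[OF \<tau>] letters] HOL.refl)
   (rule ps)
 from nil_model.card_nonnull_classes[OF this] show ?thesis unfolding card_states_below .
qed

lemma path_bond_sym: "path_bond e f g i j = path_bond e f g j i"
 by (cases i; cases j) simp_all

lemma letters_4: "bij_betw nth_letter {1..4} (set [L1, L2, L3, L4])"
proof -
 have "{1..4 :: nat} = {1, 2, 3, 4}" by auto
 then show ?thesis by (auto simp: bij_betw_def inj_on_def nth_letter_def)
qed

lemma card_classes_F4:
 assumes m: "coxeter_matrix m" and type: "has_coxeter_type matrix_F4 4 m"
 shows "card (nonnull_classes m (%_. 2) (short_pairs m)) = 304"
proof -
 from type obtain \<tau> where num: "coxeter_numbering matrix_F4 4 m \<tau>" unfolding has_coxeter_type_def by blast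
 have r: "{1..4 :: nat} = {1, 2, 3, 4}" by auto
 have "card (nonnull_classes m (%_. 2) (short_pairs m)) = state_rank (Q D1 D3 D0)"
 proof (rule card_table_classes[OF m num letters_4 _ f4_ok _ path_bond_sym])
  show "matrix_F4 i j = bond_label (path_bond Three Four Three (nth_letter i) (nth_letter j))"
   if "i \<in> {1..4}" "j \<in> {1..4}" "i ~= j" for i j
   using that unfolding r by (auto simp: matrix_F4_def path_matrix_def nth_letter_def)
 qed auto
 then show ?thesis by simp
qed

lemma card_classes_H:
 assumes m: "coxeter_matrix m"
 shows "has_coxeter_type matrix_H 3 m ==> card (nonnull_classes m (%_. 2) (short_pairs m)) = 76"
  "has_coxeter_type matrix_H 4 m ==> card (nonnull_classes m (%_. 2) (short_pairs m)) = 1460"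
proof -
 have r: "{1..3 :: nat} = {1, 2, 3}" "{1..4 :: nat} = {1, 2, 3, 4}" by auto
 assume "has_coxeter_type matrix_H 3 m"
 then obtain \<tau> where num: "coxeter_numbering matrix_H 3 m \<tau>" unfolding has_coxeter_type_def by blast
 have letters: "bij_betw nth_letter {1..3} (set [L1, L2, L3])"
  unfolding r(1) by (auto simp: bij_betw_def inj_on_def nth_letter_def)
 have "card (nonnull_classes m (%_. 2) (short_pairs m)) = state_rank (Q D0 D4 DC)"
 proof (rule card_table_classes[OF m num letters _ h3_ok _ path_bond_sym])
  show "matrix_H i j = bond_label (path_bond Five Three Two (nth_letter i) (nth_letter j))"
   if "i \<in> {1..3}" "j \<in> {1..3}" "i ~= j" for i j
   using that unfolding r by (auto simp: matrix_H_def path_matrix_def nth_letter_def)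
 qed auto
 then show "card (nonnull_classes m (%_. 2) (short_pairs m)) = 76" by simp
next
 have r: "{1..4 :: nat} = {1, 2, 3, 4}" by auto
 assume "has_coxeter_type matrix_H 4 m"
 then obtain \<tau> where num: "coxeter_numbering matrix_H 4 m \<tau>" unfolding has_coxeter_type_def by blast
 have "card (nonnull_classes m (%_. 2) (short_pairs m)) = state_rank (Q D5 DB D4)"
 proof (rule card_table_classes[OF m num letters_4 _ h4_ok _ path_bond_sym])
  show "matrix_H i j = bond_label (path_bond Five Three Three (nth_letter i) (nth_letter j))"
   if "i \<in> {1..4}" "j \<in> {1..4}" "i ~= j" for i j
   using that unfolding r by (auto simp: matrix_H_def path_matrix_def nth_letter_def)
 qed auto
 then show "card (nonnull_classes m (%_. 2) (short_pairs m)) = 1460" by simp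
qed

lemma card_classes_simply_laced:
 assumes m: "coxeter_matrix m" and type: "has_coxeter_type C n m" and C: "!!i j. i ~= j ==> C i j = 2 \<or> C i j = 3"
 shows "card (nonnull_classes m (%_. 2) (short_pairs m)) = Coset.order (coxeter_group m)"
proof -
 from type obtain \<tau> where \<tau>: "bij_betw \<tau> {1..n} UNIV" "!!i j. i \<in> {1..n} ==> j \<in> {1..n} ==> m (\<tau> i) (\<tau> j) = C i j"
  unfolding has_coxeter_type_def coxeter_numbering_def by blast
 have "m a b = 2 \<or> m a b = 3" if "a ~= b" for a b
 proof -
  have "a \<in> \<tau> ` {1..n}" "b \<in> \<tau> ` {1..n}" using \<tau>(1) by (simp_all add: bij_betw_def)
  then obtain i j where "i \<in> {1..n}" "j \<in> {1..n}" "a = \<tau> i" "b = \<tau> j" by blast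
  then show ?thesis using \<tau>(2)[of i j] C[of i j] that by metis
 qed
 from simply_laced_classes[OF m this] show ?thesis
  unfolding Coset.order_def using bij_betw_same_card by metis
qed

section \<open>The classification\<close>

text \<open>For exponents 2, a diagram with labels 2 and 3 has the same classes as its Coxeter group; the few others are finite case by case.\<close>
lemma finite_classes_cases:
 fixes m :: "'i::finite => 'i => enat"
 assumes m: "coxeter_matrix m" and irr: "irreducible_coxeter m" and d: "!!i. 2 \<le> d i"
  and fin: "finite (nonnull_classes m d (short_pairs m))"
 shows "finite (carrier (coxeter_group m)) & (\<forall>i. d i = 2) \<or> (\<exists>n\<ge>1. \<exists>e>2. type_A_end_exponent m d n e)"
proof -
 interpret finite_diagram m d by (rule finite_diagram.intro[OF m irr d fin])
 show ?thesis
 proof (cases "\<exists>i. 3 \<le> d i")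
  case True
  then show ?thesis using exponent_type_A by blast
 next
  case False
  have d2: "d i = 2" for i
  proof -
   have "~ 3 \<le> d i" using False by blast
   then show ?thesis using d[of i] by simp
  qed
  then have dd: "d = (%_. 2)" by (rule ext)
  have "finite (carrier (coxeter_group m))"
  proof (cases "\<exists>a b. adj a b & m a b ~= 3")
   case True
   then obtain a b where "adj a b" "m a b ~= 3" by blast
   from long_label_types[OF this] show ?thesis
   proof (elim disjE exE conjE)
    fix p assume "has_coxeter_type (matrix_I2 p) 2 m"
    then show ?thesis by (rule finite_type_I2[OF m])
   next
    fix n assume "has_coxeter_type (matrix_B n) n m"
    then show ?thesis unfolding has_coxeter_type_def using finite_type_B[OF m] by blast
   next
    assume "has_coxeter_type matrix_F4 4 m"
    then show ?thesis unfolding has_coxeter_type_def using finite_type_F4[OF m] by blast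
   next
    assume "has_coxeter_type matrix_H 3 m"
    then obtain \<sigma> where "coxeter_numbering matrix_H 3 m \<sigma>" unfolding has_coxeter_type_def by blast
    then show ?thesis by (rule finite_type_H[OF m]) simp
   next
    assume "has_coxeter_type matrix_H 4 m"
    then obtain \<sigma> where "coxeter_numbering matrix_H 4 m \<sigma>" unfolding has_coxeter_type_def by blast
    then show ?thesis by (rule finite_type_H[OF m]) simp
   qed
  next
   case False
   then have "m i j = 2 \<or> m i j = 3" if "i ~= j" for i j using that unfolding adj_def by blast
   from simply_laced_classes[OF m this] show ?thesis using fin bij_betw_finite unfolding dd by metis
  qed
  then show ?thesis using d2 by blast
 qed
qed

theorem theorem3:
  fixes m :: "'i::finite \<Rightarrow> 'i \<Rightarrow> enat"
    and d :: "'i \<Rightarrow> nat"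
    and k :: "'k::comm_ring_1 ring"
    and H :: "('k, ('i, 'k) free_algebra set) module"
    and first_case second_case :: bool
  defines "k \<equiv> ring_of_type_algebra"
    and "H \<equiv> nil_hecke m d (braid_pairs_less m 4)"
    and "first_case \<equiv> finite (carrier (coxeter_group m)) \<and> (\<forall>i. d i = 2)"
    and "second_case \<equiv> (\<exists>n\<ge>1. \<exists>e>2. type_A_end_exponent m d n e)"
  assumes "coxeter_matrix m" and "irreducible_coxeter m" and "\<And>i. d i \<ge> 2"
  shows
    "(finitely_generated_module k H \<longleftrightarrow>
        (first_case \<and> \<not> second_case) \<or> (\<not> first_case \<and> second_case))
     \<and>
     (first_case \<longrightarrow>
        ((\<exists>n\<ge>1. has_coxeter_type matrix_A n m) \<or> (\<exists>n\<ge>4. has_coxeter_type (matrix_D n) n m) \<or>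
           (\<exists>n\<in>{6, 7, 8}. has_coxeter_type (matrix_E n) n m) \<longrightarrow>
         free_module_of_rank k H (Coset.order (coxeter_group m))) \<and>
        (\<forall>n\<ge>2. has_coxeter_type (matrix_B n) n m \<longrightarrow>
           free_module_of_rank k H (\<Sum>l=0..n. (n choose l)\<^sup>2 * fact l)) \<and>
        (has_coxeter_type matrix_F4 4 m \<longrightarrow> free_module_of_rank k H 304) \<and>
        (has_coxeter_type matrix_H 3 m \<longrightarrow> free_module_of_rank k H 76) \<and>
        (has_coxeter_type matrix_H 4 m \<longrightarrow> free_module_of_rank k H 1460) \<and>
        (\<forall>p\<ge>3. has_coxeter_type (matrix_I2 p) 2 m \<longrightarrow>
           free_module_of_rank k H (if p < 4 then 2 * p else 2 * p - 1)))
     \<and>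
     (\<forall>n\<ge>1. \<forall>e>2. type_A_end_exponent m d n e \<longrightarrow>
        free_module_of_rank k H (fact n * (1 + n * (e - 1))))"
proof -
  let ?N = "nonnull_classes m d (short_pairs m)"
  have m: "coxeter_matrix m" by fact
  have fg: "finitely_generated_module k H \<longleftrightarrow> finite ?N"
    unfolding k_def H_def nil_hecke_def by (rule finitely_generated_iff_finite_classes[OF HOL.refl])
  have free: "free_module_of_rank k H r" if "finite ?N" "card ?N = r" for r
    unfolding k_def H_def nil_hecke_def that(2)[symmetric] by (rule free_module_nonnull_classes[OF HOL.refl that(1)])
  have exclusive: "\<not> (first_case \<and> second_case)"
  proof
    assume h: "first_case \<and> second_case"
    then obtain n e where ne: "1 \<le> n" "2 < e" "type_A_end_exponent m d n e" unfolding second_case_def by blast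
    have "\<forall>i. d i = 2" using h unfolding first_case_def by blast
    then show False using ne unfolding type_A_end_exponent_def by auto
  qed
  have second: "finite ?N \<and> card ?N = fact n * (1 + n * (e - 1))" if "type_A_end_exponent m d n e" "2 < e" for n e
    by (rule type_A_end_exponent_classes[OF m that(1)]) (use that(2) in simp)
  have first: "d = (\<lambda>_. 2)" "finite ?N" if first_case
  proof -
    show d: "d = (\<lambda>_. 2)" using that unfolding first_case_def by blast
    show "finite ?N" unfolding d
      by (rule finite_group_imp_finite_classes[OF m]) (use that in \<open>simp add: first_case_def\<close>)
  qed
  have "finite ?N \<longleftrightarrow> first_case \<or> second_case"
  proof
    assume "finite ?N"
    from finite_classes_cases[OF m assms(6,7) this] show "first_case \<or> second_case"
      unfolding first_case_def second_case_def .
  next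
    assume "first_case \<or> second_case"
    then show "finite ?N"
    proof
      assume second_case
      then obtain n e where "type_A_end_exponent m d n e" "2 < e" unfolding second_case_def by (elim exE conjE)
      then show ?thesis by (rule conjunct1[OF second])
    qed (rule first(2))
  qed
  then have 1: "finitely_generated_module k H \<longleftrightarrow> (first_case \<and> \<not> second_case) \<or> (\<not> first_case \<and> second_case)"
    using fg exclusive by blast
  have rank: "free_module_of_rank k H r" if first_case "card (nonnull_classes m (\<lambda>_. 2) (short_pairs m)) = r" for r
    using free[OF first(2)[OF that(1)], of r] that(2) first(1)[OF that(1)] by simp
  have laced: "free_module_of_rank k H (Coset.order (coxeter_group m))"
    if first_case "has_coxeter_type C n m" "\<And>i j. i \<noteq> j \<Longrightarrow> C i j = 2 \<or> C i j = 3" for C n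
    by (rule rank[OF that(1) card_classes_simply_laced[OF m that(2,3)]])
  have A: "i \<noteq> j \<Longrightarrow> matrix_A i j = 2 \<or> matrix_A i j = 3" for i j
    by (simp add: matrix_A_def path_matrix_def)
  have DE: "i \<noteq> j \<Longrightarrow> matrix_D n i j = 2 \<or> matrix_D n i j = 3" "i \<noteq> j \<Longrightarrow> matrix_E n i j = 2 \<or> matrix_E n i j = 3" for i j n
    by (simp_all add: matrix_D_def matrix_E_def simply_laced_matrix_def)
  have ADE: "free_module_of_rank k H (Coset.order (coxeter_group m))"
    if "first_case" "(\<exists>n\<ge>1. has_coxeter_type matrix_A n m) \<or> (\<exists>n\<ge>4. has_coxeter_type (matrix_D n) n m) \<or>
           (\<exists>n\<in>{6, 7, 8}. has_coxeter_type (matrix_E n) n m)"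
    using that(2)
  proof (elim disjE exE bexE conjE)
    fix n assume "has_coxeter_type matrix_A n m"
    then show ?thesis by (rule laced[OF that(1) _ A])
  next
    fix n assume "has_coxeter_type (matrix_D n) n m"
    then show ?thesis by (rule laced[OF that(1) _ DE(1)])
  next
    fix n assume "has_coxeter_type (matrix_E n) n m"
    then show ?thesis by (rule laced[OF that(1) _ DE(2)])
  qed
  have I2: "free_module_of_rank k H (if p < 4 then 2 * p else 2 * p - 1)"
    if "first_case" "3 \<le> p" "has_coxeter_type (matrix_I2 p) 2 m" for p
  proof (cases "p < 4")
    case True
    then have p: "p = 3" using that(2) by simp
    note type = that(3)
    obtain \<tau> where num: "coxeter_numbering (path_matrix (\<lambda>_. enat 3)) 2 m \<tau>"
      using type unfolding has_coxeter_type_def matrix_I2_def p by blast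
    have "card (nonnull_classes m (\<lambda>_. 2) (short_pairs m)) = fact 2 * (1 + 2 * (2 - 1))"
      by (rule coloured_path_classes(2)[OF m num]) (simp_all add: numeral_eq_enat)
    then have "card (nonnull_classes m (\<lambda>_. 2) (short_pairs m)) = 2 * p" using p by (simp add: fact_numeral)
    from rank[OF that(1) this] show ?thesis using True by simp
  next
    case False
    then have "card (nonnull_classes m (\<lambda>_. 2) (short_pairs m)) = 2 * p - 1" using card_classes_I2[OF m that(3)] by simp
    from rank[OF that(1) this] show ?thesis using False by simp
  qed
  have 3: "\<forall>n\<ge>1. \<forall>e>2. type_A_end_exponent m d n e \<longrightarrow> free_module_of_rank k H (fact n * (1 + n * (e - 1)))"
  proof (intro allI impI)
    fix n e :: nat assume "2 < e" "type_A_end_exponent m d n e"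
    note s = second[OF this(2,1)]
    show "free_module_of_rank k H (fact n * (1 + n * (e - 1)))" by (rule free[OF conjunct1[OF s] conjunct2[OF s]])
  qed
  show ?thesis
    apply (intro conjI impI allI)
    subgoal by (rule 1)
    subgoal by (rule ADE)
    subgoal by (rule rank, assumption, rule card_classes_B[OF m])
    subgoal by (rule rank, assumption, rule card_classes_F4[OF m])
    subgoal by (rule rank, assumption, rule card_classes_H(1)[OF m])
    subgoal by (rule rank, assumption, rule card_classes_H(2)[OF m])
    subgoal by (rule I2)
    subgoal using 3 by blast
    done
qed

end
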